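(* Let $B$ be an even Bratteli diagram with path-space $X$ and AF full group $G=G_B$ (so that $G$ is simple). Suppose that the dynamical system $(X,G)$ admits only finitely many ergodic $G$-invariant Borel probability measures, namely $\mu_1,\ldots,\mu_k$ (pairwise distinct), where $1\le k<\infty$. For $\alpha=(\alpha_1,\ldots,\alpha_k)\in\mathbb Z_{\ge 0}^k$ put $|\alpha|=\alpha_1+\cdots+\alpha_k$, let $\mu_\alpha=\mu_1^{\alpha_1}\times\cdots\times\mu_k^{\alpha_k}$ be the product measure on $X^{|\alpha|}$ (with $\alpha_i$ factors equal to $\mu_i$), and let $\varphi_\alpha$ be the stabilizer distribution of the diagonal action of $G$ on $(X^{|\alpha|},\mu_\alpha)$. Then: (1) For every $\alpha\in\mathbb Z_{\ge 0}^k$, $\varphi_\alpha$ is an ergodic invariant random subgroup of $G$. (2) If $\varphi$ is an ergodic invariant random subgroup of $G$, then either $\varphi=\delta_{\{e\}}$ (the Dirac measure at the trivial subgroup) or $\varphi=\varphi_\alpha$ for some $\alpha\in\mathbb Z_{\ge 0}^k$.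
   Context: A Bratteli diagram is an infinite graph $B=(V,E)$ with $V=\bigsqcup_{i\ge 0}V_i$, $E=\bigsqcup_{i\ge 1}E_i$, all $V_i,E_i$ finite, $V_0=\{v_0\}$ a single point, and range and source maps $r,s:E\to V$ with $r(E_i)=V_i$, $s(E_i)=V_{i-1}$, $s^{-1}(v)\ne\emptyset$ for all $v\in V$ and $r^{-1}(v)\neq\emptyset$ for all $v\in V\setminus V_0$. Its path-space is $X=X_B=\{(e_i)_{i\ge1}\in\prod_{i\ge 1}E_i: s(e_{i+1})=r(e_i)\ \text{for all } i\ge 1\}$ with the product topology, a compact zero-dimensional metrizable space. For $v\in V_n$ let $E(v_0,v)$ be the finite set of paths $(e_1,\ldots,e_n)$ from $v_0$ to $v$. Let $G_v^{(n)}\cong\mathrm{Sym}(E(v_0,v))$ be the group of homeomorphisms of $X$ where a permutation $\sigma$ sends $(e_1,\ldots,e_n,e_{n+1},\ldots)$ with $r(e_n)=v$ to $(\sigma(e_1,\ldots,e_n),e_{n+1},\ldots)$ and fixes all other points of $X$. Put $G_n=\prod_{v\in V_n}G_v^{(n)}$; then $G_n\subset G_{n+1}$, and $G=G_B=\bigcup_{n\ge1}G_n$ is the (AF) full group of $B$. $B$ is even if for every $n\ge 1$ there is $m>n$ such that every vertex of $V_n$ is connected to every vertex of $V_m$ and the number of paths between any such pair of vertices is (positive and) even. Simplicity of $G_B$ is characterized by $B$ being even. $\mathrm{Sub}(G)$ is the compact space of subgroups of $G$ with the topology induced from $\{0,1\}^G$; $G$ acts on it by conjugation. An invariant random subgroup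 (IRS) of $G$ is a conjugation-invariant Borel probability measure on $\mathrm{Sub}(G)$; it is ergodic if it is ergodic for the conjugation action. For a measure-preserving action of $G$ on a probability space $(Y,\nu)$, the stabilizer distribution is the push-forward of $\nu$ under $y\mapsto \mathrm{Stab}_G(y)=\{g\in G: gy=y\}\in \mathrm{Sub}(G)$. By convention $X^0$ is a singleton with trivial $G$-action, so $\varphi_{(0,\ldots,0)}=\delta_{\{G\}}$ is the Dirac measure at the subgroup $G$. *)

theory Defs
  imports "HOL-Algebra.Group_Action" "HOL-Combinatorics.Permutations" "HOL-Probability.Probability"
begin

section \<open>Bratteli diagrams\<close>

record ('v, 'e) bratteli =
  vert :: "nat \<Rightarrow> 'v set"
  edge :: "nat \<Rightarrow> 'e set"
  src :: "'e \<Rightarrow> 'v"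
  tgt :: "'e \<Rightarrow> 'v"
  root :: 'v

text \<open>Edge levels are numbered from \<open>1\<close>; the set \<open>edge B 0\<close> plays no role.\<close>

locale bratteli_diagram =
  fixes B :: "('v, 'e) bratteli"
  assumes vert_disjoint: "disjoint_family (vert B)"
    and edge_disjoint: "disjoint_family_on (edge B) {1..}"
    and finite_vert: "\<And>i. finite (vert B i)"
    and finite_edge: "\<And>i. i \<ge> 1 \<Longrightarrow> finite (edge B i)"
    and vert_0: "vert B 0 = {root B}"
    and tgt_edge: "\<And>i. i \<ge> 1 \<Longrightarrow> tgt B ` edge B i = vert B i"
    and src_edge: "\<And>i. i \<ge> 1 \<Longrightarrow> src B ` edge B i = vert B (i - 1)"
    and out_edge: "\<And>v. v \<in> (\<Union>i. vert B i) \<Longrightarrow> \<exists>e \<in> (\<Union>i\<in>{1..}. edge B i). src B e = v"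
    and in_edge: "\<And>v. v \<in> (\<Union>i. vert B i) - vert B 0 \<Longrightarrow> \<exists>e \<in> (\<Union>i\<in>{1..}. edge B i). tgt B e = v"

text \<open>Paths \<open>(e\<^sub>n\<^sub>+\<^sub>1, \<dots>, e\<^sub>m)\<close> from \<open>v \<in> V\<^sub>n\<close> to \<open>w \<in> V\<^sub>m\<close>, for \<open>n < m\<close>, as extensional functions
  on \<open>{n+1..m}\<close>.\<close>

definition paths :: "('v, 'e) bratteli \<Rightarrow> nat \<Rightarrow> 'v \<Rightarrow> nat \<Rightarrow> 'v \<Rightarrow> (nat \<Rightarrow> 'e) set" where
  "paths B n v m w =
    {p \<in> (\<Pi>\<^sub>E i\<in>{n+1..m}. edge B i).
       src B (p (n+1)) = v \<and> tgt B (p m) = w \<and> (\<forall>i\<in>{n+1..<m}. src B (p (i+1)) = tgt B (p i))}"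

definition even_bratteli :: "('v, 'e) bratteli \<Rightarrow> bool" where
  "even_bratteli B \<longleftrightarrow>
    (\<forall>n\<ge>1. \<exists>m>n. \<forall>v\<in>vert B n. \<forall>w\<in>vert B m. paths B n v m w \<noteq> {} \<and> even (card (paths B n v m w)))"

definition path_space :: "('v, 'e) bratteli \<Rightarrow> (nat \<Rightarrow> 'e) set" where
  "path_space B = {x \<in> (\<Pi>\<^sub>E i\<in>{1..}. edge B i). \<forall>i\<ge>1. src B (x (i+1)) = tgt B (x i)}"

definition path_topology :: "('v, 'e) bratteli \<Rightarrow> (nat \<Rightarrow> 'e) topology" where
  "path_topology B =
    subtopology (product_topology (\<lambda>i. discrete_topology (edge B i)) {1..}) (path_space B)"


section \<open>The AF full group\<close>

definition path_perm ::
  "('v, 'e) bratteli \<Rightarrow> nat \<Rightarrow> 'v \<Rightarrow> ((nat \<Rightarrow> 'e) \<Rightarrow> (nat \<Rightarrow> 'e)) \<Rightarrow> (nat \<Rightarrow> 'e) \<Rightarrow> (nat \<Rightarrow> 'e)" where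
  "path_perm B n v \<sigma> =
    (\<lambda>x\<in>path_space B.
       if tgt B (x n) = v then (\<lambda>i. if i \<in> {1..n} then \<sigma> (restrict x {1..n}) i else x i) else x)"

definition vertex_group :: "('v, 'e) bratteli \<Rightarrow> nat \<Rightarrow> 'v \<Rightarrow> ((nat \<Rightarrow> 'e) \<Rightarrow> (nat \<Rightarrow> 'e)) set" where
  "vertex_group B n v = path_perm B n v ` {\<sigma>. \<sigma> permutes paths B 0 (root B) n v}"

text \<open>The internal product of the \<open>vertex_group B n v\<close> over \<open>v \<in> V\<^sub>n\<close>: an element of
  \<open>vertex_group B n v\<close> fixes all paths not passing through \<open>v\<close>, so that the product of
  a tuple \<open>h\<close> acts as \<open>h v\<close> on the paths through \<open>v\<close>.\<close>

definition level_group :: "('v, 'e) bratteli \<Rightarrow> nat \<Rightarrow> ((nat \<Rightarrow> 'e) \<Rightarrow> (nat \<Rightarrow> 'e)) set" where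
  "level_group B n =
    (\<lambda>h. \<lambda>x\<in>path_space B. h (tgt B (x n)) x) ` (\<Pi>\<^sub>E v\<in>vert B n. vertex_group B n v)"

definition full_group :: "('v, 'e) bratteli \<Rightarrow> ((nat \<Rightarrow> 'e) \<Rightarrow> (nat \<Rightarrow> 'e)) monoid" where
  "full_group B = (BijGroup (path_space B)) \<lparr>carrier := \<Union>n\<in>{1..}. level_group B n\<rparr>"


section \<open>Invariant and ergodic measures\<close>

definition borel_of :: "'a topology \<Rightarrow> 'a measure" where
  "borel_of T = sigma (topspace T) {U. openin T U}"

definition invariant_prob :: "('g, 'b) monoid_scheme \<Rightarrow> ('g \<Rightarrow> 'a \<Rightarrow> 'a) \<Rightarrow> 'a measure \<Rightarrow> bool" where
  "invariant_prob G \<phi> M \<longleftrightarrow>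
    prob_space M \<and> (\<forall>g\<in>carrier G. \<phi> g \<in> measurable M M \<and> distr M M (\<phi> g) = M)"

definition ergodic_prob :: "('g, 'b) monoid_scheme \<Rightarrow> ('g \<Rightarrow> 'a \<Rightarrow> 'a) \<Rightarrow> 'a measure \<Rightarrow> bool" where
  "ergodic_prob G \<phi> M \<longleftrightarrow>
    invariant_prob G \<phi> M \<and>
    (\<forall>A\<in>sets M. (\<forall>g\<in>carrier G. \<phi> g -` A \<inter> space M = A) \<longrightarrow> measure M A = 0 \<or> measure M A = 1)"

definition ergodic_path_measures :: "('v, 'e) bratteli \<Rightarrow> (nat \<Rightarrow> 'e) measure set" where
  "ergodic_path_measures B =
    {\<mu>. sets \<mu> = sets (borel_of (path_topology B)) \<and> ergodic_prob (full_group B) (\<lambda>g. g) \<mu>}"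


section \<open>Invariant random subgroups\<close>

definition Sub_topology :: "('g, 'b) monoid_scheme \<Rightarrow> 'g set topology" where
  "Sub_topology G =
    pullback_topology {H. subgroup H G} (\<lambda>H. \<lambda>g\<in>carrier G. g \<in> H)
      (product_topology (\<lambda>_. discrete_topology (UNIV :: bool set)) (carrier G))"

definition conjugation :: "('g, 'b) monoid_scheme \<Rightarrow> 'g \<Rightarrow> 'g set \<Rightarrow> 'g set" where
  "conjugation G g H = g <#\<^bsub>G\<^esub> H #>\<^bsub>G\<^esub> inv\<^bsub>G\<^esub> g"

definition invariant_random_subgroup :: "('g, 'b) monoid_scheme \<Rightarrow> 'g set measure \<Rightarrow> bool" where
  "invariant_random_subgroup G \<phi> \<longleftrightarrow>
    sets \<phi> = sets (borel_of (Sub_topology G)) \<and> invariant_prob G (conjugation G) \<phi>"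

definition ergodic_IRS :: "('g, 'b) monoid_scheme \<Rightarrow> 'g set measure \<Rightarrow> bool" where
  "ergodic_IRS G \<phi> \<longleftrightarrow> invariant_random_subgroup G \<phi> \<and> ergodic_prob G (conjugation G) \<phi>"

definition stabilizer_distribution ::
  "('g, 'b) monoid_scheme \<Rightarrow> ('g \<Rightarrow> 'a \<Rightarrow> 'a) \<Rightarrow> 'a measure \<Rightarrow> 'g set measure" where
  "stabilizer_distribution G \<phi> M = distr M (borel_of (Sub_topology G)) (stabilizer G \<phi>)"

definition dirac_trivial :: "('g, 'b) monoid_scheme \<Rightarrow> 'g set measure" where
  "dirac_trivial G = return (borel_of (Sub_topology G)) {\<one>\<^bsub>G\<^esub>}"

text \<open>The factors of \<open>X\<^bsup>|\<alpha>|\<^esup>\<close> are indexed by the pairs \<open>(i, j)\<close> with \<open>1 \<le> i \<le> k\<close> and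
  \<open>1 \<le> j \<le> \<alpha> i\<close>. For \<open>\<alpha> = 0\<close> there is no index and the product is a one-point space.\<close>

definition power_index :: "nat \<Rightarrow> (nat \<Rightarrow> nat) \<Rightarrow> (nat \<times> nat) set" where
  "power_index k \<alpha> = (SIGMA i:{1..k}. {1..\<alpha> i})"

definition product_power ::
  "nat \<Rightarrow> (nat \<Rightarrow> 'a measure) \<Rightarrow> (nat \<Rightarrow> nat) \<Rightarrow> (nat \<times> nat \<Rightarrow> 'a) measure" where
  "product_power k \<mu> \<alpha> = (\<Pi>\<^sub>M (i, j)\<in>power_index k \<alpha>. \<mu> i)"

definition diagonal_action :: "'i set \<Rightarrow> ('a \<Rightarrow> 'a) \<Rightarrow> ('i \<Rightarrow> 'a) \<Rightarrow> ('i \<Rightarrow> 'a)" where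
  "diagonal_action J g y = (\<lambda>j\<in>J. g (y j))"

definition product_IRS ::
  "('v, 'e) bratteli \<Rightarrow> nat \<Rightarrow> (nat \<Rightarrow> (nat \<Rightarrow> 'e) measure) \<Rightarrow> (nat \<Rightarrow> nat)
    \<Rightarrow> ((nat \<Rightarrow> 'e) \<Rightarrow> (nat \<Rightarrow> 'e)) set measure" where
  "product_IRS B k \<mu> \<alpha> =
    stabilizer_distribution (full_group B) (diagonal_action (power_index k \<alpha>)) (product_power k \<mu> \<alpha>)"

end

theory Submission
  imports Defs "HOL-Complex_Analysis.Great_Picard"
begin

text \<open>An element of \<open>G\<close> is a permutation of the finite paths of some level that preserves end vertices.
  For an invariant random subgroup, recurrence provides a subgroup \<open>H\<close> that contains a positive fraction
  of the conjugates of a given element by the permutations of a high level. Double commutators of these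
  conjugates yield three-cycles, and, the diagram being even, transpositions. Hence almost every \<open>H\<close> is
  determined by its free paths, those whose cylinder has a rigid stabilizer not contained in \<open>H\<close>.

  The number of free paths of level \<open>n\<close> increases with \<open>n\<close>. By ergodicity it either tends to infinity almost
  surely or is almost surely eventually equal to a constant \<open>r\<close>. In the first case, averaging over the
  permutations of a high level shows that every given cylinder meets the free paths, whence \<open>H\<close> is trivial.
  In the second case the same averaging makes the \<open>r\<close> free paths asymptotically independent and uniform on
  their fibres. The uniform distributions on the fibres approach convex combinations of
  \<open>\<mu>\<^sub>1, \<dots>, \<mu>\<^sub>k\<close>, since every invariant measure is one. So the law of \<open>H\<close> is a mixture of finitely many
  \<open>\<phi>\<^sub>\<alpha>\<close>, and being extreme it is one of them.

  The measure \<open>\<mu>\<^sub>\<alpha>\<close> is ergodic for the diagonal action because the fibres through \<open>\<mu>\<^sub>i\<close>-almost every path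
  become equidistributed with respect to \<open>\<mu>\<^sub>i\<close>, so that averages over the permutations of a level decorrelate
  an invariant set from every box.\<close>

text \<open>Invariance under conjugation gives, through recurrence, no more than a density of good
  permutations: a constant independent of the level, while the fibres grow without bound. The
  combinatorial steps are therefore pigeonhole arguments in groups of permutations of a finite set
  of paths that ask for nothing but such a density; the thresholds \<open>D\<^sup>2 + 4\<close> and
  \<open>D + 2\<close> on fibre sizes are what the collisions consume. Three-cycles produce only
  even permutations. A transposition of level \<open>l\<close>, however, becomes at a later level an
  even number of transpositions over every vertex, and this is how evenness of the diagram enters.
  Finiteness of \<open>k\<close> enters through approximation: on finitely many cylinders, the
  distance from an invariant weight to the convex combinations of the given measures has infimum
  zero, so each high fibre has approximate barycentric coordinates. These vary with the vertex;
  expanding the product over the \<open>r\<close> free paths leaves finitely many exponents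
  \<alpha>, and only bounded coefficients have to converge. The extremality of ergodic measures is
  used both on the path space and on the space of subgroups.\<close>

no_notation m_inv (\<open>(\<open>open_block notation=\<open>prefix inv\<close>\<close>inv\<index> _)\<close> [81] 80)

hide_const (open) Finite_Cartesian_Product.transpose
hide_fact (open) Finite_Cartesian_Product.transpose_def

section \<open>Permutations preserving the fibres of a map\<close>

definition fibre_perms :: "'a set \<Rightarrow> ('a \<Rightarrow> 'b) \<Rightarrow> ('a \<Rightarrow> 'a) set" where
  "fibre_perms A t = {\<sigma>. \<sigma> permutes A \<and> (\<forall>x. t (\<sigma> x) = t x)}"

lemma fibre_permsD:
  assumes "\<sigma> \<in> fibre_perms A t"
  shows "\<sigma> permutes A" "t (\<sigma> x) = t x" "bij \<sigma>"
  using assms by (auto simp: fibre_perms_def permutes_bij)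

lemma fibre_perms_id [simp]: "id \<in> fibre_perms A t"
  by (simp add: fibre_perms_def permutes_id)

lemma fibre_perms_comp:
  "\<sigma> \<in> fibre_perms A t \<Longrightarrow> \<tau> \<in> fibre_perms A t \<Longrightarrow> \<sigma> \<circ> \<tau> \<in> fibre_perms A t"
  by (auto simp: fibre_perms_def intro: permutes_compose)

lemma fibre_perms_inv: "\<sigma> \<in> fibre_perms A t \<Longrightarrow> inv \<sigma> \<in> fibre_perms A t"
  unfolding fibre_perms_def by (auto intro: permutes_inv) (metis permutes_inverses(1))

lemma fibre_perms_transpose:
  "x \<in> A \<Longrightarrow> y \<in> A \<Longrightarrow> t x = t y \<Longrightarrow> transpose x y \<in> fibre_perms A t"
  by (auto simp: fibre_perms_def permutes_swap_id transpose_def)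

lemma finite_fibre_perms: "finite A \<Longrightarrow> finite (fibre_perms A t)"
  by (rule finite_subset[OF _ finite_permutations]) (auto simp: fibre_perms_def)

lemma card_fibre_perms_pos: "finite A \<Longrightarrow> 0 < card (fibre_perms A t)"
  by (metis card_gt_0_iff empty_iff fibre_perms_id finite_fibre_perms)

lemma fibre_perms_mono: "A \<subseteq> A' \<Longrightarrow> fibre_perms A t \<subseteq> fibre_perms A' t"
  by (auto simp: fibre_perms_def intro: permutes_subset)

lemma conj_transpose: assumes l: "bij l" shows "l \<circ> transpose a b \<circ> inv l = transpose (l a) (l b)"
proof
  fix x
  obtain y where "x = l y" using l by (metis bij_pointE)
  then show "(l \<circ> transpose a b \<circ> inv l) x = transpose (l a) (l b) x"
    using l by (auto simp: transpose_def bij_is_inj inv_f_f inj_eq)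
qed

lemma fibre_perms_comp_left_inj: "\<sigma> \<in> fibre_perms A t \<Longrightarrow> inj_on (\<lambda>a. \<sigma> \<circ> a) S"
  by (auto simp: inj_on_def dest!: fibre_permsD(3)) (metis bij_is_inj fun.inj_map injD)

lemma fibre_perms_comp_right_inj: "\<sigma> \<in> fibre_perms A t \<Longrightarrow> inj_on (\<lambda>a. a \<circ> \<sigma>) S"
  by (auto simp: inj_on_def dest!: fibre_permsD(3)) (metis bij_is_surj surj_fun_eq)

text \<open>Induction on the support: composing with the transposition of \<open>x\<close> and
  \<open>\<sigma> x\<close> fixes \<open>x\<close> and moves no new point. Only transpositions of
  two points moved by \<sigma> are asked to lie in \<open>H\<close>, because in the application the
  available information concerns the paths that are moved and no others.\<close>

lemma fibre_perms_generated_by_transpositions: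
  assumes "finite A" "id \<in> H" and comp: "\<And>a b. a \<in> H \<Longrightarrow> b \<in> H \<Longrightarrow> a \<circ> b \<in> H"
    and "\<sigma> \<in> fibre_perms A t"
    and tr: "\<And>x y. x \<in> A \<Longrightarrow> y \<in> A \<Longrightarrow> \<sigma> x \<noteq> x \<Longrightarrow> \<sigma> y \<noteq> y \<Longrightarrow> t x = t y \<Longrightarrow> transpose x y \<in> H"
  shows "\<sigma> \<in> H"
  using assms(4) tr
proof (induction "card {x \<in> A. \<sigma> x \<noteq> x}" arbitrary: \<sigma> rule: less_induct)
  case less
  show ?case
  proof (cases "\<forall>x. \<sigma> x = x")
    case True
    then have "\<sigma> = id" by auto
    then show ?thesis using assms(2) by simp
  next
    case False
    then obtain x where x: "\<sigma> x \<noteq> x" by auto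
    then have xA: "x \<in> A" using less.prems(1) by (auto dest!: fibre_permsD(1) simp: permutes_def)
    have bij: "bij \<sigma>" using less.prems(1) fibre_permsD(3) by blast
    have sA: "\<sigma> x \<in> A" using xA less.prems(1) by (meson fibre_permsD(1) permutes_in_image)
    let ?\<tau> = "transpose x (\<sigma> x)"
    have sx: "\<sigma> (\<sigma> x) \<noteq> \<sigma> x" using x bij by (metis bij_pointE)
    have \<tau>G: "?\<tau> \<in> fibre_perms A t"
      by (rule fibre_perms_transpose) (use xA sA less.prems(1) fibre_permsD(2) in metis)+
    have \<tau>H: "?\<tau> \<in> H"
      using less.prems xA sA x sx by (metis fibre_permsD(2))
    let ?\<rho> = "?\<tau> \<circ> \<sigma>"
    have fx: "?\<rho> y = y" if "\<sigma> y = y" for y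
      using that x sx by (auto simp: transpose_def)
    have "?\<rho> x = x" by simp
    then have sub: "{y \<in> A. ?\<rho> y \<noteq> y} \<subset> {y \<in> A. \<sigma> y \<noteq> y}"
    proof -
      have "x \<notin> {y \<in> A. ?\<rho> y \<noteq> y}" "x \<in> {y \<in> A. \<sigma> y \<noteq> y}"
        using x xA by simp_all
      moreover have "{y \<in> A. ?\<rho> y \<noteq> y} \<subseteq> {y \<in> A. \<sigma> y \<noteq> y}"
        using fx by blast
      ultimately show ?thesis by blast
    qed
    have "?\<rho> \<in> H"
    proof (rule less.hyps)
      show "card {y \<in> A. ?\<rho> y \<noteq> y} < card {y \<in> A. \<sigma> y \<noteq> y}"
        by (rule psubset_card_mono) (use sub assms(1) in auto)
      show "?\<rho> \<in> fibre_perms A t" using \<tau>G less.prems(1) by (rule fibre_perms_comp)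
    qed (use sub less.prems(2) in blast)
    then have "?\<tau> \<circ> ?\<rho> \<in> H" using \<tau>H comp by blast
    then show ?thesis by (simp add: comp_assoc[symmetric])
  qed
qed

subsection \<open>Pigeonhole principles\<close>

text \<open>More than \<open>card \<Gamma>\<close> pairs of an index and a point are mapped into
  \<Gamma>, so two of them collide; injectivity of each single map forces their indices
  apart.\<close>

lemma pigeonhole_images:
  assumes "finite \<Gamma>" "\<And>i. i \<in> I \<Longrightarrow> f i ` S \<subseteq> \<Gamma>" "\<And>i. i \<in> I \<Longrightarrow> inj_on (f i) S"
    and "card \<Gamma> < card I * card S"
  shows "\<exists>i\<in>I. \<exists>j\<in>I. i \<noteq> j \<and> (\<exists>a\<in>S. \<exists>b\<in>S. f i a = f j b)"
proof -
  have "\<not> inj_on (\<lambda>(i, a). f i a) (I \<times> S)"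
  proof
    assume "inj_on (\<lambda>(i, a). f i a) (I \<times> S)"
    then have "card (I \<times> S) \<le> card \<Gamma>"
      using assms(1,2) by (intro card_inj_on_le) auto
    then show False using assms(4) by (simp add: card_cartesian_product)
  qed
  then obtain i a j b where *: "i \<in> I" "j \<in> I" "a \<in> S" "b \<in> S" "f i a = f j b" "(i, a) \<noteq> (j, b)"
    by (auto simp: inj_on_def)
  moreover have "i \<noteq> j" using * assms(3) by (auto simp: inj_on_def)
  ultimately show ?thesis by blast
qed

text \<open>Second moment count: \<open>n x\<close> is the number of images containing
  \<open>x\<close>, and (n - 1)^2 \<ge> 0 gives n^2 - n \<ge> n - 1. Since \<open>n\<close> has mean
  at least 2 over \<Gamma>, the right side sums to at least \<open>card \<Gamma>\<close>, while the
  left side sums to the sizes of the intersections over ordered pairs of distinct indices. One of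
  the at most \<open>(card I)\<^sup>2\<close> pairs must carry its share.\<close>

lemma pigeonhole_images_dense:
  assumes fin: "finite \<Gamma>" "finite I" and ne: "\<Gamma> \<noteq> {}" and sub: "\<And>i. i \<in> I \<Longrightarrow> f i ` S \<subseteq> \<Gamma>"
    and inj: "\<And>i. i \<in> I \<Longrightarrow> inj_on (f i) S"
    and dense: "2 * card \<Gamma> \<le> card I * card S"
  shows "\<exists>i\<in>I. \<exists>j\<in>I. i \<noteq> j \<and> card \<Gamma> \<le> (card I)\<^sup>2 * card (f i ` S \<inter> f j ` S)"
proof -
  define n where "n x = (\<Sum>i\<in>I. if x \<in> f i ` S then 1 else (0::int))" for x
  have c: "(\<Sum>x\<in>\<Gamma>. if x \<in> B then 1 else (0::int)) = int (card B)" if "B \<subseteq> \<Gamma>" for B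
  proof -
    have "\<Gamma> \<inter> B = B" using that by auto
    moreover have "(\<Sum>x\<in>\<Gamma>. if x \<in> B then 1 else (0::int)) = (\<Sum>x\<in>\<Gamma> \<inter> B. 1)"
      using fin(1) by (subst sum.inter_restrict) auto
    ultimately show ?thesis by simp
  qed
  have s1: "(\<Sum>x\<in>\<Gamma>. n x) = int (card I * card S)"
  proof -
    have "(\<Sum>x\<in>\<Gamma>. n x) = (\<Sum>i\<in>I. \<Sum>x\<in>\<Gamma>. if x \<in> f i ` S then 1 else (0::int))"
      unfolding n_def by (rule sum.swap)
    also have "\<dots> = (\<Sum>i\<in>I. int (card S))"
      by (intro sum.cong refl, subst c) (use sub inj card_image in force)+
    finally show ?thesis by simp
  qed
  have s2: "(\<Sum>x\<in>\<Gamma>. n x * n x) = (\<Sum>i\<in>I. \<Sum>j\<in>I. int (card (f i ` S \<inter> f j ` S)))"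
  proof -
    have "(\<Sum>x\<in>\<Gamma>. n x * n x) = (\<Sum>x\<in>\<Gamma>. \<Sum>i\<in>I. \<Sum>j\<in>I. if x \<in> f i ` S \<inter> f j ` S then 1 else (0::int))"
      unfolding n_def sum_product by (intro sum.cong refl) auto
    also have "\<dots> = (\<Sum>i\<in>I. \<Sum>x\<in>\<Gamma>. \<Sum>j\<in>I. if x \<in> f i ` S \<inter> f j ` S then 1 else (0::int))"
      by (rule sum.swap)
    also have "\<dots> = (\<Sum>i\<in>I. \<Sum>j\<in>I. \<Sum>x\<in>\<Gamma>. if x \<in> f i ` S \<inter> f j ` S then 1 else (0::int))"
      by (intro sum.cong refl sum.swap)
    also have "\<dots> = (\<Sum>i\<in>I. \<Sum>j\<in>I. int (card (f i ` S \<inter> f j ` S)))"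
      by (intro sum.cong refl c) (use sub in blast)
    finally show ?thesis .
  qed
  show ?thesis
  proof (rule ccontr)
    assume "\<not> ?thesis"
    then have *: "(card I)\<^sup>2 * card (f i ` S \<inter> f j ` S) < card \<Gamma>" if "i \<in> I" "j \<in> I" "i \<noteq> j" for i j
      using that by force
    have I0: "card I > 0" using dense ne fin by (cases "card I = 0") (auto simp: card_gt_0_iff)
    define b where "b i j = (if i = j then 0 else int (card (f i ` S \<inter> f j ` S)))" for i j
    have "(\<Sum>i\<in>I. \<Sum>j\<in>I. int (card (f i ` S \<inter> f j ` S)))
        = (\<Sum>i\<in>I. \<Sum>j\<in>I. b i j + (if j = i then int (card S) else 0))"
      by (intro sum.cong refl) (auto simp: b_def inj card_image)
    also have "\<dots> = (\<Sum>i\<in>I. \<Sum>j\<in>I. b i j) + int (card I * card S)"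
      using fin(2) by (simp add: sum.distrib)
    finally have "(\<Sum>x\<in>\<Gamma>. n x * n x) - (\<Sum>x\<in>\<Gamma>. n x) = (\<Sum>i\<in>I. \<Sum>j\<in>I. b i j)"
      using s1 s2 by simp
    moreover have "(\<Sum>x\<in>\<Gamma>. n x * n x) - (\<Sum>x\<in>\<Gamma>. n x) \<ge> (\<Sum>x\<in>\<Gamma>. n x - 1)"
      unfolding sum_subtractf[symmetric]
    proof (rule sum_mono)
      fix x
      have "(n x - 1) * (n x - 1) \<ge> 0" by simp
      then show "n x - 1 \<le> n x * n x - n x" by (simp add: algebra_simps)
    qed
    moreover have "(\<Sum>x\<in>\<Gamma>. n x - 1) \<ge> int (card \<Gamma>)"
      using s1 of_nat_mono[OF dense, where ?'a = int] by (simp add: sum_subtractf)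
    ultimately have g: "(\<Sum>i\<in>I. \<Sum>j\<in>I. b i j) \<ge> int (card \<Gamma>)" by linarith
    have "int ((card I)\<^sup>2) * b i j \<le> int (card \<Gamma>) - 1" if "i \<in> I" "j \<in> I" for i j
    proof (cases "i = j")
      case True
      moreover have "card \<Gamma> > 0" using ne fin(1) by (simp add: card_gt_0_iff)
      ultimately show ?thesis by (simp add: b_def)
    next
      case False
      have "int ((card I)\<^sup>2 * card (f i ` S \<inter> f j ` S)) < int (card \<Gamma>)"
        using *[OF that False] by (subst of_nat_less_iff)
      then show ?thesis using False by (simp add: b_def)
    qed
    then have "(\<Sum>i\<in>I. \<Sum>j\<in>I. int ((card I)\<^sup>2) * b i j) \<le> (\<Sum>i\<in>I. \<Sum>j\<in>I. int (card \<Gamma>) - 1)"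
      by (intro sum_mono)
    then have "int ((card I)\<^sup>2) * (\<Sum>i\<in>I. \<Sum>j\<in>I. b i j) \<le> int ((card I)\<^sup>2) * (int (card \<Gamma>) - 1)"
      by (simp add: sum_distrib_left power2_eq_square algebra_simps)
    then have "(\<Sum>i\<in>I. \<Sum>j\<in>I. b i j) \<le> int (card \<Gamma>) - 1"
      using I0 by (simp add: mult_le_cancel_left)
    then show False using g by linarith
  qed
qed

subsection \<open>Three-cycles\<close>

text \<open>The cycle a -> b -> c -> a when the three points are distinct. Written as a product of
  transpositions, it inherits conjugation and inversion from them.\<close>

definition cyc :: "'a \<Rightarrow> 'a \<Rightarrow> 'a \<Rightarrow> 'a \<Rightarrow> 'a" where
  "cyc a b c = transpose a b \<circ> transpose b c"

lemma cyc_rotate: "a \<noteq> b \<Longrightarrow> b \<noteq> c \<Longrightarrow> a \<noteq> c \<Longrightarrow> cyc a b c = cyc b c a"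
  by (rule ext) (auto simp: cyc_def transpose_def)

lemma inv_cyc: "inv (cyc a b c) = cyc c b a"
  unfolding cyc_def by (subst o_inv_distrib) (auto simp: transpose_commute)

lemma bij_cyc [simp]: "bij (cyc a b c)"
  unfolding cyc_def by (intro bij_comp bij_transpose)

lemma conj_cyc: assumes "bij l" shows "l \<circ> cyc a b c \<circ> inv l = cyc (l a) (l b) (l c)"
proof -
  have "l \<circ> cyc a b c \<circ> inv l = (l \<circ> transpose a b \<circ> inv l) \<circ> (l \<circ> transpose b c \<circ> inv l)"
    using assms by (simp add: cyc_def fun_eq_iff bij_is_inj inv_f_f)
  then show ?thesis using assms by (simp add: conj_transpose cyc_def)
qed

text \<open>Two three-cycles that share two points have a three-cycle as quotient. Two elements of a
  relation with equal first coordinates will thus yield a three-cycle over the identity.\<close>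

lemma cyc_quotient:
  assumes "distinct [x, y, z, z']"
  shows "cyc x y z \<circ> inv (cyc x y z') = cyc x z' z"
proof
  fix w
  show "(cyc x y z \<circ> inv (cyc x y z')) w = cyc x z' z w"
    unfolding inv_cyc using assms
    by (cases "w = x"; cases "w = y"; cases "w = z"; cases "w = z'") (auto simp: cyc_def transpose_def)
qed

lemma double_transposition_cyc:
  "transpose a b \<circ> transpose c d = cyc a b c \<circ> cyc b c d"
  by (simp add: cyc_def fun_eq_iff)

section \<open>Sets all of whose three-cycles lie in a subgroup: exchange and maximality\<close>

definition all_cyc :: "(('a \<Rightarrow> 'a) \<Rightarrow> bool) \<Rightarrow> 'a set \<Rightarrow> bool" where
  "all_cyc N P \<longleftrightarrow> (\<forall>a\<in>P. \<forall>b\<in>P. \<forall>c\<in>P. a \<noteq> b \<longrightarrow> b \<noteq> c \<longrightarrow> a \<noteq> c \<longrightarrow> N (cyc a b c))"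

lemma all_cycD: "all_cyc N P \<Longrightarrow> a \<in> P \<Longrightarrow> b \<in> P \<Longrightarrow> c \<in> P \<Longrightarrow> a \<noteq> b \<Longrightarrow> b \<noteq> c \<Longrightarrow> a \<noteq> c \<Longrightarrow> N (cyc a b c)"
  by (simp add: all_cyc_def)

lemma all_cyc_conj:
  assumes conj: "\<And>s. N s \<Longrightarrow> N (l \<circ> s \<circ> inv l)" and "bij l" and "all_cyc N P"
  shows "all_cyc N (l ` P)"
proof -
  have "N (cyc (l a) (l b) (l c))" if "a \<in> P" "b \<in> P" "c \<in> P" "a \<noteq> b" "b \<noteq> c" "a \<noteq> c" for a b c
    using conj[OF all_cycD[OF assms(3) that]] conj_cyc[OF assms(2)] by metis
  then show ?thesis unfolding all_cyc_def by blast
qed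

text \<open>The missing cycles are those through both \<open>u\<close> and \<open>v\<close>. They
  arise by conjugating a cycle through \<open>v\<close> and two points of \<open>P - {u}\<close>
  with a cycle inside \<open>P\<close> that carries one of these points to \<open>u\<close>; the
  auxiliary point \<open>d\<close> exists because \<open>P\<close> has at least three
  points.\<close>

lemma all_cyc_insert:
  assumes conj: "\<And>s s'. N s \<Longrightarrow> N s' \<Longrightarrow> N (s \<circ> s' \<circ> inv s)"
    and P: "all_cyc N P" and card: "card P \<ge> 3" and u: "u \<in> P" and v: "v \<notin> P"
    and P': "all_cyc N (insert v (P - {u}))"
  shows "all_cyc N (insert v P)"
proof -
  have fin: "finite P" using card by (metis card.infinite not_numeral_le_zero)
  have third: "\<exists>d\<in>P. d \<noteq> u \<and> d \<noteq> b" if "b \<in> P" for b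
  proof (rule ccontr)
    assume "\<not> ?thesis"
    then have "P \<subseteq> {u, b}" by blast
    then have "card P \<le> card {u, b}" by (intro card_mono) auto
    also have "\<dots> \<le> 2" by (simp add: card_insert_if)
    finally show False using card by simp
  qed
  have key: "N (cyc v b c)" if bc: "b \<in> P" "c \<in> P" "b \<noteq> c" for b c
  proof -
    have vn: "v \<noteq> b" "v \<noteq> c" using v bc by auto
    consider "b \<noteq> u" "c \<noteq> u" | "b = u" | "c = u" by blast
    then show ?thesis
    proof cases
      case 1
      then show ?thesis using all_cycD[OF P', of v b c] bc vn by auto
    next
      case 2
      then obtain d where d: "d \<in> P" "d \<noteq> u" "d \<noteq> c" using third bc by blast
      have "N (cyc d c u)" using all_cycD[OF P] d bc 2 by blast
      moreover have "N (cyc v c d)" using all_cycD[OF P', of v c d] bc vn d 2 v by auto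
      ultimately have "N (cyc d c u \<circ> cyc v c d \<circ> inv (cyc d c u))" by (rule conj)
      moreover have "cyc d c u v = v" "cyc d c u c = u" "cyc d c u d = c"
        using d bc vn v u 2 by (auto simp: cyc_def transpose_def)
      ultimately show ?thesis using 2 by (simp add: conj_cyc)
    next
      case 3
      then obtain d where d: "d \<in> P" "d \<noteq> u" "d \<noteq> b" using third bc by blast
      have "N (cyc d b u)" using all_cycD[OF P] d bc 3 by blast
      moreover have "N (cyc v d b)" using all_cycD[OF P', of v d b] bc vn d 3 v by auto
      ultimately have "N (cyc d b u \<circ> cyc v d b \<circ> inv (cyc d b u))" by (rule conj)
      moreover have "cyc d b u v = v" "cyc d b u d = b" "cyc d b u b = u"
        using d bc vn v u 3 by (auto simp: cyc_def transpose_def)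
      ultimately show ?thesis using 3 by (simp add: conj_cyc)
    qed
  qed
  show ?thesis
    unfolding all_cyc_def
  proof (intro ballI impI)
    fix a b c assume *: "a \<in> insert v P" "b \<in> insert v P" "c \<in> insert v P" "a \<noteq> b" "b \<noteq> c" "a \<noteq> c"
    consider "a = v" | "b = v" | "c = v" | "a \<in> P" "b \<in> P" "c \<in> P" using * by blast
    then show "N (cyc a b c)"
    proof cases
      case 1
      then show ?thesis using key * by blast
    next
      case 2
      have "N (cyc b c a)" using key * 2 by blast
      then show ?thesis using cyc_rotate * by metis
    next
      case 3
      have "N (cyc c a b)" using key * 3 by blast
      then show ?thesis using cyc_rotate * by metis
    next
      case 4
      then show ?thesis using all_cycD[OF P] * by blast
    qed
  qed
qed

text \<open>A maximal \<open>P\<close> with all its three-cycles in \<open>N\<close> must be all of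
  \<open>W\<close>: otherwise conjugation by an element of \<open>L\<close> exchanges one point of
  \<open>P\<close> for a point outside, and \<open>all_cyc_insert\<close> enlarges \<open>P\<close>.
  \<open>L\<close> stands for elements normalising \<open>N\<close>; it has to supply products of
  two transpositions at a prescribed point whose other two points come from any prescribed set of
  size \<open>D\<close>.\<close>

lemma all_cyc_whole:
  assumes fin: "finite W" and comp: "\<And>s s'. N s \<Longrightarrow> N s' \<Longrightarrow> N (s \<circ> s')" and inv: "\<And>s. N s \<Longrightarrow> N (inv s)"
    and conj: "\<And>l s. L l \<Longrightarrow> N s \<Longrightarrow> N (l \<circ> s \<circ> inv l)"
    and L: "\<And>x Y. x \<in> W \<Longrightarrow> Y \<subseteq> W - {x} \<Longrightarrow> D \<le> card Y \<Longrightarrow>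
        \<exists>y\<in>Y. \<exists>y'\<in>Y. y \<noteq> y' \<and> L (transpose x y \<circ> transpose x y')"
    and W: "card W \<ge> 2 * D"
    and abc: "{a, b, c} \<subseteq> W" "a \<noteq> b" "b \<noteq> c" "a \<noteq> c" "N (cyc a b c)"
  shows "all_cyc N W"
proof -
  have conj': "N (s \<circ> s' \<circ> inv s)" if "N s" "N s'" for s s'
    using that comp inv by blast
  let ?F = "{P. P \<subseteq> W \<and> 3 \<le> card P \<and> all_cyc N P}"
  have "finite ?F" using fin by simp
  moreover have "{a, b, c} \<in> ?F"
  proof -
    have "N (cyc c b a)" using inv[OF abc(5)] by (simp add: inv_cyc)
    moreover have "cyc a b c = cyc b c a" "cyc b c a = cyc c a b" "cyc c b a = cyc b a c" "cyc b a c = cyc a c b"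
      using abc by (metis cyc_rotate)+
    ultimately have "all_cyc N {a, b, c}"
      unfolding all_cyc_def using abc by auto
    then show ?thesis using abc by simp
  qed
  ultimately obtain P where P: "P \<in> ?F" and max: "\<And>Q. Q \<in> ?F \<Longrightarrow> P \<subseteq> Q \<Longrightarrow> Q = P"
    using finite_has_maximal2[of ?F "{a, b, c}"] by (metis (no_types, lifting))
  have finP: "finite P" using P fin finite_subset by auto
  have "P = W"
  proof (rule ccontr)
    assume "P \<noteq> W"
    then obtain v where v: "v \<in> W" "v \<notin> P" using P by blast
    have bij: "bij (transpose x y \<circ> transpose x y')" for x y y' :: 'a
      by (intro bij_comp bij_transpose)
    have "\<exists>u w. u \<in> P \<and> w \<in> W \<and> w \<notin> P \<and> all_cyc N (insert w (P - {u}))"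
    \<comment> \<open>As \<open>card W\<close> is at least \<open>2 * D\<close>, one of
      \<open>P\<close> and \<open>W - P\<close> has \<open>D\<close> points. A large
      \<open>P\<close> takes in \<open>v\<close> and gives up \<open>y'\<close>; a small one gives
      up \<open>x\<close> for the point \<open>y'\<close> of the complement.\<close>
    proof (cases "card P \<ge> D")
      case True
      then obtain y y' where y: "y \<in> P" "y' \<in> P" "y \<noteq> y'" "L (transpose v y \<circ> transpose v y')"
        using L[of v P] v P by blast
      let ?l = "transpose v y \<circ> transpose v y'"
      have "all_cyc N (?l ` P)"
        using P by (intro all_cyc_conj conj[OF y(4)] bij) auto
      moreover have "?l ` P = insert v (P - {y'})"
      proof -
        have "?l z = z" if "z \<in> P - {y, y'}" for z using that v by (auto simp: transpose_def)
        then have 1: "?l ` (P - {y, y'}) = P - {y, y'}" by force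
        have 2: "?l y = v" "?l y' = y" using y v by (auto simp: transpose_def)
        have 3: "P = insert y (insert y' (P - {y, y'}))" using y by blast
        have "?l ` P = ?l ` insert y (insert y' (P - {y, y'}))" by (rule arg_cong[OF 3])
        also have "\<dots> = insert v (insert y (P - {y, y'}))" unfolding image_insert 1 2 ..
        also have "\<dots> = insert v (P - {y'})" using y by blast
        finally show ?thesis .
      qed
      ultimately show ?thesis using y v by auto
    next
      case False
      obtain x where x: "x \<in> P" using P by fastforce
      have "card (W - P) = card W - card P" using P fin finP by (simp add: card_Diff_subset)
      then have "D \<le> card (W - P)" using W False by simp
      then obtain y y' where y: "y \<in> W - P" "y' \<in> W - P" "y \<noteq> y'" "L (transpose x y \<circ> transpose x y')"
        using L[of x "W - P"] x P by blast
      let ?l = "transpose x y \<circ> transpose x y'"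
      have "all_cyc N (?l ` P)"
        using P by (intro all_cyc_conj conj[OF y(4)] bij) auto
      moreover have "?l ` P = insert y' (P - {x})"
      proof -
        have "?l z = z" if "z \<in> P - {x}" for z using that y by (auto simp: transpose_def)
        then have 1: "?l ` (P - {x}) = P - {x}" by force
        have 2: "?l x = y'" using y x by (auto simp: transpose_def)
        have "?l ` P = ?l ` insert x (P - {x})" using x by (simp add: insert_absorb)
        also have "\<dots> = insert y' (P - {x})" unfolding image_insert 1 2 ..
        finally show ?thesis .
      qed
      ultimately show ?thesis using x y by auto
    qed
    then obtain u w where uw: "u \<in> P" "w \<in> W" "w \<notin> P" "all_cyc N (insert w (P - {u}))" by blast
    have "all_cyc N (insert w P)"
      by (rule all_cyc_insert[OF conj' _ _ uw(1) uw(3,4)]) (use P in auto)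
    moreover have "3 \<le> card (insert w P)" using P uw finP by auto
    ultimately have "insert w P = P" using max[of "insert w P"] P uw by blast
    then show False using uw by blast
  qed
  then show ?thesis using P by blast
qed

text \<open>The key to the double commutator argument below. The relation \<open>K\<close> is a subgroup of
  \<open>\<Gamma> \<times> \<Gamma>\<close>, where \<open>\<Gamma> = fibre_perms A t\<close>, that contains all \<open>(a b\<^sup>-\<^sup>1, a\<^sup>-\<^sup>1 b)\<close> with \<open>a\<close>, \<open>b\<close> from
  a set of density \<open>\<ge> 2 / D\<close>. Collisions among translates of that set put three-cycles into the second
  projection of \<open>K\<close> and, after a second round, into the fibre of \<open>K\<close> over the identity.\<close>

lemma dense_relation_contains_cyc:
  fixes A :: "'a set" and t :: "'a \<Rightarrow> 'b" and K :: "('a \<Rightarrow> 'a) \<Rightarrow> ('a \<Rightarrow> 'a) \<Rightarrow> bool"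
  defines "\<Gamma> \<equiv> fibre_perms A t"
  assumes fin: "finite A" and T: "T \<subseteq> \<Gamma>" and dense: "2 * card \<Gamma> \<le> D * card T"
    and K: "\<And>a b. a \<in> T \<Longrightarrow> b \<in> T \<Longrightarrow> K (a \<circ> inv b) (inv a \<circ> b)"
    and comp: "\<And>x y x' y'. K x y \<Longrightarrow> K x' y' \<Longrightarrow> K (x \<circ> x') (y \<circ> y')"
    and inv: "\<And>x y. K x y \<Longrightarrow> K (inv x) (inv y)"
    and bij: "\<And>x y. K x y \<Longrightarrow> bij x \<and> bij y"
    and W: "W = {x \<in> A. t x = w}" "card W \<ge> D\<^sup>2 + 4"
  shows "all_cyc (K id) W"
proof -
  have fin\<Gamma>: "finite \<Gamma>" unfolding \<Gamma>_def using fin by (rule finite_fibre_perms)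
  have pos: "card \<Gamma> > 0" unfolding \<Gamma>_def using fin by (rule card_fibre_perms_pos)
  have finW: "finite W" using fin W by simp
  have WA: "W \<subseteq> A" "\<And>x y. x \<in> W \<Longrightarrow> y \<in> W \<Longrightarrow> t x = t y" using W by auto
  have DT: "card \<Gamma> < D * card T" using dense pos by linarith
  have D2: "D \<le> D\<^sup>2" by (simp add: power2_eq_square)
  have D22: "2 * D \<le> D\<^sup>2 + 4"
  proof -
    have "0 \<le> (int D - 1)\<^sup>2" by simp
    then have "2 * int D \<le> (int D)\<^sup>2 + 1" by (simp add: power2_eq_square algebra_simps)
    then have "int (2 * D) \<le> int (D\<^sup>2 + 4)" by simp
    then show ?thesis by (simp only: of_nat_le_iff)
  qed
  have tr: "transpose x y \<in> \<Gamma>" if "x \<in> W" "y \<in> W" for x y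
    unfolding \<Gamma>_def using that WA by (intro fibre_perms_transpose) blast+
  have T\<Gamma>: "a \<in> \<Gamma>" if "a \<in> T" for a using that T by blast
  have T_bij: "bij a" if "a \<in> \<Gamma>" for a using that T unfolding \<Gamma>_def by (blast dest: fibre_permsD)
  have comp\<Gamma>: "a \<circ> b \<in> \<Gamma>" if "a \<in> \<Gamma>" "b \<in> \<Gamma>" for a b using that unfolding \<Gamma>_def by (rule fibre_perms_comp)
  define L where "L y \<longleftrightarrow> (\<exists>x. K x y)" for y
  \<comment> \<open>The right translates of \<open>T\<close> by the transpositions of
    \<open>x\<close> with the points of \<open>Y\<close> are too many to be disjoint. A collision
    makes \<open>inv a \<circ> b\<close> a product of two such transpositions, which thereby lies in
    the second projection of \<open>K\<close>.\<close>
  have L: "\<exists>y\<in>Y. \<exists>y'\<in>Y. y \<noteq> y' \<and> L (transpose x y \<circ> transpose x y')"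
    if x: "x \<in> W" and Y: "Y \<subseteq> W - {x}" "D \<le> card Y" for x Y
  proof -
    have "card \<Gamma> < card Y * card T" using DT Y(2) by (meson less_le_trans mult_le_mono1)
    moreover have "(\<lambda>a. a \<circ> transpose x i) ` T \<subseteq> \<Gamma>" if "i \<in> Y" for i
      using that x Y T tr comp\<Gamma> by blast
    moreover have "inj_on (\<lambda>a. a \<circ> transpose x i) T" if "i \<in> Y" for i
      by (rule fibre_perms_comp_right_inj) (use tr[of x i] that x Y in \<open>auto simp: \<Gamma>_def\<close>)
    ultimately have "\<exists>i\<in>Y. \<exists>j\<in>Y. i \<noteq> j \<and> (\<exists>a\<in>T. \<exists>b\<in>T. a \<circ> transpose x i = b \<circ> transpose x j)"
      by (intro pigeonhole_images[OF fin\<Gamma>])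
    then obtain i j a b where *: "i \<in> Y" "j \<in> Y" "i \<noteq> j" "a \<in> T" "b \<in> T"
      "a \<circ> transpose x i = b \<circ> transpose x j" by blast
    have "b = a \<circ> transpose x i \<circ> transpose x j"
      unfolding *(6) by (simp add: comp_assoc)
    then have "inv a \<circ> b = transpose x i \<circ> transpose x j"
      using T_bij[OF T\<Gamma>[OF *(4)]] by (simp add: fun_eq_iff bij_is_inj inv_f_f)
    then have "L (transpose x i \<circ> transpose x j)" using K[OF *(4,5)] L_def by metis
    then show ?thesis using * by blast
  qed
  have exists: "\<exists>a b c. {a, b, c} \<subseteq> W \<and> a \<noteq> b \<and> b \<noteq> c \<and> a \<noteq> c \<and> K id (cyc a b c)"
  proof -
    obtain p where p: "p \<in> W" using W(2) by fastforce
    have "card (W - {p}) \<ge> D" using p finW W(2) D2 by simp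
    then obtain I where I: "I \<subseteq> W - {p}" "card I = D" "finite I" by (meson obtain_subset_with_card_n)
    \<comment> \<open>Left translates this time, so that a collision involves a three-cycle
      depending only on \<open>p\<close>, \<open>i\<close>, \<open>j\<close>. Among \<open>D\<close>
      translates of a set of density at least 2 / \<open>D\<close>, two meet in density at least 1 /
      \<open>D\<^sup>2\<close>.\<close>
    let ?f = "\<lambda>i a. transpose p i \<circ> a"
    have sub: "?f i ` T \<subseteq> \<Gamma>" if "i \<in> I" for i
      using that p I T tr comp\<Gamma> by blast
    have inj: "inj_on (?f i) S" if "i \<in> I" for i S
      by (rule fibre_perms_comp_left_inj) (use tr[of p i] that p I in \<open>auto simp: \<Gamma>_def\<close>)
    have "\<exists>i\<in>I. \<exists>j\<in>I. i \<noteq> j \<and> card \<Gamma> \<le> (card I)\<^sup>2 * card (?f i ` T \<inter> ?f j ` T)"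
      by (rule pigeonhole_images_dense[OF fin\<Gamma> I(3) _ sub inj]) (use dense pos I(2) in auto)
    then obtain i j where ij: "i \<in> I" "j \<in> I" "i \<noteq> j" and c1: "card \<Gamma> \<le> D\<^sup>2 * card (?f i ` T \<inter> ?f j ` T)"
      using I(2) by auto
    have ijW: "i \<in> W" "j \<in> W" "i \<noteq> p" "j \<noteq> p" using ij I by auto
    let ?c = "transpose p j \<circ> transpose p i"
    have c_vals: "?c p = i" "?c i = j" "?c j = p"
      using ijW ij by (auto simp: transpose_def)
    have c_cyc: "?c = cyc p i j"
      using ijW ij by (intro ext) (auto simp: cyc_def transpose_def)
    \<comment> \<open>For \<open>a\<close> in \<open>S\<close> both \<open>a\<close> and
      \<open>?c \<circ> a\<close> lie in \<open>T\<close>, so the first coordinate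
      \<open>a \<circ> inv (?c \<circ> a)\<close> is \<open>inv ?c\<close> whatever \<open>a\<close>
      is; only the second coordinate, a conjugate of \<open>?c\<close>, depends on
      \<open>a\<close>.\<close>
    define S where "S = {a \<in> T. ?c \<circ> a \<in> T}"
    have "card (?f i ` T \<inter> ?f j ` T) \<le> card S"
    proof (rule card_inj_on_le)
      show "inj_on (?f i) (?f i ` T \<inter> ?f j ` T)" using ij(1) by (rule inj)
      show "finite S" using finite_subset[OF T fin\<Gamma>] by (simp add: S_def)
      show "?f i ` (?f i ` T \<inter> ?f j ` T) \<subseteq> S"
      proof (rule image_subsetI)
        fix e assume "e \<in> ?f i ` T \<inter> ?f j ` T"
        then obtain a b where ab: "a \<in> T" "b \<in> T" "e = transpose p i \<circ> a" "e = transpose p j \<circ> b" by blast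
        have "transpose p i \<circ> e = a" unfolding ab(3) by (simp add: comp_assoc[symmetric])
        moreover have "?c \<circ> a = transpose p j \<circ> e" unfolding ab(3) by (simp add: comp_assoc)
        moreover have "transpose p j \<circ> e = b" unfolding ab(4) by (simp add: comp_assoc[symmetric])
        ultimately show "transpose p i \<circ> e \<in> S" using ab unfolding S_def by simp
      qed
    qed
    then have c2: "card \<Gamma> \<le> D\<^sup>2 * card S" using c1 by (meson le_trans mult_le_mono2)
    then have "card S > 0" using pos by (cases "card S = 0") auto
    have KS: "K (inv ?c) (inv a \<circ> ?c \<circ> a)" if "a \<in> S" for a
    proof -
      have "K (a \<circ> inv (?c \<circ> a)) (inv a \<circ> (?c \<circ> a))"
        using that unfolding S_def by (intro K) auto
      moreover have "a \<circ> inv (?c \<circ> a) = inv ?c"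
      proof -
        have ba: "bij a" using that T\<Gamma> T_bij unfolding S_def by blast
        have "inv (?c \<circ> a) = inv a \<circ> inv ?c"
          using ba by (intro o_inv_distrib bij_comp bij_transpose)
        then show ?thesis
          using ba by (simp add: comp_assoc[symmetric] surj_iff[THEN iffD1, OF bij_is_surj])
      qed
      ultimately show ?thesis by (simp add: comp_assoc)
    qed
    \<comment> \<open>Three points are removed, so the threshold \<open>D\<^sup>2 + 4\<close> leaves
      more than \<open>D\<^sup>2\<close> translates of a set of density at least 1 /
      \<open>D\<^sup>2\<close>.\<close>
    have c3: "card (W - {p, i, j}) \<ge> D\<^sup>2 + 1"
    proof -
      have "card {p, i, j} = 3" using ij ijW by auto
      then have "card (W - {p, i, j}) = card W - 3"
        using p ijW finW by (subst card_Diff_subset) auto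
      then show ?thesis using W(2) by simp
    qed
    let ?g = "\<lambda>l a. transpose j l \<circ> a"
    have "card \<Gamma> < card (W - {p, i, j}) * card S"
    proof -
      have "(D\<^sup>2 + 1) * card S \<le> card (W - {p, i, j}) * card S" using c3 by (rule mult_le_mono1)
      then show ?thesis using c2 \<open>card S > 0\<close> by (simp add: algebra_simps)
    qed
    moreover have "?g l ` S \<subseteq> \<Gamma>" if "l \<in> W - {p, i, j}" for l
      using that ijW T\<Gamma> tr comp\<Gamma> unfolding S_def by blast
    moreover have "inj_on (?g l) S" if "l \<in> W - {p, i, j}" for l
      by (rule fibre_perms_comp_left_inj) (use tr[of j l] that ijW in \<open>auto simp: \<Gamma>_def\<close>)
    ultimately have "\<exists>l\<in>W - {p, i, j}. \<exists>l'\<in>W - {p, i, j}. l \<noteq> l' \<and>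
        (\<exists>a\<in>S. \<exists>a'\<in>S. transpose j l \<circ> a = transpose j l' \<circ> a')"
      by (intro pigeonhole_images[OF fin\<Gamma>])
    then obtain l l' a a' where ll: "l \<in> W - {p, i, j}" "l' \<in> W - {p, i, j}" "l \<noteq> l'" "a \<in> S" "a' \<in> S"
      "transpose j l \<circ> a = transpose j l' \<circ> a'" by blast
    have aG: "a \<in> \<Gamma>" "a' \<in> \<Gamma>" using ll T\<Gamma> unfolding S_def by auto
    then have ba: "bij a" "bij a'" using T_bij by auto
    \<comment> \<open>The collision reads \<open>a' = e \<circ> a\<close>, where
      \<open>inv e\<close> fixes \<open>p\<close> and \<open>i\<close> and moves \<open>j\<close> to
      \<open>l'\<close>. The conjugates of \<open>?c\<close> by \<open>inv a\<close> and by
      \<open>inv a'\<close> therefore share two points and differ in the third, and their quotient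
      is a three-cycle over the identity.\<close>
    define e where "e = transpose j l' \<circ> transpose j l"
    have be: "bij e" unfolding e_def by (intro bij_comp bij_transpose)
    have a'e: "a' = e \<circ> a"
    proof -
      have "e \<circ> a = transpose j l' \<circ> (transpose j l \<circ> a)" by (simp add: e_def comp_assoc)
      also have "\<dots> = a'" unfolding ll(6) by (simp add: comp_assoc[symmetric])
      finally show ?thesis by simp
    qed
    have conj_inv: "inv b \<circ> cyc x y z \<circ> b = cyc (inv b x) (inv b y) (inv b z)" if "bij b" for b :: "'a \<Rightarrow> 'a" and x y z
      using conj_cyc[OF bij_imp_bij_inv[OF that]] that by (simp add: inv_inv_eq)
    have ia': "inv a' = inv a \<circ> inv e" unfolding a'e using be ba by (intro o_inv_distrib)
    have inve: "inv e = transpose j l \<circ> transpose j l'"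
      unfolding e_def by (subst o_inv_distrib) auto
    have ie: "inv e p = p" "inv e i = i" "inv e j = l'"
      unfolding inve using ll ijW ij by (auto simp: transpose_def)
    let ?b = "inv a"
    have s: "inv a \<circ> ?c \<circ> a = cyc (?b p) (?b i) (?b j)"
      unfolding c_cyc using ba by (simp add: conj_inv)
    have s': "inv a' \<circ> ?c \<circ> a' = cyc (?b p) (?b i) (?b l')"
      unfolding c_cyc conj_inv[OF ba(2)] by (simp add: ia' ie)
    have inj_b: "inj ?b" using ba by (simp add: bij_is_inj bij_imp_bij_inv)
    have dist: "distinct [?b p, ?b i, ?b j, ?b l']"
      using inj_b ll ijW ij by (auto simp: inj_eq)
    have "K (inv ?c \<circ> inv (inv ?c)) (cyc (?b p) (?b i) (?b j) \<circ> inv (cyc (?b p) (?b i) (?b l')))"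
      using comp[OF KS[OF ll(4)] inv[OF KS[OF ll(5)]]] unfolding s s' .
    moreover have "inv ?c \<circ> inv (inv ?c) = id"
      unfolding c_cyc by (metis bij_cyc bij_imp_bij_inv bij_is_inj inv_inv_eq inv_o_cancel)
    ultimately have "K id (cyc (?b p) (?b l') (?b j))"
      using cyc_quotient[OF dist] by metis
    moreover have "?b x \<in> W" if "x \<in> W" for x
    proof -
      have "inv a \<in> fibre_perms A t" using aG unfolding \<Gamma>_def by (intro fibre_perms_inv)
      then show ?thesis using that unfolding W(1)
        by (metis (mono_tags, lifting) fibre_permsD(1,2) mem_Collect_eq permutes_in_image)
    qed
    ultimately show ?thesis
    proof -
      assume *: "K id (cyc (?b p) (?b l') (?b j))" "\<And>x. x \<in> W \<Longrightarrow> ?b x \<in> W"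
      have "{?b p, ?b l', ?b j} \<subseteq> W" using *(2) p ijW ll(2) by blast
      moreover have "?b p \<noteq> ?b l'" "?b l' \<noteq> ?b j" "?b p \<noteq> ?b j" using dist by auto
      ultimately show ?thesis using *(1) by blast
    qed
  qed
  show ?thesis
  proof -
    obtain a b c where abc: "{a, b, c} \<subseteq> W" "a \<noteq> b" "b \<noteq> c" "a \<noteq> c" "K id (cyc a b c)"
      using exists by blast
    show ?thesis
    proof (rule all_cyc_whole[where N = "K id" and L = L and D = D, OF finW])
      show "2 * D \<le> card W" using W(2) D22 by linarith
      show "K id (s \<circ> s')" if "K id s" "K id s'" for s s' using comp[OF that] by simp
      show "K id (inv s)" if "K id s" for s using inv[OF that] by simp
      \<comment> \<open>The fibre over the identity is normalised by the whole second projection of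
        \<open>K\<close>: conjugating \<open>id\<close> in the first coordinate gives
        \<open>id\<close> again.\<close>
      show "K id (l \<circ> s \<circ> inv l)" if Ll: "L l" and s: "K id s" for l s
      proof -
        obtain x where x: "K x l" using Ll unfolding L_def by blast
        have "K (x \<circ> id \<circ> inv x) (l \<circ> s \<circ> inv l)"
          by (rule comp[OF comp[OF x s] inv[OF x]])
        moreover have "x \<circ> id \<circ> inv x = id"
          using bij[OF x] by (metis bij_is_surj comp_id surj_iff)
        ultimately show ?thesis by (simp only:)
      qed
      show "\<exists>y\<in>Y. \<exists>y'\<in>Y. y \<noteq> y' \<and> L (transpose x y \<circ> transpose x y')"
        if "x \<in> W" "Y \<subseteq> W - {x}" "D \<le> card Y" for x Y
        using that by (rule L)
    qed (rule abc)+
  qed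
qed


text \<open>As \<gamma> moves \<open>A\<close> off itself, \<open>c y\<close> is supported on the
  image of \<open>A\<close> and commutes with \<Gamma>. Hence the quotient of the conjugates of
  \<gamma> by \<open>a\<close> and by \<open>b\<close> equals
  \<open>a \<circ> inv b \<circ> c (inv a \<circ> b)\<close>, and \<open>N\<close> cuts out a
  subgroup \<open>K\<close> of \<Gamma> \<times> \<Gamma> of the kind just treated. Over
  \<open>id\<close> in the first coordinate only elements supported on the image of \<open>A\<close>
  remain, and \<gamma> carries the three-cycles on \<open>W\<close> there.\<close>

lemma double_commutator_cyc:
  fixes A :: "'a set" and t :: "'a \<Rightarrow> 'b" and N :: "('a \<Rightarrow> 'a) \<Rightarrow> bool"
  defines "\<Gamma> \<equiv> fibre_perms A t"
  assumes fin: "finite A" and \<gamma>: "bij \<gamma>" "\<gamma> ` A \<inter> A = {}"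
    and comp: "\<And>s s'. N s \<Longrightarrow> N s' \<Longrightarrow> N (s \<circ> s')" and inv: "\<And>s. N s \<Longrightarrow> N (inv s)"
    and T: "T \<subseteq> \<Gamma>" and dense: "2 * card \<Gamma> \<le> D * card T"
    and N: "\<And>a. a \<in> T \<Longrightarrow> N (a \<circ> \<gamma> \<circ> inv a)"
    and W: "W = {x \<in> A. t x = w}" "card W \<ge> D\<^sup>2 + 4"
  shows "all_cyc N (\<gamma> ` W)"
proof -
  define c where "c y = \<gamma> \<circ> y \<circ> inv \<gamma>" for y :: "'a \<Rightarrow> 'a"
  have g: "inv \<gamma> (\<gamma> x) = x" "\<gamma> (inv \<gamma> x) = x" for x
    using \<gamma>(1) by (auto simp: bij_is_inj inv_f_f bij_is_surj surj_f_inv_f)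
  have c_comp: "c (y \<circ> y') = c y \<circ> c y'" for y y'
    by (simp add: c_def fun_eq_iff g)
  have c_inv: "inv (c y) = c (inv y)" if "bij y" for y
    by (rule inv_unique_comp) (use that in \<open>auto simp: c_def fun_eq_iff g bij_is_inj inv_f_f bij_is_surj surj_f_inv_f\<close>)
  have c_bij: "bij (c y)" if "bij y" for y
    unfolding c_def by (intro bij_comp that \<gamma>(1) bij_imp_bij_inv)
  have Gbij: "bij x" if "x \<in> \<Gamma>" for x using that unfolding \<Gamma>_def by (rule fibre_permsD)
  have comm: "x \<circ> c y = c y \<circ> x" if "x \<in> \<Gamma>" "y \<in> \<Gamma>" for x y
  proof
    fix z
    have x: "x permutes A" and y: "y permutes A" using that unfolding \<Gamma>_def by (auto dest: fibre_permsD)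
    show "(x \<circ> c y) z = (c y \<circ> x) z"
    proof (cases "z \<in> A")
      case True
      have *: "c y z' = z'" if "z' \<in> A" for z'
      proof -
        have "inv \<gamma> z' \<notin> A" using \<gamma>(2) that g(2)[of z'] by (metis disjoint_iff image_eqI)
        then show ?thesis using y g by (simp add: c_def permutes_not_in)
      qed
      have "x z \<in> A" using True x by (simp add: permutes_in_image)
      then show ?thesis using True * by simp
    next
      case False
      have "c y z \<notin> A"
      proof (cases "inv \<gamma> z \<in> A")
        case True
        then have "y (inv \<gamma> z) \<in> A" using y by (simp add: permutes_in_image)
        then show ?thesis using \<gamma>(2) by (auto simp: c_def)
      next
        case F: False
        then show ?thesis using y g False by (simp add: c_def permutes_not_in)
      qed
      then show ?thesis using False x by (simp add: permutes_not_in)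
    qed
  qed
  define K where "K x y \<longleftrightarrow> x \<in> \<Gamma> \<and> y \<in> \<Gamma> \<and> N (x \<circ> c y)" for x y
  have "all_cyc (K id) W"
  proof (rule dense_relation_contains_cyc[OF fin T[unfolded \<Gamma>_def] dense[unfolded \<Gamma>_def] _ _ _ _ W])
    fix a b assume ab: "a \<in> T" "b \<in> T"
    have G: "a \<in> \<Gamma>" "b \<in> \<Gamma>" "inv a \<in> \<Gamma>" "inv b \<in> \<Gamma>" using ab T unfolding \<Gamma>_def by (auto intro: fibre_perms_inv)
    have bb: "bij a" "bij b" using G Gbij by auto
    have i: "a (inv a z) = z" "inv a (a z) = z" "b (inv b z) = z" "inv b (b z) = z" for z
      using bb by (auto simp: bij_is_inj inv_f_f bij_is_surj surj_f_inv_f)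
    have "N ((a \<circ> \<gamma> \<circ> inv a) \<circ> inv (b \<circ> \<gamma> \<circ> inv b))" using N ab comp inv by blast
    moreover have "inv (b \<circ> \<gamma> \<circ> inv b) = b \<circ> inv \<gamma> \<circ> inv b"
      by (rule inv_unique_comp) (auto simp: fun_eq_iff i g)
    moreover have "(a \<circ> \<gamma> \<circ> inv a) \<circ> (b \<circ> inv \<gamma> \<circ> inv b) = a \<circ> (c (inv a \<circ> b) \<circ> inv b)"
      by (simp add: c_def fun_eq_iff)
    moreover have "c (inv a \<circ> b) \<circ> inv b = inv b \<circ> c (inv a \<circ> b)"
      using comm[of "inv b" "inv a \<circ> b"] G unfolding \<Gamma>_def by (simp add: fibre_perms_comp)
    ultimately have "N (a \<circ> inv b \<circ> c (inv a \<circ> b))" by (simp add: comp_assoc)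
    then show "K (a \<circ> inv b) (inv a \<circ> b)"
      using G unfolding K_def \<Gamma>_def by (simp add: fibre_perms_comp)
  next
    fix x y x' y' assume k: "K x y" "K x' y'"
    have "N ((x \<circ> c y) \<circ> (x' \<circ> c y'))" using k comp K_def by blast
    moreover have "(x \<circ> c y) \<circ> (x' \<circ> c y') = x \<circ> (c y \<circ> x') \<circ> c y'" by (simp add: comp_assoc)
    moreover have "c y \<circ> x' = x' \<circ> c y" using comm k K_def by metis
    moreover have "x \<circ> (x' \<circ> c y) \<circ> c y' = x \<circ> x' \<circ> c (y \<circ> y')" by (simp add: c_comp comp_assoc)
    ultimately have "N (x \<circ> x' \<circ> c (y \<circ> y'))" by metis
    then show "K (x \<circ> x') (y \<circ> y')"
      using k unfolding K_def \<Gamma>_def by (simp add: fibre_perms_comp)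
  next
    fix x y assume k: "K x y"
    then have b: "bij x" "bij y" using Gbij K_def by auto
    have G: "inv x \<in> \<Gamma>" "inv y \<in> \<Gamma>" using k unfolding K_def \<Gamma>_def by (auto intro: fibre_perms_inv)
    have "N (inv (x \<circ> c y))" using k inv K_def by blast
    moreover have "inv (x \<circ> c y) = c (inv y) \<circ> inv x"
      using b c_bij by (simp add: o_inv_distrib c_inv)
    moreover have "c (inv y) \<circ> inv x = inv x \<circ> c (inv y)" using comm[OF G] by simp
    ultimately show "K (inv x) (inv y)" using G unfolding K_def by simp
  next
    fix x y assume k: "K x y"
    then show "bij x \<and> bij y" using Gbij K_def by auto
  qed
  then have "N (cyc (\<gamma> x) (\<gamma> y) (\<gamma> z))"
    if "x \<in> W" "y \<in> W" "z \<in> W" "x \<noteq> y" "y \<noteq> z" "x \<noteq> z" for x y z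
    using all_cycD[OF _ that, of "K id"] by (simp add: K_def c_def conj_cyc[OF \<gamma>(1)])
  then show ?thesis unfolding all_cyc_def by blast
qed

text \<open>Take two points \<open>r\<close>, \<open>s\<close> of \<open>R\<close> with the same
  value of \<open>t\<close>; evenness guarantees a partner. The points \<open>r\<close>,
  \<open>s\<close>, \<open>\<sigma> r\<close>, \<open>\<sigma> s\<close> all lie over that value,
  and \<sigma> acts on them as a product of two transpositions, hence of two three-cycles. What is
  left is an involution of the same kind for \<open>R - {r, s}\<close>.\<close>

lemma even_involution_in:
  assumes cyc: "\<And>w. all_cyc N {x \<in> U. t x = w}" and id: "N id"
    and comp: "\<And>s s'. N s \<Longrightarrow> N s' \<Longrightarrow> N (s \<circ> s')"
    and "finite R" "R \<subseteq> U" "\<And>x. \<sigma> (\<sigma> x) = x" "\<And>x. \<sigma> x \<noteq> x \<Longrightarrow> x \<in> R \<or> \<sigma> x \<in> R"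
    and "\<And>x. x \<in> R \<Longrightarrow> \<sigma> x \<in> U - R" "\<And>x. t (\<sigma> x) = t x"
    and "\<And>w. even (card {x \<in> R. t x = w})"
  shows "N \<sigma>"
  using assms(4-)
proof (induction "card R" arbitrary: R \<sigma> rule: less_induct)
  case less
  show ?case
  proof (cases "R = {}")
    case True
    then have "\<sigma> = id" using less.prems(4) by (intro ext) auto
    then show ?thesis using id by simp
  next
    case False
    then obtain r where r: "r \<in> R" by blast
    let ?F = "{x \<in> R. t x = t r}"
    have "card ?F \<noteq> 1" using less.prems(7)[of "t r"] by (metis odd_one)
    moreover have "card ?F > 0" using r less.prems(1) by (auto simp: card_gt_0_iff)
    ultimately have "\<not> ?F \<subseteq> {r}" using card_mono[of "{r}" ?F] by auto
    then obtain s where s: "s \<in> R" "t s = t r" "s \<noteq> r" by blast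
    have d: "\<sigma> r \<notin> R" "\<sigma> s \<notin> R" "\<sigma> r \<in> U" "\<sigma> s \<in> U" using less.prems(5) r s by auto
    have ne: "\<sigma> r \<noteq> \<sigma> s" using s less.prems(3) by metis
    have dist: "r \<noteq> \<sigma> r" "r \<noteq> s" "r \<noteq> \<sigma> s" "\<sigma> r \<noteq> s" "\<sigma> r \<noteq> \<sigma> s" "s \<noteq> \<sigma> s" using d r s ne by auto
    define \<rho> where "\<rho> x = (if x \<in> {r, s, \<sigma> r, \<sigma> s} then x else \<sigma> x)" for x
    have r4: "\<sigma> x \<in> {r, s, \<sigma> r, \<sigma> s} \<longleftrightarrow> x \<in> {r, s, \<sigma> r, \<sigma> s}" for x
    proof -
      have *: "\<sigma> x = y \<longleftrightarrow> x = \<sigma> y" for y using less.prems(3) by metis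
      show ?thesis unfolding insert_iff empty_iff * less.prems(3) by blast
    qed
    have eq: "\<sigma> = (cyc r (\<sigma> r) s \<circ> cyc (\<sigma> r) s (\<sigma> s)) \<circ> \<rho>"
    proof
      fix x
      show "\<sigma> x = ((cyc r (\<sigma> r) s \<circ> cyc (\<sigma> r) s (\<sigma> s)) \<circ> \<rho>) x"
      proof (cases "x \<in> {r, s, \<sigma> r, \<sigma> s}")
        case True
        then show ?thesis unfolding double_transposition_cyc[symmetric] using dist less.prems(3)
          by (auto simp: \<rho>_def transpose_def)
      next
        case False
        then show ?thesis unfolding double_transposition_cyc[symmetric] using r4[of x]
          by (auto simp: \<rho>_def transpose_def)
      qed
    qed
    have "N \<rho>"
    proof (rule less.hyps[of "R - {r, s}"])
      show "card (R - {r, s}) < card R" using r less.prems(1) by (intro psubset_card_mono) auto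
      show "\<rho> (\<rho> x) = x" for x using r4[of x] less.prems(3)[of x] by (auto simp: \<rho>_def)
      show "x \<in> R - {r, s} \<or> \<rho> x \<in> R - {r, s}" if "\<rho> x \<noteq> x" for x
        using that less.prems(4)[of x] r4[of x] by (auto simp: \<rho>_def split: if_splits)
      show "\<rho> x \<in> U - (R - {r, s})" if "x \<in> R - {r, s}" for x
        using that less.prems(5)[of x] d by (auto simp: \<rho>_def split: if_splits)
      show "t (\<rho> x) = t x" for x using less.prems(6) by (simp add: \<rho>_def)
      show "even (card {x \<in> R - {r, s}. t x = w})" for w
      proof (cases "w = t r")
        case True
        have "{x \<in> R - {r, s}. t x = w} = {x \<in> R. t x = w} - {r, s}" by auto
        moreover have "{r, s} \<subseteq> {x \<in> R. t x = w}" using r s True by auto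
        ultimately have "card {x \<in> R - {r, s}. t x = w} = card {x \<in> R. t x = w} - 2"
          using s(3) by (simp add: card_Diff_subset card_insert_if)
        then show ?thesis using less.prems(7)[of w] by simp
      next
        case False
        then have "{x \<in> R - {r, s}. t x = w} = {x \<in> R. t x = w}" using s by auto
        then show ?thesis using less.prems(7)[of w] by simp
      qed
    qed (use less.prems(1,2) in auto)
    moreover have "N (cyc r (\<sigma> r) s)" "N (cyc (\<sigma> r) s (\<sigma> s))"
      using r s d dist less.prems(2,6) by (auto intro!: all_cycD[OF cyc[of "t r"]])
    ultimately show ?thesis using comp eq by metis
  qed
qed

text \<open>Being joined by a transposition in \<open>N\<close> is transitive, and each
  \<open>a\<close> in \<open>T\<close> maps either half over \<open>w\<close> to a set of mutually
  joined points. If \<open>x\<close> and \<open>y\<close> are not joined, the two images must be the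
  same pair \<open>X\<close>, \<open>Y\<close> for every \<open>a\<close> in \<open>T\<close>. But
  \<open>T\<close> is so dense that its translates by transpositions at \<open>x\<close> collide,
  and then two different transpositions would carry the partition into \<open>X\<close> and
  \<open>Y\<close> to the same partition, which is impossible.\<close>

lemma dense_halves_transpose:
  fixes A B :: "'a set" and t :: "'a \<Rightarrow> 'b" and N :: "('a \<Rightarrow> 'a) \<Rightarrow> bool"
  defines "\<Gamma> \<equiv> fibre_perms (A \<union> B) t"
  assumes fin: "finite A" "finite B" and disj: "A \<inter> B = {}"
    and comp: "\<And>s s'. N s \<Longrightarrow> N s' \<Longrightarrow> N (s \<circ> s')"
    and T: "T \<subseteq> \<Gamma>" and dense: "card \<Gamma> < D * card T"
    and NA: "\<And>a x y. a \<in> T \<Longrightarrow> x \<in> A \<Longrightarrow> y \<in> A \<Longrightarrow> t x = t y \<Longrightarrow> N (transpose (a x) (a y))"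
    and NB: "\<And>a x y. a \<in> T \<Longrightarrow> x \<in> B \<Longrightarrow> y \<in> B \<Longrightarrow> t x = t y \<Longrightarrow> N (transpose (a x) (a y))"
    and cA: "card {x \<in> A. t x = w} \<ge> D + 2" and cB: "card {x \<in> B. t x = w} \<ge> D + 2"
    and xy: "x \<in> A \<union> B" "y \<in> A \<union> B" "t x = w" "t y = w"
  shows "N (transpose x y)"
proof (rule ccontr)
  assume neg: "\<not> N (transpose x y)"
  let ?A = "{x \<in> A. t x = w}" and ?B = "{x \<in> B. t x = w}" and ?W = "{x \<in> A \<union> B. t x = w}"
  define X where "X = {z \<in> ?W. N (transpose x z)}"
  define Y where "Y = {z \<in> ?W. N (transpose z y)}"
  have XY: "X \<inter> Y = {}"
  proof (rule ccontr)
    assume "X \<inter> Y \<noteq> {}"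
    then obtain z where z: "N (transpose x z)" "N (transpose z y)" by (auto simp: X_def Y_def)
    show False
    proof (cases "z = x \<or> z = y \<or> x = y")
      case True
      then show ?thesis
      proof (elim disjE)
        assume "x = y"
        have "N (transpose x z \<circ> transpose x z)" using z comp by blast
        then show False using neg \<open>x = y\<close> by simp
      qed (use z neg in auto)
    next
      case False
      have "N (transpose x z \<circ> transpose z y \<circ> transpose x z)" using z comp by blast
      moreover have "transpose x z \<circ> transpose z y \<circ> transpose x z = transpose x y"
        using False by (intro ext) (auto simp: transpose_def)
      ultimately show False using neg by simp
    qed
  qed
  have fin\<Gamma>: "finite \<Gamma>" unfolding \<Gamma>_def using fin by (intro finite_fibre_perms) auto
  have img: "{a ` ?A, a ` ?B} = {X, Y}" and xX': "x \<in> X" if a: "a \<in> T" for a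
  proof -
    have aG: "a permutes A \<union> B" "\<And>z. t (a z) = t z" using a T unfolding \<Gamma>_def by (auto dest: fibre_permsD)
    have "a ` ?W = ?W"
    proof
      show "a ` ?W \<subseteq> ?W" using permutes_in_image[OF aG(1)] aG(2) by blast
      show "?W \<subseteq> a ` ?W"
      proof
        fix z assume z: "z \<in> ?W"
        have "a (inv a z) = z" using aG by (simp add: permutes_inverses)
        moreover have "inv a z \<in> ?W" using z aG(1) aG(2)[of "inv a z"]
          by (metis (mono_tags, lifting) calculation mem_Collect_eq permutes_in_image)
        ultimately show "z \<in> a ` ?W" by (metis image_eqI)
      qed
    qed
    moreover define P Q where "P = a ` ?A" and "Q = a ` ?B"
    ultimately have W: "P \<union> Q = ?W" by auto
    have sA: "N (transpose u v)" if "u \<in> P" "v \<in> P" for u v using NA[OF a] that by (auto simp: P_def)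
    have sB: "N (transpose u v)" if "u \<in> Q" "v \<in> Q" for u v using NB[OF a] that by (auto simp: Q_def)
    have XW: "X = {z \<in> P \<union> Q. N (transpose x z)}" and YW: "Y = {z \<in> P \<union> Q. N (transpose z y)}"
      unfolding X_def Y_def W by auto
    have "x \<in> P \<union> Q" "y \<in> P \<union> Q" unfolding W using xy by auto
    then have cases: "(x \<in> P \<and> y \<in> Q) \<or> (x \<in> Q \<and> y \<in> P)"
      using neg sA sB by blast
    have eqI: "P' = X \<and> Q' = Y" if "P' \<subseteq> X" "Q' \<subseteq> Y" "P' \<union> Q' = P \<union> Q" for P' Q'
      using that XY unfolding XW YW by blast
    from cases have "(P = X \<and> Q = Y) \<or> (Q = X \<and> P = Y)"
    proof
      assume "x \<in> P \<and> y \<in> Q"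
      then have "P \<subseteq> X" "Q \<subseteq> Y" unfolding XW YW using sA sB by blast+
      then show ?thesis using eqI by blast
    next
      assume "x \<in> Q \<and> y \<in> P"
      then have "Q \<subseteq> X" "P \<subseteq> Y" unfolding XW YW using sA sB by blast+
      then show ?thesis using eqI[of Q P] by (simp add: Un_commute)
    qed
    then show "{a ` ?A, a ` ?B} = {X, Y}" unfolding P_def[symmetric] Q_def[symmetric] by auto
    show "x \<in> X" using cases sA sB unfolding XW by blast
  qed
  have Tne: "T \<noteq> {}" using dense by auto
  then obtain a0 where a0: "a0 \<in> T" by blast
  have xX: "x \<in> X" by (rule xX'[OF a0])
  have a0inj: "inj a0" using a0 T unfolding \<Gamma>_def by (auto dest!: fibre_permsD(3) simp: bij_is_inj)
  have "card (a0 ` ?A) \<ge> D + 2" "card (a0 ` ?B) \<ge> D + 2"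
    using cA cB card_image[OF inj_on_subset[OF a0inj subset_UNIV]] by simp_all
  then have "\<forall>Z\<in>{a0 ` ?A, a0 ` ?B}. card Z \<ge> D + 2" by simp
  then have cX: "card X \<ge> D + 2" and cY: "card Y \<ge> D + 2"
    unfolding img[OF a0] by simp_all
  obtain x' where x': "x' \<in> X" "x' \<noteq> x"
  proof -
    have "\<not> X \<subseteq> {x}"
    proof
      assume "X \<subseteq> {x}"
      then have "card X \<le> 1" using card_mono[of "{x}" X] by simp
      then show False using cX by simp
    qed
    then show thesis using that by blast
  qed
  have W_G: "transpose x i \<in> \<Gamma>" if "i \<in> Y" for i
    unfolding \<Gamma>_def by (rule fibre_perms_transpose) (use xy that in \<open>auto simp: Y_def\<close>)
  have "\<exists>i\<in>Y. \<exists>j\<in>Y. i \<noteq> j \<and> (\<exists>a\<in>T. \<exists>b\<in>T. transpose x i \<circ> a = transpose x j \<circ> b)"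
  proof (rule pigeonhole_images[OF fin\<Gamma>])
    have "D * card T \<le> card Y * card T" using cY by (intro mult_le_mono1) simp
    then show "card \<Gamma> < card Y * card T" using dense by (rule less_le_trans[rotated])
  next
    fix i assume "i \<in> Y"
    then show "inj_on (\<lambda>a. transpose x i \<circ> a) T"
      using W_G[of i] unfolding \<Gamma>_def by (intro fibre_perms_comp_left_inj)
    show "(\<lambda>a. transpose x i \<circ> a) ` T \<subseteq> \<Gamma>"
      using W_G[OF \<open>i \<in> Y\<close>] T unfolding \<Gamma>_def by (auto intro!: fibre_perms_comp)
  qed
  then obtain i j a b where ij: "i \<in> Y" "j \<in> Y" "i \<noteq> j" "a \<in> T" "b \<in> T"
    and e: "transpose x i \<circ> a = transpose x j \<circ> b" by blast
  \<comment> \<open>Both sides are the image of the partition into \<open>X\<close> and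
    \<open>Y\<close>. On the left one block contains \<open>i\<close> and \<open>x'\<close>; on the
    right one block misses \<open>i\<close> and the other misses \<open>x'\<close>.\<close>
  have "(\<lambda>S. transpose x i ` S) ` {a ` ?A, a ` ?B} = (\<lambda>S. transpose x j ` S) ` {b ` ?A, b ` ?B}"
    using e by (simp only: image_insert image_comp image_empty)
  then have *: "transpose x i ` X \<in> {transpose x j ` X, transpose x j ` Y}"
    unfolding img[OF ij(4)] img[OF ij(5)] image_insert image_empty
    by (rule equalityD1[THEN insert_subset[THEN iffD1, THEN conjunct1]])
  have i1: "i \<in> transpose x i ` X" using xX by (metis image_eqI transpose_apply_first)
  have i2: "x' \<in> transpose x i ` X"
    using x' ij XY by (metis disjoint_iff image_eqI transpose_apply_other)
  have "i \<notin> transpose x j ` X"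
    using ij XY xX by (auto simp: transpose_def split: if_splits)
  moreover have "x' \<notin> transpose x j ` Y"
    using x' ij XY xX by (auto simp: transpose_def split: if_splits)
  ultimately show False using * i1 i2 by auto
qed

subsection \<open>Asymptotic independence of the values of a random permutation\<close>

text \<open>The value at \<open>p\<close> is resampled: \<Phi> exchanges it with an auxiliary point
  \<open>q\<close> of the fibre and is an involution of \<Gamma> \<times> \<open>F\<close>. This
  turns the condition on \<open>\<sigma> p\<close> into one on the independent variable
  \<open>q\<close>, and membership in \<open>E\<close> can change only if \<open>q\<close> is a
  value of \<sigma> on \<open>J\<close>. At most \<open>card \<Gamma> * card J\<close> pairs have
  this defect.\<close>

lemma fibre_perms_resample:
  fixes Q :: "'a set" and t :: "'a \<Rightarrow> 'b"
  defines "\<Gamma> \<equiv> fibre_perms Q t"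
  assumes fin: "finite Q" and E: "E \<subseteq> \<Gamma>"
    and dep: "\<And>\<sigma> \<sigma>'. \<sigma> \<in> \<Gamma> \<Longrightarrow> \<sigma>' \<in> \<Gamma> \<Longrightarrow> (\<And>q. q \<in> J \<Longrightarrow> \<sigma> q = \<sigma>' q) \<Longrightarrow> \<sigma> \<in> E \<longleftrightarrow> \<sigma>' \<in> E"
    and J: "J \<subseteq> Q" and p: "p \<in> Q" "p \<notin> J"
  defines "F \<equiv> {x \<in> Q. t x = t p}"
  shows "\<bar>real (card {\<sigma> \<in> E. \<sigma> p \<in> A}) * card F - real (card E) * card (A \<inter> F)\<bar> \<le> real (card \<Gamma>) * card J"
proof -
  have fin\<Gamma>: "finite \<Gamma>" unfolding \<Gamma>_def using fin by (rule finite_fibre_perms)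
  have finF: "finite F" using fin by (simp add: F_def)
  have finE: "finite E" using E fin\<Gamma> finite_subset by blast
  have finJ: "finite J" using J fin finite_subset by blast
  have \<sigma>p: "\<sigma> p \<in> F" if "\<sigma> \<in> \<Gamma>" for \<sigma>
    using that p unfolding \<Gamma>_def F_def by (auto dest: fibre_permsD simp: permutes_in_image)
  have trG: "transpose (\<sigma> p) q \<circ> \<sigma> \<in> \<Gamma>" if "\<sigma> \<in> \<Gamma>" "q \<in> F" for \<sigma> q
    unfolding \<Gamma>_def
    by (intro fibre_perms_comp fibre_perms_transpose) (use that \<sigma>p[OF that(1)] in \<open>auto simp: \<Gamma>_def F_def\<close>)
  define \<Phi> where "\<Phi> = (\<lambda>(\<sigma> :: 'a \<Rightarrow> 'a, q). (transpose (\<sigma> p) q \<circ> \<sigma>, \<sigma> p))"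
  have \<Phi>\<Phi>: "\<Phi> (\<Phi> z) = z" for z
    by (cases z) (simp add: \<Phi>_def comp_assoc[symmetric] transpose_commute)
  have \<Phi>in: "\<Phi> z \<in> \<Gamma> \<times> F" if "z \<in> \<Gamma> \<times> F" for z
    using that trG \<sigma>p by (auto simp: \<Phi>_def)
  let ?S1 = "{\<sigma> \<in> E. \<sigma> p \<in> A} \<times> F"
  let ?S2 = "{z \<in> \<Gamma> \<times> F. transpose (fst z p) (snd z) \<circ> fst z \<in> E \<and> snd z \<in> A}"
  let ?S3 = "E \<times> (A \<inter> F)"
  let ?X = "{z \<in> \<Gamma> \<times> F. snd z \<in> fst z ` J}"
  have "card ?S1 = card ?S2"
  proof (rule bij_betw_same_card[of \<Phi>], rule bij_betw_byWitness[of _ \<Phi>])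
    show "\<Phi> ` ?S1 \<subseteq> ?S2"
    proof (rule image_subsetI)
      fix z assume z: "z \<in> ?S1"
      then have "z \<in> \<Gamma> \<times> F" using E by auto
      then show "\<Phi> z \<in> ?S2"
        using z \<Phi>in[of z] \<Phi>\<Phi>[of z] by (cases z) (auto simp: \<Phi>_def)
    qed
    show "\<Phi> ` ?S2 \<subseteq> ?S1"
    proof (rule image_subsetI)
      fix z assume z: "z \<in> ?S2"
      then show "\<Phi> z \<in> ?S1" using \<Phi>in[of z] by (cases z) (auto simp: \<Phi>_def)
    qed
  qed (use \<Phi>\<Phi> in auto)
  then have 1: "card {\<sigma> \<in> E. \<sigma> p \<in> A} * card F = card ?S2" by (simp add: card_cartesian_product)
  have same: "(transpose (\<sigma> p) q \<circ> \<sigma> \<in> E) = (\<sigma> \<in> E)" if "\<sigma> \<in> \<Gamma>" "q \<in> F" "q \<notin> \<sigma> ` J" for \<sigma> q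
  proof (rule dep[OF trG[OF that(1,2)] that(1)])
    fix r assume r: "r \<in> J"
    have "inj \<sigma>" using that(1) unfolding \<Gamma>_def by (auto dest!: fibre_permsD(3) simp: bij_is_inj)
    then have "\<sigma> r \<noteq> \<sigma> p" using r p by (auto simp: inj_eq)
    moreover have "\<sigma> r \<noteq> q" using r that by auto
    ultimately show "(transpose (\<sigma> p) q \<circ> \<sigma>) r = \<sigma> r" by simp
  qed
  have fS: "finite ?S2" "finite ?S3" "finite ?X" using fin\<Gamma> finF finE by auto
  have "?S2 \<subseteq> ?S3 \<union> ?X"
  proof
    fix z assume "z \<in> ?S2"
    then show "z \<in> ?S3 \<union> ?X" using same[of "fst z" "snd z"] by (cases z) auto
  qed
  moreover have "?S3 \<subseteq> ?S2 \<union> ?X"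
  proof
    fix z assume "z \<in> ?S3"
    then show "z \<in> ?S2 \<union> ?X" using same[of "fst z" "snd z"] E by (cases z) auto
  qed
  ultimately have "card ?S2 \<le> card ?S3 + card ?X" "card ?S3 \<le> card ?S2 + card ?X"
    using fS by (meson card_Un_le card_mono finite_UnI le_trans)+
  moreover have "card ?X \<le> card \<Gamma> * card J"
  proof -
    have "?X \<subseteq> (\<lambda>(\<sigma>, r). (\<sigma>, \<sigma> r)) ` (\<Gamma> \<times> J)" by force
    then have "card ?X \<le> card (\<Gamma> \<times> J)"
      using fin\<Gamma> finJ by (meson card_image_le card_mono finite_SigmaI finite_imageI le_trans)
    then show ?thesis by (simp add: card_cartesian_product)
  qed
  ultimately have "\<bar>real (card ?S2) - real (card ?S3)\<bar> \<le> real (card \<Gamma> * card J)"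
    by linarith
  then show ?thesis unfolding 1[symmetric] by (simp add: card_cartesian_product)
qed

text \<open>Points are added one at a time: adding one to a set of j points costs j /
  \<open>h\<close> by resampling, and j + j^2 \<le> (j + 1)^2. The error does not depend on the sets
  \<open>A p\<close> and vanishes as the smallest fibre grows.\<close>

lemma fibre_perms_independence:
  fixes Q :: "'a set" and t :: "'a \<Rightarrow> 'b" and A :: "'a \<Rightarrow> 'a set"
  defines "\<Gamma> \<equiv> fibre_perms Q t"
  assumes fin: "finite Q" and h: "h > 0" "\<And>p. p \<in> Q \<Longrightarrow> h \<le> real (card {x \<in> Q. t x = t p})"
    and J: "finite J" "J \<subseteq> Q"
  shows "\<bar>real (card {\<sigma> \<in> \<Gamma>. \<forall>p\<in>J. \<sigma> p \<in> A p}) / card \<Gamma> -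
     (\<Prod>p\<in>J. real (card (A p \<inter> {x \<in> Q. t x = t p})) / card {x \<in> Q. t x = t p})\<bar> \<le> (card J)\<^sup>2 / h"
  using J
proof (induction J)
  case empty
  then show ?case using card_fibre_perms_pos[OF fin, of t] by (simp add: \<Gamma>_def)
next
  case (insert p J)
  let ?F = "{x \<in> Q. t x = t p}"
  let ?r = "\<lambda>p. real (card (A p \<inter> {x \<in> Q. t x = t p})) / card {x \<in> Q. t x = t p}"
  let ?E = "{\<sigma> \<in> \<Gamma>. \<forall>p\<in>J. \<sigma> p \<in> A p}"
  let ?P = "\<Prod>p\<in>J. ?r p"
  have pos: "real (card \<Gamma>) > 0" unfolding \<Gamma>_def using card_fibre_perms_pos[OF fin] by simp
  have pQ: "p \<in> Q" "J \<subseteq> Q" using insert.prems by auto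
  have hF: "h \<le> real (card ?F)" using h(2) pQ by simp
  then have F0: "real (card ?F) > 0" using h(1) by linarith
  have "\<bar>real (card {\<sigma> \<in> ?E. \<sigma> p \<in> A p}) * card ?F - real (card ?E) * card (A p \<inter> ?F)\<bar> \<le> real (card \<Gamma>) * card J"
    unfolding \<Gamma>_def by (rule fibre_perms_resample[OF fin]) (use pQ insert.hyps in auto)
  moreover have "{\<sigma> \<in> ?E. \<sigma> p \<in> A p} = {\<sigma> \<in> \<Gamma>. \<forall>p\<in>insert p J. \<sigma> p \<in> A p}" by auto
  ultimately have "\<bar>real (card {\<sigma> \<in> \<Gamma>. \<forall>p\<in>insert p J. \<sigma> p \<in> A p}) * card ?F - real (card ?E) * card (A p \<inter> ?F)\<bar>
      \<le> real (card \<Gamma>) * card J" by simp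
  then have "\<bar>real (card {\<sigma> \<in> \<Gamma>. \<forall>p\<in>insert p J. \<sigma> p \<in> A p}) * card ?F - real (card ?E) * card (A p \<inter> ?F)\<bar> / (card \<Gamma> * card ?F)
      \<le> real (card \<Gamma>) * card J / (card \<Gamma> * card ?F)"
    by (intro divide_right_mono) auto
  also have "\<dots> = card J / card ?F" using pos by simp
  also have "\<dots> \<le> card J / h" using hF h(1) by (intro divide_left_mono) auto
  also have "\<bar>real (card {\<sigma> \<in> \<Gamma>. \<forall>p\<in>insert p J. \<sigma> p \<in> A p}) * card ?F - real (card ?E) * card (A p \<inter> ?F)\<bar> / (card \<Gamma> * card ?F)
     = \<bar>(real (card {\<sigma> \<in> \<Gamma>. \<forall>p\<in>insert p J. \<sigma> p \<in> A p}) * card ?F - real (card ?E) * card (A p \<inter> ?F)) / (card \<Gamma> * card ?F)\<bar>"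
    by (simp add: abs_divide)
  also have "(real (card {\<sigma> \<in> \<Gamma>. \<forall>p\<in>insert p J. \<sigma> p \<in> A p}) * card ?F - real (card ?E) * card (A p \<inter> ?F)) / (card \<Gamma> * card ?F)
     = real (card {\<sigma> \<in> \<Gamma>. \<forall>p\<in>insert p J. \<sigma> p \<in> A p}) / card \<Gamma> - real (card ?E) / card \<Gamma> * ?r p"
    using pos F0 by (simp add: diff_divide_distrib)
  finally have 1: "\<bar>real (card {\<sigma> \<in> \<Gamma>. \<forall>p\<in>insert p J. \<sigma> p \<in> A p}) / card \<Gamma> - real (card ?E) / card \<Gamma> * ?r p\<bar> \<le> card J / h" .
  have r01: "0 \<le> ?r p" "?r p \<le> 1"
    using F0 fin by (auto simp: divide_le_eq_1 intro!: card_mono)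
  have "\<bar>real (card ?E) / card \<Gamma> * ?r p - ?P * ?r p\<bar> = \<bar>real (card ?E) / card \<Gamma> - ?P\<bar> * ?r p"
    unfolding left_diff_distrib[symmetric] abs_mult using r01 by simp
  also have "\<dots> \<le> (card J)\<^sup>2 / h * 1"
    using insert.IH[OF pQ(2)] r01 by (intro mult_mono) auto
  finally have 2: "\<bar>real (card ?E) / card \<Gamma> * ?r p - ?P * ?r p\<bar> \<le> (card J)\<^sup>2 / h" by simp
  have "(\<Prod>p\<in>insert p J. ?r p) = ?P * ?r p" using insert.hyps by simp
  then have "\<bar>real (card {\<sigma> \<in> \<Gamma>. \<forall>p\<in>insert p J. \<sigma> p \<in> A p}) / card \<Gamma> - (\<Prod>p\<in>insert p J. ?r p)\<bar>
     \<le> card J / h + (card J)\<^sup>2 / h" using 1 2 by linarith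
  also have "\<dots> = (real (card J) + (real (card J))\<^sup>2) / h" by (simp add: add_divide_distrib)
  also have "\<dots> \<le> (real (card (insert p J)))\<^sup>2 / h"
    using insert.hyps h(1) by (intro divide_right_mono) (auto simp: power2_eq_square algebra_simps)
  finally show ?case by simp
qed

section \<open>Invariant measures\<close>

lemma sets_borel_of_base:
  assumes "countable \<B>" and op: "\<And>U. U \<in> \<B> \<Longrightarrow> openin T U"
    and base: "\<And>U x. openin T U \<Longrightarrow> x \<in> U \<Longrightarrow> \<exists>V\<in>\<B>. x \<in> V \<and> V \<subseteq> U"
  shows "sets (borel_of T) = sigma_sets (topspace T) \<B>" and "space (borel_of T) = topspace T"
proof -
  have sub: "{U. openin T U} \<subseteq> Pow (topspace T)" by (auto dest: openin_subset)
  show "space (borel_of T) = topspace T" unfolding borel_of_def using sub by (rule space_measure_of)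
  have "sets (borel_of T) = sigma_sets (topspace T) {U. openin T U}"
    unfolding borel_of_def using sub by (rule sets_measure_of)
  also have "\<dots> = sigma_sets (topspace T) \<B>"
  proof (rule sigma_sets_eqI)
    fix U assume "U \<in> {U. openin T U}"
    then have U: "openin T U" by simp
    let ?C = "{V \<in> \<B>. V \<subseteq> U}"
    have "U = \<Union> ?C" using base[OF U] by blast
    moreover have "countable ?C" using assms(1) by simp
    ultimately show "U \<in> sigma_sets (topspace T) \<B>"
      by (metis (no_types, lifting) mem_Collect_eq sigma_sets.Basic sigma_sets_UNION)
  qed (use op in auto)
  finally show "sets (borel_of T) = sigma_sets (topspace T) \<B>" .
qed

text \<open>The sets satisfying the identity form a Dynkin system: complements because the
  coefficients sum to one, disjoint unions by countable additivity. Working with values avoids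
  building the mixture as a measure, and a one-element \<open>J\<close> gives uniqueness of a
  measure on an intersection-stable generator.\<close>

lemma finite_mixture_eq:
  fixes N :: "'i \<Rightarrow> 'a measure"
  assumes gen: "Int_stable E" "E \<subseteq> Pow \<Omega>"
    and M: "prob_space M" "sets M = sigma_sets \<Omega> E"
    and N: "\<And>j. j \<in> J \<Longrightarrow> prob_space (N j)" "\<And>j. j \<in> J \<Longrightarrow> sets (N j) = sigma_sets \<Omega> E"
    and J: "finite J" "(\<Sum>j\<in>J. c j) = (1::real)"
    and eq: "\<And>A. A \<in> E \<Longrightarrow> measure M A = (\<Sum>j\<in>J. c j * measure (N j) A)"
    and A: "A \<in> sets M"
  shows "measure M A = (\<Sum>j\<in>J. c j * measure (N j) A)"
proof -
  interpret M: prob_space M by fact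
  have sp: "space M = \<Omega>" using sets_eq_imp_space_eq[of M "sigma \<Omega> E"] M(2) gen(2) by simp
  have spN: "space (N j) = \<Omega>" if "j \<in> J" for j
    using sets_eq_imp_space_eq[of "N j" M] M(2) N(2)[OF that] sp by simp
  have "A \<in> sigma_sets \<Omega> E" using A M(2) by simp
  from gen this show ?thesis
  proof (induction rule: sigma_sets_induct_disjoint)
    case (basic A)
    then show ?case by (rule eq)
  next
    case empty
    then show ?case by simp
  next
    case (compl A)
    have "measure (N j) (\<Omega> - A) = 1 - measure (N j) A" if "j \<in> J" for j
    proof -
      interpret N: prob_space "N j" by (rule N) fact
      show ?thesis using N.prob_compl[of A] compl(1) N(2)[OF that] spN[OF that] by simp
    qed
    then have "(\<Sum>j\<in>J. c j * measure (N j) (\<Omega> - A)) = (\<Sum>j\<in>J. c j - c j * measure (N j) A)"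
      by (intro sum.cong refl) (simp add: right_diff_distrib)
    also have "\<dots> = 1 - measure M A" using compl(2) J(2) by (simp add: sum_subtractf)
    also have "\<dots> = measure M (\<Omega> - A)" using M.prob_compl[of A] compl(1) M(2) sp by simp
    finally show ?case by simp
  next
    case (union A)
    have "(\<lambda>i. measure M (A i)) sums measure M (\<Union>i. A i)"
      using union M(2) by (intro M.finite_measure_UNION) auto
    moreover have "(\<lambda>i. \<Sum>j\<in>J. c j * measure (N j) (A i)) sums (\<Sum>j\<in>J. c j * measure (N j) (\<Union>i. A i))"
    proof (intro sums_sum sums_mult)
      fix j assume j: "j \<in> J"
      interpret N: prob_space "N j" by (rule N) fact
      show "(\<lambda>i. measure (N j) (A i)) sums measure (N j) (\<Union>i. A i)"
        using union N(2)[OF j] by (intro N.finite_measure_UNION) auto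
    qed
    ultimately show ?case using union(3) sums_unique2 by simp
  qed
qed

text \<open>A Poincare-type recurrence statement; the witness \<open>\<omega>\<close> comes from Fatou's lemma for
  the events that the visiting frequency is at least half of its mean.\<close>

lemma recurrent_visits:
  fixes act :: "'g \<Rightarrow> 'a \<Rightarrow> 'a" and \<Gamma> :: "nat \<Rightarrow> 'g set"
  assumes "prob_space M" and fin: "\<And>n. finite (\<Gamma> n)"
    and act: "\<And>n a. a \<in> \<Gamma> n \<Longrightarrow> act a \<in> measurable M M" "\<And>n a. a \<in> \<Gamma> n \<Longrightarrow> distr M M (act a) = M"
    and A: "A \<in> sets M" "measure M A > 0"
  shows "\<exists>\<omega>\<in>space M. \<exists>\<^sub>\<infinity>n. measure M A / 2 * card (\<Gamma> n) \<le> card {a \<in> \<Gamma> n. act a \<omega> \<in> A}"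
proof -
  interpret prob_space M by fact
  let ?e = "measure M A"
  define f where "f n \<omega> = (\<Sum>a\<in>\<Gamma> n. indicat_real (act a -` A \<inter> space M) \<omega>)" for n \<omega>
  have actA: "act a -` A \<inter> space M \<in> sets M" "measure M (act a -` A \<inter> space M) = ?e" if "a \<in> \<Gamma> n" for a n
  proof -
    show "act a -` A \<inter> space M \<in> sets M" using act(1)[OF that] A(1) by (rule measurable_sets)
    have "measure (distr M M (act a)) A = measure M (act a -` A \<inter> space M)"
      using act(1)[OF that] A(1) by (rule measure_distr)
    then show "measure M (act a -` A \<inter> space M) = ?e" using act(2)[OF that] by simp
  qed
  have f_card: "f n \<omega> = card {a \<in> \<Gamma> n. act a \<omega> \<in> A}" if "\<omega> \<in> space M" for n \<omega>
  proof -
    have "f n \<omega> = (\<Sum>a\<in>\<Gamma> n. if act a \<omega> \<in> A then 1 else 0)"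
      unfolding f_def using that by (intro sum.cong) (auto simp: indicator_def)
    also have "\<dots> = card {a \<in> \<Gamma> n. act a \<omega> \<in> A}"
      using fin by (subst sum.inter_filter[symmetric]) auto
    finally show ?thesis .
  qed
  have meas[measurable]: "f n \<in> borel_measurable M" for n
    unfolding f_def using actA(1) by (intro borel_measurable_sum borel_measurable_indicator)
  have int_f: "(\<integral>\<omega>. f n \<omega> \<partial>M) = card (\<Gamma> n) * ?e" for n
  proof -
    have "(\<integral>\<omega>. f n \<omega> \<partial>M) = (\<Sum>a\<in>\<Gamma> n. \<integral>\<omega>. indicat_real (act a -` A \<inter> space M) \<omega> \<partial>M)"
      unfolding f_def by (rule Bochner_Integration.integral_sum)
        (auto intro!: integrable_real_indicator actA simp: emeasure_finite less_top[symmetric])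
    also have "\<dots> = (\<Sum>a\<in>\<Gamma> n. ?e)" using actA by (intro sum.cong) auto
    finally show ?thesis by simp
  qed
  define B where "B n = {\<omega> \<in> space M. ?e / 2 * card (\<Gamma> n) \<le> f n \<omega>}" for n
  have B[measurable]: "B n \<in> sets M" for n unfolding B_def by measurable
  \<comment> \<open>\<open>f n\<close> has mean \<open>?e * card (\<Gamma> n)\<close>; it is at most
    \<open>card (\<Gamma> n)\<close> on \<open>B n\<close> and at most half its mean elsewhere, so
    \<open>B n\<close> must have measure at least \<open>?e / 2\<close>.\<close>
  have PB: "measure M (B n) \<ge> ?e / 2" for n
  proof (cases "card (\<Gamma> n) = 0")
    case True
    then have "B n = space M" using fin[of n] by (auto simp: B_def f_def)
    then show ?thesis using prob_space prob_le_1[of A] by (simp add: order_trans[OF prob_le_1])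
  next
    case False
    have f_le: "f n \<omega> \<le> card (\<Gamma> n)" for \<omega>
    proof -
      have "f n \<omega> \<le> (\<Sum>a\<in>\<Gamma> n. 1)" unfolding f_def by (intro sum_mono) (auto simp: indicator_def)
      then show ?thesis by simp
    qed
    have "card (\<Gamma> n) * ?e \<le> (\<integral>\<omega>. card (\<Gamma> n) * indicat_real (B n) \<omega> + ?e / 2 * card (\<Gamma> n) \<partial>M)"
      unfolding int_f[symmetric]
    proof (rule integral_mono)
      show "integrable M (f n)" unfolding f_def
        by (auto intro!: integrable_sum integrable_real_indicator actA simp: emeasure_finite less_top[symmetric])
      fix \<omega> assume "\<omega> \<in> space M"
      then show "f n \<omega> \<le> card (\<Gamma> n) * indicat_real (B n) \<omega> + ?e / 2 * card (\<Gamma> n)"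
        using f_le[of \<omega>] by (auto simp: B_def indicator_def not_le intro: add_increasing2)
    qed (auto intro!: integrable_real_indicator simp: emeasure_finite less_top[symmetric])
    also have "\<dots> = card (\<Gamma> n) * measure M (B n) + ?e / 2 * card (\<Gamma> n)"
      by (subst Bochner_Integration.integral_add)
         (auto intro!: integrable_real_indicator simp: emeasure_finite less_top[symmetric] prob_space)
    finally have "real (card (\<Gamma> n)) * (?e / 2) \<le> card (\<Gamma> n) * measure M (B n)" by (simp add: algebra_simps)
    then show ?thesis using False by (simp add: mult_le_cancel_left)
  qed
  define C where "C N = (\<Union>n\<in>{N..}. B n)" for N :: nat
  have Cs: "C N \<in> sets M" for N unfolding C_def by measurable
  have "(\<lambda>N. measure M (C N)) \<longlonglongrightarrow> measure M (\<Inter>N. C N)"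
    by (rule finite_Lim_measure_decseq) (use Cs in \<open>force simp: decseq_def C_def\<close>)+
  moreover have "?e / 2 \<le> measure M (C N)" for N
  proof -
    have "B N \<subseteq> C N" by (auto simp: C_def)
    then show ?thesis using PB[of N] finite_measure_mono[OF _ Cs] by (meson order_trans)
  qed
  ultimately have "?e / 2 \<le> measure M (\<Inter>N. C N)" by (meson LIMSEQ_le_const)
  then have "(\<Inter>N. C N) \<noteq> {}" using A(2) by auto
  then obtain \<omega> where \<omega>: "\<And>N. \<omega> \<in> C N" by auto
  have "\<omega> \<in> space M" using \<omega>[of 0] by (auto simp: C_def B_def)
  moreover have "\<exists>\<^sub>\<infinity>n. \<omega> \<in> B n"
    unfolding INFM_nat_le using \<omega> by (auto simp: C_def)
  ultimately show ?thesis
    by (intro bexI[of _ \<omega>]) (auto simp: B_def f_card elim!: frequently_elim1)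
qed

text \<open>The Radon-Nikodym density of \<open>N\<close> is almost everywhere invariant, and the set of points in whose
  orbit it exceeds 1 is strictly invariant.\<close>

lemma ergodic_prob_extreme:
  fixes G (structure) and \<phi> :: "'g \<Rightarrow> 'a \<Rightarrow> 'a"
  assumes G: "group G" "countable (carrier G)"
    and act: "\<And>x. x \<in> space M \<Longrightarrow> \<phi> \<one> x = x"
      "\<And>g h x. g \<in> carrier G \<Longrightarrow> h \<in> carrier G \<Longrightarrow> x \<in> space M \<Longrightarrow> \<phi> (g \<otimes> h) x = \<phi> g (\<phi> h x)"
    and M: "ergodic_prob G \<phi> M" and N: "invariant_prob G \<phi> N" "sets N = sets M"
    and c: "0 < c" "\<And>A. A \<in> sets M \<Longrightarrow> c * measure N A \<le> measure M A"
  shows "N = M"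
proof -
  interpret group G by fact
  have Mi: "invariant_prob G \<phi> M" using M by (simp add: ergodic_prob_def)
  interpret M: prob_space M using Mi by (simp add: invariant_prob_def)
  interpret N: prob_space N using N(1) by (simp add: invariant_prob_def)
  have sp: "space N = space M" using N(2) by (rule sets_eq_imp_space_eq)
  have meas: "\<phi> g \<in> measurable M M" "distr M M (\<phi> g) = M" "distr N M (\<phi> g) = N" if "g \<in> carrier G" for g
  proof -
    show "\<phi> g \<in> measurable M M" "distr M M (\<phi> g) = M" using Mi that by (auto simp: invariant_prob_def)
    have "distr N N (\<phi> g) = N" using N that by (auto simp: invariant_prob_def)
    moreover have "distr N M (\<phi> g) = distr N N (\<phi> g)" using N(2) by (intro distr_cong) auto
    ultimately show "distr N M (\<phi> g) = N" by simp
  qed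
  have "absolutely_continuous M N"
    unfolding absolutely_continuous_def
  proof
    fix A assume A: "A \<in> null_sets M"
    then have "measure M A = 0" "A \<in> sets M" by (auto simp: measure_eq_0_null_sets)
    then have "measure N A \<le> 0" using c(1) c(2)[of A] by (simp add: mult_le_0_iff)
    then show "A \<in> null_sets N" using A N(2)
      by (auto simp: null_sets_def N.emeasure_eq_measure measure_le_0_iff)
  qed
  then obtain f where f[measurable]: "f \<in> borel_measurable M" and fN: "density M f = N"
    using M.Radon_Nikodym N(2) by blast
  \<comment> \<open>Both measures are invariant, so translating the density by \<open>g\<close>
    gives another density of the same measure; densities are unique almost everywhere.\<close>
  have inv_f: "AE x in M. f (\<phi> g x) = f x" if g: "g \<in> carrier G" for g
  proof -
    have ig: "m_inv G g \<in> carrier G" using g by simp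
    note [measurable] = meas(1)[OF g] meas(1)[OF ig]
    have "N = density (distr M M (\<phi> g)) f" using meas(2)[OF g] fN by simp
    also have "\<dots> = distr (density M (\<lambda>x. f (\<phi> g x))) M (\<phi> g)" by (rule density_distr) auto
    finally have "distr N M (\<phi> (m_inv G g)) = distr (distr (density M (\<lambda>x. f (\<phi> g x))) M (\<phi> g)) M (\<phi> (m_inv G g))" by simp
    also have "\<dots> = distr (density M (\<lambda>x. f (\<phi> g x))) M (\<phi> (m_inv G g) \<circ> \<phi> g)" by (rule distr_distr) auto
    also have "\<dots> = distr (density M (\<lambda>x. f (\<phi> g x))) M (\<lambda>x. x)"
      using act(2)[OF ig g] act(1) g by (intro distr_cong) auto
    also have "\<dots> = density M (\<lambda>x. f (\<phi> g x))" by (rule distr_id2) simp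
    finally have "density M (\<lambda>x. f (\<phi> g x)) = density M f" using meas(3)[OF ig] fN by simp
    then show ?thesis by (intro M.density_unique) auto
  qed
  have AE_all: "AE x in M. \<forall>g\<in>carrier G. f (\<phi> g x) = f x"
    using inv_f G(2) by (simp add: AE_ball_countable)
  define E where "E = {x \<in> space M. \<exists>g\<in>carrier G. f (\<phi> g x) > 1}"
  have E[measurable]: "E \<in> sets M"
  proof -
    have "E = (\<Union>g\<in>carrier G. {x \<in> space M. f (\<phi> g x) > 1})" by (auto simp: E_def)
    moreover have "{x \<in> space M. f (\<phi> g x) > 1} \<in> sets M" if "g \<in> carrier G" for g
    proof -
      note [measurable] = meas(1)[OF that]
      show ?thesis by measurable
    qed
    ultimately show ?thesis using G(2) by (metis (no_types, lifting) sets.countable_UN'')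
  qed
  have AE_E: "AE x in M. x \<in> E \<longleftrightarrow> f x > 1"
    using AE_all by (rule AE_mp) (auto simp: E_def intro!: AE_I2 bexI[of _ \<one>] act)
  have "\<phi> h -` E \<inter> space M = E" if h: "h \<in> carrier G" for h
  proof -
    have "\<phi> h x \<in> E \<longleftrightarrow> x \<in> E" if x: "x \<in> space M" for x
    proof -
      have hx: "\<phi> h x \<in> space M" using meas(1)[OF h] x by (rule measurable_space)
      have "(\<exists>g\<in>carrier G. f (\<phi> g (\<phi> h x)) > 1) \<longleftrightarrow> (\<exists>g\<in>carrier G. f (\<phi> g x) > 1)"
      proof
        assume "\<exists>g\<in>carrier G. f (\<phi> g (\<phi> h x)) > 1"
        then obtain g where "g \<in> carrier G" "f (\<phi> g (\<phi> h x)) > 1" by blast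
        then have "f (\<phi> (g \<otimes> h) x) > 1" "g \<otimes> h \<in> carrier G" using act(2) h x by auto
        then show "\<exists>g\<in>carrier G. f (\<phi> g x) > 1" by blast
      next
        assume "\<exists>g\<in>carrier G. f (\<phi> g x) > 1"
        then obtain g where g: "g \<in> carrier G" "f (\<phi> g x) > 1" by blast
        then have "g = (g \<otimes> m_inv G h) \<otimes> h" using h by (simp add: m_assoc)
        then have "f (\<phi> (g \<otimes> m_inv G h) (\<phi> h x)) > 1" using act(2)[of "g \<otimes> m_inv G h" h x] g h x by auto
        then show "\<exists>g\<in>carrier G. f (\<phi> g (\<phi> h x)) > 1" using g h by (meson inv_closed m_closed)
      qed
      then show ?thesis using x hx by (simp add: E_def)
    qed
    then show ?thesis using sets.sets_into_space[OF E] by auto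
  qed
  then have "measure M E = 0 \<or> measure M E = 1"
    using M E by (auto simp: ergodic_prob_def)
  then have "AE x in M. f x \<le> 1"
  proof
    assume "measure M E = 0"
    then have "AE x in M. x \<notin> E" using E by (intro AE_not_in) (auto simp: null_sets_def M.emeasure_eq_measure)
    then show ?thesis using AE_E by eventually_elim auto
  next
    \<comment> \<open>A density that exceeds 1 almost everywhere cannot have integral 1.\<close>
    assume "measure M E = 1"
    then have "AE x in M. x \<in> E" using E by (simp add: M.prob_eq_1)
    then have gt: "AE x in M. f x > 1" using AE_E by eventually_elim auto
    have "(\<integral>\<^sup>+x. f x \<partial>M) = emeasure N (space M)"
      unfolding fN[symmetric] by (subst emeasure_density) (auto intro!: nn_integral_cong)
    also have "\<dots> = 1" using N.emeasure_space_1 sp by simp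
    finally have i1: "(\<integral>\<^sup>+x. f x \<partial>M) = 1" .
    have "(\<integral>\<^sup>+x. f x - 1 \<partial>M) = (\<integral>\<^sup>+x. f x \<partial>M) - (\<integral>\<^sup>+x. 1 \<partial>M)"
      by (rule nn_integral_diff) (use gt in \<open>auto simp: M.emeasure_space_1 elim: eventually_mono\<close>)
    also have "\<dots> = 0" using i1 by (simp add: M.emeasure_space_1)
    finally have "AE x in M. f x - 1 = 0" by (subst (asm) nn_integral_0_iff_AE) auto
    then have "AE x in M. False" using gt by eventually_elim (auto simp: diff_eq_0_iff_ennreal dest: leD)
    then show ?thesis by eventually_elim simp
  qed
  then have le: "emeasure N A \<le> emeasure M A" if "A \<in> sets M" for A
  proof -
    have "emeasure N A = (\<integral>\<^sup>+x. f x * indicator A x \<partial>M)"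
      unfolding fN[symmetric] using that by (intro emeasure_density) auto
    also have "\<dots> \<le> (\<integral>\<^sup>+x. indicator A x \<partial>M)"
      by (rule nn_integral_mono_AE) (use \<open>AE x in M. f x \<le> 1\<close> in \<open>auto simp: indicator_def elim: eventually_mono\<close>)
    finally show ?thesis using that by simp
  qed
  show ?thesis
  proof (rule measure_eqI[OF N(2)])
    fix A assume "A \<in> sets N"
    then have A: "A \<in> sets M" using N(2) by simp
    \<comment> \<open>Domination on a set and on its complement, with equal total mass, gives
      equality.\<close>
    have 1: "measure N A \<le> measure M A" if "A \<in> sets M" for A
      using le[OF that] by (simp add: N.emeasure_eq_measure M.emeasure_eq_measure)
    have "measure N (space M - A) \<le> measure M (space M - A)" using 1 A by auto
    then have "measure M A \<le> measure N A"
      using N.prob_compl[of A] M.prob_compl[of A] A N(2) sp by simp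
    then show "emeasure N A = emeasure M A"
      using 1[OF A] by (simp add: N.emeasure_eq_measure M.emeasure_eq_measure)
  qed
qed

declare One_nat_def [simp del]

section \<open>Finite paths and the level groups\<close>

text \<open>Truncations of infinite paths, so that restriction to lower levels is immediate. As
  every vertex emits an edge, these are all composable edge sequences once \<open>n \<ge> 1\<close>
  (\<open>fin_paths_iff\<close>).\<close>

definition fin_paths :: "('v, 'e) bratteli \<Rightarrow> nat \<Rightarrow> (nat \<Rightarrow> 'e) set" where
  "fin_paths B n = (\<lambda>x. restrict x {1..n}) ` path_space B"

definition end_vertex :: "('v, 'e) bratteli \<Rightarrow> nat \<Rightarrow> (nat \<Rightarrow> 'e) \<Rightarrow> 'v" where
  "end_vertex B n p = tgt B (p n)"

definition glue :: "nat \<Rightarrow> (nat \<Rightarrow> 'e) \<Rightarrow> (nat \<Rightarrow> 'e) \<Rightarrow> (nat \<Rightarrow> 'e)" where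
  "glue n p x = (\<lambda>i. if i \<in> {1..n} then p i else x i)"

definition exts :: "('v, 'e) bratteli \<Rightarrow> nat \<Rightarrow> nat \<Rightarrow> (nat \<Rightarrow> 'e) \<Rightarrow> (nat \<Rightarrow> 'e) set" where
  "exts B n m p = {q \<in> fin_paths B m. restrict q {1..n} = p}"

text \<open>One permutation of all paths of level \<open>n\<close> that preserves end vertices
  encodes a tuple of permutations, one for each vertex; \<open>level_group_eq\<close> is the
  translation.\<close>

definition level_perms :: "('v, 'e) bratteli \<Rightarrow> nat \<Rightarrow> ((nat \<Rightarrow> 'e) \<Rightarrow> (nat \<Rightarrow> 'e)) set" where
  "level_perms B n = fibre_perms (fin_paths B n) (end_vertex B n)"

definition path_act :: "('v, 'e) bratteli \<Rightarrow> nat \<Rightarrow> ((nat \<Rightarrow> 'e) \<Rightarrow> (nat \<Rightarrow> 'e)) \<Rightarrow> (nat \<Rightarrow> 'e) \<Rightarrow> (nat \<Rightarrow> 'e)" where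
  "path_act B n \<sigma> = (\<lambda>x\<in>path_space B. glue n (\<sigma> (restrict x {1..n})) x)"

text \<open>The embedding of the permutations of level \<open>n\<close> into those of level
  \<open>m\<close>. Outside \<open>fin_paths B m\<close> the value is the identity, as
  \<open>permutes\<close> demands.\<close>

definition lift_perm :: "('v, 'e) bratteli \<Rightarrow> nat \<Rightarrow> nat \<Rightarrow> ((nat \<Rightarrow> 'e) \<Rightarrow> (nat \<Rightarrow> 'e)) \<Rightarrow> (nat \<Rightarrow> 'e) \<Rightarrow> (nat \<Rightarrow> 'e)" where
  "lift_perm B n m \<sigma> = (\<lambda>q. if q \<in> fin_paths B m then glue n (\<sigma> (restrict q {1..n})) q else q)"

lemma restrict_restrict_le: "n \<le> m \<Longrightarrow> restrict (restrict x {1..m}) {1..n} = restrict x {1..n::nat}"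
  by (auto simp: restrict_def fun_eq_iff)

lemma restrict_glue: "restrict (glue n p x) {1..n} = restrict p {1..n}"
  by (auto simp: glue_def restrict_def)

lemma restrict_glue_le: "n \<le> m \<Longrightarrow> restrict (glue n p x) {1..m} = glue n p (restrict x {1..m})"
  by (auto simp: glue_def restrict_def fun_eq_iff)

lemma glue_restrict [simp]: "glue n (restrict x {1..n}) x = x"
  by (auto simp: glue_def)

lemma glue_glue [simp]: "glue n p (glue n q x) = glue n p x"
  by (auto simp: glue_def)

context bratteli_diagram
begin

abbreviation "X \<equiv> path_space B"
abbreviation "P \<equiv> fin_paths B"
abbreviation "t \<equiv> end_vertex B"
abbreviation "\<Gamma> \<equiv> level_perms B"
abbreviation "G \<equiv> full_group B"

lemma path_space_iff:
  "x \<in> X \<longleftrightarrow> x \<in> extensional {1..} \<and> (\<forall>i\<ge>1. x i \<in> edge B i \<and> src B (x (i+1)) = tgt B (x i))"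
  by (auto simp: path_space_def PiE_iff)

lemma edge_tgt: "i \<ge> 1 \<Longrightarrow> e \<in> edge B i \<Longrightarrow> tgt B e \<in> vert B i"
  using tgt_edge by blast

lemma edge_src: "i \<ge> 1 \<Longrightarrow> e \<in> edge B i \<Longrightarrow> src B e \<in> vert B (i - 1)"
  using src_edge by blast

lemma next_edge:
  assumes "v \<in> vert B n" shows "\<exists>e\<in>edge B (Suc n). src B e = v"
proof -
  obtain i e where e: "i \<ge> 1" "e \<in> edge B i" "src B e = v" using out_edge[of v] assms by auto
  then have "v \<in> vert B (i - 1)" using edge_src by blast
  then have "i - 1 = n" using vert_disjoint assms by (auto simp: disjoint_family_on_def)
  then have "i = Suc n" using e by simp
  then show ?thesis using e by blast
qed

text \<open>No vertex is a dead end, so beyond level \<open>n\<close> an outgoing edge can be chosen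
  recursively.\<close>

lemma extend_path:
  assumes n: "n \<ge> 1" and p: "p \<in> (\<Pi>\<^sub>E i\<in>{1..n}. edge B i)"
    and c: "\<And>i. 1 \<le> i \<Longrightarrow> i < n \<Longrightarrow> src B (p (i+1)) = tgt B (p i)"
  shows "\<exists>x\<in>X. restrict x {1..n} = p"
proof -
  define nxt where "nxt k e = (SOME e'. e' \<in> edge B (n + Suc k) \<and> src B e' = tgt B e)" for k e
  define y where "y = rec_nat (p n) nxt"
  have y0: "y 0 = p n" and yS: "y (Suc k) = nxt k (y k)" for k by (auto simp: y_def)
  have nxt: "nxt k e \<in> edge B (n + Suc k) \<and> src B (nxt k e) = tgt B e" if "e \<in> edge B (n + k)" for k e
  proof -
    have "tgt B e \<in> vert B (n + k)" using that n by (intro edge_tgt) auto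
    then have "\<exists>e'. e' \<in> edge B (n + Suc k) \<and> src B e' = tgt B e" using next_edge[of "tgt B e" "n + k"] by auto
    then show ?thesis unfolding nxt_def by (rule someI_ex)
  qed
  have y: "y k \<in> edge B (n + k)" for k
  proof (induction k)
    case 0
    then show ?case using p n by (auto simp: y0 PiE_iff)
  next
    case (Suc k)
    then show ?case using nxt by (simp add: yS)
  qed
  define x where "x i = (if i \<in> {1..n} then p i else if i > n then y (i - n) else undefined)" for i
  have "x \<in> X" unfolding path_space_iff
  proof (intro conjI allI impI)
    show "x \<in> extensional {1..}" using n by (auto simp: x_def extensional_def)
    fix i :: nat assume i: "i \<ge> 1"
    show "x i \<in> edge B i"
    proof (cases "i \<le> n")
      case True
      then show ?thesis using p i by (auto simp: x_def PiE_iff)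
    next
      case False
      then show ?thesis using y[of "i - n"] by (simp add: x_def)
    qed
    show "src B (x (i+1)) = tgt B (x i)"
    proof (cases "i < n")
      case True
      then show ?thesis using c i by (simp add: x_def)
    next
      case False
      have "y (Suc (i - n)) = nxt (i - n) (y (i - n))" by (rule yS)
      then have "src B (y (Suc (i - n))) = tgt B (y (i - n))" using nxt[OF y] by simp
      moreover have "x (i + 1) = y (Suc (i - n))" using False by (simp add: x_def Suc_diff_le flip: Suc_eq_plus1)
      moreover have "x i = y (i - n)" using False i by (auto simp: x_def y0)
      ultimately show ?thesis by simp
    qed
  qed
  moreover have "restrict x {1..n} = p" using p by (auto simp: x_def fun_eq_iff PiE_iff extensional_def)
  ultimately show ?thesis by blast
qed

lemma fin_paths_iff:
  assumes "n \<ge> 1"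
  shows "p \<in> P n \<longleftrightarrow> p \<in> (\<Pi>\<^sub>E i\<in>{1..n}. edge B i) \<and> (\<forall>i. 1 \<le> i \<longrightarrow> i < n \<longrightarrow> src B (p (i+1)) = tgt B (p i))"
proof
  assume "p \<in> P n"
  then show "p \<in> (\<Pi>\<^sub>E i\<in>{1..n}. edge B i) \<and> (\<forall>i. 1 \<le> i \<longrightarrow> i < n \<longrightarrow> src B (p (i+1)) = tgt B (p i))"
    by (auto simp: fin_paths_def path_space_iff)
next
  assume "p \<in> (\<Pi>\<^sub>E i\<in>{1..n}. edge B i) \<and> (\<forall>i. 1 \<le> i \<longrightarrow> i < n \<longrightarrow> src B (p (i+1)) = tgt B (p i))"
  then show "p \<in> P n" using extend_path[OF assms, of p] by (auto simp: fin_paths_def)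
qed

lemma finite_fin_paths [simp]: "finite (P n)"
proof (cases "n \<ge> 1")
  case True
  have "finite (\<Pi>\<^sub>E i\<in>{1..n}. edge B i)" using finite_edge by (intro finite_PiE) auto
  then show ?thesis by (rule finite_subset[rotated]) (use fin_paths_iff[OF True] in blast)
next
  case False
  then have "P n \<subseteq> {\<lambda>_. undefined}" by (auto simp: fin_paths_def)
  then show ?thesis using finite_subset by blast
qed

lemma restrict_in_fin_paths [simp]: "x \<in> X \<Longrightarrow> restrict x {1..n} \<in> P n"
  by (simp add: fin_paths_def)

lemma path_space_nonempty: "X \<noteq> {}"
proof -
  obtain e where e: "e \<in> edge B 1" using next_edge[of "root B" 0] vert_0 by (auto simp: One_nat_def)
  have "\<exists>x\<in>X. restrict x {1..1} = (\<lambda>i\<in>{1..1}. e)" by (rule extend_path) (use e in auto)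
  then show ?thesis by blast
qed

lemma fin_paths_nonempty: "P n \<noteq> {}"
  using path_space_nonempty by (simp add: fin_paths_def)

lemma restrict_fin_path: "q \<in> P m \<Longrightarrow> n \<le> m \<Longrightarrow> restrict q {1..n} \<in> P n"
  by (auto simp: fin_paths_def restrict_restrict_le image_iff)

lemma fin_path_restrict_self: "p \<in> P n \<Longrightarrow> restrict p {1..n} = p"
  by (auto simp: fin_paths_def)

lemma end_vertex_restrict: "n \<ge> 1 \<Longrightarrow> t n (restrict x {1..n}) = t n x"
  by (simp add: end_vertex_def)

lemma end_vertex_in: "n \<ge> 1 \<Longrightarrow> p \<in> P n \<Longrightarrow> t n p \<in> vert B n"
  by (auto simp: end_vertex_def fin_paths_iff PiE_iff intro!: edge_tgt)

lemma glue_path: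
  assumes n: "n \<ge> 1" and p: "p \<in> P n" and x: "x \<in> X" and t: "t n p = t n x"
  shows "glue n p x \<in> X"
  unfolding path_space_iff
proof (intro conjI allI impI)
  show "glue n p x \<in> extensional {1..}" using x by (auto simp: glue_def extensional_def path_space_iff)
  fix i :: nat assume i: "i \<ge> 1"
  show "glue n p x i \<in> edge B i"
    using i p x n by (auto simp: glue_def fin_paths_iff path_space_iff PiE_iff)
  show "src B (glue n p x (i + 1)) = tgt B (glue n p x i)"
  proof -
    consider "i < n" | "i = n" | "i > n" by linarith
    then show ?thesis
    proof cases
      case 1
      then show ?thesis using i p n by (auto simp: glue_def fin_paths_iff)
    next
      case 2
      then show ?thesis using i x t n by (auto simp: glue_def path_space_iff end_vertex_def)
    next
      case 3
      then show ?thesis using i x by (auto simp: glue_def path_space_iff)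
    qed
  qed
qed

lemma restrict_glue_path: "p \<in> P n \<Longrightarrow> restrict (glue n p x) {1..n} = p"
  by (simp add: restrict_glue fin_path_restrict_self)

lemma glue_fin_path:
  assumes n: "n \<ge> 1" "n \<le> m" and p: "p \<in> P n" and q: "q \<in> P m" and t: "t n p = t n q"
  shows "glue n p q \<in> P m" "t m (glue n p q) = t m q"
proof -
  obtain x where x: "x \<in> X" "q = restrict x {1..m}" using q by (auto simp: fin_paths_def)
  have "t n p = t n x" using t x n by (simp add: end_vertex_def)
  then have "glue n p x \<in> X" by (rule glue_path[OF n(1) p x(1)])
  moreover have "glue n p q = restrict (glue n p x) {1..m}" using x n by (simp add: restrict_glue_le)
  ultimately show "glue n p q \<in> P m" by (simp add: fin_paths_def)
  show "t m (glue n p q) = t m q"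
    using t n by (cases "n = m") (auto simp: end_vertex_def glue_def)
qed

lemma exts_iff: "q \<in> exts B n m p \<longleftrightarrow> q \<in> P m \<and> restrict q {1..n} = p"
  by (simp add: exts_def)

lemma exts_subset: "exts B n m p \<subseteq> P m" by (auto simp: exts_def)

lemma finite_exts [simp]: "finite (exts B n m p)"
  by (rule finite_subset[OF exts_subset finite_fin_paths])

lemma exts_self: "p \<in> P n \<Longrightarrow> exts B n n p = {p}"
  by (auto simp: exts_def fin_path_restrict_self)

subsection \<open>The full group\<close>

lemma level_permsD:
  assumes "\<sigma> \<in> \<Gamma> n"
  shows "\<sigma> permutes P n" "t n (\<sigma> p) = t n p" "bij \<sigma>" "p \<in> P n \<Longrightarrow> \<sigma> p \<in> P n"
  using assms unfolding level_perms_def by (auto dest: fibre_permsD simp: permutes_in_image)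

lemma level_perms_closed:
  shows level_perms_id: "id \<in> \<Gamma> n"
    and level_perms_comp: "\<sigma> \<in> \<Gamma> n \<Longrightarrow> \<tau> \<in> \<Gamma> n \<Longrightarrow> \<sigma> \<circ> \<tau> \<in> \<Gamma> n"
    and level_perms_inv: "\<sigma> \<in> \<Gamma> n \<Longrightarrow> inv \<sigma> \<in> \<Gamma> n"
    and level_perms_transpose: "p \<in> P n \<Longrightarrow> q \<in> P n \<Longrightarrow> t n p = t n q \<Longrightarrow> transpose p q \<in> \<Gamma> n"
  unfolding level_perms_def by (auto intro: fibre_perms_comp fibre_perms_inv fibre_perms_transpose)

lemma finite_level_perms [simp]: "finite (\<Gamma> n)"
  unfolding level_perms_def by (rule finite_fibre_perms) simp

lemma card_level_perms_pos: "0 < card (\<Gamma> n)"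
  unfolding level_perms_def by (rule card_fibre_perms_pos) simp

lemma path_act_in:
  assumes "n \<ge> 1" "\<sigma> \<in> \<Gamma> n" "x \<in> X"
  shows "path_act B n \<sigma> x \<in> X" "restrict (path_act B n \<sigma> x) {1..n} = \<sigma> (restrict x {1..n})"
proof -
  have *: "\<sigma> (restrict x {1..n}) \<in> P n" "t n (\<sigma> (restrict x {1..n})) = t n x"
    using level_permsD(4)[OF assms(2) restrict_in_fin_paths[OF assms(3)]]
      level_permsD(2)[OF assms(2)] end_vertex_restrict[OF assms(1)] by metis+
  then show "path_act B n \<sigma> x \<in> X" using assms by (simp add: path_act_def glue_path)
  show "restrict (path_act B n \<sigma> x) {1..n} = \<sigma> (restrict x {1..n})"
    using * assms(3) by (simp add: path_act_def restrict_glue_path)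
qed

lemma path_act_comp:
  assumes "n \<ge> 1" "\<sigma> \<in> \<Gamma> n" "\<tau> \<in> \<Gamma> n"
  shows "path_act B n (\<sigma> \<circ> \<tau>) = compose X (path_act B n \<sigma>) (path_act B n \<tau>)"
proof
  fix x
  show "path_act B n (\<sigma> \<circ> \<tau>) x = compose X (path_act B n \<sigma>) (path_act B n \<tau>) x"
  proof (cases "x \<in> X")
    case True
    have "path_act B n \<sigma> (path_act B n \<tau> x) = glue n (\<sigma> (\<tau> (restrict x {1..n}))) (path_act B n \<tau> x)"
      by (subst path_act_def) (simp add: path_act_in[OF assms(1,3) True])
    also have "\<dots> = glue n (\<sigma> (\<tau> (restrict x {1..n}))) x" using True by (simp add: path_act_def)
    finally have "path_act B n \<sigma> (path_act B n \<tau> x) = glue n (\<sigma> (\<tau> (restrict x {1..n}))) x" .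
    moreover have "path_act B n (\<sigma> \<circ> \<tau>) x = glue n (\<sigma> (\<tau> (restrict x {1..n}))) x"
      using True by (simp add: path_act_def)
    ultimately show ?thesis using True by (simp add: compose_def)
  qed (simp add: path_act_def compose_def)
qed

lemma path_act_id: "path_act B n id = (\<lambda>x\<in>X. x)"
  by (auto simp: path_act_def fun_eq_iff)

lemma path_act_bij:
  assumes "n \<ge> 1" "\<sigma> \<in> \<Gamma> n" shows "path_act B n \<sigma> \<in> Bij X"
proof -
  have i: "inv \<sigma> \<in> \<Gamma> n" using assms(2) by (rule level_perms_inv)
  have b: "bij \<sigma>" using assms(2) by (rule level_permsD)
  have "compose X (path_act B n \<sigma>) (path_act B n (inv \<sigma>)) = (\<lambda>x\<in>X. x)"
    "compose X (path_act B n (inv \<sigma>)) (path_act B n \<sigma>) = (\<lambda>x\<in>X. x)"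
    using path_act_comp[OF assms i] path_act_comp[OF assms(1) i assms(2)] b path_act_id
    by (simp_all add: bij_is_inj bij_is_surj surj_iff[THEN iffD1])
  then have 1: "path_act B n \<sigma> (path_act B n (inv \<sigma>) x) = x"
    "path_act B n (inv \<sigma>) (path_act B n \<sigma> x) = x" if "x \<in> X" for x
    using that by (auto simp: compose_def fun_eq_iff split: if_splits dest!: spec[of _ x])
  have "bij_betw (path_act B n \<sigma>) X X"
    by (rule bij_betw_byWitness[where f' = "path_act B n (inv \<sigma>)"])
       (use 1 path_act_in[OF assms] path_act_in[OF assms(1) i] in auto)
  then show ?thesis by (simp add: Bij_def path_act_def)
qed

lemma lift_perm_act:
  assumes n: "n \<ge> 1" "n \<le> m" and s: "\<sigma> \<in> \<Gamma> n"
  shows "path_act B m (lift_perm B n m \<sigma>) = path_act B n \<sigma>"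
proof
  fix x
  show "path_act B m (lift_perm B n m \<sigma>) x = path_act B n \<sigma> x"
  proof (cases "x \<in> X")
    case True
    then show ?thesis using n
      by (auto simp: path_act_def lift_perm_def restrict_restrict_le glue_def)
  qed (simp add: path_act_def)
qed

lemma lift_perm_apply:
  assumes n: "n \<ge> 1" "n \<le> m" and s: "\<sigma> \<in> \<Gamma> n" and q: "q \<in> P m"
  shows "lift_perm B n m \<sigma> q \<in> P m" "t m (lift_perm B n m \<sigma> q) = t m q"
    "restrict (lift_perm B n m \<sigma> q) {1..n} = \<sigma> (restrict q {1..n})"
proof -
  have *: "\<sigma> (restrict q {1..n}) \<in> P n" "t n (\<sigma> (restrict q {1..n})) = t n q"
    using level_permsD(4)[OF s restrict_fin_path[OF q n(2)]]
      level_permsD(2)[OF s] end_vertex_restrict[OF n(1)] by metis+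
  show "lift_perm B n m \<sigma> q \<in> P m" "t m (lift_perm B n m \<sigma> q) = t m q"
    using glue_fin_path[OF n *(1) q *(2)] q by (auto simp: lift_perm_def)
  show "restrict (lift_perm B n m \<sigma> q) {1..n} = \<sigma> (restrict q {1..n})"
    using q * by (simp add: lift_perm_def restrict_glue_path)
qed

lemma lift_perm_in:
  assumes n: "n \<ge> 1" "n \<le> m" and s: "\<sigma> \<in> \<Gamma> n"
  shows "lift_perm B n m \<sigma> \<in> \<Gamma> m"
proof -
  have i: "inv \<sigma> \<in> \<Gamma> n" using s by (rule level_perms_inv)
  have b: "bij \<sigma>" using s by (rule level_permsD)
  have inv1: "lift_perm B n m (inv \<tau>) (lift_perm B n m \<tau> q) = q" if "q \<in> P m" "\<tau> \<in> \<Gamma> n" for q \<tau>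
  proof -
    have bt: "bij \<tau>" using that(2) by (rule level_permsD)
    have "lift_perm B n m (inv \<tau>) (lift_perm B n m \<tau> q) = glue n (inv \<tau> (\<tau> (restrict q {1..n}))) (lift_perm B n m \<tau> q)"
      using lift_perm_apply[OF n that(2,1)] by (simp add: lift_perm_def)
    also have "\<dots> = q" using that bt by (simp add: lift_perm_def bij_is_inj inv_f_f)
    finally show ?thesis .
  qed
  have "bij_betw (lift_perm B n m \<sigma>) (P m) (P m)"
    by (rule bij_betw_byWitness[where f' = "lift_perm B n m (inv \<sigma>)"])
      (use inv1[OF _ s] inv1[OF _ i] b lift_perm_apply[OF n s] lift_perm_apply[OF n i] in \<open>auto simp: inv_inv_eq\<close>)
  then have "lift_perm B n m \<sigma> permutes P m"
    by (intro bij_imp_permutes) (auto simp: lift_perm_def)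
  moreover have "t m (lift_perm B n m \<sigma> q) = t m q" for q
    using lift_perm_apply(2)[OF n s, of q] by (cases "q \<in> P m") (auto simp: lift_perm_def)
  ultimately show ?thesis by (simp add: level_perms_def fibre_perms_def)
qed

lemma path_act_inj:
  assumes "n \<ge> 1" "\<sigma> \<in> \<Gamma> n" "\<tau> \<in> \<Gamma> n" "path_act B n \<sigma> = path_act B n \<tau>"
  shows "\<sigma> = \<tau>"
proof
  fix p
  show "\<sigma> p = \<tau> p"
  proof (cases "p \<in> P n")
    case True
    then obtain x where x: "x \<in> X" "p = restrict x {1..n}" by (auto simp: fin_paths_def)
    then show ?thesis
      using path_act_in(2)[OF assms(1,2) x(1)] path_act_in(2)[OF assms(1,3) x(1)] assms(4) by simp
  next
    case False
    then show ?thesis using assms(2,3) by (metis level_permsD(1) permutes_not_in)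
  qed
qed

lemma paths_root:
  assumes "n \<ge> 1"
  shows "paths B 0 (root B) n v = {p \<in> P n. t n p = v}"
proof -
  have "src B (p 1) = root B" if "p \<in> (\<Pi>\<^sub>E i\<in>{1..n}. edge B i)" for p
    using that assms edge_src[of 1 "p 1"] vert_0 by (auto simp: PiE_iff)
  then show ?thesis using assms by (auto simp: paths_def fin_paths_iff end_vertex_def)
qed

text \<open>A tuple \<open>h\<close> acts on a path through its component at the vertex reached at
  level \<open>n\<close>. Each component permutes the paths to its own vertex, so the components
  assemble to one permutation that preserves end vertices; conversely such a permutation splits over
  the vertices.\<close>

lemma level_group_eq:
  assumes n: "n \<ge> 1"
  shows "level_group B n = path_act B n ` \<Gamma> n"
proof
  show "level_group B n \<subseteq> path_act B n ` \<Gamma> n"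
  proof
    fix g assume "g \<in> level_group B n"
    then obtain h where h: "h \<in> (\<Pi>\<^sub>E v\<in>vert B n. vertex_group B n v)" and g: "g = (\<lambda>x\<in>X. h (tgt B (x n)) x)"
      by (auto simp: level_group_def)
    have "\<forall>v\<in>vert B n. \<exists>s. s permutes paths B 0 (root B) n v \<and> h v = path_perm B n v s"
      using h by (auto simp: vertex_group_def PiE_iff)
    then obtain s where s: "\<And>v. v \<in> vert B n \<Longrightarrow> s v permutes {p \<in> P n. t n p = v}"
      "\<And>v. v \<in> vert B n \<Longrightarrow> h v = path_perm B n v (s v)"
      unfolding paths_root[OF n] by metis
    define \<sigma> where "\<sigma> p = (if p \<in> P n then s (t n p) p else p)" for p
    have in1: "\<sigma> p \<in> P n" "t n (\<sigma> p) = t n p" if "p \<in> P n" for p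
      using permutes_in_image[OF s(1)[OF end_vertex_in[OF n that]], of p] that by (auto simp: \<sigma>_def)
    have "inj_on \<sigma> (P n)"
    proof (rule inj_onI)
      fix p q assume pq: "p \<in> P n" "q \<in> P n" "\<sigma> p = \<sigma> q"
      then have "t n p = t n q" using in1 by metis
      then show "p = q" using pq s(1)[OF end_vertex_in[OF n pq(1)]]
        by (auto simp: \<sigma>_def dest: permutes_inj injD)
    qed
    then have "bij_betw \<sigma> (P n) (P n)"
      using in1(1) by (intro bij_betw_imageI endo_inj_surj) auto
    then have "\<sigma> permutes P n" by (rule bij_imp_permutes) (simp add: \<sigma>_def)
    moreover have "t n (\<sigma> p) = t n p" for p using in1(2) by (cases "p \<in> P n") (auto simp: \<sigma>_def)
    ultimately have "\<sigma> \<in> \<Gamma> n" by (simp add: level_perms_def fibre_perms_def)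
    moreover have "g = path_act B n \<sigma>"
    proof
      fix x
      show "g x = path_act B n \<sigma> x"
      proof (cases "x \<in> X")
        case True
        have e: "end_vertex B n (restrict x {1..n}) = tgt B (x n)" using n by (simp add: end_vertex_def)
        then have v: "tgt B (x n) \<in> vert B n" using end_vertex_in[OF n restrict_in_fin_paths[OF True, of n]] by simp
        have "\<sigma> (restrict x {1..n}) = s (tgt B (x n)) (restrict x {1..n})"
          using True e by (simp add: \<sigma>_def)
        then show ?thesis using True s(2)[OF v]
          by (auto simp: g path_act_def path_perm_def glue_def fun_eq_iff)
      qed (simp add: g path_act_def)
    qed
    ultimately show "g \<in> path_act B n ` \<Gamma> n" by blast
  qed
  show "path_act B n ` \<Gamma> n \<subseteq> level_group B n"
  proof
    fix g assume "g \<in> path_act B n ` \<Gamma> n"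
    then obtain \<sigma> where s: "\<sigma> \<in> \<Gamma> n" and g: "g = path_act B n \<sigma>" by blast
    define s where "s v p = (if p \<in> P n \<and> t n p = v then \<sigma> p else p)" for v p
    define h where "h = (\<lambda>v\<in>vert B n. path_perm B n v (s v))"
    have "s v permutes paths B 0 (root B) n v" for v
    proof -
      have "inj_on (s v) {p \<in> P n. t n p = v}"
        using level_permsD(3)[OF s] by (auto simp: s_def inj_on_def bij_def)
      moreover have "s v ` {p \<in> P n. t n p = v} \<subseteq> {p \<in> P n. t n p = v}"
        using level_permsD[OF s] by (auto simp: s_def)
      ultimately have "bij_betw (s v) {p \<in> P n. t n p = v} {p \<in> P n. t n p = v}"
        by (intro bij_betw_imageI endo_inj_surj) auto
      then show ?thesis unfolding paths_root[OF n] by (rule bij_imp_permutes) (auto simp: s_def)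
    qed
    then have "h \<in> (\<Pi>\<^sub>E v\<in>vert B n. vertex_group B n v)"
      by (auto simp: h_def vertex_group_def)
    moreover have "g = (\<lambda>x\<in>X. h (tgt B (x n)) x)"
    proof
      fix x
      show "g x = (\<lambda>x\<in>X. h (tgt B (x n)) x) x"
      proof (cases "x \<in> X")
        case True
        have e: "end_vertex B n (restrict x {1..n}) = tgt B (x n)" using n by (simp add: end_vertex_def)
        then have v: "tgt B (x n) \<in> vert B n" using end_vertex_in[OF n restrict_in_fin_paths[OF True, of n]] by simp
        show ?thesis using True e v
          by (auto simp: g path_act_def h_def path_perm_def s_def glue_def fun_eq_iff)
      qed (simp add: g path_act_def)
    qed
    ultimately show "g \<in> level_group B n" by (auto simp: level_group_def)
  qed
qed

lemma carrier_full_group: "carrier G = (\<Union>n\<in>{1..}. path_act B n ` \<Gamma> n)"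
  by (simp add: full_group_def level_group_eq)

lemma full_group_cases:
  assumes "g \<in> carrier G"
  obtains n \<sigma> where "n \<ge> 1" "\<sigma> \<in> \<Gamma> n" "g = path_act B n \<sigma>"
  using assms unfolding carrier_full_group by auto

lemma path_act_carrier: "n \<ge> 1 \<Longrightarrow> \<sigma> \<in> \<Gamma> n \<Longrightarrow> path_act B n \<sigma> \<in> carrier G"
  unfolding carrier_full_group by auto

text \<open>Lifting turns a permutation of level \<open>m\<close> into one of every later level with
  the same action, so finitely many elements live together on all sufficiently high levels. Group
  identities and conditions on finite sets of elements become statements about permutations of a
  single level.\<close>

lemma full_group_level:
  assumes "finite F" "F \<subseteq> carrier G"
  shows "\<exists>N\<ge>1. \<forall>n\<ge>N. F \<subseteq> path_act B n ` \<Gamma> n"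
  using assms
proof (induction F)
  case empty
  then show ?case by auto
next
  case (insert g F)
  then obtain N where N: "N \<ge> 1" "\<And>n. n \<ge> N \<Longrightarrow> F \<subseteq> path_act B n ` \<Gamma> n" by auto
  obtain m \<sigma> where m: "m \<ge> 1" "\<sigma> \<in> \<Gamma> m" "g = path_act B m \<sigma>"
    using insert.prems full_group_cases by blast
  have "g \<in> path_act B n ` \<Gamma> n" if "n \<ge> m" for n
    using lift_perm_act[OF m(1) that m(2)] lift_perm_in[OF m(1) that m(2)] m(3) by force
  then show ?case using N by (intro exI[of _ "max N m"]) auto
qed

lemma full_group_simps:
  "\<one>\<^bsub>G\<^esub> = (\<lambda>x\<in>X. x)"
  "g \<otimes>\<^bsub>G\<^esub> h = (\<lambda>g\<in>Bij X. \<lambda>h\<in>Bij X. compose X g h) g h"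
  by (simp_all add: full_group_def BijGroup_def)

lemma carrier_Bij: "g \<in> carrier G \<Longrightarrow> g \<in> Bij X"
  by (metis full_group_cases path_act_bij)

lemma full_group_mult: "g \<in> carrier G \<Longrightarrow> h \<in> carrier G \<Longrightarrow> g \<otimes>\<^bsub>G\<^esub> h = compose X g h"
  by (simp add: full_group_simps carrier_Bij)

lemma path_act_mult:
  assumes "n \<ge> 1" "\<sigma> \<in> \<Gamma> n" "\<tau> \<in> \<Gamma> n"
  shows "path_act B n \<sigma> \<otimes>\<^bsub>G\<^esub> path_act B n \<tau> = path_act B n (\<sigma> \<circ> \<tau>)"
  using assms by (simp add: full_group_mult path_act_carrier path_act_comp)

lemma path_act_one: "path_act B n id = \<one>\<^bsub>G\<^esub>"
  by (simp add: path_act_id full_group_simps)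

lemma group_full_group: "group G"
proof (rule groupI)
  have lev: "\<exists>n\<ge>1. \<forall>g\<in>F. \<exists>\<sigma>\<in>\<Gamma> n. g = path_act B n \<sigma>" if "finite F" "F \<subseteq> carrier G" for F
    using full_group_level[OF that] by (metis image_iff order_refl subset_iff)
  fix g h assume gh: "g \<in> carrier G" "h \<in> carrier G"
  obtain n \<sigma> \<tau> where n: "n \<ge> 1" "\<sigma> \<in> \<Gamma> n" "\<tau> \<in> \<Gamma> n" "g = path_act B n \<sigma>" "h = path_act B n \<tau>"
    using lev[of "{g, h}"] gh by auto
  show "g \<otimes>\<^bsub>G\<^esub> h \<in> carrier G"
    using n level_perms_closed by (simp add: path_act_mult path_act_carrier)
  fix k assume k: "k \<in> carrier G"
  show "g \<otimes>\<^bsub>G\<^esub> h \<otimes>\<^bsub>G\<^esub> k = g \<otimes>\<^bsub>G\<^esub> (h \<otimes>\<^bsub>G\<^esub> k)"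
  proof -
    obtain n \<sigma> \<tau> \<rho> where n: "n \<ge> 1" "\<sigma> \<in> \<Gamma> n" "\<tau> \<in> \<Gamma> n" "\<rho> \<in> \<Gamma> n"
      "g = path_act B n \<sigma>" "h = path_act B n \<tau>" "k = path_act B n \<rho>"
      using lev[of "{g, h, k}"] gh k by auto
    then show ?thesis by (simp add: path_act_mult level_perms_closed comp_assoc)
  qed
next
  show "\<one>\<^bsub>G\<^esub> \<in> carrier G" using path_act_one[of 1] path_act_carrier[of 1 id] level_perms_closed(1) by simp
next
  fix g assume "g \<in> carrier G"
  then obtain n \<sigma> where n: "n \<ge> 1" "\<sigma> \<in> \<Gamma> n" "g = path_act B n \<sigma>" by (rule full_group_cases)
  then have i: "inv \<sigma> \<in> \<Gamma> n" "inv \<sigma> \<circ> \<sigma> = id" by (auto simp: bij_is_inj level_permsD(3) level_perms_inv)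
  show "\<one>\<^bsub>G\<^esub> \<otimes>\<^bsub>G\<^esub> g = g"
    using n path_act_mult[of n id \<sigma>] level_perms_closed(1) by (simp add: path_act_one)
  show "\<exists>h\<in>carrier G. h \<otimes>\<^bsub>G\<^esub> g = \<one>\<^bsub>G\<^esub>"
    using n i by (intro bexI[of _ "path_act B n (inv \<sigma>)"]) (auto simp: path_act_mult path_act_one path_act_carrier)
qed

lemma path_act_inv:
  assumes "n \<ge> 1" "\<sigma> \<in> \<Gamma> n"
  shows "m_inv G (path_act B n \<sigma>) = path_act B n (inv \<sigma>)"
proof -
  interpret group G by (rule group_full_group)
  have i: "inv \<sigma> \<in> \<Gamma> n" "inv \<sigma> \<circ> \<sigma> = id" using assms by (auto simp: bij_is_inj level_permsD(3) level_perms_inv)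
  show ?thesis
    by (rule inv_equality) (use i assms in \<open>auto simp: path_act_mult path_act_one path_act_carrier\<close>)
qed

lemma countable_full_group: "countable (carrier G)"
  unfolding carrier_full_group by (intro countable_UN countableI_type countable_image) (auto intro: countable_finite)

end

subsection \<open>Counting extensions\<close>

context bratteli_diagram
begin

definition ext_to :: "nat \<Rightarrow> nat \<Rightarrow> (nat \<Rightarrow> 'e) \<Rightarrow> 'v \<Rightarrow> (nat \<Rightarrow> 'e) set" where
  "ext_to n m p w = {q \<in> exts B n m p. t m q = w}"

definition fibre :: "nat \<Rightarrow> 'v \<Rightarrow> (nat \<Rightarrow> 'e) set" where
  "fibre n v = {p \<in> P n. t n p = v}"

lemma ext_to_iff: "q \<in> ext_to n m p w \<longleftrightarrow> q \<in> P m \<and> restrict q {1..n} = p \<and> t m q = w"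
  by (auto simp: ext_to_def exts_def)

lemma finite_ext_to [simp]: "finite (ext_to n m p w)" by (simp add: ext_to_def)

lemma finite_fibre [simp]: "finite (fibre n v)" by (simp add: fibre_def)

lemma ext_to_subset_fibre: "ext_to n m p w \<subseteq> fibre m w"
  by (auto simp: ext_to_iff fibre_def)

text \<open>Every vertex is reached from the root, by induction on the level: the range map is onto
  on each level, and the source of the last edge is reached already.\<close>

lemma fibre_vertex: "n \<ge> 1 \<Longrightarrow> v \<in> vert B n \<longleftrightarrow> fibre n v \<noteq> {}"
proof
  assume n: "n \<ge> 1" and v: "v \<in> vert B n"
  have "\<exists>p\<in>P m. v = t m p" if "m \<ge> 1" "v \<in> vert B m" for m v
    using that
  proof (induction m arbitrary: v rule: nat_induct_at_least[of 1])
    case base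
    obtain e where e: "e \<in> edge B 1" "tgt B e = v" using base unfolding tgt_edge[of 1, OF order_refl, symmetric] by auto
    have "(\<lambda>i\<in>{1..1}. e) \<in> P 1" using e by (auto simp: fin_paths_iff)
    then show ?case using e by (intro bexI[of _ "\<lambda>i\<in>{1..1}. e"]) (auto simp: end_vertex_def)
  next
    case (Suc m)
    obtain e where e: "e \<in> edge B (Suc m)" "tgt B e = v" using Suc.prems unfolding tgt_edge[of "Suc m", OF Suc_leI[OF zero_less_Suc, folded One_nat_def], symmetric] by auto
    have "src B e \<in> vert B m" using edge_src[of "Suc m" e] e by simp
    then obtain p where p: "p \<in> P m" "src B e = t m p" using Suc.IH by blast
    let ?q = "p(Suc m := e)"
    have "?q \<in> P (Suc m)"
      using p e Suc.hyps by (auto simp: fin_paths_iff PiE_iff extensional_def end_vertex_def le_Suc_eq less_Suc_eq)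
    then show ?case using e by (intro bexI[of _ ?q]) (auto simp: end_vertex_def)
  qed
  then show "fibre n v \<noteq> {}" using n v by (auto simp: fibre_def)
qed (auto simp: fibre_def end_vertex_in)

text \<open>Replacing the initial segment \<open>p\<close> by \<open>p'\<close> is a bijection of
  the extensions, so their number depends on \<open>p\<close> only through its end vertex.\<close>

lemma card_ext_to_cong:
  assumes n: "n \<ge> 1" "n \<le> m" and p: "p \<in> P n" "p' \<in> P n" "t n p = t n p'"
  shows "card (ext_to n m p w) = card (ext_to n m p' w)"
proof (rule bij_betw_same_card[of "glue n p'"], rule bij_betw_byWitness[of _ "glue n p"])
  have *: "glue n p' q \<in> ext_to n m p' w" if "q \<in> ext_to n m p w" "p' \<in> P n" "t n p = t n p'" for p p' q
  proof -
    have q: "q \<in> P m" "restrict q {1..n} = p" "t m q = w" using that by (auto simp: ext_to_iff)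
    have "t n p' = t n q" using that(3) q(2) end_vertex_restrict[OF n(1), of q] by simp
    then show ?thesis using glue_fin_path[OF n that(2) q(1)] q(3) restrict_glue_path[OF that(2)] by (simp add: ext_to_iff)
  qed
  show "glue n p' ` ext_to n m p w \<subseteq> ext_to n m p' w" using *[of _ p p'] p by blast
  show "glue n p ` ext_to n m p' w \<subseteq> ext_to n m p w" using *[of _ p' p] p by auto
qed (auto simp: ext_to_iff)

lemma card_paths_ext_to:
  assumes n: "n \<ge> 1" "n < m" and p: "p \<in> P n"
  shows "card (paths B n (t n p) m w) = card (ext_to n m p w)"
proof (rule bij_betw_same_card[symmetric, of "\<lambda>q. restrict q {n+1..m}"],
       rule bij_betw_byWitness[of _ "\<lambda>r. \<lambda>i\<in>{1..m}. if i \<le> n then p i else r i"])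
  have m: "m \<ge> 1" using n by simp
  show "\<forall>q\<in>ext_to n m p w. (\<lambda>i\<in>{1..m}. if i \<le> n then p i else restrict q {n + 1..m} i) = q"
  proof
    fix q assume "q \<in> ext_to n m p w"
    then have q: "q \<in> P m" "restrict q {1..n} = p" by (auto simp: ext_to_iff)
    show "(\<lambda>i\<in>{1..m}. if i \<le> n then p i else restrict q {n + 1..m} i) = q"
    proof
      fix i
      have "q i = undefined" if "i \<notin> {1..m}"
        using q(1) that m by (auto simp: fin_paths_iff PiE_iff extensional_def)
      then show "(\<lambda>i\<in>{1..m}. if i \<le> n then p i else restrict q {n + 1..m} i) i = q i"
        using q(2) by (auto simp: restrict_def)
    qed
  qed
  show "\<forall>r\<in>paths B n (t n p) m w. restrict (\<lambda>i\<in>{1..m}. if i \<le> n then p i else r i) {n + 1..m} = r"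
    by (auto simp: paths_def PiE_iff extensional_def fun_eq_iff)
  show "(\<lambda>q. restrict q {n + 1..m}) ` ext_to n m p w \<subseteq> paths B n (t n p) m w"
  proof (rule image_subsetI)
    fix q assume "q \<in> ext_to n m p w"
    then have q: "q \<in> P m" "restrict q {1..n} = p" "t m q = w" by (auto simp: ext_to_iff)
    have *: "q i \<in> edge B i" "i < m \<Longrightarrow> src B (q (i+1)) = tgt B (q i)" if "1 \<le> i" "i \<le> m" for i
      using q(1) that m by (auto simp: fin_paths_iff PiE_iff)
    have "p n = q n" using q(2) n by auto
    then have "src B (q (n+1)) = t n p" using *(2)[of n] n by (simp add: end_vertex_def)
    then show "restrict q {n + 1..m} \<in> paths B n (t n p) m w"
      using * q(3) n by (auto simp: paths_def end_vertex_def)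
  qed
  show "(\<lambda>r. \<lambda>i\<in>{1..m}. if i \<le> n then p i else r i) ` paths B n (t n p) m w \<subseteq> ext_to n m p w"
  proof (rule image_subsetI)
    fix r assume r: "r \<in> paths B n (t n p) m w"
    let ?q = "\<lambda>i\<in>{1..m}. if i \<le> n then p i else r i"
    have pn: "\<And>i. 1 \<le> i \<Longrightarrow> i \<le> n \<Longrightarrow> p i \<in> edge B i" "\<And>i. 1 \<le> i \<Longrightarrow> i < n \<Longrightarrow> src B (p (i+1)) = tgt B (p i)"
      using p n by (auto simp: fin_paths_iff PiE_iff)
    have rn: "\<And>i. n < i \<Longrightarrow> i \<le> m \<Longrightarrow> r i \<in> edge B i" "\<And>i. n < i \<Longrightarrow> i < m \<Longrightarrow> src B (r (i+1)) = tgt B (r i)"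
      "src B (r (n+1)) = tgt B (p n)" "tgt B (r m) = w"
      using r by (auto simp: paths_def PiE_iff end_vertex_def)
    have "?q \<in> P m" unfolding fin_paths_iff[OF m]
    proof (intro conjI allI impI)
      show "?q \<in> (\<Pi>\<^sub>E i\<in>{1..m}. edge B i)" using pn(1) rn(1) by auto
      fix i assume i: "1 \<le> i" "i < m"
      consider "i < n" | "i = n" | "i > n" by linarith
      then show "src B (?q (i + 1)) = tgt B (?q i)"
        by cases (use i pn(2) rn in auto)
    qed
    moreover have "restrict ?q {1..n} = p"
      using p n by (auto simp: fin_paths_iff PiE_iff extensional_def fun_eq_iff)
    moreover have "t m ?q = w" using rn(4) n m by (simp add: end_vertex_def)
    ultimately show "?q \<in> ext_to n m p w" by (simp add: ext_to_iff)
  qed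
qed

lemma ext_to_decompose:
  assumes n: "n \<ge> 1" "n \<le> m" "m \<le> l" and p: "p \<in> P n"
  shows "ext_to n l p w = (\<Union>r\<in>exts B n m p. ext_to m l r w)"
    "disjoint_family_on (\<lambda>r. ext_to m l r w) A"
proof -
  show "ext_to n l p w = (\<Union>r\<in>exts B n m p. ext_to m l r w)"
    using n by (auto simp: ext_to_iff exts_iff restrict_restrict_le intro: restrict_fin_path)
  show "disjoint_family_on (\<lambda>r. ext_to m l r w) A"
    by (auto simp: disjoint_family_on_def ext_to_iff)
qed

end

section \<open>Even diagrams: parity, growth of fibres and positive density of extensions\<close>

locale even_diagram = bratteli_diagram +
  assumes even: "even_bratteli B"
begin

text \<open>Connectedness and evenness read off from extensions of a path instead of paths between
  vertices; the counts agree by \<open>card_paths_ext_to\<close>.\<close>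

definition good :: "nat \<Rightarrow> nat \<Rightarrow> bool" where
  "good n m \<longleftrightarrow> (\<forall>p\<in>P n. \<forall>w\<in>vert B m. ext_to n m p w \<noteq> {} \<and> even (card (ext_to n m p w)))"

lemma good_exists:
  assumes "n \<ge> 1"
  shows "\<exists>m>n. good n m"
proof -
  obtain m where m: "m > n" "\<forall>v\<in>vert B n. \<forall>w\<in>vert B m. paths B n v m w \<noteq> {} \<and> even (card (paths B n v m w))"
    using even assms unfolding even_bratteli_def by blast
  have "ext_to n m p w \<noteq> {} \<and> even (card (ext_to n m p w))" if "p \<in> P n" "w \<in> vert B m" for p w
  proof -
    have *: "paths B n (t n p) m w \<noteq> {}" "even (card (paths B n (t n p) m w))"
      using m(2) that end_vertex_in[OF assms that(1)] by blast+
    have "finite (paths B n (t n p) m w)"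
      by (rule finite_subset[of _ "\<Pi>\<^sub>E i\<in>{n+1..m}. edge B i"]) (auto simp: paths_def intro!: finite_PiE finite_edge)
    then have "card (paths B n (t n p) m w) > 0" using * by (simp add: card_gt_0_iff)
    then show ?thesis using * card_paths_ext_to[OF assms m(1) that(1), of w] by auto
  qed
  then show ?thesis using m(1) by (auto simp: good_def)
qed

text \<open>The extensions to level \<open>l\<close> are classified by their edges beyond
  \<open>m\<close>. Such a tail fixes the vertex at level \<open>m\<close>, so each class is a copy
  of the set of extensions of \<open>p\<close> to that vertex, whose size is even.\<close>

lemma good_mono:
  assumes n: "n \<ge> 1" "n < m" "m \<le> l" and g: "good n m"
  shows "good n l"
  unfolding good_def
proof (intro ballI)
  fix p w assume p: "p \<in> P n" and w: "w \<in> vert B l"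
  have ml: "m \<ge> 1" "l \<ge> 1" "n \<le> l" using n by auto
  let ?S = "ext_to n l p w"
  obtain q0 where q0: "q0 \<in> P l" "t l q0 = w" using w fibre_vertex[of l w] ml by (auto simp: fibre_def)
  have rq: "restrict q {1..m} \<in> P m" "t m (restrict q {1..m}) \<in> vert B m" if "q \<in> P l" for q
    using restrict_fin_path[OF that n(3)] end_vertex_in[OF ml(1)] by blast+
  have glue_in: "glue m r q \<in> ?S" if q: "q \<in> P l" "t l q = w" and r: "r \<in> ext_to n m p (t m (restrict q {1..m}))" for q r
  proof -
    have r': "r \<in> P m" "restrict r {1..n} = p" "t m r = t m q"
      using r ml by (auto simp: ext_to_iff end_vertex_restrict)
    have "restrict (glue m r q) {1..n} = restrict (restrict (glue m r q) {1..m}) {1..n}"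
      using n by (simp add: restrict_restrict_le)
    also have "\<dots> = p" using restrict_glue_path[OF r'(1)] r'(2) by simp
    finally show ?thesis using glue_fin_path[OF ml(1) n(3) r'(1) q(1) r'(3)] q(2) by (simp add: ext_to_iff)
  qed
  have "ext_to n m p (t m (restrict q0 {1..m})) \<noteq> {}"
    using g p rq(2)[OF q0(1)] unfolding good_def by blast
  then have "?S \<noteq> {}" using glue_in[OF q0] by blast
  moreover have "even (card ?S)"
  proof -
    let ?f = "\<lambda>q. restrict q {m+1..l}"
    have "card ?S = (\<Sum>y\<in>?f ` ?S. card {q \<in> ?S. ?f q = y})"
      using sum.image_gen[of ?S "\<lambda>_. 1::nat" ?f] by simp
    moreover have "even (card {q \<in> ?S. ?f q = y})" if y: "y \<in> ?f ` ?S" for y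
    proof -
      obtain q1 where q1: "q1 \<in> ?S" "y = ?f q1" using y by blast
      then have q1P: "q1 \<in> P l" "t l q1 = w" by (auto simp: ext_to_iff)
      let ?v = "t m (restrict q1 {1..m})"
      have "card {q \<in> ?S. ?f q = y} = card (ext_to n m p ?v)"
      proof (rule bij_betw_same_card[of "\<lambda>q. restrict q {1..m}"], rule bij_betw_byWitness[of _ "\<lambda>r. glue m r q1"])
        have out: "q i = undefined" if "q \<in> P l" "i \<notin> {1..l}" for q i
          using that ml by (auto simp: fin_paths_iff PiE_iff extensional_def)
        show "\<forall>q\<in>{q \<in> ?S. ?f q = y}. glue m (restrict q {1..m}) q1 = q"
        proof
          fix q assume "q \<in> {q \<in> ?S. ?f q = y}"
          then have q: "q \<in> P l" "?f q = ?f q1" using q1(2) by (auto simp: ext_to_iff)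
          show "glue m (restrict q {1..m}) q1 = q"
          proof
            fix i
            show "glue m (restrict q {1..m}) q1 i = q i"
            proof (cases "i \<in> {m+1..l}")
              case True
              then show ?thesis using fun_cong[OF q(2), of i] by (auto simp: glue_def)
            next
              case False
              then show ?thesis using out[OF q(1), of i] out[OF q1P(1), of i] n by (auto simp: glue_def)
            qed
          qed
        qed
        show "\<forall>r\<in>ext_to n m p ?v. restrict (glue m r q1) {1..m} = r"
          by (auto simp: ext_to_iff restrict_glue_path)
        show "(\<lambda>q. restrict q {1..m}) ` {q \<in> ?S. ?f q = y} \<subseteq> ext_to n m p ?v"
        proof (rule image_subsetI)
          fix q assume "q \<in> {q \<in> ?S. ?f q = y}"
          then have q: "q \<in> P l" "?f q = ?f q1" "restrict q {1..n} = p" "t l q = w" using q1(2) by (auto simp: ext_to_iff)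
          \<comment> \<open>The tail determines the vertex at level \<open>m\<close> as the source
            of its first edge or, if \<open>m = l\<close>, as the prescribed end vertex
            \<open>w\<close>.\<close>
          have "t m q = t m q1"
          proof (cases "m = l")
            case True
            then show ?thesis using q q1P by simp
          next
            case False
            then have "q (m + 1) = q1 (m + 1)" using fun_cong[OF q(2), of "m+1"] n by simp
            moreover have "src B (q (m+1)) = t m q" "src B (q1 (m+1)) = t m q1"
              using q(1) q1P(1) ml False n(3) by (auto simp: fin_paths_iff end_vertex_def)
            ultimately show ?thesis by simp
          qed
          then show "restrict q {1..m} \<in> ext_to n m p ?v"
            using rq[OF q(1)] q(3) n ml by (simp add: ext_to_iff end_vertex_restrict restrict_restrict_le)
        qed
        have "?f (glue m r q1) = y" for r using q1(2) by (auto simp: glue_def fun_eq_iff)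
        then show "(\<lambda>r. glue m r q1) ` ext_to n m p ?v \<subseteq> {q \<in> ?S. ?f q = y}"
          using glue_in[OF q1P] by blast
      qed
      then show ?thesis using g p rq(2)[OF q1P(1)] unfolding good_def by simp
    qed
    ultimately show ?thesis by (simp add: dvd_sum)
  qed
  ultimately show "?S \<noteq> {} \<and> even (card ?S)" by blast
qed

lemma good_eventually:
  assumes "n \<ge> 1"
  shows "\<exists>m>n. \<forall>l\<ge>m. good n l"
  using good_exists[OF assms] good_mono[OF assms] by blast

text \<open>Each passage through a further good stretch at least doubles the number of extensions, a
  positive even number being at least 2. This growth is what makes the later arguments with a fixed
  density, and the error terms with a factor 1 / \<open>h\<close>, effective.\<close>

lemma card_ext_to_unbounded:
  assumes "n \<ge> 1"
  shows "\<exists>m>n. \<forall>l\<ge>m. \<forall>p\<in>P n. \<forall>w\<in>vert B l. N \<le> card (ext_to n l p w)"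
proof -
  have "\<exists>m>n. \<forall>l\<ge>m. \<forall>p\<in>P n. \<forall>w\<in>vert B l. Suc N \<le> card (ext_to n l p w)"
  proof (induction N)
    case 0
    obtain m where "m > n" "\<And>l. l \<ge> m \<Longrightarrow> good n l" using good_eventually[OF assms] by blast
    then show ?case by (auto simp: good_def card_gt_0_iff Suc_le_eq intro!: exI[of _ m])
  next
    case (Suc N)
    then obtain m where m: "m > n" "\<And>p w. p \<in> P n \<Longrightarrow> w \<in> vert B m \<Longrightarrow> Suc N \<le> card (ext_to n m p w)" by blast
    obtain m3 where m3: "m3 > m" "\<And>l. l \<ge> m3 \<Longrightarrow> good m l" using good_eventually[of m] m assms by auto
    have "Suc (Suc N) \<le> card (ext_to n l p w)" if l: "l \<ge> m3" and p: "p \<in> P n" and w: "w \<in> vert B l" for l p w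
    proof -
      have m1: "m \<ge> 1" "n \<le> m" "m \<le> l" using m(1) assms m3(1) l by auto
      obtain v where v: "v \<in> vert B m" using fin_paths_nonempty[of m] end_vertex_in[OF m1(1)] by blast
      have "2 \<le> card (ext_to m l r w)" if "r \<in> P m" for r
      proof -
        have "ext_to m l r w \<noteq> {}" "even (card (ext_to m l r w))" using m3(2)[OF l] that w by (auto simp: good_def)
        then have "card (ext_to m l r w) \<noteq> 0" "card (ext_to m l r w) \<noteq> 1" by auto
        then show ?thesis by linarith
      qed
      then have "(\<Sum>r\<in>ext_to n m p v. 2) \<le> (\<Sum>r\<in>ext_to n m p v. card (ext_to m l r w))"
        by (intro sum_mono) (auto simp: ext_to_iff)
      also have "\<dots> = card (\<Union>r\<in>ext_to n m p v. ext_to m l r w)"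
        using ext_to_decompose(2)[OF assms m1(2,3) p]
        by (subst card_UN_disjoint) (auto simp: disjoint_family_on_def)
      also have "\<dots> \<le> card (ext_to n l p w)"
        unfolding ext_to_decompose(1)[OF assms m1(2,3) p] by (intro card_mono) (auto simp: ext_to_def)
      finally have "2 * card (ext_to n m p v) \<le> card (ext_to n l p w)" by simp
      then show ?thesis using m(2)[OF p v] by linarith
    qed
    then show ?case using m3(1) m(1) by (intro exI[of _ m3]) auto
  qed
  then show ?thesis by (meson Suc_leD)
qed

lemma card_fibre_unbounded: "\<exists>m\<ge>1. \<forall>l\<ge>m. \<forall>w\<in>vert B l. N \<le> card (fibre l w)"
proof -
  obtain m where m: "m > 1" "\<And>l p w. l \<ge> m \<Longrightarrow> p \<in> P 1 \<Longrightarrow> w \<in> vert B l \<Longrightarrow> N \<le> card (ext_to 1 l p w)"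
    using card_ext_to_unbounded[of 1 N] by auto
  obtain p where p: "p \<in> P 1" using fin_paths_nonempty by blast
  have "N \<le> card (fibre l w)" if "l \<ge> m" "w \<in> vert B l" for l w
    using m(2)[OF that(1) p that(2)] card_mono[OF finite_fibre ext_to_subset_fibre] by (meson le_trans)
  then show ?thesis using m(1) by (intro exI[of _ m]) auto
qed

text \<open>At a level \<open>m\<close> where \<open>p\<close> reaches every vertex, each
  \<open>r\<close> in \<open>P m\<close> has the same end vertex as some extension of
  \<open>p\<close>, so \<open>r\<close> has no more extensions to \<open>w\<close> than
  \<open>p\<close>. The fibre over \<open>w\<close> therefore has at most \<open>card (P m)\<close>
  times the size of \<open>ext_to n l p w\<close>, with a constant independent of
  \<open>l\<close>.\<close>

lemma ext_to_density:
  assumes n: "n \<ge> 1"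
  shows "\<exists>\<epsilon>>0. \<exists>m\<ge>n. \<forall>l\<ge>m. \<forall>p\<in>P n. \<forall>w\<in>vert B l. \<epsilon> * real (card (fibre l w)) \<le> real (card (ext_to n l p w))"
proof -
  obtain m where m: "m > n" "good n m" using good_exists[OF n] by blast
  let ?C = "card (P m)"
  have C: "?C > 0" using fin_paths_nonempty by (simp add: card_gt_0_iff)
  have m1: "m \<ge> 1" "n \<le> m" using n m by auto
  have "card (fibre l w) \<le> ?C * card (ext_to n l p w)" if l: "l \<ge> m" and p: "p \<in> P n" and w: "w \<in> vert B l" for l p w
  proof -
    have le: "card (ext_to m l r w) \<le> card (ext_to n l p w)" if r: "r \<in> P m" for r
    proof -
      have "ext_to n m p (t m r) \<noteq> {}" using m(2) p end_vertex_in[OF m1(1) r] by (auto simp: good_def)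
      then obtain r' where r': "r' \<in> ext_to n m p (t m r)" by blast
      then have "r' \<in> P m" "t m r = t m r'" by (auto simp: ext_to_iff)
      then have "card (ext_to m l r w) = card (ext_to m l r' w)" by (rule card_ext_to_cong[OF m1(1) l r])
      also have "\<dots> \<le> card (ext_to n l p w)"
        unfolding ext_to_decompose(1)[OF n m1(2) l p] using r' by (intro card_mono) (auto simp: ext_to_def)
      finally show ?thesis .
    qed
    have "fibre l w \<subseteq> (\<Union>r\<in>P m. ext_to m l r w)"
      using restrict_fin_path[OF _ l] by (auto simp: fibre_def ext_to_iff)
    then have "card (fibre l w) \<le> card (\<Union>r\<in>P m. ext_to m l r w)" by (intro card_mono) auto
    also have "\<dots> \<le> (\<Sum>r\<in>P m. card (ext_to m l r w))" by (rule card_UN_le) simp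
    also have "\<dots> \<le> (\<Sum>r\<in>P m. card (ext_to n l p w))" using le by (intro sum_mono)
    finally show ?thesis by simp
  qed
  then have "real (card (fibre l w)) \<le> real ?C * real (card (ext_to n l p w))"
    if "l \<ge> m" "p \<in> P n" "w \<in> vert B l" for l p w
    using that by (metis of_nat_le_iff of_nat_mult)
  then show ?thesis using C m1
    by (intro exI[of _ "1 / ?C"] conjI exI[of _ m]) (auto simp: field_simps)
qed

end

section \<open>Invariant measures on the path space\<close>

definition cylinder :: "('v, 'e) bratteli \<Rightarrow> nat \<Rightarrow> (nat \<Rightarrow> 'e) \<Rightarrow> (nat \<Rightarrow> 'e) set" where
  "cylinder B n p = {x \<in> path_space B. restrict x {1..n} = p}"

text \<open>The clopen sets that depend on the first \<open>n\<close> edges only; for varying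
  \<open>n\<close> they form the ring carrying the content from which invariant measures are
  built.\<close>

definition level_set :: "('v, 'e) bratteli \<Rightarrow> nat \<Rightarrow> (nat \<Rightarrow> 'e) set \<Rightarrow> bool" where
  "level_set B n S \<longleftrightarrow> S \<subseteq> path_space B \<and>
    (\<forall>x\<in>S. \<forall>y\<in>path_space B. restrict y {1..n} = restrict x {1..n} \<longrightarrow> y \<in> S)"

text \<open>Invariant measures in combinatorial form: \<open>m (n, p)\<close> is the measure of the cylinder of \<open>p \<in> P n\<close>.\<close>

definition inv_weight :: "('v, 'e) bratteli \<Rightarrow> (nat \<times> (nat \<Rightarrow> 'e) \<Rightarrow> real) \<Rightarrow> bool" where
  "inv_weight B m \<longleftrightarrow>
    (\<forall>n\<ge>1. \<forall>p\<in>fin_paths B n. 0 \<le> m (n, p) \<and> m (n, p) = (\<Sum>q\<in>exts B n (Suc n) p. m (Suc n, q))) \<and>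
    (\<forall>n\<ge>1. \<forall>p\<in>fin_paths B n. \<forall>q\<in>fin_paths B n. end_vertex B n p = end_vertex B n q \<longrightarrow> m (n, p) = m (n, q)) \<and>
    (\<Sum>p\<in>fin_paths B 1. m (1, p)) = 1"

context bratteli_diagram
begin

abbreviation "cyl \<equiv> cylinder B"
abbreviation "PS \<equiv> borel_of (path_topology B)"

lemma topspace_path_topology [simp]: "topspace (path_topology B) = X"
  by (auto simp: path_topology_def path_space_def)

lemma cyl_open: "openin (path_topology B) (cyl n p)"
proof -
  let ?U = "\<lambda>i. if i \<in> {1..n} then {p i} \<inter> edge B i else edge B i"
  have "openin (product_topology (\<lambda>i. discrete_topology (edge B i)) {1..}) (Pi\<^sub>E {1..} ?U)"
    unfolding openin_PiE_gen
    by (intro disjI2 conjI) (auto intro: finite_subset[of _ "{1..n}"])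
  moreover have "cyl n p = (if p \<in> extensional {1..n} then Pi\<^sub>E {1..} ?U \<inter> X else {})"
  proof -
    have "x \<in> cyl n p \<longleftrightarrow> x \<in> Pi\<^sub>E {1..} ?U \<and> x \<in> X" if "p \<in> extensional {1..n}" for x
    proof (cases "x \<in> X")
      case True
      have "restrict x {1..n} = p \<longleftrightarrow> (\<forall>i\<in>{1..n}. x i = p i)"
        using that by (auto simp: fun_eq_iff extensional_def restrict_def)
      moreover have "x \<in> extensional {1..}" "\<forall>i\<in>{1..}. x i \<in> edge B i"
        using True by (auto simp: path_space_iff)
      then have "x \<in> Pi\<^sub>E {1..} ?U \<longleftrightarrow> (\<forall>i\<in>{1..n}. x i = p i)"
        by (auto simp: PiE_iff split: if_splits)
      ultimately show ?thesis using True by (simp add: cylinder_def)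
    qed (simp add: cylinder_def)
    then show ?thesis by (auto simp: cylinder_def)
  qed
  ultimately show ?thesis unfolding path_topology_def by (auto simp: openin_subtopology)
qed

lemma cyl_base:
  assumes U: "openin (path_topology B) U" "x \<in> U"
  shows "\<exists>n\<ge>1. cyl n (restrict x {1..n}) \<subseteq> U"
proof -
  obtain V where V: "openin (product_topology (\<lambda>i. discrete_topology (edge B i)) {1..}) V" "U = V \<inter> X"
    using U unfolding path_topology_def openin_subtopology by blast
  have xV: "x \<in> V" "x \<in> X" using V U by auto
  obtain W where W: "finite {i \<in> {1..}. W i \<noteq> edge B i}" "x \<in> Pi\<^sub>E {1..} W" "Pi\<^sub>E {1..} W \<subseteq> V"
    using V(1) xV(1) unfolding openin_product_topology_alt by fastforce
  define n where "n = Max (insert 1 {i \<in> {1..}. W i \<noteq> edge B i})"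
  have n: "n \<ge> 1" "\<And>i. i > n \<Longrightarrow> W i = edge B i"
  proof -
    show "n \<ge> 1" unfolding n_def using W(1) by (intro Max_ge) auto
    fix i assume i: "i > n"
    show "W i = edge B i"
    proof (rule ccontr)
      assume "W i \<noteq> edge B i"
      then have "i \<in> insert 1 {i \<in> {1..}. W i \<noteq> edge B i}" using i \<open>n \<ge> 1\<close> by auto
      then have "i \<le> n" unfolding n_def using W(1) by (intro Max_ge) auto
      then show False using i by simp
    qed
  qed
  have "cyl n (restrict x {1..n}) \<subseteq> U"
  proof
    fix y assume "y \<in> cyl n (restrict x {1..n})"
    then have y: "y \<in> X" "restrict y {1..n} = restrict x {1..n}" by (auto simp: cylinder_def)
    have "y i \<in> W i" if "i \<ge> 1" for i
    proof (cases "i \<le> n")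
      case True
      then have "y i = x i" using fun_cong[OF y(2), of i] that by simp
      then show ?thesis using W(2) that by (auto simp: PiE_iff)
    next
      case False
      then show ?thesis using n(2)[of i] y(1) that by (simp add: path_space_iff)
    qed
    then have "y \<in> Pi\<^sub>E {1..} W" using y(1) by (auto simp: PiE_iff path_space_iff)
    then show "y \<in> U" using W(3) V(2) y(1) by blast
  qed
  then show ?thesis using n(1) by blast
qed

text \<open>Two cylinders are nested or disjoint; the empty set is added to make the family stable
  under intersections.\<close>

definition cyls :: "(nat \<Rightarrow> 'e) set set" where
  "cyls = insert {} (\<Union>n\<in>{1..}. cyl n ` P n)"

lemma cyls_subset: "cyls \<subseteq> Pow X" by (auto simp: cyls_def cylinder_def)

lemma cyl_in_cyls: "n \<ge> 1 \<Longrightarrow> p \<in> P n \<Longrightarrow> cyl n p \<in> cyls" by (auto simp: cyls_def)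

lemma countable_cyls: "countable cyls"
  unfolding cyls_def by (intro countable_insert countable_UN countableI_type countable_image) (auto intro: countable_finite)

lemma cyl_exts:
  assumes "n \<le> m" "p \<in> P n" shows "cyl n p = (\<Union>q\<in>exts B n m p. cyl m q)"
  using assms by (auto simp: cylinder_def exts_iff restrict_restrict_le)

lemma cyl_disjoint: "p \<noteq> q \<Longrightarrow> cyl n p \<inter> cyl n q = {}"
  by (auto simp: cylinder_def)

lemma Int_stable_cyls: "Int_stable cyls"
proof -
  have *: "cyl n p \<inter> cyl m q \<in> cyls" if "1 \<le> n" "n \<le> m" "p \<in> P n" "q \<in> P m" for n m p q
  proof (cases "restrict q {1..n} = p")
    case True
    then have "cyl n p \<inter> cyl m q = cyl m q" using that by (auto simp: cylinder_def restrict_restrict_le)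
    then show ?thesis using that cyl_in_cyls by simp
  next
    case False
    then have "cyl n p \<inter> cyl m q = {}" using that by (auto simp: cylinder_def restrict_restrict_le)
    then show ?thesis by (simp add: cyls_def)
  qed
  have "cyl n p \<inter> cyl m q \<in> cyls" if "1 \<le> n" "1 \<le> m" "p \<in> P n" "q \<in> P m" for n m p q
    using *[of n m p q] *[of m n q p] that by (cases "n \<le> m") (auto simp: Int_commute)
  then show ?thesis unfolding Int_stable_def by (auto simp: cyls_def)
qed

lemma sets_PS: "sets PS = sigma_sets X cyls" and space_PS: "space PS = X"
proof -
  have base: "\<exists>V\<in>cyls. x \<in> V \<and> V \<subseteq> U" if U: "openin (path_topology B) U" "x \<in> U" for U x
  proof -
    obtain n where n: "n \<ge> 1" "cyl n (restrict x {1..n}) \<subseteq> U" using cyl_base[OF U] by blast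
    have "x \<in> X" using openin_subset[OF U(1)] U(2) by auto
    then show ?thesis using n cyl_in_cyls[OF n(1) restrict_in_fin_paths]
      by (intro bexI[of _ "cyl n (restrict x {1..n})"]) (auto simp: cylinder_def)
  qed
  have op: "openin (path_topology B) U" if "U \<in> cyls" for U
    using that cyl_open by (auto simp: cyls_def)
  show "sets PS = sigma_sets X cyls" "space PS = X"
    using sets_borel_of_base[OF countable_cyls op base] by auto
qed

lemma cyl_sets [measurable]: "n \<ge> 1 \<Longrightarrow> cyl n p \<in> sets PS"
proof (cases "p \<in> P n")
  case True
  assume "n \<ge> 1"
  then show ?thesis using True cyl_in_cyls sets_PS by (auto intro: sigma_sets.Basic)
next
  case False
  then have "cyl n p = {}" by (auto simp: cylinder_def)
  then show ?thesis by simp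
qed

lemma path_act_vimage_cyl:
  assumes "n \<ge> 1" "\<sigma> \<in> \<Gamma> n" "p \<in> P n"
  shows "path_act B n \<sigma> -` cyl n p \<inter> X = cyl n (inv \<sigma> p)"
proof -
  have b: "bij \<sigma>" using assms(2) by (rule level_permsD)
  have "\<sigma> (restrict x {1..n}) = p \<longleftrightarrow> restrict x {1..n} = inv \<sigma> p" for x
    using b by (metis bij_inv_eq_iff)
  moreover have "path_act B n \<sigma> -` cyl n p \<inter> X = {x \<in> X. \<sigma> (restrict x {1..n}) = p}"
    using path_act_in[OF assms(1,2)] by (auto simp: cylinder_def)
  ultimately show ?thesis by (simp add: cylinder_def)
qed

lemma full_group_in: "g \<in> carrier G \<Longrightarrow> x \<in> X \<Longrightarrow> g x \<in> X"
  using path_act_in by (metis full_group_cases)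

lemma full_group_measurable:
  assumes "g \<in> carrier G" shows "g \<in> measurable PS PS"
proof (rule measurable_sigma_sets[OF sets_PS cyls_subset])
  show "g \<in> space PS \<rightarrow> X" using full_group_in[OF assms] by (auto simp: space_PS)
  obtain n \<sigma> where n: "n \<ge> 1" "\<sigma> \<in> \<Gamma> n" "g = path_act B n \<sigma>" using assms by (rule full_group_cases)
  fix A assume "A \<in> cyls"
  then consider "A = {}" | m p where "m \<ge> 1" "p \<in> P m" "A = cyl m p" by (auto simp: cyls_def)
  then show "g -` A \<inter> space PS \<in> sets PS"
  proof cases
    case (2 m p)
    define l where "l = max n m"
    have l: "n \<le> l" "m \<le> l" "l \<ge> 1" using n by (auto simp: l_def)
    let ?s = "lift_perm B n l \<sigma>"
    have s: "?s \<in> \<Gamma> l" "g = path_act B l ?s"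
      using lift_perm_in[OF n(1) l(1) n(2)] lift_perm_act[OF n(1) l(1) n(2)] n(3) by auto
    have "g -` A \<inter> X = (\<Union>q\<in>exts B m l p. path_act B l ?s -` cyl l q \<inter> X)"
      unfolding 2(3) cyl_exts[OF l(2) 2(2)] s(2)[symmetric] by auto
    also have "\<dots> = (\<Union>q\<in>exts B m l p. cyl l (inv ?s q))"
      using path_act_vimage_cyl[OF l(3) s(1)] by (intro SUP_cong) (auto simp: exts_iff)
    also have "\<dots> \<in> sets PS" using l by (intro sets.finite_UN) auto
    finally show ?thesis by (simp add: space_PS)
  qed simp
qed

lemma level_set_mono: "n \<le> m \<Longrightarrow> level_set B n S \<Longrightarrow> level_set B m S"
  unfolding level_set_def by (metis restrict_restrict_le)

lemma level_set_cyl: "level_set B n (cyl n p)" by (auto simp: level_set_def cylinder_def)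

lemma level_set_eq:
  assumes "level_set B n S" shows "S = (\<Union>p\<in>(\<lambda>x. restrict x {1..n}) ` S. cyl n p)"
  using assms by (auto simp: level_set_def cylinder_def)

lemma level_set_sets: assumes "n \<ge> 1" "level_set B n S" shows "S \<in> sets PS"
proof -
  have "(\<lambda>x. restrict x {1..n}) ` S \<subseteq> P n" using assms by (auto simp: level_set_def)
  then have "finite ((\<lambda>x. restrict x {1..n}) ` S)" using finite_subset finite_fin_paths by blast
  then have "(\<Union>p\<in>(\<lambda>x. restrict x {1..n}) ` S. cyl n p) \<in> sets PS"
    using assms(1) by (intro sets.finite_UN) auto
  then show ?thesis using level_set_eq[OF assms(2)] by simp
qed

text \<open>The path space is closed in a product of finite discrete spaces, because a failure of
  composability is visible in two adjacent coordinates.\<close>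

lemma compact_path_topology: "compact_space (path_topology B)"
proof -
  let ?T = "product_topology (\<lambda>i. discrete_topology (edge B i)) {1..}"
  have top: "topspace ?T = (\<Pi>\<^sub>E i\<in>{1..}. edge B i)" by simp
  have comp: "compact_space ?T"
    unfolding compact_space_product_topology using finite_edge by (auto simp: compact_space_discrete_topology)
  have "closedin ?T X"
    unfolding closedin_def
  proof
    show "X \<subseteq> topspace ?T" by (auto simp: path_space_def)
    show "openin ?T (topspace ?T - X)"
    proof (subst openin_subopen, intro ballI)
      fix x assume x: "x \<in> topspace ?T - X"
      then obtain i where i: "i \<ge> 1" "src B (x (i+1)) \<noteq> tgt B (x i)" by (auto simp: path_space_def)
      let ?U = "\<lambda>j. if j \<in> {i, i+1} then {x j} else edge B j"
      have "openin ?T (Pi\<^sub>E {1..} ?U)"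
        unfolding openin_PiE_gen
      proof (intro disjI2 conjI ballI)
        show "finite {j \<in> {1..}. ?U j \<noteq> topspace (discrete_topology (edge B j))}"
          by (rule finite_subset[of _ "{i, i+1}"]) auto
      qed (use x in \<open>auto simp: PiE_iff\<close>)
      moreover have "x \<in> Pi\<^sub>E {1..} ?U" using x by (auto simp: PiE_iff)
      moreover have "Pi\<^sub>E {1..} ?U \<subseteq> topspace ?T - X"
      proof
        fix y assume y: "y \<in> Pi\<^sub>E {1..} ?U"
        have "y i = x i" "y (i+1) = x (i+1)" using PiE_mem[OF y, of i] PiE_mem[OF y, of "i+1"] i by simp_all
        then have "y \<notin> X" using i by (auto simp: path_space_def)
        moreover have "y \<in> topspace ?T" using y x unfolding top by (auto simp: PiE_iff split: if_splits)
        ultimately show "y \<in> topspace ?T - X" by simp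
      qed
      ultimately show "\<exists>V. openin ?T V \<and> x \<in> V \<and> V \<subseteq> topspace ?T - X" by blast
    qed
  qed
  then have "compactin ?T X" using comp closedin_compact_space by blast
  then show ?thesis unfolding path_topology_def by (rule compact_space_subtopology)
qed

lemma level_set_open: assumes "n \<ge> 1" "level_set B n S" shows "openin (path_topology B) S"
proof -
  have "openin (path_topology B) (\<Union>p\<in>(\<lambda>x. restrict x {1..n}) ` S. cyl n p)"
    using cyl_open by (intro openin_Union) auto
  then show ?thesis using level_set_eq[OF assms(2)] by simp
qed

lemma level_set_closed: assumes "n \<ge> 1" "level_set B n S" shows "closedin (path_topology B) S"
proof -
  have "level_set B n (X - S)" using assms(2) by (auto simp: level_set_def)
  then have "openin (path_topology B) (X - S)" by (rule level_set_open[OF assms(1)])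
  then show ?thesis using assms(2) by (simp add: closedin_def level_set_def)
qed

lemma inv_weightD:
  assumes "inv_weight B m" "n \<ge> 1" "p \<in> P n"
  shows "0 \<le> m (n, p)" "m (n, p) = (\<Sum>q\<in>exts B n (Suc n) p. m (Suc n, q))"
    "q \<in> P n \<Longrightarrow> t n p = t n q \<Longrightarrow> m (n, p) = m (n, q)"
  using assms unfolding inv_weight_def by blast+

lemma inv_weight_exts:
  assumes m: "inv_weight B m" "n \<ge> 1" "p \<in> P n" and l: "n \<le> l"
  shows "m (n, p) = (\<Sum>q\<in>exts B n l p. m (l, q))"
  using l
proof (induction l rule: dec_induct)
  case base
  then show ?case using m by (simp add: exts_self)
next
  case (step l)
  have l1: "l \<ge> 1" using step m by simp
  have "exts B n (Suc l) p = (\<Union>q\<in>exts B n l p. exts B l (Suc l) q)"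
    using step by (auto simp: exts_iff restrict_restrict_le restrict_fin_path)
  moreover have "(\<Sum>r\<in>(\<Union>q\<in>exts B n l p. exts B l (Suc l) q). m (Suc l, r)) = (\<Sum>q\<in>exts B n l p. \<Sum>r\<in>exts B l (Suc l) q. m (Suc l, r))"
    by (rule sum.UNION_disjoint) (auto simp: exts_iff)
  moreover have "\<dots> = (\<Sum>q\<in>exts B n l p. m (l, q))"
    using inv_weightD(2)[OF m(1) l1] by (intro sum.cong) (auto simp: exts_iff)
  ultimately show ?case using step by simp
qed

lemma inv_weight_sum_level:
  assumes m: "inv_weight B m" "n \<ge> 1"
  shows "(\<Sum>p\<in>P n. m (n, p)) = 1"
proof -
  have "P n = (\<Union>p\<in>P 1. exts B 1 n p)" using m
    by (auto simp: exts_iff simp del: atLeastAtMost_singleton intro: restrict_fin_path)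
  then have "(\<Sum>p\<in>P n. m (n, p)) = (\<Sum>p\<in>(\<Union>p\<in>P 1. exts B 1 n p). m (n, p))" by simp
  also have "\<dots> = (\<Sum>p\<in>P 1. \<Sum>q\<in>exts B 1 n p. m (n, q))"
    by (rule sum.UNION_disjoint) (auto simp: exts_iff)
  also have "\<dots> = (\<Sum>p\<in>P 1. m (1, p))"
    using inv_weight_exts[OF m(1) order_refl _ m(2)] by (intro sum.cong) auto
  also have "\<dots> = 1" using m(1) unfolding inv_weight_def by blast
  finally show ?thesis .
qed

lemma inv_weight_le_1: "inv_weight B m \<Longrightarrow> n \<ge> 1 \<Longrightarrow> p \<in> P n \<Longrightarrow> m (n, p) \<le> 1"
  using member_le_sum[of p "P n" "\<lambda>p. m (n, p)"] inv_weightD(1) inv_weight_sum_level[of m n] by auto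

section \<open>The correspondence between invariant measures and invariant weights\<close>

definition inv_measure :: "(nat \<Rightarrow> 'e) measure \<Rightarrow> bool" where
  "inv_measure \<mu> \<longleftrightarrow> sets \<mu> = sets PS \<and> invariant_prob G (\<lambda>g. g) \<mu>"

definition weight :: "(nat \<Rightarrow> 'e) measure \<Rightarrow> nat \<times> (nat \<Rightarrow> 'e) \<Rightarrow> real" where
  "weight \<mu> = (\<lambda>(n, p). measure \<mu> (cyl n p))"

lemma inv_measureD:
  assumes "inv_measure \<mu>"
  shows "prob_space \<mu>" "sets \<mu> = sets PS" "space \<mu> = X"
    "g \<in> carrier G \<Longrightarrow> g \<in> measurable \<mu> \<mu>" "g \<in> carrier G \<Longrightarrow> distr \<mu> \<mu> g = \<mu>"
  using assms sets_eq_imp_space_eq[of \<mu> PS] by (auto simp: inv_measure_def invariant_prob_def space_PS)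

lemma inv_measure_vimage:
  assumes "inv_measure \<mu>" "g \<in> carrier G" "A \<in> sets \<mu>"
  shows "measure \<mu> (g -` A \<inter> X) = measure \<mu> A"
proof -
  have "measure (distr \<mu> \<mu> g) A = measure \<mu> (g -` A \<inter> space \<mu>)"
    using inv_measureD(4)[OF assms(1,2)] assms(3) by (rule measure_distr)
  then show ?thesis using inv_measureD[OF assms(1)] assms(2) by simp
qed

text \<open>Conditioning on an invariant set preserves invariance: the transposition of
  \<open>p\<close> and \<open>q\<close> carries one cylinder to the other and leaves
  \<open>A\<close> in place. With \<open>A = X\<close> this gives the weight of the measure
  itself.\<close>

lemma inv_weight_restrict:
  assumes \<mu>: "inv_measure \<mu>" and A: "A \<in> sets \<mu>" "measure \<mu> A > 0"
    and inv: "\<And>g. g \<in> carrier G \<Longrightarrow> g -` A \<inter> X = A"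
  shows "inv_weight B (\<lambda>(n, p). measure \<mu> (cyl n p \<inter> A) / measure \<mu> A)"
proof -
  interpret prob_space \<mu> by (rule inv_measureD[OF \<mu>])
  have cs: "cyl n p \<inter> A \<in> sets \<mu>" if "n \<ge> 1" for n p
    using cyl_sets[OF that] A inv_measureD(2)[OF \<mu>] by auto
  have sumA: "(\<Sum>q\<in>Q. measure \<mu> (cyl n q \<inter> A)) = measure \<mu> ((\<Union>q\<in>Q. cyl n q) \<inter> A)"
    if "n \<ge> 1" "finite Q" for n Q
  proof -
    have "measure \<mu> (\<Union>q\<in>Q. cyl n q \<inter> A) = (\<Sum>q\<in>Q. measure \<mu> (cyl n q \<inter> A))"
      using that cs by (intro finite_measure_finite_Union) (auto simp: disjoint_family_on_def cylinder_def)
    moreover have "(\<Union>q\<in>Q. cyl n q \<inter> A) = (\<Union>q\<in>Q. cyl n q) \<inter> A" by blast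
    ultimately show ?thesis by simp
  qed
  have eq: "measure \<mu> (cyl n p \<inter> A) = measure \<mu> (cyl n q \<inter> A)"
    if n: "n \<ge> 1" and pq: "p \<in> P n" "q \<in> P n" "t n p = t n q" for n p q
  proof -
    let ?g = "path_act B n (transpose p q)"
    have s: "transpose p q \<in> \<Gamma> n" using pq by (rule level_perms_transpose)
    then have g: "?g \<in> carrier G" using n by (intro path_act_carrier)
    have "?g -` (cyl n q \<inter> A) \<inter> X = (?g -` cyl n q \<inter> X) \<inter> (?g -` A \<inter> X)" by auto
    also have "\<dots> = cyl n p \<inter> A"
      using path_act_vimage_cyl[OF n s pq(2)] inv[OF g] by simp
    finally show ?thesis using inv_measure_vimage[OF \<mu> g cs[OF n]] by metis
  qed
  have sub: "cyl n p = (\<Union>q\<in>exts B n (Suc n) p. cyl (Suc n) q)" if "p \<in> P n" for n p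
    using that by (intro cyl_exts) auto
  have tot: "(\<Union>p\<in>P 1. cyl 1 p) \<inter> A = A"
    using sets.sets_into_space[OF A(1)] inv_measureD(3)[OF \<mu>]
    by (auto simp: cylinder_def simp del: atLeastAtMost_singleton dest: subsetD)
  show ?thesis
    unfolding inv_weight_def prod.case sum_divide_distrib[symmetric]
  proof (intro conjI allI impI ballI)
    fix n p assume n: "n \<ge> 1" "p \<in> P n"
    show "measure \<mu> (cyl n p \<inter> A) / measure \<mu> A = (\<Sum>q\<in>exts B n (Suc n) p. measure \<mu> (cyl (Suc n) q \<inter> A)) / measure \<mu> A"
      using sumA[of "Suc n" "exts B n (Suc n) p"] sub[OF n(2)] by simp
  next
    show "(\<Sum>p\<in>P 1. measure \<mu> (cyl 1 p \<inter> A)) / measure \<mu> A = 1"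
      using sumA[of 1 "P 1"] tot A(2) by simp
  qed (auto dest: eq)
qed

lemma inv_weight_weight:
  assumes \<mu>: "inv_measure \<mu>" shows "inv_weight B (weight \<mu>)"
proof -
  interpret prob_space \<mu> by (rule inv_measureD[OF \<mu>])
  have "inv_weight B (\<lambda>(n, p). measure \<mu> (cyl n p \<inter> X) / measure \<mu> X)"
    by (rule inv_weight_restrict[OF \<mu>])
       (use full_group_in inv_measureD(3)[OF \<mu>] prob_space sets.top[of \<mu>] in auto)
  moreover have "cyl n p \<inter> X = cyl n p" for n p by (auto simp: cylinder_def)
  ultimately show ?thesis using prob_space inv_measureD(3)[OF \<mu>] by (simp add: weight_def case_prod_unfold)
qed

lemma inv_measure_eqI:
  assumes "prob_space \<mu>" "sets \<mu> = sets PS" "prob_space \<nu>" "sets \<nu> = sets PS"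
    and eq: "\<And>n p. n \<ge> 1 \<Longrightarrow> p \<in> P n \<Longrightarrow> measure \<mu> (cyl n p) = measure \<nu> (cyl n p)"
  shows "\<mu> = \<nu>"
proof (rule measure_eqI)
  show "sets \<mu> = sets \<nu>" using assms by simp
  interpret \<mu>: prob_space \<mu> by fact
  interpret \<nu>: prob_space \<nu> by fact
  fix A assume A: "A \<in> sets \<mu>"
  have "measure \<mu> A = (\<Sum>j\<in>{()}. 1 * measure \<nu> A)"
    by (rule finite_mixture_eq[OF Int_stable_cyls cyls_subset])
       (use assms A sets_PS in \<open>auto simp: cyls_def\<close>)
  then show "emeasure \<mu> A = emeasure \<nu> A" by (simp add: \<mu>.emeasure_eq_measure \<nu>.emeasure_eq_measure)
qed

text \<open>Caratheodory extension of the finitely additive content that the weight defines on level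
  sets; compactness supplies continuity at the empty set. Invariance holds on cylinders, because a
  group element permutes the cylinders of a high level and respects end vertices.\<close>

lemma inv_weight_measure:
  assumes m: "inv_weight B m"
  obtains \<mu> where "inv_measure \<mu>" "\<And>n p. n \<ge> 1 \<Longrightarrow> p \<in> P n \<Longrightarrow> weight \<mu> (n, p) = m (n, p)"
proof -
  define R where "R = {S. \<exists>n\<ge>1. level_set B n S}"
  define \<rho> where "\<rho> n S = (\<lambda>x. restrict x {1..n}) ` S" for n :: nat and S :: "(nat \<Rightarrow> 'e) set"
  define F where "F n S = (\<Sum>p\<in>\<rho> n S. m (n, p))" for n S
  have \<rho>P: "\<rho> n S \<subseteq> P n" if "S \<subseteq> X" for n S using that by (auto simp: \<rho>_def)
  have fin\<rho>: "finite (\<rho> n S)" if "S \<subseteq> X" for n S using \<rho>P[OF that] finite_subset finite_fin_paths by blast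
  have lsX: "S \<subseteq> X" if "level_set B n S" for n S using that by (simp add: level_set_def)
  have F_lev: "F l S = F n S" if "1 \<le> n" "n \<le> l" "level_set B n S" for n l S
  proof -
    have "\<rho> l S = (\<Union>p\<in>\<rho> n S. exts B n l p)"
    proof
      show "\<rho> l S \<subseteq> (\<Union>p\<in>\<rho> n S. exts B n l p)"
        using lsX[OF that(3)] that(2) by (fastforce simp: \<rho>_def exts_iff restrict_restrict_le)
      show "(\<Union>p\<in>\<rho> n S. exts B n l p) \<subseteq> \<rho> l S"
      proof
        fix q assume "q \<in> (\<Union>p\<in>\<rho> n S. exts B n l p)"
        then obtain x where x: "x \<in> S" "q \<in> P l" "restrict q {1..n} = restrict x {1..n}" by (auto simp: \<rho>_def exts_iff)
        then obtain y where y: "y \<in> X" "q = restrict y {1..l}" by (auto simp: fin_paths_def)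
        then have "restrict y {1..n} = restrict x {1..n}" using x that(2) by (simp add: restrict_restrict_le)
        then have "y \<in> S" using that(3) x(1) y(1) unfolding level_set_def by blast
        then show "q \<in> \<rho> l S" using y by (auto simp: \<rho>_def)
      qed
    qed
    then have "F l S = (\<Sum>p\<in>\<rho> n S. \<Sum>q\<in>exts B n l p. m (l, q))"
      unfolding F_def using fin\<rho>[OF lsX[OF that(3)]] by (simp, intro sum.UNION_disjoint) (auto simp: exts_iff)
    also have "\<dots> = F n S" unfolding F_def
    proof (intro sum.cong refl)
      fix p assume "p \<in> \<rho> n S"
      then have "p \<in> P n" using \<rho>P[OF lsX[OF that(3)]] by blast
      then show "(\<Sum>q\<in>exts B n l p. m (l, q)) = m (n, p)" using inv_weight_exts[OF m that(1) _ that(2)] by simp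
    qed
    finally show ?thesis .
  qed
  \<comment> \<open>\<open>F n S\<close> is the same for all levels \<open>n\<close> at which
    \<open>S\<close> is a level set, so the least such level is just a choice of
    representative.\<close>
  define f where "f S = ennreal (F (LEAST n. n \<ge> 1 \<and> level_set B n S) S)" for S
  have f_eq: "f S = ennreal (F n S)" if "n \<ge> 1" "level_set B n S" for n S
  proof -
    let ?L = "LEAST n. n \<ge> 1 \<and> level_set B n S"
    have 1: "?L \<ge> 1 \<and> level_set B ?L S"
      by (rule LeastI[of "\<lambda>n. n \<ge> 1 \<and> level_set B n S" n, OF conjI[OF that]])
    have 2: "?L \<le> n" by (rule Least_le[of "\<lambda>n. n \<ge> 1 \<and> level_set B n S" n, OF conjI[OF that]])
    show ?thesis unfolding f_def F_lev[OF conjunct1[OF 1] 2 conjunct2[OF 1]] ..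
  qed
  have F_nonneg: "F n S \<ge> 0" if "n \<ge> 1" "S \<subseteq> X" for n S
    unfolding F_def using \<rho>P[OF that(2)] inv_weightD(1)[OF m that(1)] by (intro sum_nonneg) auto
  have common: "\<exists>n\<ge>1. level_set B n S \<and> level_set B n T" if ST: "S \<in> R" "T \<in> R" for S T
  proof -
    obtain a b where "a \<ge> 1" "level_set B a S" "b \<ge> 1" "level_set B b T" using ST by (auto simp: R_def)
    then show ?thesis using level_set_mono[of a "max a b" S] level_set_mono[of b "max a b" T]
      by (intro exI[of _ "max a b"]) auto
  qed
  have R: "ring_of_sets X R"
  proof (rule ring_of_setsI)
    show "R \<subseteq> Pow X" by (auto simp: R_def level_set_def)
    show "{} \<in> R" by (auto simp: R_def level_set_def)
    fix S T assume ST: "S \<in> R" "T \<in> R"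
    then obtain n where n: "n \<ge> 1" "level_set B n S" "level_set B n T" using common by blast
    show "S \<union> T \<in> R" using n by (auto simp: R_def level_set_def intro!: exI[of _ n])
    have "level_set B n (S - T)" unfolding level_set_def
    proof (intro conjI ballI impI)
      show "S - T \<subseteq> X" using n by (auto simp: level_set_def)
      fix x y assume xy: "x \<in> S - T" "y \<in> X" "restrict y {1..n} = restrict x {1..n}"
      then have "y \<in> S" using n(2) unfolding level_set_def by blast
      moreover have "y \<notin> T"
      proof
        assume "y \<in> T"
        moreover have "x \<in> X" using xy n(2) by (auto simp: level_set_def)
        ultimately have "x \<in> T" using n(3) xy(3) unfolding level_set_def by metis
        then show False using xy by simp
      qed
      ultimately show "y \<in> S - T" by simp
    qed
    then show "S - T \<in> R" using n by (auto simp: R_def)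
  qed
  interpret ring_of_sets X R by (rule R)
  have pos: "positive R f"
  proof -
    have "level_set B 1 {}" by (simp add: level_set_def)
    then show ?thesis using f_eq[of 1 "{}"] by (simp add: positive_def F_def \<rho>_def)
  qed
  have add: "additive R f"
    unfolding additive_def
  proof (intro ballI impI)
    fix S T assume ST: "S \<in> R" "T \<in> R" "S \<inter> T = {}"
    then obtain n where n: "n \<ge> 1" "level_set B n S" "level_set B n T" using common by blast
    have u: "level_set B n (S \<union> T)" using n by (auto simp: level_set_def)
    have "\<rho> n S \<inter> \<rho> n T = {}"
    proof (rule ccontr)
      assume "\<rho> n S \<inter> \<rho> n T \<noteq> {}"
      then obtain e where e: "e \<in> \<rho> n S" "e \<in> \<rho> n T" by blast
      then obtain x y where x: "x \<in> S" "e = restrict x {1..n}" and y: "y \<in> T" "e = restrict y {1..n}"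
        unfolding \<rho>_def by blast
      have "y \<in> X" using y n(3) by (auto simp: level_set_def)
      then have "y \<in> S" using n(2) x y unfolding level_set_def by metis
      then show False using ST y by blast
    qed
    then have "F n (S \<union> T) = F n S + F n T"
      unfolding F_def using fin\<rho>[OF lsX[OF n(2)]] fin\<rho>[OF lsX[OF n(3)]]
      by (simp add: \<rho>_def image_Un sum.union_disjoint)
    then show "f (S \<union> T) = f S + f T"
      using f_eq[OF n(1)] n u F_nonneg[OF n(1) lsX] by simp
  qed
  have fin: "f A \<noteq> \<infinity>" for A by (simp add: f_def)
  have cont: "(\<lambda>i. f (A i)) \<longlonglongrightarrow> 0" if A: "range A \<subseteq> R" "decseq A" "(\<Inter>i. A i) = {}" for A
  proof -
    \<comment> \<open>A decreasing sequence of nonempty closed sets in a compact space has a common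
      point. An empty intersection is thus reached after finitely many terms.\<close>
    have "\<exists>i. A i = {}"
    proof (rule ccontr)
      assume ne: "\<not> (\<exists>i. A i = {})"
      have "closedin (path_topology B) (A i)" for i
        using A(1) level_set_closed by (auto simp: R_def subset_iff)
      then have "(\<Inter>i. A i) \<noteq> {}"
        using ne A(2) by (intro compact_space_imp_nest[OF compact_path_topology]) auto
      then show False using A(3) by simp
    qed
    then obtain i where i: "A i = {}" by blast
    have "f (A j) = 0" if "j \<ge> i" for j
    proof -
      have "A j = {}" using A(2) that i by (auto simp: decseq_def)
      then show ?thesis using pos by (simp add: positive_def)
    qed
    then have "eventually (\<lambda>j. f (A j) = 0) sequentially" by (auto simp: eventually_sequentially)
    then show ?thesis by (rule tendsto_eventually)
  qed
  obtain \<nu> where \<nu>: "\<And>S. S \<in> R \<Longrightarrow> \<nu> S = f S" "measure_space X (sigma_sets X R) \<nu>"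
    using caratheodory_empty_continuous[OF pos add fin cont] by blast
  define \<mu> where "\<mu> = measure_of X R \<nu>"
  have RX: "R \<subseteq> Pow X" by (auto simp: R_def level_set_def)
  have sets_R: "sigma_sets X R = sets PS"
  proof
    show "sigma_sets X R \<subseteq> sets PS"
      using sets.sigma_sets_subset[of R PS] level_set_sets by (auto simp: R_def space_PS)
    have "cyls \<subseteq> R"
    proof
      fix A assume "A \<in> cyls"
      then show "A \<in> R" using level_set_cyl empty_sets by (auto simp: cyls_def R_def)
    qed
    then show "sets PS \<subseteq> sigma_sets X R" unfolding sets_PS by (rule sigma_sets_mono')
  qed
  have sets_\<mu>: "sets \<mu> = sets PS" unfolding \<mu>_def using RX sets_R by simp
  have space_\<mu>: "space \<mu> = X" unfolding \<mu>_def using RX by (rule space_measure_of)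
  have em: "emeasure \<mu> S = f S" if "S \<in> R" for S
  proof -
    have "emeasure \<mu> S = \<nu> S" unfolding \<mu>_def
      using \<nu>(2) RX that by (intro emeasure_measure_of_sigma[OF sigma_algebra_sigma_sets[OF RX]] | subst emeasure_measure_of[OF refl RX] | auto simp: measure_space_def)+
    then show ?thesis using \<nu>(1) that by simp
  qed
  have "prob_space \<mu>"
  proof
    have X1: "level_set B 1 X" by (simp add: level_set_def)
    then have "X \<in> R" by (auto simp: R_def)
    then have "emeasure \<mu> X = ennreal (F 1 X)" using em f_eq[of 1, OF _ X1] by simp
    also have "F 1 X = 1" using inv_weight_sum_level[OF m, of 1] by (simp add: F_def \<rho>_def fin_paths_def)
    finally show "emeasure \<mu> (space \<mu>) = 1" by (simp add: space_\<mu>)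
  qed
  then interpret prob_space \<mu> .
  have w: "measure \<mu> (cyl n p) = m (n, p)" if np: "n \<ge> 1" "p \<in> P n" for n p
  proof -
    have "cyl n p \<in> R" using level_set_cyl np by (auto simp: R_def)
    then have "emeasure \<mu> (cyl n p) = ennreal (F n (cyl n p))" using em f_eq[OF np(1) level_set_cyl] by simp
    moreover have "\<rho> n (cyl n p) = {p}" using np by (auto simp: \<rho>_def cylinder_def fin_paths_def)
    ultimately show ?thesis using inv_weightD(1)[OF m np] by (simp add: F_def measure_def)
  qed
  have "inv_measure \<mu>"
    unfolding inv_measure_def invariant_prob_def
  proof (intro conjI ballI)
    show "sets \<mu> = sets PS" by (rule sets_\<mu>)
    show "prob_space \<mu>" by fact
    fix g assume g: "g \<in> carrier G"
    show gm: "g \<in> measurable \<mu> \<mu>"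
      using full_group_measurable[OF g] measurable_cong_sets[OF sets_\<mu> sets_\<mu>] by blast
    show "distr \<mu> \<mu> g = \<mu>"
    proof (rule inv_measure_eqI)
      show "prob_space (distr \<mu> \<mu> g)" using gm by (rule prob_space_distr)
      show "prob_space \<mu>" by fact
      show "sets (distr \<mu> \<mu> g) = sets PS" "sets \<mu> = sets PS" using sets_\<mu> by auto
      obtain k \<sigma> where k: "k \<ge> 1" "\<sigma> \<in> \<Gamma> k" "g = path_act B k \<sigma>" using g by (rule full_group_cases)
      fix n p assume np: "n \<ge> 1" "p \<in> P n"
      define l where "l = max k n"
      have l: "k \<le> l" "n \<le> l" "l \<ge> 1" using np by (auto simp: l_def)
      let ?s = "lift_perm B k l \<sigma>"
      have s: "?s \<in> \<Gamma> l" "g = path_act B l ?s"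
        using lift_perm_in[OF k(1) l(1) k(2)] lift_perm_act[OF k(1) l(1) k(2)] k(3) by auto
      have bs: "bij ?s" "inv ?s \<in> \<Gamma> l" using level_permsD(3)[OF s(1)] level_perms_inv[OF s(1)] by auto
      have "measure (distr \<mu> \<mu> g) (cyl n p) = measure \<mu> (g -` cyl n p \<inter> X)"
        using gm np sets_\<mu> by (subst measure_distr) (auto simp: space_\<mu>)
      also have "g -` cyl n p \<inter> X = (\<Union>q\<in>exts B n l p. path_act B l ?s -` cyl l q \<inter> X)"
        unfolding cyl_exts[OF l(2) np(2)] s(2)[symmetric] by auto
      also have "\<dots> = (\<Union>q\<in>exts B n l p. cyl l (inv ?s q))"
        using path_act_vimage_cyl[OF l(3) s(1)] by (intro SUP_cong) (auto simp: exts_iff)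
      also have "measure \<mu> \<dots> = (\<Sum>q\<in>exts B n l p. measure \<mu> (cyl l (inv ?s q)))"
      proof (rule finite_measure_finite_Union)
        have "inj (inv ?s)" using bs(1) by (simp add: bij_imp_bij_inv bij_is_inj)
        then show "disjoint_family_on (\<lambda>q. cyl l (inv ?s q)) (exts B n l p)"
          unfolding disjoint_family_on_def by (intro ballI impI cyl_disjoint) (simp only: inj_eq not_False_eq_True)
        show "(\<lambda>q. cyl l (inv ?s q)) ` exts B n l p \<subseteq> sets \<mu>"
          unfolding sets_\<mu> using cyl_sets[OF l(3)] by blast
      qed simp
      also have "\<dots> = (\<Sum>q\<in>exts B n l p. m (l, q))"
      proof (rule sum.cong[OF refl])
        fix q assume "q \<in> exts B n l p"
        then have q: "q \<in> P l" by (simp add: exts_iff)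
        then have "inv ?s q \<in> P l" "t l (inv ?s q) = t l q" using level_permsD(2,4)[OF bs(2)] by blast+
        then show "measure \<mu> (cyl l (inv ?s q)) = m (l, q)"
          using w[OF l(3)] inv_weightD(3)[OF m l(3) _ q] by simp
      qed
      also have "\<dots> = m (n, p)" using inv_weight_exts[OF m np l(2)] by simp
      finally show "measure (distr \<mu> \<mu> g) (cyl n p) = measure \<mu> (cyl n p)" using w[OF np] by simp
    qed
  qed
  then show thesis using that w by (simp add: weight_def)
qed

end

subsection \<open>Extreme invariant weights\<close>

definition convex_coeffs :: "nat \<Rightarrow> (nat \<Rightarrow> real) set" where
  "convex_coeffs k = {c. (\<forall>i\<in>{1..k}. 0 \<le> c i) \<and> (\<Sum>i=1..k. c i) = 1}"

context bratteli_diagram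
begin

definition cyl_index :: "(nat \<times> (nat \<Rightarrow> 'e)) set" where
  "cyl_index = (SIGMA n:{1..}. P n)"

lemma countable_cyl_index: "countable cyl_index"
  unfolding cyl_index_def by (intro countable_SIGMA countableI_type) (auto intro: countable_finite)

lemma cyl_index_nonempty: "cyl_index \<noteq> {}"
  using fin_paths_nonempty[of 1] by (auto simp: cyl_index_def)

text \<open>Bounded values on countably many cylinders converge along a subsequence, and the
  conditions on an invariant weight are finite sums and equalities, hence survive limits. They are
  required only eventually, since the uniform distribution on a fibre of level \<open>N\<close>
  satisfies those of level \<open>n\<close> only when \<open>N\<close> exceeds
  \<open>n\<close>.\<close>

lemma weights_limit:
  assumes b: "\<And>j s. s \<in> cyl_index \<Longrightarrow> 0 \<le> mm j s \<and> mm j s \<le> 1"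
    and sum: "\<And>n. n \<ge> 1 \<Longrightarrow> eventually (\<lambda>j. \<forall>p\<in>P n. mm j (n, p) = (\<Sum>q\<in>exts B n (Suc n) p. mm j (Suc n, q))) sequentially"
    and eq: "\<And>n. n \<ge> 1 \<Longrightarrow> eventually (\<lambda>j. \<forall>p\<in>P n. \<forall>q\<in>P n. t n p = t n q \<longrightarrow> mm j (n, p) = mm j (n, q)) sequentially"
    and tot: "eventually (\<lambda>j. (\<Sum>p\<in>P 1. mm j (1, p)) = 1) sequentially"
  obtains r m where "strict_mono (r :: nat \<Rightarrow> nat)" "inv_weight B m"
    "\<And>s. s \<in> cyl_index \<Longrightarrow> (\<lambda>j. mm (r j) s) \<longlonglongrightarrow> m s"
proof -
  have "norm (mm j s) \<le> 1" if "s \<in> cyl_index" for j s using b[OF that, of j] by simp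
  then obtain r where r: "strict_mono (r :: nat \<Rightarrow> nat)" and "\<And>s. s \<in> cyl_index \<Longrightarrow> \<exists>l. (\<lambda>j. mm (r j) s) \<longlonglongrightarrow> l"
    using function_convergent_subsequence[OF countable_cyl_index] by blast
  then obtain m where m: "\<And>s. s \<in> cyl_index \<Longrightarrow> (\<lambda>j. mm (r j) s) \<longlonglongrightarrow> m s" by metis
  have sub: "eventually (\<lambda>j. Q (r j)) sequentially" if "eventually Q sequentially" for Q
    using eventually_subseq[OF r that] .
  have idx: "(n, p) \<in> cyl_index" if "n \<ge> 1" "p \<in> P n" for n p using that by (simp add: cyl_index_def)
  have "inv_weight B m"
    unfolding inv_weight_def
  proof (intro conjI allI ballI impI)
    fix n p assume n: "n \<ge> (1::nat)" and p: "p \<in> P n"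
    show "0 \<le> m (n, p)"
      using m[OF idx[OF n p]] by (rule LIMSEQ_le_const) (use b idx[OF n p] in auto)
    have "(\<lambda>j. \<Sum>q\<in>exts B n (Suc n) p. mm (r j) (Suc n, q)) \<longlonglongrightarrow> (\<Sum>q\<in>exts B n (Suc n) p. m (Suc n, q))"
      by (intro tendsto_sum m idx) (use n in \<open>auto simp: exts_iff\<close>)
    moreover have "eventually (\<lambda>j. (\<Sum>q\<in>exts B n (Suc n) p. mm (r j) (Suc n, q)) = mm (r j) (n, p)) sequentially"
      using sub[OF sum[OF n]] by (rule eventually_mono) (use p in simp)
    ultimately have "(\<lambda>j. mm (r j) (n, p)) \<longlonglongrightarrow> (\<Sum>q\<in>exts B n (Suc n) p. m (Suc n, q))"
      by (rule Lim_transform_eventually)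
    then show "m (n, p) = (\<Sum>q\<in>exts B n (Suc n) p. m (Suc n, q))"
      using m[OF idx[OF n p]] LIMSEQ_unique by blast
    fix q assume q: "q \<in> P n" "t n p = t n q"
    have "eventually (\<lambda>j. mm (r j) (n, p) = mm (r j) (n, q)) sequentially"
      using sub[OF eq[OF n]] by (rule eventually_mono) (use p q in blast)
    then have "(\<lambda>j. mm (r j) (n, q)) \<longlonglongrightarrow> m (n, p)"
      using m[OF idx[OF n p]] by (rule Lim_transform_eventually[rotated])
    then show "m (n, p) = m (n, q)" using m[OF idx[OF n q(1)]] LIMSEQ_unique by blast
  next
    have "(\<lambda>j. \<Sum>p\<in>P 1. mm (r j) (1, p)) \<longlonglongrightarrow> (\<Sum>p\<in>P 1. m (1, p))"
      by (intro tendsto_sum m idx) auto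
    moreover have "(\<lambda>j. \<Sum>p\<in>P 1. mm (r j) (1, p)) \<longlonglongrightarrow> 1"
      using sub[OF tot] by (rule tendsto_eventually)
    ultimately show "(\<Sum>p\<in>P 1. m (1, p)) = 1" by (rule LIMSEQ_unique)
  qed
  then show thesis by (rule that[OF r _ m])
qed

lemma inv_weight_bounds: "inv_weight B m \<Longrightarrow> s \<in> cyl_index \<Longrightarrow> 0 \<le> m s \<and> m s \<le> 1"
  using inv_weightD(1) inv_weight_le_1 by (auto simp: cyl_index_def)

lemma inv_weights_compact:
  assumes "\<And>j. inv_weight B (mm j)"
  obtains r m where "strict_mono (r :: nat \<Rightarrow> nat)" "inv_weight B m"
    "\<And>s. s \<in> cyl_index \<Longrightarrow> (\<lambda>j. mm (r j) s) \<longlonglongrightarrow> m s"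
proof (rule weights_limit[of mm])
  fix n :: nat assume n: "n \<ge> 1"
  show "eventually (\<lambda>j. \<forall>p\<in>P n. mm j (n, p) = (\<Sum>q\<in>exts B n (Suc n) p. mm j (Suc n, q))) sequentially"
    using inv_weightD(2)[OF assms n] by (intro always_eventually) blast
  show "eventually (\<lambda>j. \<forall>p\<in>P n. \<forall>q\<in>P n. t n p = t n q \<longrightarrow> mm j (n, p) = mm j (n, q)) sequentially"
    using inv_weightD(3)[OF assms n] by (intro always_eventually) blast
next
  show "eventually (\<lambda>j. (\<Sum>p\<in>P 1. mm j (1, p)) = 1) sequentially"
    using assms unfolding inv_weight_def by (intro always_eventually) blast
qed (use inv_weight_bounds[OF assms] that in blast)+

text \<open>A non-trivial invariant set splits the weight into its two conditional weights, so an extreme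
  weight must belong to an ergodic measure.\<close>

lemma extreme_ergodic:
  assumes \<mu>: "inv_measure \<mu>"
    and ext: "\<And>m1 m2 c. inv_weight B m1 \<Longrightarrow> inv_weight B m2 \<Longrightarrow> 0 < c \<Longrightarrow> c < 1 \<Longrightarrow>
      (\<And>s. s \<in> cyl_index \<Longrightarrow> weight \<mu> s = c * m1 s + (1 - c) * m2 s) \<Longrightarrow> (\<forall>s\<in>cyl_index. m1 s = weight \<mu> s)"
  shows "\<mu> \<in> ergodic_path_measures B"
proof -
  interpret prob_space \<mu> by (rule inv_measureD[OF \<mu>])
  note sp = inv_measureD(3)[OF \<mu>] and st = inv_measureD(2)[OF \<mu>]
  have "measure \<mu> A = 0 \<or> measure \<mu> A = 1"
    if A: "A \<in> sets \<mu>" and inv: "\<And>g. g \<in> carrier G \<Longrightarrow> g -` A \<inter> X = A" for A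
  proof (rule ccontr)
    assume neg: "\<not> ?thesis"
    then have A01: "0 < measure \<mu> A" "measure \<mu> A < 1"
      using prob_le_1[of A] by (auto simp: less_le)
    let ?C = "X - A"
    have C: "?C \<in> sets \<mu>" using A sp by (metis sets.compl_sets)
    have mC: "measure \<mu> ?C = 1 - measure \<mu> A" using prob_compl[OF A] sp by simp
    have invC: "g -` ?C \<inter> X = ?C" if "g \<in> carrier G" for g
      using inv[OF that] full_group_in[OF that] by auto
    have AX: "A \<subseteq> X" using sets.sets_into_space[OF A] sp by simp
    let ?m1 = "\<lambda>(n, p). measure \<mu> (cyl n p \<inter> A) / measure \<mu> A"
    let ?m2 = "\<lambda>(n, p). measure \<mu> (cyl n p \<inter> ?C) / measure \<mu> ?C"
    have "\<forall>s\<in>cyl_index. ?m1 s = weight \<mu> s"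
    proof (rule ext[of ?m1 ?m2 "measure \<mu> A"])
      show "inv_weight B ?m1" by (rule inv_weight_restrict[OF \<mu> A A01(1) inv])
      show "inv_weight B ?m2" by (rule inv_weight_restrict[OF \<mu> C _ invC]) (use mC A01 in auto)
      fix s assume "s \<in> cyl_index"
      then obtain n p where s: "s = (n, p)" "n \<ge> 1" by (auto simp: cyl_index_def)
      have cm: "cyl n p \<in> sets \<mu>" using cyl_sets[OF s(2)] st by simp
      have "cyl n p = (cyl n p \<inter> A) \<union> (cyl n p \<inter> ?C)" by (auto simp: cylinder_def)
      moreover have "measure \<mu> ((cyl n p \<inter> A) \<union> (cyl n p \<inter> ?C)) = measure \<mu> (cyl n p \<inter> A) + measure \<mu> (cyl n p \<inter> ?C)"
        by (rule finite_measure_Union) (use cm A C in auto)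
      ultimately have "measure \<mu> (cyl n p) = measure \<mu> (cyl n p \<inter> A) + measure \<mu> (cyl n p \<inter> ?C)" by (simp only:)
      then show "weight \<mu> s = measure \<mu> A * ?m1 s + (1 - measure \<mu> A) * ?m2 s"
        using A01 mC by (simp add: weight_def s)
    qed (use A01 in auto)
    then have m1: "measure \<mu> (cyl n p \<inter> A) = measure \<mu> A * measure \<mu> (cyl n p)" if "n \<ge> 1" "p \<in> P n" for n p
      using that A01 by (auto simp: cyl_index_def weight_def field_simps)
    have em: "emeasure \<mu> A \<noteq> 0" "emeasure \<mu> A \<noteq> \<infinity>" using A01 by (auto simp: emeasure_eq_measure)
    \<comment> \<open>The conditional measure given \<open>A\<close> has the weights of \<mu> and
      therefore equals \<mu>; evaluating it on \<open>A\<close> contradicts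
      \<open>measure \<mu> A < 1\<close>.\<close>
    have "uniform_measure \<mu> A = \<mu>"
    proof (rule inv_measure_eqI)
      show "prob_space (uniform_measure \<mu> A)" using em by (rule prob_space_uniform_measure)
      show "measure (uniform_measure \<mu> A) (cyl n p) = measure \<mu> (cyl n p)" if "n \<ge> 1" "p \<in> P n" for n p
        using m1[OF that] A01 em cyl_sets[OF that(1)] st by (simp add: Int_commute)
    qed (use st prob_space_axioms in auto)
    then have "measure \<mu> A = measure (uniform_measure \<mu> A) A" by simp
    also have "\<dots> = 1" using em A A01 by simp
    finally show False using A01 by simp
  qed
  then show ?thesis using \<mu> sp st
    by (auto simp: ergodic_path_measures_def ergodic_prob_def inv_measure_def)
qed

text \<open>Krein--Milman by lexicographic maximisation: first maximise the given functional, then one cylinder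
  weight after the other.\<close>

lemma exists_ergodic_maximiser:
  assumes F: "finite F" "F \<subseteq> cyl_index" and m0: "inv_weight B m0"
  shows "\<exists>\<mu>\<in>ergodic_path_measures B. (\<Sum>s\<in>F. a s * m0 s) \<le> (\<Sum>s\<in>F. a s * weight \<mu> s)"
proof -
  define idx where "idx = from_nat_into cyl_index"
  have idx: "idx j \<in> cyl_index" "range idx = cyl_index" for j
    unfolding idx_def using cyl_index_nonempty countable_cyl_index by (auto simp: from_nat_into range_from_nat_into)
  \<comment> \<open>Objective 0 is the given functional, objective \<open>Suc i\<close> the weight
    of cylinder number \<open>i\<close>. Weights lying in all faces therefore agree on every
    cylinder.\<close>
  define obj where "obj j m = (case j of 0 \<Rightarrow> (\<Sum>s\<in>F. a s * m s) | Suc i \<Rightarrow> m (idx i))" for j :: nat and m :: "nat \<times> (nat \<Rightarrow> 'e) \<Rightarrow> real"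
  define face where "face = rec_nat {m. inv_weight B m} (\<lambda>j A. {m \<in> A. \<forall>m'\<in>A. obj j m' \<le> obj j m})"
  have f0: "face 0 = {m. inv_weight B m}" and fS: "face (Suc j) = {m \<in> face j. \<forall>m'\<in>face j. obj j m' \<le> obj j m}" for j
    by (simp_all add: face_def)
  have dec: "face j \<subseteq> face i" if "i \<le> j" for i j
    using that by (induction j rule: dec_induct) (auto simp: fS)
  have K: "inv_weight B m" if "m \<in> face j" for m j using dec[of 0 j] that by (auto simp: f0)
  have obj_lim: "(\<lambda>n. obj j (mm n)) \<longlonglongrightarrow> obj j m" if "\<And>s. s \<in> cyl_index \<Longrightarrow> (\<lambda>n. mm n s) \<longlonglongrightarrow> m s" for j mm m
    using that F idx(1) by (cases j) (auto simp: obj_def intro!: tendsto_sum tendsto_mult)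
  have closed: "m \<in> face j"
    if "inv_weight B m" "\<And>s. s \<in> cyl_index \<Longrightarrow> (\<lambda>n. mm n s) \<longlonglongrightarrow> m s" "\<And>n. mm n \<in> face j" for j m mm
    using that
  proof (induction j)
    case 0
    then show ?case by (simp add: f0)
  next
    case (Suc j)
    then have "m \<in> face j" by (simp add: fS)
    moreover have "obj j m' \<le> obj j m" if "m' \<in> face j" for m'
    proof (rule LIMSEQ_le_const[OF obj_lim[OF Suc.prems(2)]])
      show "\<exists>N. \<forall>n\<ge>N. obj j m' \<le> obj j (mm n)" using Suc.prems(3) that by (auto simp: fS)
    qed
    ultimately show ?case by (simp add: fS)
  qed
  have ne: "face j \<noteq> {}" for j
  proof (induction j)
    case 0
    then show ?case using m0 by (auto simp: f0)
  next
    case (Suc j)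
    define V where "V = obj j ` face j"
    have bd: "\<bar>obj j m\<bar> \<le> (\<Sum>s\<in>F. \<bar>a s\<bar>) + 1" if "m \<in> face j" for m
    proof (cases j)
      case 0
      have "\<bar>\<Sum>s\<in>F. a s * m s\<bar> \<le> (\<Sum>s\<in>F. \<bar>a s * m s\<bar>)" by (rule sum_abs)
      also have "\<dots> \<le> (\<Sum>s\<in>F. \<bar>a s\<bar>)"
      proof (rule sum_mono)
        fix s assume "s \<in> F"
        then have "0 \<le> m s" "m s \<le> 1" using F(2) inv_weight_bounds[OF K[OF that], of s] by blast+
        then show "\<bar>a s * m s\<bar> \<le> \<bar>a s\<bar>" using mult_left_le[of "m s" "\<bar>a s\<bar>"] by (simp add: abs_mult)
      qed
      finally show ?thesis using 0 by (simp add: obj_def)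
    next
      case (Suc i)
      have 1: "0 \<le> m (idx i)" "m (idx i) \<le> 1" using idx(1) inv_weight_bounds[OF K[OF that]] by auto
      have 2: "0 \<le> (\<Sum>s\<in>F. \<bar>a s\<bar>)" by (intro sum_nonneg) simp
      have 3: "obj j m = m (idx i)" using Suc by (simp add: obj_def)
      show ?thesis unfolding 3 using 1 2 by linarith
    qed
    have V: "V \<noteq> {}" "bdd_above V"
      using Suc bd by (auto simp: V_def bdd_above_def intro!: exI[of _ "(\<Sum>s\<in>F. \<bar>a s\<bar>) + 1"] dest!: abs_le_D1)
    \<comment> \<open>The maximum is attained: a maximising sequence has a limit weight by
      compactness, and faces are closed under convergence on cylinders.\<close>
    have "\<exists>m\<in>face j. Sup V - 1 / real (Suc n) < obj j m" for n
      using less_cSup_iff[OF V, of "Sup V - 1 / real (Suc n)"] by (auto simp: V_def)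
    then have "\<forall>n. \<exists>m. m \<in> face j \<and> Sup V - 1 / real (Suc n) < obj j m" by blast
    then obtain mm where mm: "\<And>n. mm n \<in> face j" "\<And>n. Sup V - 1 / real (Suc n) < obj j (mm n)"
      using choice[of "\<lambda>n m. m \<in> face j \<and> Sup V - 1 / real (Suc n) < obj j m"] by auto
    obtain r m where r: "strict_mono (r :: nat \<Rightarrow> nat)" and m: "inv_weight B m"
      and lim: "\<And>s. s \<in> cyl_index \<Longrightarrow> (\<lambda>j. mm (r j) s) \<longlonglongrightarrow> m s"
      using inv_weights_compact[of mm] K[OF mm(1)] by blast
    have mf: "m \<in> face j" by (rule closed[OF m lim]) (use mm in auto)
    have "(\<lambda>n. Sup V - 1 / real (Suc n)) \<longlonglongrightarrow> Sup V - 0"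
      by (intro tendsto_intros) (rule LIMSEQ_Suc[OF lim_1_over_n])
    then have "(\<lambda>n. Sup V - 1 / real (Suc (r n))) \<longlonglongrightarrow> Sup V"
      using LIMSEQ_subseq_LIMSEQ[OF _ r] by (fastforce simp: o_def)
    then have "Sup V \<le> obj j m"
      using obj_lim[OF lim] by (rule LIMSEQ_le) (use mm(2) in \<open>auto intro: less_imp_le\<close>)
    then have "m \<in> face (Suc j)"
      using mf cSup_upper[OF _ V(2)] by (force simp: fS V_def)
    then show ?case by blast
  qed
  then have "\<forall>j. \<exists>m. m \<in> face j" by blast
  then obtain mm where mm: "\<And>j. mm j \<in> face j" using choice[of "\<lambda>j m. m \<in> face j"] by auto
  obtain r m where r: "strict_mono (r :: nat \<Rightarrow> nat)" and m: "inv_weight B m"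
    and lim: "\<And>s. s \<in> cyl_index \<Longrightarrow> (\<lambda>j. mm (r j) s) \<longlonglongrightarrow> m s"
    using inv_weights_compact[of mm] K[OF mm] by blast
  \<comment> \<open>The faces decrease, so a tail of the convergent subsequence lies in each of
    them, and with it the limit.\<close>
  have mf: "m \<in> face i" for i
  proof (rule closed[OF m, of "\<lambda>j. mm (r (j + i))"])
    show "(\<lambda>n. mm (r (n + i)) s) \<longlonglongrightarrow> m s" if "s \<in> cyl_index" for s
      using LIMSEQ_ignore_initial_segment[OF lim[OF that], of i] .
    fix n
    have "i \<le> r (n + i)" using seq_suble[OF r, of "n + i"] by simp
    then show "mm (r (n + i)) \<in> face i" using dec mm by blast
  qed
  obtain \<mu> where \<mu>: "inv_measure \<mu>" "\<And>n p. n \<ge> 1 \<Longrightarrow> p \<in> P n \<Longrightarrow> weight \<mu> (n, p) = m (n, p)"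
    using inv_weight_measure[OF m] by blast
  have w: "weight \<mu> s = m s" if "s \<in> cyl_index" for s using \<mu>(2) that by (auto simp: cyl_index_def)
  have "\<mu> \<in> ergodic_path_measures B"
  proof (rule extreme_ergodic[OF \<mu>(1)])
    fix m1 m2 c assume m12: "inv_weight B m1" "inv_weight B m2" and c: "0 < c" "c < (1::real)"
      and conv: "\<And>s. s \<in> cyl_index \<Longrightarrow> weight \<mu> s = c * m1 s + (1 - c) * m2 s"
    have obj_conv: "obj j m = c * obj j m1 + (1 - c) * obj j m2" for j
    proof (cases j)
      case 0
      have "(\<Sum>s\<in>F. a s * m s) = (\<Sum>s\<in>F. c * (a s * m1 s) + (1 - c) * (a s * m2 s))"
      proof (intro sum.cong refl)
        fix s assume "s \<in> F"
        then have "s \<in> cyl_index" using F(2) by blast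
        then have e: "m s = c * m1 s + (1 - c) * m2 s" using conv w by metis
        show "a s * m s = c * (a s * m1 s) + (1 - c) * (a s * m2 s)" unfolding e by (simp add: algebra_simps)
      qed
      then show ?thesis using 0 by (simp add: obj_def sum.distrib sum_distrib_left)
    next
      case (Suc i)
      then show ?thesis using conv[OF idx(1)] w[OF idx(1)] by (simp add: obj_def)
    qed
    have "m1 \<in> face j \<and> m2 \<in> face j" for j
    proof (induction j)
      case 0
      then show ?case using m12 by (simp add: f0)
    next
      case (Suc j)
      have max: "obj j m' \<le> obj j m" if "m' \<in> face j" for m' using mf[of "Suc j"] that by (simp add: fS)
      have le: "obj j m1 \<le> obj j m" "obj j m2 \<le> obj j m" using max Suc by auto
      \<comment> \<open>A proper convex combination attains a maximum only if both components
        do.\<close>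
      have "obj j m1 = obj j m"
      proof (rule ccontr)
        assume "obj j m1 \<noteq> obj j m"
        then have "c * obj j m1 < c * obj j m" using le c by simp
        moreover have "(1 - c) * obj j m2 \<le> (1 - c) * obj j m" using le c by (intro mult_left_mono) auto
        ultimately show False using obj_conv[of j] by (simp add: algebra_simps)
      qed
      moreover have "obj j m2 = obj j m"
      proof (rule ccontr)
        assume "obj j m2 \<noteq> obj j m"
        then have "(1 - c) * obj j m2 < (1 - c) * obj j m" using le c by simp
        moreover have "c * obj j m1 \<le> c * obj j m" using le c by (intro mult_left_mono) auto
        ultimately show False using obj_conv[of j] by (simp add: algebra_simps)
      qed
      ultimately show ?case using Suc max by (simp add: fS)
    qed
    then have m1f: "m1 \<in> face (Suc (Suc i))" for i by blast
    have "obj (Suc i) m \<le> obj (Suc i) m1" for i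
      using m1f[of i] mf[of "Suc i"] unfolding fS[of "Suc i"] by blast
    moreover have "obj (Suc i) m1 \<le> obj (Suc i) m" for i
      using m1f[of i] mf[of "Suc (Suc i)"] unfolding fS[of "Suc i"] by blast
    ultimately have "obj (Suc i) m1 = obj (Suc i) m" for i by (simp add: antisym)
    then have "m1 (idx i) = m (idx i)" for i by (auto simp: obj_def dest: meta_spec[of _ i])
    then show "\<forall>s\<in>cyl_index. m1 s = weight \<mu> s" using w idx(2) by (metis imageE)
  qed
  moreover have "(\<Sum>s\<in>F. a s * m0 s) \<le> (\<Sum>s\<in>F. a s * m s)"
    using mf[of "Suc 0"] m0 by (simp add: fS f0 obj_def)
  moreover have "(\<Sum>s\<in>F. a s * m s) = (\<Sum>s\<in>F. a s * weight \<mu> s)"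
    using F(2) w by (intro sum.cong refl) auto
  ultimately show ?thesis by auto
qed

end

subsection \<open>Approximation by finitely many ergodic measures\<close>

locale fin_ergodic_diagram = even_diagram +
  fixes k :: nat and \<mu> :: "nat \<Rightarrow> (nat \<Rightarrow> 'b) measure"
  assumes k: "k \<ge> 1" and bij: "bij_betw \<mu> {1..k} (ergodic_path_measures B)"
begin

definition mix :: "(nat \<Rightarrow> real) \<Rightarrow> nat \<times> (nat \<Rightarrow> 'b) \<Rightarrow> real" where
  "mix c s = (\<Sum>i=1..k. c i * weight (\<mu> i) s)"

text \<open>The weight of the cylinder of \<open>p\<close> under the uniform distribution on the
  paths from the root to \<open>w\<close>.\<close>

definition dens :: "nat \<Rightarrow> 'a \<Rightarrow> nat \<times> (nat \<Rightarrow> 'b) \<Rightarrow> real" where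
  "dens N w = (\<lambda>(n, p). real (card (ext_to n N p w)) / real (card (fibre N w)))"

lemma mu_ergodic: "i \<in> {1..k} \<Longrightarrow> \<mu> i \<in> ergodic_path_measures B"
  using bij by (auto simp: bij_betw_def)

lemma mu_surj: "\<nu> \<in> ergodic_path_measures B \<Longrightarrow> \<exists>i\<in>{1..k}. \<nu> = \<mu> i"
  using bij by (auto simp: bij_betw_def)

lemma mu_inv: "i \<in> {1..k} \<Longrightarrow> inv_measure (\<mu> i)"
  using mu_ergodic[of i] by (auto simp: ergodic_path_measures_def inv_measure_def ergodic_prob_def)

lemma mu_prob: "i \<in> {1..k} \<Longrightarrow> prob_space (\<mu> i)"
  and mu_sets: "i \<in> {1..k} \<Longrightarrow> sets (\<mu> i) = sets PS"
  and mu_space: "i \<in> {1..k} \<Longrightarrow> space (\<mu> i) = X"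
  using inv_measureD[OF mu_inv[of i]] by auto

lemma mu_bounds: "i \<in> {1..k} \<Longrightarrow> s \<in> cyl_index \<Longrightarrow> 0 \<le> weight (\<mu> i) s \<and> weight (\<mu> i) s \<le> 1"
  by (intro inv_weight_bounds inv_weight_weight mu_inv)

lemma convex_coeffs_le_1: "c \<in> convex_coeffs k \<Longrightarrow> i \<in> {1..k} \<Longrightarrow> c i \<le> 1"
  using member_le_sum[of i "{1..k}" c] by (auto simp: convex_coeffs_def)

lemma mix_bounds:
  assumes "c \<in> convex_coeffs k" "s \<in> cyl_index" shows "0 \<le> mix c s \<and> mix c s \<le> 1"
proof
  have c: "\<And>i. i \<in> {1..k} \<Longrightarrow> 0 \<le> c i" "(\<Sum>i=1..k. c i) = 1" using assms by (auto simp: convex_coeffs_def)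
  show "0 \<le> mix c s" unfolding mix_def using c mu_bounds[OF _ assms(2)] by (intro sum_nonneg mult_nonneg_nonneg) auto
  have "mix c s \<le> (\<Sum>i=1..k. c i)"
    unfolding mix_def using c mu_bounds[OF _ assms(2)] by (intro sum_mono mult_left_le) auto
  then show "mix c s \<le> 1" using c by simp
qed

text \<open>A separation argument with a nearly closest mixture \<open>b\<close>. Some ergodic
  measure scores at least as much as \<open>m\<close> under the functional \<open>v\<close>, the
  difference of \<open>m\<close> and \<open>mix b\<close>; by assumption it is one of the
  \<open>\<mu> i\<close>. Moving \<open>b\<close> a step \<sigma> towards it lowers the squared
  distance \<open>D\<close> by at least 2 \<sigma> \<delta> up to terms in \<sigma>^2, which brings
  it below its infimum \<delta>.\<close>

lemma weight_near_mixture: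
  assumes m: "inv_weight B m" and F: "finite F" "F \<subseteq> cyl_index" and \<epsilon>: "\<epsilon> > 0"
  shows "\<exists>c\<in>convex_coeffs k. \<forall>s\<in>F. \<bar>m s - mix c s\<bar> < \<epsilon>"
proof (rule ccontr)
  assume neg: "\<not> ?thesis"
  define D where "D c = (\<Sum>s\<in>F. (m s - mix c s)\<^sup>2)" for c
  have D_ge: "\<epsilon>\<^sup>2 \<le> D c" if c: "c \<in> convex_coeffs k" for c
  proof -
    obtain s where s: "s \<in> F" "\<epsilon> \<le> \<bar>m s - mix c s\<bar>" using neg c by (meson not_le_imp_less)
    have "\<epsilon>\<^sup>2 \<le> \<bar>m s - mix c s\<bar>\<^sup>2" using s \<epsilon> by (intro power_mono) auto
    also have "\<dots> = (m s - mix c s)\<^sup>2" by simp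
    also have "\<dots> \<le> D c" unfolding D_def using s(1) F(1) by (intro member_le_sum) auto
    finally show ?thesis .
  qed
  have ne: "D ` convex_coeffs k \<noteq> {}"
  proof -
    have "(\<lambda>j. if j = 1 then 1 else 0) \<in> convex_coeffs k" using k by (simp add: convex_coeffs_def)
    then show ?thesis by blast
  qed
  define \<delta> where "\<delta> = Inf (D ` convex_coeffs k)"
  have bdd: "bdd_below (D ` convex_coeffs k)" using D_ge by (auto simp: bdd_below_def)
  have \<delta>_le: "\<delta> \<le> D c" if "c \<in> convex_coeffs k" for c
    unfolding \<delta>_def using bdd that by (intro cInf_lower) auto
  have "\<epsilon>\<^sup>2 \<le> \<delta>" unfolding \<delta>_def using ne D_ge by (intro cInf_greatest) auto
  moreover have "\<epsilon>\<^sup>2 > 0" using \<epsilon> by simp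
  ultimately have \<delta>: "\<delta> > 0" by linarith
  define C where "C = real (card F)"
  \<comment> \<open>The linear gain has to beat two errors of second order: the slack
    \<open>\<sigma>\<^sup>2\<close> in the choice of \<open>b\<close> and the quadratic term, at
    most \<open>\<sigma>\<^sup>2 * C\<close>.\<close>
  define \<sigma> where "\<sigma> = min 1 (\<delta> / (1 + C))"
  have C: "C \<ge> 0" by (simp add: C_def)
  have \<sigma>: "0 < \<sigma>" "\<sigma> \<le> 1" "\<sigma> * (1 + C) \<le> \<delta>"
  proof -
    show "0 < \<sigma>" "\<sigma> \<le> 1" using \<delta> C by (auto simp: \<sigma>_def)
    have "\<sigma> \<le> \<delta> / (1 + C)" by (simp add: \<sigma>_def)
    then show "\<sigma> * (1 + C) \<le> \<delta>" using C by (simp add: pos_le_divide_eq)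
  qed
  have "\<exists>d\<in>D ` convex_coeffs k. d < \<delta> + \<sigma>\<^sup>2"
    using cInf_less_iff[OF ne bdd, of "\<delta> + \<sigma>\<^sup>2"] \<sigma>(1) by (simp add: \<delta>_def)
  then obtain b where b: "b \<in> convex_coeffs k" "D b < \<delta> + \<sigma>\<^sup>2" by blast
  define v where "v s = m s - mix b s" for s
  obtain \<nu> where \<nu>: "\<nu> \<in> ergodic_path_measures B" "(\<Sum>s\<in>F. v s * m s) \<le> (\<Sum>s\<in>F. v s * weight \<nu> s)"
    using exists_ergodic_maximiser[OF F m, of v] by blast
  obtain i where i: "i \<in> {1..k}" "\<nu> = \<mu> i" using mu_surj[OF \<nu>(1)] by blast
  define w where "w s = weight (\<mu> i) s - mix b s" for s
  define b' where "b' j = (1 - \<sigma>) * b j + \<sigma> * (if j = i then 1 else 0)" for j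
  have b': "b' \<in> convex_coeffs k"
  proof -
    have "(\<Sum>j=1..k. b' j) = (1 - \<sigma>) * (\<Sum>j=1..k. b j) + \<sigma> * (\<Sum>j=1..k. if j = i then 1 else 0)"
      by (simp only: b'_def sum.distrib sum_distrib_left)
    also have "\<dots> = 1" using b(1) i(1) by (simp add: convex_coeffs_def)
    finally show ?thesis using b(1) \<sigma> by (simp add: convex_coeffs_def b'_def)
  qed
  have mix_b': "mix b' s = (1 - \<sigma>) * mix b s + \<sigma> * weight (\<mu> i) s" for s
  proof -
    have "mix b' s = (\<Sum>j=1..k. (1 - \<sigma>) * (b j * weight (\<mu> j) s) + \<sigma> * (if j = i then weight (\<mu> j) s else 0))"
      unfolding mix_def b'_def by (intro sum.cong refl) (simp add: algebra_simps)
    also have "\<dots> = (1 - \<sigma>) * mix b s + \<sigma> * (\<Sum>j=1..k. if j = i then weight (\<mu> j) s else 0)"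
      by (simp only: mix_def sum.distrib sum_distrib_left)
    also have "(\<Sum>j=1..k. if j = i then weight (\<mu> j) s else 0) = weight (\<mu> i) s" using i(1) by simp
    finally show ?thesis .
  qed
  have "D b' = (\<Sum>s\<in>F. (v s)\<^sup>2 - 2 * \<sigma> * (v s * w s) + \<sigma>\<^sup>2 * (w s)\<^sup>2)"
    unfolding D_def mix_b' v_def w_def by (intro sum.cong refl) (simp add: power2_eq_square algebra_simps)
  also have "\<dots> = D b - 2 * \<sigma> * (\<Sum>s\<in>F. v s * w s) + \<sigma>\<^sup>2 * (\<Sum>s\<in>F. (w s)\<^sup>2)"
    by (simp only: D_def v_def sum.distrib sum_subtractf sum_distrib_left)
  finally have Db': "D b' = D b - 2 * \<sigma> * (\<Sum>s\<in>F. v s * w s) + \<sigma>\<^sup>2 * (\<Sum>s\<in>F. (w s)\<^sup>2)" .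
  have "(\<Sum>s\<in>F. (w s)\<^sup>2) \<le> (\<Sum>s\<in>F. 1)"
  proof (rule sum_mono)
    fix s assume "s \<in> F"
    then have "s \<in> cyl_index" using F by blast
    then have "\<bar>w s\<bar> \<le> 1" using mu_bounds[OF i(1), of s] mix_bounds[OF b(1), of s] by (auto simp: w_def)
    then show "(w s)\<^sup>2 \<le> 1" by (simp add: abs_square_le_1)
  qed
  then have w2: "\<sigma>\<^sup>2 * (\<Sum>s\<in>F. (w s)\<^sup>2) \<le> \<sigma>\<^sup>2 * C" by (intro mult_left_mono) (auto simp: C_def)
  have "(\<Sum>s\<in>F. v s * w s) = (\<Sum>s\<in>F. v s * weight (\<mu> i) s) - (\<Sum>s\<in>F. v s * mix b s)"
    by (simp add: w_def right_diff_distrib sum_subtractf)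
  also have "\<dots> \<ge> (\<Sum>s\<in>F. v s * m s) - (\<Sum>s\<in>F. v s * mix b s)" using \<nu>(2) i(2) by simp
  also have "(\<Sum>s\<in>F. v s * m s) - (\<Sum>s\<in>F. v s * mix b s) = D b"
    unfolding sum_subtractf[symmetric] D_def v_def by (intro sum.cong refl) (simp add: power2_eq_square algebra_simps)
  finally have "\<delta> \<le> (\<Sum>s\<in>F. v s * w s)" using \<delta>_le[OF b(1)] by linarith
  then have "2 * \<sigma> * \<delta> \<le> 2 * \<sigma> * (\<Sum>s\<in>F. v s * w s)" using \<sigma>(1) by (intro mult_left_mono) auto
  then have "2 * \<sigma> * \<delta> \<le> \<sigma>\<^sup>2 + \<sigma>\<^sup>2 * C" using Db' \<delta>_le[OF b'] b(2) w2 by linarith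
  then have "\<sigma> * (2 * \<delta>) \<le> \<sigma> * (\<sigma> * (1 + C))" by (simp add: power2_eq_square algebra_simps)
  then have "2 * \<delta> \<le> \<sigma> * (1 + C)" using \<sigma>(1) by (simp only: mult_le_cancel_left_pos)
  then show False using \<sigma>(3) \<delta> by linarith
qed

lemma fibre_pos: "N \<ge> 1 \<Longrightarrow> w \<in> vert B N \<Longrightarrow> real (card (fibre N w)) > 0"
  using fibre_vertex[of N w] by (simp add: card_gt_0_iff)

lemma dens_bounds: "0 \<le> dens N w s \<and> dens N w s \<le> 1"
proof -
  obtain n p where s: "s = (n, p)" by fastforce
  have "card (ext_to n N p w) \<le> card (fibre N w)" by (intro card_mono ext_to_subset_fibre) simp
  then show ?thesis by (auto simp: s dens_def divide_le_eq_1)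
qed

lemma dens_sum:
  assumes "n \<ge> 1" "Suc n \<le> N" "p \<in> P n"
  shows "dens N w (n, p) = (\<Sum>q\<in>exts B n (Suc n) p. dens N w (Suc n, q))"
proof -
  have "card (ext_to n N p w) = card (\<Union>q\<in>exts B n (Suc n) p. ext_to (Suc n) N q w)"
    using ext_to_decompose(1)[OF assms(1) _ assms(2,3), of w] by simp
  also have "\<dots> = (\<Sum>q\<in>exts B n (Suc n) p. card (ext_to (Suc n) N q w))"
    by (rule card_UN_disjoint) (auto simp: ext_to_iff)
  finally show ?thesis by (simp add: dens_def sum_divide_distrib)
qed

lemma dens_total:
  assumes "1 \<le> N" "w \<in> vert B N"
  shows "(\<Sum>p\<in>P 1. dens N w (1, p)) = 1"
proof -
  have "fibre N w = (\<Union>p\<in>P 1. ext_to 1 N p w)"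
  proof
    show "fibre N w \<subseteq> (\<Union>p\<in>P 1. ext_to 1 N p w)"
    proof
      fix q assume q: "q \<in> fibre N w"
      then have "restrict q {1..1} \<in> P 1" using assms(1) by (intro restrict_fin_path[of q N]) (auto simp: fibre_def)
      then show "q \<in> (\<Union>p\<in>P 1. ext_to 1 N p w)" using q by (auto simp: ext_to_iff fibre_def)
    qed
    show "(\<Union>p\<in>P 1. ext_to 1 N p w) \<subseteq> fibre N w" using ext_to_subset_fibre by blast
  qed
  then have "card (fibre N w) = (\<Sum>p\<in>P 1. card (ext_to 1 N p w))"
    by (simp only:) (rule card_UN_disjoint, auto simp: ext_to_iff)
  moreover have "(\<Sum>p\<in>P 1. dens N w (1, p)) = real (\<Sum>p\<in>P 1. card (ext_to 1 N p w)) / real (card (fibre N w))"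
    by (simp add: dens_def sum_divide_distrib)
  ultimately show ?thesis using fibre_pos[OF assms] by simp
qed

text \<open>If this failed at vertices of arbitrarily high level, the uniform distributions on their
  fibres would converge along a subsequence to an invariant weight, which
  \<open>weight_near_mixture\<close> places close to a mixture. The level obtained works for all
  vertices at once.\<close>

lemma dens_near_mixture:
  assumes F: "finite F" "F \<subseteq> cyl_index" and \<epsilon>: "\<epsilon> > 0"
  shows "\<exists>N0. \<forall>N\<ge>N0. \<forall>w\<in>vert B N. \<exists>c\<in>convex_coeffs k. \<forall>s\<in>F. \<bar>dens N w s - mix c s\<bar> < \<epsilon>"
proof (rule ccontr)
  assume "\<not> ?thesis"
  then have "\<forall>j. \<exists>N w. N \<ge> j \<and> w \<in> vert B N \<and> \<not> (\<exists>c\<in>convex_coeffs k. \<forall>s\<in>F. \<bar>dens N w s - mix c s\<bar> < \<epsilon>)"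
    by blast
  then obtain NN ww where Nw: "\<And>j. NN j \<ge> j" "\<And>j. ww j \<in> vert B (NN j)"
    and bad: "\<And>j. \<not> (\<exists>c\<in>convex_coeffs k. \<forall>s\<in>F. \<bar>dens (NN j) (ww j) s - mix c s\<bar> < \<epsilon>)"
    by metis
  obtain r m where r: "strict_mono (r :: nat \<Rightarrow> nat)" and m: "inv_weight B m"
    and lim: "\<And>s. s \<in> cyl_index \<Longrightarrow> (\<lambda>j. dens (NN (r j)) (ww (r j)) s) \<longlonglongrightarrow> m s"
  proof (rule weights_limit[of "\<lambda>j. dens (NN j) (ww j)"])
    fix n :: nat assume n: "n \<ge> 1"
    have ce: "dens N w (n, p) = dens N w (n, q)" if "Suc n \<le> N" "p \<in> P n" "q \<in> P n" "t n p = t n q" for N w p q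
      using card_ext_to_cong[OF n Suc_leD[OF that(1)] that(2-4), of w] by (simp add: dens_def)
    have ev: "eventually (\<lambda>j. Suc n \<le> NN j) sequentially"
      unfolding eventually_sequentially using Nw(1) le_trans by blast
    show "eventually (\<lambda>j. \<forall>p\<in>P n. dens (NN j) (ww j) (n, p) = (\<Sum>q\<in>exts B n (Suc n) p. dens (NN j) (ww j) (Suc n, q))) sequentially"
      using ev by (rule eventually_mono) (use dens_sum[OF n] in blast)
    show "eventually (\<lambda>j. \<forall>p\<in>P n. \<forall>q\<in>P n. t n p = t n q \<longrightarrow> dens (NN j) (ww j) (n, p) = dens (NN j) (ww j) (n, q)) sequentially"
      using ev by (rule eventually_mono) (use ce in blast)
  next
    have "eventually (\<lambda>j. 1 \<le> NN j) sequentially"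
      unfolding eventually_sequentially using Nw(1) le_trans by blast
    then show "eventually (\<lambda>j. (\<Sum>p\<in>P 1. dens (NN j) (ww j) (1, p)) = 1) sequentially"
      by (rule eventually_mono) (use dens_total Nw(2) in blast)
  qed (use dens_bounds in blast)+
  obtain c where c: "c \<in> convex_coeffs k" "\<And>s. s \<in> F \<Longrightarrow> \<bar>m s - mix c s\<bar> < \<epsilon> / 2"
    using weight_near_mixture[OF m F, of "\<epsilon> / 2"] \<epsilon> by auto
  have "eventually (\<lambda>j. \<forall>s\<in>F. \<bar>dens (NN (r j)) (ww (r j)) s - m s\<bar> < \<epsilon> / 2) sequentially"
  proof (rule eventually_ball_finite[OF F(1)], rule ballI)
    fix s assume "s \<in> F"
    then have "(\<lambda>j. dens (NN (r j)) (ww (r j)) s) \<longlonglongrightarrow> m s" using lim F(2) by blast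
    then show "eventually (\<lambda>j. \<bar>dens (NN (r j)) (ww (r j)) s - m s\<bar> < \<epsilon> / 2) sequentially"
      using \<epsilon> tendstoD[of _ "m s" sequentially "\<epsilon> / 2"] by (simp add: dist_real_def)
  qed
  then obtain j where j: "\<forall>s\<in>F. \<bar>dens (NN (r j)) (ww (r j)) s - m s\<bar> < \<epsilon> / 2"
    unfolding eventually_sequentially by blast
  have "\<bar>dens (NN (r j)) (ww (r j)) s - mix c s\<bar> < \<epsilon>" if "s \<in> F" for s
    using j c(2)[OF that] that by (smt (verit) field_sum_of_halves)
  then show False using bad c(1) by blast
qed

section \<open>Equidistribution of fibres with respect to an ergodic measure\<close>

definition vmass :: "nat \<Rightarrow> nat \<Rightarrow> 'a \<Rightarrow> real" where
  "vmass i N w = (\<Sum>x\<in>fibre N w. weight (\<mu> i) (N, x))"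

lemma vmass_nonneg: "i \<in> {1..k} \<Longrightarrow> N \<ge> 1 \<Longrightarrow> 0 \<le> vmass i N w"
  unfolding vmass_def using mu_bounds[of i] by (intro sum_nonneg) (auto simp: cyl_index_def fibre_def)

lemma sum_over_fibres:
  assumes "N \<ge> 1" "A \<subseteq> P N"
  shows "(\<Sum>x\<in>A. f x) = (\<Sum>w\<in>vert B N. \<Sum>x\<in>{x \<in> A. t N x = w}. f x)"
proof -
  have A: "finite A" using assms(2) finite_subset finite_fin_paths by blast
  have "t N ` A \<subseteq> vert B N" using assms end_vertex_in by blast
  then show ?thesis using sum.group[OF A finite_vert, of "t N" N f] by simp
qed

lemma vmass_total:
  assumes "i \<in> {1..k}" "N \<ge> 1" shows "(\<Sum>w\<in>vert B N. vmass i N w) = 1"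
  using sum_over_fibres[OF assms(2) order_refl, of "\<lambda>x. weight (\<mu> i) (N, x)"]
    inv_weight_sum_level[OF inv_weight_weight[OF mu_inv[OF assms(1)]] assms(2)]
  by (simp add: vmass_def fibre_def)

lemma weight_fibre:
  assumes "i \<in> {1..k}" "N \<ge> 1" "x \<in> P N"
  shows "weight (\<mu> i) (N, x) = vmass i N (t N x) / card (fibre N (t N x))"
proof -
  have "weight (\<mu> i) (N, y) = weight (\<mu> i) (N, x)" if "y \<in> fibre N (t N x)" for y
    using inv_weightD(3)[OF inv_weight_weight[OF mu_inv[OF assms(1)]] assms(2), of y x] that assms(3)
    by (auto simp: fibre_def)
  then have "vmass i N (t N x) = card (fibre N (t N x)) * weight (\<mu> i) (N, x)"
    by (simp add: vmass_def)
  moreover have "card (fibre N (t N x)) \<noteq> 0" using assms(3) by (auto simp: fibre_def)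
  ultimately show ?thesis by simp
qed

text \<open>All paths of level \<open>N\<close> ending in \<open>w\<close> have the same weight, so
  the measure is the average of the uniform distributions on the fibres, weighted with
  \<open>vmass\<close>.\<close>

lemma weight_average:
  assumes i: "i \<in> {1..k}" and n: "n \<ge> 1" "n \<le> N" and p: "p \<in> P n"
  shows "weight (\<mu> i) (n, p) = (\<Sum>w\<in>vert B N. vmass i N w * dens N w (n, p))"
proof -
  have N: "N \<ge> 1" using n by simp
  have "weight (\<mu> i) (n, p) = (\<Sum>x\<in>exts B n N p. weight (\<mu> i) (N, x))"
    by (rule inv_weight_exts[OF inv_weight_weight[OF mu_inv[OF i]] n(1) p n(2)])
  also have "\<dots> = (\<Sum>w\<in>vert B N. \<Sum>x\<in>{x \<in> exts B n N p. t N x = w}. weight (\<mu> i) (N, x))"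
    by (rule sum_over_fibres[OF N exts_subset])
  also have "\<dots> = (\<Sum>w\<in>vert B N. vmass i N w * dens N w (n, p))"
  proof (rule sum.cong[OF refl])
    fix w
    have "(\<Sum>x\<in>{x \<in> exts B n N p. t N x = w}. weight (\<mu> i) (N, x)) = (\<Sum>x\<in>ext_to n N p w. vmass i N w / card (fibre N w))"
      unfolding ext_to_def using weight_fibre[OF i N] exts_subset[of n N p] by (intro sum.cong) auto
    then show "(\<Sum>x\<in>{x \<in> exts B n N p. t N x = w}. weight (\<mu> i) (N, x)) = vmass i N w * dens N w (n, p)"
      by (simp add: dens_def)
  qed
  finally show ?thesis .
qed

lemma full_group_act:
  "x \<in> X \<Longrightarrow> \<one>\<^bsub>G\<^esub> x = x"
  "g \<in> carrier G \<Longrightarrow> h \<in> carrier G \<Longrightarrow> x \<in> X \<Longrightarrow> (g \<otimes>\<^bsub>G\<^esub> h) x = g (h x)"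
  by (simp_all add: full_group_mult compose_def full_group_simps(1))

text \<open>A coefficient \<open>c l > 0\<close> makes \<open>\<mu> i\<close> dominate a multiple of
  \<open>\<mu> l\<close>; ergodicity of \<open>\<mu> i\<close> then forces the two to coincide,
  against the injectivity of \<mu>.\<close>

lemma ergodic_mixture_trivial:
  assumes i: "i \<in> {1..k}" and c: "c \<in> convex_coeffs k"
    and eq: "\<And>s. s \<in> cyl_index \<Longrightarrow> weight (\<mu> i) s = mix c s"
  shows "c i = 1" "l \<in> {1..k} \<Longrightarrow> l \<noteq> i \<Longrightarrow> c l = 0"
proof -
  have all: "measure (\<mu> i) A = (\<Sum>j=1..k. c j * measure (\<mu> j) A)" if "A \<in> sets (\<mu> i)" for A
  proof (rule finite_mixture_eq[OF Int_stable_cyls cyls_subset mu_prob[OF i]])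
    show "(\<Sum>j=1..k. c j) = 1" using c by (simp add: convex_coeffs_def)
    fix A assume "A \<in> cyls"
    then consider "A = {}" | n p where "n \<ge> 1" "p \<in> P n" "A = cyl n p" by (auto simp: cyls_def)
    then show "measure (\<mu> i) A = (\<Sum>j=1..k. c j * measure (\<mu> j) A)"
    proof cases
      case (2 n p)
      then show ?thesis using eq[of "(n, p)"] by (simp add: cyl_index_def mix_def weight_def)
    qed simp
  qed (use mu_sets[OF i] mu_sets mu_prob sets_PS that in auto)
  have zero: "c l = 0" if l: "l \<in> {1..k}" "l \<noteq> i" for l
  proof (rule ccontr)
    assume "c l \<noteq> 0"
    then have cl: "c l > 0" using c l by (auto simp: convex_coeffs_def less_le)
    have "\<mu> l = \<mu> i"
    proof (rule ergodic_prob_extreme[OF group_full_group countable_full_group])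
      show "ergodic_prob G (\<lambda>g. g) (\<mu> i)" using mu_ergodic[OF i] by (simp add: ergodic_path_measures_def)
      show "invariant_prob G (\<lambda>g. g) (\<mu> l)" using mu_inv[OF l(1)] by (simp add: inv_measure_def)
      show "sets (\<mu> l) = sets (\<mu> i)" using mu_sets i l by simp
      show "0 < c l" by (rule cl)
      fix A assume A: "A \<in> sets (\<mu> i)"
      have "c l * measure (\<mu> l) A \<le> (\<Sum>j=1..k. c j * measure (\<mu> j) A)"
        using l(1) c by (intro member_le_sum) (auto simp: convex_coeffs_def)
      then show "c l * measure (\<mu> l) A \<le> measure (\<mu> i) A" using all[OF A] by simp
    qed (use full_group_act mu_space[OF i] in auto)
    then show False using inj_onD[OF bij_betw_imp_inj_on[OF bij] _ l(1) i] l(2) by blast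
  qed
  then show "l \<in> {1..k} \<Longrightarrow> l \<noteq> i \<Longrightarrow> c l = 0" .
  have "(\<Sum>j=1..k. c j) = c i + (\<Sum>j\<in>{1..k} - {i}. c j)" using i by (simp add: sum.remove)
  also have "(\<Sum>j\<in>{1..k} - {i}. c j) = 0" using zero by (intro sum.neutral) auto
  finally show "c i = 1" using c by (simp add: convex_coeffs_def)
qed

text \<open>This serves in place of a pointwise ergodic theorem: fibres through
  \<open>\<mu> i\<close>-typical paths are asymptotically distributed like \<open>\<mu> i\<close>.
  Each fibre is close to a mixture with coefficients \<open>cc j w\<close>, and the averages
  \<open>a j\<close> of these coefficients represent \<open>\<mu> i\<close> ever more exactly. By
  extremality \<open>a j i\<close> tends to 1 along a subsequence; being an average of numbers
  \<open>cc j w i\<close> that are at most 1, it forces most fibres to be close to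
  \<open>\<mu> i\<close>.\<close>

lemma dens_L1_limit:
  assumes i: "i \<in> {1..k}" and s: "s \<in> cyl_index"
  shows "(\<lambda>N. \<Sum>w\<in>vert B N. vmass i N w * \<bar>dens N w s - weight (\<mu> i) s\<bar>) \<longlonglongrightarrow> 0" (is "?S \<longlonglongrightarrow> 0")
proof (rule ccontr)
  assume "\<not> ?S \<longlonglongrightarrow> 0"
  then obtain \<epsilon> where \<epsilon>: "\<epsilon> > 0" "\<And>N0. \<exists>N\<ge>N0. \<epsilon> \<le> \<bar>?S N\<bar>"
    unfolding LIMSEQ_iff by (auto simp: not_less)
  define idx where "idx = from_nat_into cyl_index"
  have idx: "idx j \<in> cyl_index" "range idx = cyl_index" for j
    unfolding idx_def using cyl_index_nonempty countable_cyl_index by (auto simp: from_nat_into range_from_nat_into)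
  let ?F = "\<lambda>j. insert s (idx ` {..j})"
  let ?near = "\<lambda>j N c. \<forall>w\<in>vert B N. c w \<in> convex_coeffs k \<and> (\<forall>s\<in>?F j. \<bar>dens N w s - mix (c w) s\<bar> < 1 / real (Suc j))"
  have "\<exists>N c. N \<ge> Suc j \<and> \<epsilon> \<le> \<bar>?S N\<bar> \<and> ?near j N c" for j
  proof -
    obtain N0 where N0: "\<forall>N\<ge>N0. \<forall>w\<in>vert B N. \<exists>c\<in>convex_coeffs k. \<forall>s\<in>?F j. \<bar>dens N w s - mix c s\<bar> < 1 / real (Suc j)"
      using dens_near_mixture[of "?F j" "1 / real (Suc j)"] idx(1) s by auto
    obtain N where N: "N \<ge> max N0 (Suc j)" "\<epsilon> \<le> \<bar>?S N\<bar>" using \<epsilon>(2) by blast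
    have "\<forall>w\<in>vert B N. \<exists>c. c \<in> convex_coeffs k \<and> (\<forall>s\<in>?F j. \<bar>dens N w s - mix c s\<bar> < 1 / real (Suc j))"
      using N0 N(1) by (meson max.boundedE)
    then have "\<exists>c. ?near j N c" by (rule bchoice)
    then show ?thesis using N by auto
  qed
  moreover define Q where "Q j z \<longleftrightarrow> fst z \<ge> Suc j \<and> \<epsilon> \<le> \<bar>?S (fst z)\<bar> \<and> ?near j (fst z) (snd z)"
    for j and z :: "nat \<times> ('a \<Rightarrow> nat \<Rightarrow> real)"
  ultimately have "\<forall>j. \<exists>z. Q j z" by simp
  then obtain z where z: "\<And>j. Q j (z j)" using choice[of Q] by blast
  define NN cc where "NN j = fst (z j)" and "cc j = snd (z j)" for j
  have N: "\<And>j. NN j \<ge> Suc j" "\<And>j. \<epsilon> \<le> \<bar>?S (NN j)\<bar>" and near: "\<And>j. ?near j (NN j) (cc j)"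
    using z unfolding Q_def NN_def cc_def by blast+
  have N1: "NN j \<ge> 1" for j using N(1)[of j] by simp
  \<comment> \<open>The barycentric coordinates of the fibres, averaged over the vertices with the
    masses that \<open>\<mu> i\<close> gives them.\<close>
  define a where "a j l = (\<Sum>w\<in>vert B (NN j). vmass i (NN j) w * cc j w l)" for j l
  have vm: "vmass i (NN j) w \<ge> 0" "(\<Sum>w\<in>vert B (NN j). vmass i (NN j) w) = 1" for j w
    using vmass_nonneg[OF i N1] vmass_total[OF i N1] by auto
  have cc: "cc j w \<in> convex_coeffs k" if "w \<in> vert B (NN j)" for j w using near that by blast
  have a: "a j \<in> convex_coeffs k" for j
  proof -
    have "(\<Sum>l=1..k. a j l) = (\<Sum>w\<in>vert B (NN j). vmass i (NN j) w * (\<Sum>l=1..k. cc j w l))"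
      unfolding a_def by (subst sum.swap) (simp add: sum_distrib_left)
    also have "\<dots> = (\<Sum>w\<in>vert B (NN j). vmass i (NN j) w)"
      using cc by (intro sum.cong refl) (simp add: convex_coeffs_def)
    also have "\<dots> = 1" by (rule vm)
    finally have 1: "(\<Sum>l=1..k. a j l) = 1" .
    have "0 \<le> a j l" if "l \<in> {1..k}" for l
      unfolding a_def using vm(1) cc that by (intro sum_nonneg mult_nonneg_nonneg) (auto simp: convex_coeffs_def)
    then show ?thesis using 1 by (simp add: convex_coeffs_def)
  qed
  have mix_a: "mix (a j) s' = (\<Sum>w\<in>vert B (NN j). vmass i (NN j) w * mix (cc j w) s')" for j s'
  proof -
    have "mix (a j) s' = (\<Sum>l=1..k. \<Sum>w\<in>vert B (NN j). vmass i (NN j) w * (cc j w l * weight (\<mu> l) s'))"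
      unfolding mix_def a_def sum_distrib_right by (intro sum.cong refl) (simp add: mult.assoc)
    also have "\<dots> = (\<Sum>w\<in>vert B (NN j). \<Sum>l=1..k. vmass i (NN j) w * (cc j w l * weight (\<mu> l) s'))"
      by (rule sum.swap)
    finally show ?thesis by (simp add: mix_def sum_distrib_left)
  qed
  have near_a: "\<bar>weight (\<mu> i) s' - mix (a j) s'\<bar> \<le> 1 / real (Suc j)" if s': "s' \<in> ?F j" "fst s' \<le> NN j" for j s'
  proof -
    have "s' \<in> cyl_index" using s' idx(1) s by auto
    then have "weight (\<mu> i) s' = (\<Sum>w\<in>vert B (NN j). vmass i (NN j) w * dens (NN j) w s')"
      using weight_average[OF i _ s'(2), of "snd s'"] by (auto simp: cyl_index_def)
    then have "\<bar>weight (\<mu> i) s' - mix (a j) s'\<bar> = \<bar>\<Sum>w\<in>vert B (NN j). vmass i (NN j) w * (dens (NN j) w s' - mix (cc j w) s')\<bar>"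
      by (simp add: mix_a right_diff_distrib sum_subtractf)
    also have "\<dots> \<le> (\<Sum>w\<in>vert B (NN j). \<bar>vmass i (NN j) w * (dens (NN j) w s' - mix (cc j w) s')\<bar>)" by (rule sum_abs)
    also have "\<dots> \<le> (\<Sum>w\<in>vert B (NN j). vmass i (NN j) w * (1 / real (Suc j)))"
    proof (rule sum_mono)
      fix w assume w: "w \<in> vert B (NN j)"
      have "\<bar>dens (NN j) w s' - mix (cc j w) s'\<bar> \<le> 1 / real (Suc j)" using near w s'(1) less_imp_le by blast
      then show "\<bar>vmass i (NN j) w * (dens (NN j) w s' - mix (cc j w) s')\<bar> \<le> vmass i (NN j) w * (1 / real (Suc j))"
        unfolding abs_mult abs_of_nonneg[OF vm(1)] using vm(1) by (intro mult_left_mono)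
    qed
    also have "\<dots> = 1 / real (Suc j)" by (simp only: sum_distrib_right[symmetric] vm(2) mult_1)
    finally show ?thesis .
  qed
  have "norm (a j l) \<le> 1" if "l \<in> {1..k}" for j l
    using convex_coeffs_le_1[OF a that] a[of j] that by (auto simp: convex_coeffs_def)
  then obtain r where r: "strict_mono (r :: nat \<Rightarrow> nat)" and "\<And>l. l \<in> {1..k} \<Longrightarrow> \<exists>x. (\<lambda>j. a (r j) l) \<longlonglongrightarrow> x"
    using function_convergent_subsequence[of "{1..k}" a 1] countable_finite by blast
  then obtain b where b: "\<And>l. l \<in> {1..k} \<Longrightarrow> (\<lambda>j. a (r j) l) \<longlonglongrightarrow> b l" by metis
  have bS: "b \<in> convex_coeffs k"
  proof -
    have "(\<lambda>j. \<Sum>l=1..k. a (r j) l) \<longlonglongrightarrow> (\<Sum>l=1..k. b l)" by (intro tendsto_sum b)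
    then have "(\<Sum>l=1..k. b l) = 1" using a by (simp add: convex_coeffs_def LIMSEQ_const_iff)
    moreover have "0 \<le> b l" if "l \<in> {1..k}" for l
      by (rule LIMSEQ_le_const[OF b[OF that]]) (use a that in \<open>auto simp: convex_coeffs_def\<close>)
    ultimately show ?thesis by (simp add: convex_coeffs_def)
  qed
  have "weight (\<mu> i) s' = mix b s'" if s': "s' \<in> cyl_index" for s'
  proof -
    obtain j0 where j0: "s' = idx j0" using idx(2) s' by blast
    have "(\<lambda>j. mix (a (r j)) s') \<longlonglongrightarrow> mix b s'"
      unfolding mix_def by (intro tendsto_sum tendsto_mult b tendsto_const)
    moreover have "(\<lambda>j. mix (a (r j)) s') \<longlonglongrightarrow> weight (\<mu> i) s'"
    proof (rule LIM_zero_cancel, rule Lim_null_comparison)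
      show "eventually (\<lambda>j. norm (mix (a (r j)) s' - weight (\<mu> i) s') \<le> 1 / real (Suc j)) sequentially"
        unfolding eventually_sequentially
      proof (intro exI[of _ "max j0 (fst s')"] allI impI)
        fix j assume j: "max j0 (fst s') \<le> j"
        have rj: "j \<le> r j" using seq_suble[OF r] .
        have "\<bar>weight (\<mu> i) s' - mix (a (r j)) s'\<bar> \<le> 1 / real (Suc (r j))"
          using j rj N(1)[of "r j"] by (intro near_a) (auto simp: j0)
        also have "\<dots> \<le> 1 / real (Suc j)" using rj by (intro divide_left_mono) auto
        finally show "norm (mix (a (r j)) s' - weight (\<mu> i) s') \<le> 1 / real (Suc j)"
          by (simp add: abs_minus_commute)
      qed
      show "(\<lambda>j. 1 / real (Suc j)) \<longlonglongrightarrow> 0" by (rule LIMSEQ_Suc[OF lim_1_over_n])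
    qed
    ultimately show ?thesis using LIMSEQ_unique by blast
  qed
  then have bi: "b i = 1" by (rule ergodic_mixture_trivial(1)[OF i bS])
  have bound: "?S (NN j) \<le> 1 / real (Suc j) + 2 * (1 - a j i)" for j
  proof -
    have "?S (NN j) \<le> (\<Sum>w\<in>vert B (NN j). vmass i (NN j) w * (1 / real (Suc j) + 2 * (1 - cc j w i)))"
    proof (rule sum_mono, rule mult_left_mono[OF _ vm(1)])
      fix w assume w: "w \<in> vert B (NN j)"
      have 1: "\<bar>dens (NN j) w s - mix (cc j w) s\<bar> < 1 / real (Suc j)" using near w by blast
      have "mix (cc j w) s - weight (\<mu> i) s = (\<Sum>l=1..k. (cc j w l - (if l = i then 1 else 0)) * weight (\<mu> l) s)"
        using i by (simp add: mix_def left_diff_distrib sum_subtractf if_distrib[of "\<lambda>x. x * _"] cong: if_cong)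
      also have "\<bar>\<dots>\<bar> \<le> (\<Sum>l=1..k. \<bar>(cc j w l - (if l = i then 1 else 0)) * weight (\<mu> l) s\<bar>)" by (rule sum_abs)
      also have "\<dots> \<le> (\<Sum>l=1..k. \<bar>cc j w l - (if l = i then 1 else 0)\<bar>)"
        unfolding abs_mult using mu_bounds[OF _ s] by (intro sum_mono mult_left_le) auto
      \<comment> \<open>The l1 distance of a probability vector from vertex number \<open>i\<close>
        of the simplex is twice the mass it puts elsewhere.\<close>
      also have "\<dots> = (\<Sum>l=1..k. cc j w l + (if l = i then 1 - 2 * cc j w l else 0))"
        using cc[OF w] convex_coeffs_le_1[OF cc[OF w]] by (intro sum.cong refl) (auto simp: convex_coeffs_def)
      also have "\<dots> = 2 * (1 - cc j w i)"
        using i cc[OF w] by (simp add: sum.distrib convex_coeffs_def)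
      finally show "\<bar>dens (NN j) w s - weight (\<mu> i) s\<bar> \<le> 1 / real (Suc j) + 2 * (1 - cc j w i)"
        using 1 by linarith
    qed
    also have "\<dots> = (\<Sum>w\<in>vert B (NN j). vmass i (NN j) w * (1 / real (Suc j) + 2) - 2 * (vmass i (NN j) w * cc j w i))"
      by (intro sum.cong refl) (simp add: algebra_simps)
    also have "\<dots> = 1 * (1 / real (Suc j) + 2) - 2 * a j i"
      unfolding sum_subtractf sum_distrib_right[symmetric] vm(2) sum_distrib_left[symmetric] a_def ..
    finally show ?thesis by simp
  qed
  have nn: "0 \<le> ?S (NN j)" for j using vm(1) by (intro sum_nonneg mult_nonneg_nonneg) auto
  have "(\<lambda>j. 1 / real (Suc (r j)) + 2 * (1 - a (r j) i)) \<longlonglongrightarrow> 0 + 2 * (1 - 1)"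
  proof (intro tendsto_intros)
    show "(\<lambda>j. a (r j) i) \<longlonglongrightarrow> 1" using b[OF i] bi by simp
    show "(\<lambda>j. 1 / real (Suc (r j))) \<longlonglongrightarrow> 0"
      using LIMSEQ_subseq_LIMSEQ[OF LIMSEQ_Suc[OF lim_1_over_n] r] by (simp add: o_def)
  qed
  moreover have "\<epsilon> \<le> 1 / real (Suc (r j)) + 2 * (1 - a (r j) i)" for j
    using N(2)[of "r j"] bound[of "r j"] nn[of "r j"] by linarith
  ultimately have "\<epsilon> \<le> 0 + 2 * (1 - 1)" by (intro LIMSEQ_le_const) auto
  then show False using \<epsilon>(1) by simp
qed

end

section \<open>Random subgroups\<close>

locale countable_group = group G for G (structure) +
  assumes countable_carrier: "countable (carrier G)"
begin

abbreviation "Subs \<equiv> {H. subgroup H G}"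
abbreviation "SM \<equiv> borel_of (Sub_topology G)"

definition above :: "'a set \<Rightarrow> 'a set set" where
  "above F = {H. subgroup H G \<and> F \<subseteq> H}"

text \<open>The events of containing a given finite set form an intersection-stable generator, so
  they determine the law of a random subgroup.\<close>

definition aboves :: "'a set set set" where
  "aboves = above ` {F. finite F \<and> F \<subseteq> carrier G}"

lemma aboves_subset: "aboves \<subseteq> Pow Subs" by (auto simp: aboves_def above_def)

lemma Int_stable_aboves: "Int_stable aboves"
proof -
  have "above F \<inter> above F' = above (F \<union> F')" for F F' by (auto simp: above_def)
  then show ?thesis unfolding Int_stable_def aboves_def by (force simp del: Un_subset_iff simp: Un_subset_iff)
qed

text \<open>The topology has a countable base of boxes that prescribe finitely many elements of
  \<open>H\<close> and finitely many non-elements; such a box is \<open>above F\<close> minus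
  finitely many sets of the form \<open>above {g}\<close>.\<close>

lemma sets_SM: "sets SM = sigma_sets Subs aboves" and space_SM: "space SM = Subs"
proof -
  define T where "T = product_topology (\<lambda>_. discrete_topology (UNIV :: bool set)) (carrier G)"
  define f where "f H = (\<lambda>g\<in>carrier G. g \<in> H)" for H :: "'a set"
  have ST: "Sub_topology G = pullback_topology Subs f T" by (simp add: Sub_topology_def T_def f_def[abs_def])
  have topT: "topspace T = (\<Pi>\<^sub>E g\<in>carrier G. UNIV)" by (simp add: T_def)
  have top: "topspace (Sub_topology G) = Subs"
    unfolding ST topspace_pullback_topology topT by (auto simp: f_def)
  define box where "box F F' = {H. subgroup H G \<and> F \<subseteq> H \<and> F' \<inter> H = {}}" for F F' :: "'a set"
  define \<B> where "\<B> = (\<lambda>(F, F'). box F F') ` ({F. finite F \<and> F \<subseteq> carrier G} \<times> {F. finite F \<and> F \<subseteq> carrier G})"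
  have cf: "countable {F. finite F \<and> F \<subseteq> carrier G}"
    using countable_Collect_finite_subset[OF countable_carrier] by simp
  have cB: "countable \<B>" unfolding \<B>_def by (intro countable_image countable_SIGMA cf)
  have op: "openin (Sub_topology G) U" if U: "U \<in> \<B>" for U
  proof -
    obtain F F' where F: "U = box F F'" "finite F" "F \<subseteq> carrier G" "finite F'" "F' \<subseteq> carrier G"
      using U by (auto simp: \<B>_def)
    let ?W = "\<lambda>g. (if g \<in> F then {True} else UNIV) \<inter> (if g \<in> F' then {False} else UNIV)"
    have "openin T (Pi\<^sub>E (carrier G) ?W)"
      unfolding T_def openin_PiE_gen
      by (intro disjI2 conjI) (auto intro!: finite_subset[of _ "F \<union> F'"] F)
    moreover have "U = f -` (Pi\<^sub>E (carrier G) ?W) \<inter> Subs"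
    proof -
      have "f H \<in> Pi\<^sub>E (carrier G) ?W \<longleftrightarrow> F \<subseteq> H \<and> F' \<inter> H = {}" for H
        using F(3,5) by (auto simp: f_def PiE_iff subset_iff split: if_splits)
      then show ?thesis unfolding F(1) box_def by auto
    qed
    ultimately show ?thesis unfolding ST openin_pullback_topology by blast
  qed
  have base: "\<exists>V\<in>\<B>. H \<in> V \<and> V \<subseteq> U" if U: "openin (Sub_topology G) U" "H \<in> U" for U H
  proof -
    obtain V where V: "openin T V" "U = f -` V \<inter> Subs" using U(1) unfolding ST openin_pullback_topology by blast
    have "f H \<in> V" "subgroup H G" using U(2) V by auto
    then obtain W where W: "finite {g \<in> carrier G. W g \<noteq> UNIV}" "f H \<in> Pi\<^sub>E (carrier G) W" "Pi\<^sub>E (carrier G) W \<subseteq> V"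
      using V(1) unfolding T_def openin_product_topology_alt by fastforce
    let ?I = "{g \<in> carrier G. W g \<noteq> UNIV}"
    have "box (?I \<inter> H) (?I - H) \<subseteq> U"
    proof
      fix H' assume "H' \<in> box (?I \<inter> H) (?I - H)"
      then have H': "subgroup H' G" "?I \<inter> H \<subseteq> H'" "(?I - H) \<inter> H' = {}" by (auto simp: box_def)
      have "f H' g \<in> W g" if g: "g \<in> carrier G" for g
      proof (cases "W g = UNIV")
        case False
        then have "g \<in> H' \<longleftrightarrow> g \<in> H" using H' g by blast
        then show ?thesis using W(2) g by (auto simp: f_def PiE_iff)
      qed simp
      then have "f H' \<in> Pi\<^sub>E (carrier G) W" by (auto simp: f_def)
      then show "H' \<in> U" using W(3) V(2) H'(1) by blast
    qed
    moreover have "H \<in> box (?I \<inter> H) (?I - H)" using \<open>subgroup H G\<close> by (auto simp: box_def)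
    moreover have "box (?I \<inter> H) (?I - H) \<in> \<B>" unfolding \<B>_def using W(1) by (intro image_eqI[of _ _ "(?I \<inter> H, ?I - H)"]) auto
    ultimately show ?thesis by blast
  qed
  have s1: "sets SM = sigma_sets Subs \<B>" and s2: "space SM = Subs"
    using sets_borel_of_base[OF cB op base] unfolding top by auto
  show "space SM = Subs" by (rule s2)
  interpret S: sigma_algebra Subs "sigma_sets Subs aboves" using aboves_subset by (rule sigma_algebra_sigma_sets)
  show "sets SM = sigma_sets Subs aboves"
    unfolding s1
  proof (rule sigma_sets_eqI)
    fix U assume "U \<in> \<B>"
    then obtain F F' where F: "U = box F F'" "finite F" "F \<subseteq> carrier G" "finite F'" "F' \<subseteq> carrier G"
      by (auto simp: \<B>_def)
    have "above {g} \<in> sigma_sets Subs aboves" if "g \<in> carrier G" for g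
      using that by (intro sigma_sets.Basic) (auto simp: aboves_def)
    then have "(\<Union>g\<in>F'. above {g}) \<in> sigma_sets Subs aboves"
      using F by (intro S.finite_UN) auto
    moreover have "above F \<in> sigma_sets Subs aboves" using F by (intro sigma_sets.Basic) (auto simp: aboves_def)
    ultimately have "above F - (\<Union>g\<in>F'. above {g}) \<in> sigma_sets Subs aboves" by (rule S.Diff[rotated])
    moreover have "U = above F - (\<Union>g\<in>F'. above {g})" unfolding F(1) box_def above_def by auto
    ultimately show "U \<in> sigma_sets Subs aboves" by simp
  next
    fix U assume "U \<in> aboves"
    then obtain F where "finite F" "F \<subseteq> carrier G" "U = above F" by (auto simp: aboves_def)
    then have "U = (\<lambda>(F, F'). box F F') (F, {})" by (auto simp: above_def box_def)
    then show "U \<in> sigma_sets Subs \<B>" unfolding \<B>_def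
      using \<open>finite F\<close> \<open>F \<subseteq> carrier G\<close> by (intro sigma_sets.Basic) auto
  qed
qed

lemma above_sets [measurable]: "finite F \<Longrightarrow> F \<subseteq> carrier G \<Longrightarrow> above F \<in> sets SM"
  unfolding sets_SM by (intro sigma_sets.Basic) (auto simp: aboves_def)

lemma mem_sets: "g \<in> carrier G \<Longrightarrow> {H. subgroup H G \<and> g \<in> H} \<in> sets SM"
  using above_sets[of "{g}"] by (simp add: above_def)

lemma measurable_SM:
  assumes "\<And>x. x \<in> space M \<Longrightarrow> subgroup (f x) G"
    and "\<And>g. g \<in> carrier G \<Longrightarrow> {x \<in> space M. g \<in> f x} \<in> sets M"
  shows "f \<in> measurable M SM"
proof (rule measurable_sigma_sets[OF sets_SM aboves_subset])
  show "f \<in> space M \<rightarrow> Subs" using assms(1) by auto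
  fix A assume "A \<in> aboves"
  then obtain F where F: "finite F" "F \<subseteq> carrier G" "A = above F" by (auto simp: aboves_def)
  have "f -` A \<inter> space M = {x \<in> space M. \<forall>g\<in>F. g \<in> f x}"
    using assms(1) by (auto simp: F above_def)
  also have "\<dots> \<in> sets M" using assms(2) F by (intro sets.sets_Collect_finite_All) auto
  finally show "f -` A \<inter> space M \<in> sets M" .
qed

lemma conjugation_mem:
  assumes g: "g \<in> carrier G" and H: "subgroup H G"
  shows "h \<in> conjugation G g H \<longleftrightarrow> h \<in> carrier G \<and> m_inv G g \<otimes> h \<otimes> g \<in> H"
proof
  have HG: "H \<subseteq> carrier G" using H by (rule subgroup.subset)
  assume "h \<in> conjugation G g H"
  then obtain x where x: "x \<in> H" "h = g \<otimes> x \<otimes> m_inv G g"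
    by (auto simp: conjugation_def l_coset_def r_coset_def)
  then have xG: "x \<in> carrier G" using HG by auto
  have "m_inv G g \<otimes> h \<otimes> g = x" using g xG unfolding x(2) by (simp add: m_assoc, simp add: m_assoc[symmetric])
  then show "h \<in> carrier G \<and> m_inv G g \<otimes> h \<otimes> g \<in> H" using x xG g by simp
next
  assume h: "h \<in> carrier G \<and> m_inv G g \<otimes> h \<otimes> g \<in> H"
  then have "h = g \<otimes> (m_inv G g \<otimes> h \<otimes> g) \<otimes> m_inv G g" using g by (simp add: m_assoc, simp add: m_assoc[symmetric])
  then show "h \<in> conjugation G g H" using h unfolding conjugation_def l_coset_def r_coset_def by blast
qed

lemma conjugation_subgroup:
  assumes g: "g \<in> carrier G" and H: "subgroup H G"
  shows "subgroup (conjugation G g H) G"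
proof (rule subgroupI)
  show "conjugation G g H \<subseteq> carrier G" using conjugation_mem[OF g H] by blast
  show "conjugation G g H \<noteq> {}"
    using conjugation_mem[OF g H, of \<one>] g subgroup.one_closed[OF H] by auto
  fix a assume a: "a \<in> conjugation G g H"
  then have a': "a \<in> carrier G" "m_inv G g \<otimes> a \<otimes> g \<in> H" using conjugation_mem[OF g H] by auto
  have "m_inv G (m_inv G g \<otimes> a \<otimes> g) \<in> H" using subgroup.m_inv_closed[OF H a'(2)] .
  moreover have "m_inv G (m_inv G g \<otimes> a \<otimes> g) = m_inv G g \<otimes> m_inv G a \<otimes> g"
    using g a' by (simp add: inv_mult_group m_assoc)
  ultimately show "m_inv G a \<in> conjugation G g H" using a' conjugation_mem[OF g H] by simp
  fix b assume b: "b \<in> conjugation G g H"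
  then have b': "b \<in> carrier G" "m_inv G g \<otimes> b \<otimes> g \<in> H" using conjugation_mem[OF g H] by auto
  have "(m_inv G g \<otimes> a \<otimes> g) \<otimes> (m_inv G g \<otimes> b \<otimes> g) \<in> H" using subgroup.m_closed[OF H a'(2) b'(2)] .
  moreover have "(m_inv G g \<otimes> a \<otimes> g) \<otimes> (m_inv G g \<otimes> b \<otimes> g) = m_inv G g \<otimes> (a \<otimes> b) \<otimes> g"
  proof -
    have "g \<otimes> (m_inv G g \<otimes> (b \<otimes> g)) = b \<otimes> g" using g b' by (simp add: m_assoc[symmetric])
    then show ?thesis using g a' b' by (simp add: m_assoc)
  qed
  ultimately show "a \<otimes> b \<in> conjugation G g H" using a' b' conjugation_mem[OF g H] by simp
qed

lemma conjugation_one: "subgroup H G \<Longrightarrow> conjugation G \<one> H = H"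
  using conjugation_mem[of \<one> H] subgroup.subset[of H G] by auto

lemma conjugation_mult:
  assumes "g \<in> carrier G" "h \<in> carrier G" "subgroup H G"
  shows "conjugation G (g \<otimes> h) H = conjugation G g (conjugation G h H)"
proof (rule Set.set_eqI)
  fix x
  have "m_inv G (g \<otimes> h) \<otimes> x \<otimes> (g \<otimes> h) = m_inv G h \<otimes> (m_inv G g \<otimes> x \<otimes> g) \<otimes> h" if "x \<in> carrier G"
    using assms that by (simp add: inv_mult_group m_assoc)
  then show "x \<in> conjugation G (g \<otimes> h) H \<longleftrightarrow> x \<in> conjugation G g (conjugation G h H)"
    using assms by (auto simp: conjugation_mem conjugation_subgroup)
qed

lemma conjugation_measurable:
  assumes "g \<in> carrier G" shows "conjugation G g \<in> measurable SM SM"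
proof (rule measurable_SM)
  fix h assume h: "h \<in> carrier G"
  have "{H \<in> space SM. h \<in> conjugation G g H} = {H. subgroup H G \<and> m_inv G g \<otimes> h \<otimes> g \<in> H}"
    using conjugation_mem[OF assms] h by (auto simp: space_SM)
  then show "{H \<in> space SM. h \<in> conjugation G g H} \<in> sets SM" using mem_sets assms h by simp
qed (use conjugation_subgroup[OF assms] in \<open>auto simp: space_SM\<close>)

lemma random_subgroup_mixture:
  assumes "prob_space \<phi>" "sets \<phi> = sets SM" "\<And>j. j \<in> J \<Longrightarrow> prob_space (N j)" "\<And>j. j \<in> J \<Longrightarrow> sets (N j) = sets SM"
    and "finite J" "(\<Sum>j\<in>J. c j) = (1::real)"
    and "\<And>F. finite F \<Longrightarrow> F \<subseteq> carrier G \<Longrightarrow> measure \<phi> (above F) = (\<Sum>j\<in>J. c j * measure (N j) (above F))"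
    and "A \<in> sets SM"
  shows "measure \<phi> A = (\<Sum>j\<in>J. c j * measure (N j) A)"
  by (rule finite_mixture_eq[OF Int_stable_aboves aboves_subset]) (use assms sets_SM in \<open>auto simp: aboves_def\<close>)

lemma IRS_D:
  assumes "invariant_random_subgroup G \<phi>"
  shows "prob_space \<phi>" "sets \<phi> = sets SM" "space \<phi> = Subs"
    "g \<in> carrier G \<Longrightarrow> conjugation G g \<in> measurable \<phi> \<phi>" "g \<in> carrier G \<Longrightarrow> distr \<phi> \<phi> (conjugation G g) = \<phi>"
  using assms sets_eq_imp_space_eq[of \<phi> SM]
  by (auto simp: invariant_random_subgroup_def invariant_prob_def space_SM)

lemma IRS_conj_measure:
  assumes "invariant_random_subgroup G \<phi>" "g \<in> carrier G" "A \<in> sets SM"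
  shows "measure \<phi> {H. subgroup H G \<and> conjugation G g H \<in> A} = measure \<phi> A"
proof -
  note D = IRS_D[OF assms(1)]
  have "measure (distr \<phi> \<phi> (conjugation G g)) A = measure \<phi> (conjugation G g -` A \<inter> space \<phi>)"
    using D(4)[OF assms(2)] assms(3) D(2) by (intro measure_distr) auto
  moreover have "conjugation G g -` A \<inter> space \<phi> = {H. subgroup H G \<and> conjugation G g H \<in> A}"
    using D(3) by auto
  ultimately show ?thesis using D(5)[OF assms(2)] by simp
qed

end

section \<open>Invariant random subgroups are determined by their fixed points\<close>

sublocale bratteli_diagram \<subseteq> FG: countable_group "full_group B"
  by (rule countable_group.intro[OF group_full_group countable_group_axioms.intro[OF countable_full_group]])

text \<open>Disjoint supports: \<alpha> is supported on \<open>A\<close>, where \<open>s\<close>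
  moves nothing. It is used to transfer a swap between a subgroup and its conjugates.\<close>

lemma fibre_perms_commute:
  assumes "\<alpha> \<in> fibre_perms A f" "inj s" "\<And>z. s z \<noteq> z \<Longrightarrow> z \<notin> A"
  shows "inv \<alpha> \<circ> s \<circ> \<alpha> = s"
proof -
  have p: "\<alpha> permutes A" "bij \<alpha>" using assms(1) by (auto dest: fibre_permsD)
  have "s (\<alpha> z) = \<alpha> (s z)" for z
  proof (cases "z \<in> A")
    case True
    then have "\<alpha> z \<in> A" using p by (simp add: permutes_in_image)
    then show ?thesis using assms(3) True by metis
  next
    case False
    have "s z \<notin> A"
    proof (cases "s z = z")
      case neq: False
      then have "s (s z) \<noteq> s z" using assms(2) by (metis injD)
      then show ?thesis by (rule assms(3))
    qed (use False in simp)
    then show ?thesis using False p(1) by (simp add: permutes_not_in)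
  qed
  then show ?thesis using p(2) by (simp add: fun_eq_iff bij_is_inj inv_f_f)
qed

context bratteli_diagram
begin

definition swap :: "nat \<Rightarrow> (nat \<Rightarrow> 'e) \<Rightarrow> (nat \<Rightarrow> 'e) \<Rightarrow> (nat \<Rightarrow> 'e) \<Rightarrow> nat \<Rightarrow> 'e" where
  "swap n p q = path_act B n (transpose p q)"

text \<open>\<open>swaps n p H\<close> means that \<open>H\<close> contains the rigid stabilizer of the cylinder of \<open>p\<close>.\<close>

definition swaps :: "nat \<Rightarrow> (nat \<Rightarrow> 'e) \<Rightarrow> ((nat \<Rightarrow> 'e) \<Rightarrow> nat \<Rightarrow> 'e) set \<Rightarrow> bool" where
  "swaps n p H \<longleftrightarrow> (\<forall>m\<ge>n. \<forall>x\<in>exts B n m p. \<forall>y\<in>exts B n m p. t m x = t m y \<longrightarrow> swap m x y \<in> H)"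

text \<open>The trace of \<open>H\<close> on level \<open>m\<close>, in the form of permutations of
  finite paths to which the combinatorial lemmas apply.\<close>

definition perms_in :: "nat \<Rightarrow> ((nat \<Rightarrow> 'e) \<Rightarrow> nat \<Rightarrow> 'e) set \<Rightarrow> ((nat \<Rightarrow> 'e) \<Rightarrow> nat \<Rightarrow> 'e) set" where
  "perms_in m H = {s \<in> \<Gamma> m. path_act B m s \<in> H}"

lemma swap_carrier: "n \<ge> 1 \<Longrightarrow> p \<in> P n \<Longrightarrow> q \<in> P n \<Longrightarrow> t n p = t n q \<Longrightarrow> swap n p q \<in> carrier G"
  unfolding swap_def by (intro path_act_carrier level_perms_transpose)

lemma perms_in_closed:
  assumes H: "subgroup H G" and m: "m \<ge> 1"
  shows "id \<in> perms_in m H"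
    and "s \<in> perms_in m H \<Longrightarrow> s' \<in> perms_in m H \<Longrightarrow> s \<circ> s' \<in> perms_in m H"
    and "s \<in> perms_in m H \<Longrightarrow> inv s \<in> perms_in m H"
proof -
  show "id \<in> perms_in m H"
    using subgroup.one_closed[OF H] path_act_one[of m] by (simp add: perms_in_def level_perms_id)
  show "s \<circ> s' \<in> perms_in m H" if "s \<in> perms_in m H" "s' \<in> perms_in m H"
    using that subgroup.m_closed[OF H, of "path_act B m s" "path_act B m s'"] path_act_mult[OF m, of s s']
    by (simp add: perms_in_def level_perms_comp)
  show "inv s \<in> perms_in m H" if "s \<in> perms_in m H"
    using that subgroup.m_inv_closed[OF H, of "path_act B m s"] path_act_inv[OF m, of s]
    by (simp add: perms_in_def level_perms_inv)
qed

lemma conj_path_act: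
  assumes "m \<ge> 1" "\<alpha> \<in> \<Gamma> m" "s \<in> \<Gamma> m" "subgroup H G"
  shows "path_act B m s \<in> conjugation G (path_act B m \<alpha>) H \<longleftrightarrow> inv \<alpha> \<circ> s \<circ> \<alpha> \<in> perms_in m H"
proof -
  have i: "inv \<alpha> \<in> \<Gamma> m" using assms(2) by (rule level_perms_inv)
  have "inv \<alpha> \<circ> s \<in> \<Gamma> m" "inv \<alpha> \<circ> s \<circ> \<alpha> \<in> \<Gamma> m" using i assms by (intro level_perms_comp; simp)+
  moreover have "m_inv G (path_act B m \<alpha>) \<otimes>\<^bsub>G\<^esub> path_act B m s \<otimes>\<^bsub>G\<^esub> path_act B m \<alpha> = path_act B m (inv \<alpha> \<circ> s \<circ> \<alpha>)"
    using assms i calculation by (simp add: path_act_inv path_act_mult)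
  ultimately show ?thesis
    using FG.conjugation_mem[OF path_act_carrier[OF assms(1,2)] assms(4)] path_act_carrier[OF assms(1,3)]
    by (simp add: perms_in_def)
qed

lemma lift_perm_fixed: "\<sigma> (restrict q {1..n}) = restrict q {1..n} \<Longrightarrow> lift_perm B n m \<sigma> q = q"
  by (auto simp: lift_perm_def glue_def fun_eq_iff)

lemma lift_perm_in_perms_in:
  assumes "n \<ge> 1" "n \<le> m" "\<sigma> \<in> \<Gamma> n"
  shows "lift_perm B n m \<sigma> \<in> perms_in m H \<longleftrightarrow> path_act B n \<sigma> \<in> H"
  using assms by (simp add: perms_in_def lift_perm_in lift_perm_act)

lemma lift_perm_exts:
  assumes n: "n \<ge> 1" "n \<le> m" and s: "\<sigma> \<in> \<Gamma> n" and p: "p \<in> P n"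
  shows "lift_perm B n m \<sigma> ` {x \<in> exts B n m p. t m x = w} = {x \<in> exts B n m (\<sigma> p). t m x = w}"
proof
  show "lift_perm B n m \<sigma> ` {x \<in> exts B n m p. t m x = w} \<subseteq> {x \<in> exts B n m (\<sigma> p). t m x = w}"
    using lift_perm_apply[OF n s] by (auto simp: exts_iff)
  let ?l = "lift_perm B n m \<sigma>"
  have l: "?l \<in> \<Gamma> m" using n s by (rule lift_perm_in)
  show "{x \<in> exts B n m (\<sigma> p). t m x = w} \<subseteq> ?l ` {x \<in> exts B n m p. t m x = w}"
  proof
    fix x assume "x \<in> {x \<in> exts B n m (\<sigma> p). t m x = w}"
    then have x: "x \<in> P m" "restrict x {1..n} = \<sigma> p" "t m x = w" by (auto simp: exts_iff)
    obtain y where y: "y \<in> P m" "x = ?l y"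
      using permutes_image[OF level_permsD(1)[OF l]] x(1) by blast
    have "\<sigma> (restrict y {1..n}) = \<sigma> p" using lift_perm_apply(3)[OF n s y(1)] y(2) x(2) by simp
    then have "restrict y {1..n} = p" using level_permsD(3)[OF s] by (metis bij_pointE)
    moreover have "t m y = w" using lift_perm_apply(2)[OF n s y(1)] y(2) x(3) by simp
    ultimately show "x \<in> ?l ` {x \<in> exts B n m p. t m x = w}" using y by (auto simp: exts_iff)
  qed
qed

lemma fibre_perms_exts_subset: "fibre_perms (exts B n m p) (t m) \<subseteq> \<Gamma> m"
  unfolding level_perms_def by (rule fibre_perms_mono[OF exts_subset])

text \<open>Recurrence for one subgroup \<open>H\<close> at infinitely many levels, along
  permutations taken from \<open>R j\<close>. Inverses are built in: if the conjugate of
  \<open>H\<close> by \<open>inv b\<close> contains an element, then \<open>H\<close> contains the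
  conjugate of that element by \<open>b\<close>. The event \<open>A\<close> is asserted for the
  conjugates, not for \<open>H\<close>.\<close>

lemma recurrent_conjugates:
  assumes IRS: "invariant_random_subgroup G \<phi>" and l: "l \<ge> 1"
    and A: "A \<in> sets FG.SM" "measure \<phi> A > 0"
    and R: "\<And>j. R j \<subseteq> \<Gamma> (l + j)" "\<And>j \<alpha>. \<alpha> \<in> R j \<Longrightarrow> inv \<alpha> \<in> R j"
  shows "\<exists>H. subgroup H G \<and> (\<forall>j0. \<exists>j\<ge>j0. measure \<phi> A / 2 * card (R j) \<le>
    card {b \<in> R j. conjugation G (path_act B (l + j) (inv b)) H \<in> A})"
proof -
  note D = FG.IRS_D[OF IRS]
  let ?G = "\<lambda>j. path_act B (l + j) ` R j"
  have inj: "inj_on (path_act B (l + j)) (R j)" for j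
    using path_act_inj[of "l + j"] l R(1)[of j] by (intro inj_onI) auto
  have finR: "finite (R j)" for j using R(1) finite_subset finite_level_perms by blast
  have car: "a \<in> carrier G" if "a \<in> ?G j" for a j
    using that R(1)[of j] l path_act_carrier[of "l + j"] by auto
  have "\<exists>H\<in>space \<phi>. \<exists>\<^sub>\<infinity>j. measure \<phi> A / 2 * card (?G j) \<le> card {a \<in> ?G j. conjugation G a H \<in> A}"
    by (rule recurrent_visits[OF D(1)]) (use finR D(4,5) car A D(2) in auto)
  then obtain H where H: "subgroup H G" "\<exists>\<^sub>\<infinity>j. measure \<phi> A / 2 * card (?G j) \<le> card {a \<in> ?G j. conjugation G a H \<in> A}"
    using D(3) by auto
  have le: "card {a \<in> ?G j. conjugation G a H \<in> A} \<le> card {b \<in> R j. conjugation G (path_act B (l + j) (inv b)) H \<in> A}" for j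
  proof -
    let ?T = "{b \<in> R j. conjugation G (path_act B (l + j) (inv b)) H \<in> A}"
    have "{a \<in> ?G j. conjugation G a H \<in> A} \<subseteq> (\<lambda>b. path_act B (l + j) (inv b)) ` ?T"
    proof
      fix a assume "a \<in> {a \<in> ?G j. conjugation G a H \<in> A}"
      then obtain \<alpha> where \<alpha>: "\<alpha> \<in> R j" "a = path_act B (l + j) \<alpha>" "conjugation G a H \<in> A" by blast
      have "inv (inv \<alpha>) = \<alpha>" using R(1) \<alpha>(1) level_permsD(3) by (metis inv_inv_eq subsetD)
      then show "a \<in> (\<lambda>b. path_act B (l + j) (inv b)) ` ?T" using \<alpha> R(2) by (intro image_eqI[of _ _ "inv \<alpha>"]) auto
    qed
    then show ?thesis using finR by (intro surj_card_le) auto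
  qed
  have "\<exists>j\<ge>j0. measure \<phi> A / 2 * card (R j) \<le> card {b \<in> R j. conjugation G (path_act B (l + j) (inv b)) H \<in> A}" for j0
  proof -
    obtain j where j: "j \<ge> j0" "measure \<phi> A / 2 * card (?G j) \<le> card {a \<in> ?G j. conjugation G a H \<in> A}"
      using H(2) unfolding INFM_nat_le by blast
    have "card (?G j) = card (R j)" using inj by (rule card_image)
    moreover have "real (card {a \<in> ?G j. conjugation G a H \<in> A}) \<le> real (card {b \<in> R j. conjugation G (path_act B (l + j) (inv b)) H \<in> A})"
      using le by (simp only: of_nat_le_iff)
    ultimately show ?thesis using j by (intro exI[of _ j]) auto
  qed
  then show ?thesis using H(1) by (intro exI[of _ H]) simp
qed

end

section \<open>Elements that recurrence forces into a random subgroup\<close>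

context even_diagram
begin

text \<open>Seen at level \<open>m\<close>, the swap of \<open>x\<close> and \<open>y\<close>
  exchanges their extensions in pairs, and by \<open>good l m\<close> an even number of pairs over
  every vertex. It is thus a product of three-cycles in \<open>U\<close>, so a single transposition
  of level \<open>l\<close> is reached from even permutations of level \<open>m\<close>.\<close>

lemma even_swap_in:
  assumes H: "subgroup H G" and l: "l \<ge> 1" "l \<le> m" "good l m"
    and xy: "x \<in> P l" "y \<in> P l" "t l x = t l y" and U: "exts B l m x \<subseteq> U" "exts B l m y \<subseteq> U"
    and cyc: "\<And>w. all_cyc (\<lambda>s. s \<in> perms_in m H) {z \<in> U. t m z = w}"
  shows "swap l x y \<in> H"
proof (cases "x = y")
  case True
  have "swap l x y = path_act B l id" using True by (simp add: swap_def)
  then show ?thesis using subgroup.one_closed[OF H] path_act_one by simp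
next
  case False
  have m: "m \<ge> 1" using l by simp
  let ?\<tau> = "transpose x y"
  have \<tau>: "?\<tau> \<in> \<Gamma> l" using xy by (rule level_perms_transpose)
  define s where "s = lift_perm B l m ?\<tau>"
  have s: "s \<in> \<Gamma> m" unfolding s_def using l(1,2) \<tau> by (rule lift_perm_in)
  have "path_act B m (s \<circ> s) = path_act B l (?\<tau> \<circ> ?\<tau>)"
    using path_act_comp[OF m s s] path_act_comp[OF l(1) \<tau> \<tau>] lift_perm_act[OF l(1,2) \<tau>] by (simp add: s_def)
  then have "path_act B m (s \<circ> s) = path_act B m id" by (simp add: path_act_id)
  then have ss: "s \<circ> s = id" by (rule path_act_inj[OF m level_perms_comp[OF s s] level_perms_id])
  have moved: "z \<in> P m \<and> (restrict z {1..l} = x \<or> restrict z {1..l} = y)" if "s z \<noteq> z" for z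
  proof -
    have "z \<in> P m" using that s by (metis level_permsD(1) permutes_not_in)
    moreover have "?\<tau> (restrict z {1..l}) \<noteq> restrict z {1..l}" using that lift_perm_fixed unfolding s_def by metis
    ultimately show ?thesis by (auto simp: transpose_def split: if_splits)
  qed
  have s_in: "s z \<in> P m" "t m (s z) = t m z" "restrict (s z) {1..l} = ?\<tau> (restrict z {1..l})" if "z \<in> P m" for z
    using lift_perm_apply[OF l(1,2) \<tau> that] by (auto simp: s_def)
  have "s \<in> perms_in m H"
  proof (rule even_involution_in[where U = U and t = "t m" and R = "exts B l m x" and N = "\<lambda>s. s \<in> perms_in m H"])
    show "s (s z) = z" for z using fun_cong[OF ss, of z] by simp
    show "z \<in> exts B l m x \<or> s z \<in> exts B l m x" if "s z \<noteq> z" for z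
      using moved[OF that] s_in[of z] by (auto simp: exts_iff)
    show "s z \<in> U - exts B l m x" if "z \<in> exts B l m x" for z
      using that s_in[of z] False U(2) by (auto simp: exts_iff)
    show "t m (s z) = t m z" for z using s by (rule level_permsD)
    show "even (card {z \<in> exts B l m x. t m z = w})" for w
    proof (cases "w \<in> vert B m")
      case True
      then show ?thesis using l(3) xy(1) unfolding good_def ext_to_def by blast
    next
      case False
      then have e: "{z \<in> exts B l m x. t m z = w} = {}" using end_vertex_in[OF m] by (auto simp: exts_iff)
      show ?thesis unfolding e by simp
    qed
  qed (use cyc perms_in_closed[OF H m] U in auto)
  then show ?thesis unfolding s_def swap_def using lift_perm_in_perms_in[OF l(1,2) \<tau>] by simp
qed

text \<open>If the event had positive measure, recurrence along permutations \<open>b\<close> of the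
  extensions of \<open>p\<close> would give one \<open>H\<close> containing
  \<open>b \<circ> \<gamma> \<circ> inv b\<close> for a dense set of \<open>b\<close>, where
  \<gamma> is the lift of \<sigma> and displaces these extensions. Double commutators then provide
  all three-cycles on the extensions of \<open>\<sigma> p\<close>, and evenness provides the swap.
  As \<open>b\<close> commutes with the swap, the swap lies in the conjugates of \<open>H\<close> as
  well, contrary to the event.\<close>

lemma displaced_swap_AE:
  assumes IRS: "invariant_random_subgroup G \<phi>" and n: "n \<ge> 1" "n \<le> l" and s: "\<sigma> \<in> \<Gamma> n"
    and p: "p \<in> P n" "\<sigma> p \<noteq> p" and xy: "x \<in> exts B n l (\<sigma> p)" "y \<in> exts B n l (\<sigma> p)" "t l x = t l y"
  shows "measure \<phi> {H. subgroup H G \<and> path_act B n \<sigma> \<in> H \<and> swap l x y \<notin> H} = 0" (is "measure \<phi> ?A = 0")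
proof (rule ccontr)
  assume "measure \<phi> ?A \<noteq> 0"
  then have e: "measure \<phi> ?A > 0" by (simp add: zero_less_measure_iff)
  let ?e = "measure \<phi> ?A"
  have l1: "l \<ge> 1" using n by simp
  have xyP: "x \<in> P l" "y \<in> P l" using xy by (auto simp: exts_iff)
  have A: "?A \<in> sets FG.SM"
  proof -
    have eq: "?A = {H. subgroup H G \<and> path_act B n \<sigma> \<in> H} - {H. subgroup H G \<and> swap l x y \<in> H}" by auto
    show ?thesis unfolding eq
      by (intro sets.Diff FG.mem_sets path_act_carrier[OF n(1) s] swap_carrier[OF l1 xyP xy(3)])
  qed
  let ?R = "\<lambda>j. fibre_perms (exts B n (l + j) p) (t (l + j))"
  have "\<exists>H. subgroup H G \<and> (\<forall>j0. \<exists>j\<ge>j0. ?e / 2 * card (?R j) \<le> card {b \<in> ?R j. conjugation G (path_act B (l + j) (inv b)) H \<in> ?A})"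
    by (rule recurrent_conjugates[OF IRS l1 A e]) (use fibre_perms_exts_subset fibre_perms_inv in blast)+
  then obtain H where H: "subgroup H G"
    and freq: "\<And>j0. \<exists>j\<ge>j0. ?e / 2 * card (?R j) \<le> card {b \<in> ?R j. conjugation G (path_act B (l + j) (inv b)) H \<in> ?A}" by blast
  \<comment> \<open>Frequency at least \<open>?e / 2\<close> becomes density at least 2 /
    \<open>D\<close> with \<open>D\<close> independent of the level, so the level can afterwards be
    taken high enough for fibres of size \<open>D\<^sup>2 + 4\<close>.\<close>
  obtain D :: nat where D: "4 / ?e \<le> real D" using real_arch_simple by blast
  obtain m1 where m1: "\<And>m w. m \<ge> m1 \<Longrightarrow> w \<in> vert B m \<Longrightarrow> D\<^sup>2 + 4 \<le> card (ext_to n m p w)"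
    using card_ext_to_unbounded[OF n(1), of "D\<^sup>2 + 4"] p(1) by blast
  obtain m2 where m2: "\<And>m. m \<ge> m2 \<Longrightarrow> good l m" using good_eventually[OF l1] by blast
  obtain j where j: "j \<ge> max m1 m2" "?e / 2 * card (?R j) \<le> card {b \<in> ?R j. conjugation G (path_act B (l + j) (inv b)) H \<in> ?A}"
    using freq by blast
  define m where "m = l + j"
  have m: "m \<ge> 1" "n \<le> m" "l \<le> m" "m \<ge> m1" "m \<ge> m2" using j(1) n by (auto simp: m_def)
  let ?F = "fibre_perms (exts B n m p) (t m)"
  define \<gamma> where "\<gamma> = lift_perm B n m \<sigma>"
  have \<gamma>: "\<gamma> \<in> \<Gamma> m" unfolding \<gamma>_def using n(1) m(2) s by (rule lift_perm_in)
  define T where "T = {b \<in> ?F. conjugation G (path_act B m (inv b)) H \<in> ?A}"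
  have freqT: "?e / 2 * card ?F \<le> card T" using j(2) by (simp add: T_def m_def)
  have F\<Gamma>: "b \<in> \<Gamma> m" "inv b \<in> \<Gamma> m" "inv (inv b) = b" "bij b" if "b \<in> ?F" for b
  proof -
    show b: "b \<in> \<Gamma> m" using that fibre_perms_exts_subset by (rule subsetD[rotated])
    then show "inv b \<in> \<Gamma> m" by (rule level_perms_inv)
    show "bij b" using b by (rule level_permsD)
    then show "inv (inv b) = b" by (rule inv_inv_eq)
  qed
  have dense: "2 * card ?F \<le> D * card T"
  proof -
    have "2 * real (card ?F) \<le> (real D * (?e / 2)) * card ?F"
    proof (rule mult_right_mono)
      have "4 \<le> real D * ?e" using D e by (simp add: pos_divide_le_eq)
      then show "2 \<le> real D * (?e / 2)" by simp
    qed simp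
    also have "\<dots> \<le> real D * card T" using mult_left_mono[OF freqT, of "real D"] by (simp add: mult.assoc)
    finally have "real (2 * card ?F) \<le> real (D * card T)" by simp
    then show ?thesis by (simp only: of_nat_le_iff)
  qed
  have disj: "\<gamma> ` exts B n m p \<inter> exts B n m p = {}"
    using lift_perm_apply(3)[OF n(1) m(2) s] p(2) by (auto simp: \<gamma>_def exts_iff)
  have N: "b \<circ> \<gamma> \<circ> inv b \<in> perms_in m H" if "b \<in> T" for b
  proof -
    have b: "b \<in> ?F" "path_act B n \<sigma> \<in> conjugation G (path_act B m (inv b)) H" using that by (auto simp: T_def)
    then have "path_act B m \<gamma> \<in> conjugation G (path_act B m (inv b)) H"
      using lift_perm_act[OF n(1) m(2) s] by (simp add: \<gamma>_def)
    then show ?thesis using conj_path_act[OF m(1) F\<Gamma>(2)[OF b(1)] \<gamma> H] F\<Gamma>(3)[OF b(1)] by simp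
  qed
  have cyc: "all_cyc (\<lambda>s. s \<in> perms_in m H) {z \<in> exts B n m (\<sigma> p). t m z = w}" for w
  proof (cases "w \<in> vert B m")
    case True
    have "all_cyc (\<lambda>s. s \<in> perms_in m H) (\<gamma> ` {z \<in> exts B n m p. t m z = w})"
    proof (rule double_commutator_cyc[where T = T and D = D and A = "exts B n m p" and t = "t m"])
      show "D\<^sup>2 + 4 \<le> card {z \<in> exts B n m p. t m z = w}" using m1[OF m(4) True] by (simp add: ext_to_def)
      show "bij \<gamma>" using \<gamma> by (rule level_permsD)
      show "T \<subseteq> ?F" by (auto simp: T_def)
    qed (use disj N dense perms_in_closed[OF H m(1)] in auto)
    then show ?thesis unfolding \<gamma>_def lift_perm_exts[OF n(1) m(2) s p(1)] .
  next
    case False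
    then have e: "{z \<in> exts B n m (\<sigma> p). t m z = w} = {}" using end_vertex_in[OF m(1)] by (auto simp: exts_iff)
    show ?thesis unfolding e by (simp add: all_cyc_def)
  qed
  have sub: "exts B l m z \<subseteq> exts B n m (\<sigma> p)" if "z \<in> exts B n l (\<sigma> p)" for z
    using that n(2) by (auto simp: exts_iff restrict_restrict_le)
  have in_H: "swap l x y \<in> H"
    by (rule even_swap_in[OF H l1 m(3) m2[OF m(5)] xyP xy(3) sub[OF xy(1)] sub[OF xy(2)] cyc])
  have "T \<noteq> {}"
  proof
    assume "T = {}"
    then have "?e / 2 * real (card ?F) \<le> 0" using freqT by simp
    moreover have "?e / 2 * real (card ?F) > 0" using e card_fibre_perms_pos[OF finite_exts] by (intro mult_pos_pos) simp_all
    ultimately show False by linarith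
  qed
  then obtain b where b: "b \<in> ?F" "swap l x y \<notin> conjugation G (path_act B m (inv b)) H" by (auto simp: T_def)
  let ?\<tau> = "transpose x y"
  have \<tau>: "?\<tau> \<in> \<Gamma> l" using xyP xy(3) by (rule level_perms_transpose)
  let ?s = "lift_perm B l m ?\<tau>"
  have s': "?s \<in> \<Gamma> m" using l1 m(3) \<tau> by (rule lift_perm_in)
  have "inv (inv b) \<circ> ?s \<circ> inv b = ?s"
  proof (rule fibre_perms_commute)
    show "inv b \<in> ?F" using b(1) by (rule fibre_perms_inv)
    show "inj ?s" using level_permsD(3)[OF s'] by (rule bij_is_inj)
    fix z assume z: "?s z \<noteq> z"
    then have "?\<tau> (restrict z {1..l}) \<noteq> restrict z {1..l}" using lift_perm_fixed by metis
    then have "restrict z {1..l} = x \<or> restrict z {1..l} = y" by (auto simp: transpose_def split: if_splits)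
    then have "restrict z {1..n} = \<sigma> p" using xy(1,2) n(2) by (auto simp: exts_iff restrict_restrict_le)
    then show "z \<notin> exts B n m p" using p(2) by (auto simp: exts_iff)
  qed
  moreover have "path_act B m ?s \<notin> conjugation G (path_act B m (inv b)) H"
    using b(2) lift_perm_act[OF l1 m(3) \<tau>] by (simp add: swap_def)
  ultimately have "?s \<notin> perms_in m H" using conj_path_act[OF m(1) F\<Gamma>(2)[OF b(1)] s' H] by simp
  then show False using in_H lift_perm_in_perms_in[OF l1 m(3) \<tau>] by (simp add: swap_def)
qed

lemma swaps_sets:
  assumes "n \<ge> 1"
  shows "{H. subgroup H G \<and> swaps n p H} \<in> sets FG.SM"
proof -
  let ?I = "{(m, x, y). m \<ge> n \<and> x \<in> exts B n m p \<and> y \<in> exts B n m p \<and> t m x = t m y}"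
  have "?I \<subseteq> (SIGMA m:UNIV. exts B n m p \<times> exts B n m p)" by auto
  moreover have "countable (SIGMA m:UNIV. exts B n m p \<times> exts B n m p)"
    by (intro countable_SIGMA countableI_type countable_finite finite_cartesian_product finite_exts)
  ultimately have c: "countable ?I" by (rule countable_subset)
  have "{H \<in> space FG.SM. \<forall>i\<in>?I. (case i of (m, x, y) \<Rightarrow> swap m x y) \<in> H} \<in> sets FG.SM"
  proof (rule sets.sets_Collect_countable_All'[OF _ c])
    fix i assume "i \<in> ?I"
    then have "(case i of (m, x, y) \<Rightarrow> swap m x y) \<in> carrier G"
      using assms by (auto intro!: swap_carrier simp: exts_iff)
    then show "{H \<in> space FG.SM. (case i of (m, x, y) \<Rightarrow> swap m x y) \<in> H} \<in> sets FG.SM"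
      using FG.mem_sets by (simp add: FG.space_SM)
  qed
  moreover have "{H \<in> space FG.SM. \<forall>i\<in>?I. (case i of (m, x, y) \<Rightarrow> swap m x y) \<in> H} = {H. subgroup H G \<and> swaps n p H}"
    by (auto simp: swaps_def FG.space_SM)
  ultimately show ?thesis by simp
qed

text \<open>On an event of positive measure some \<open>H\<close> would contain, for a dense set of
  \<open>b\<close>, all transpositions inside the images under \<open>b\<close> of the extensions of
  \<open>p\<close> and of those of \<open>q\<close>. By \<open>dense_halves_transpose\<close> the
  halves merge, and \<open>H\<close> contains every permutation of all these extensions that
  preserves end vertices. The lifted swap of \<open>p\<close> and \<open>q\<close> is one of
  them.\<close>

lemma joined_swap_AE:
  assumes IRS: "invariant_random_subgroup G \<phi>" and n: "n \<ge> 1"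
    and pq: "p \<in> P n" "q \<in> P n" "t n p = t n q" "p \<noteq> q"
  shows "measure \<phi> {H. subgroup H G \<and> swaps n p H \<and> swaps n q H \<and> swap n p q \<notin> H} = 0" (is "measure \<phi> ?A = 0")
proof (rule ccontr)
  assume "measure \<phi> ?A \<noteq> 0"
  then have e: "measure \<phi> ?A > 0" by (simp add: zero_less_measure_iff)
  let ?e = "measure \<phi> ?A"
  have A: "?A \<in> sets FG.SM"
  proof -
    have eq: "?A = ({H. subgroup H G \<and> swaps n p H} \<inter> {H. subgroup H G \<and> swaps n q H}) - {H. subgroup H G \<and> swap n p q \<in> H}" by auto
    show ?thesis unfolding eq
      by (intro sets.Diff sets.Int FG.mem_sets[OF swap_carrier[OF n pq(1-3)]] swaps_sets[OF n])
  qed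
  define W where "W m = exts B n m p \<union> exts B n m q" for m
  have WP: "W m \<subseteq> P m" for m using exts_subset by (auto simp: W_def)
  have finW: "finite (W m)" for m by (simp add: W_def)
  let ?R = "\<lambda>j. fibre_perms (W (n + j)) (t (n + j))"
  have R\<Gamma>: "fibre_perms (W m) (t m) \<subseteq> \<Gamma> m" for m
    unfolding level_perms_def by (rule fibre_perms_mono[OF WP])
  have "\<exists>H. subgroup H G \<and> (\<forall>j0. \<exists>j\<ge>j0. ?e / 2 * card (?R j) \<le> card {b \<in> ?R j. conjugation G (path_act B (n + j) (inv b)) H \<in> ?A})"
    by (rule recurrent_conjugates[OF IRS n A e]) (use R\<Gamma> fibre_perms_inv in blast)+
  then obtain H where H: "subgroup H G"
    and freq: "\<And>j0. \<exists>j\<ge>j0. ?e / 2 * card (?R j) \<le> card {b \<in> ?R j. conjugation G (path_act B (n + j) (inv b)) H \<in> ?A}" by blast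
  obtain D :: nat where D: "4 / ?e \<le> real D" using real_arch_simple by blast
  obtain m1 where m1: "\<And>m p w. m \<ge> m1 \<Longrightarrow> p \<in> P n \<Longrightarrow> w \<in> vert B m \<Longrightarrow> D + 2 \<le> card (ext_to n m p w)"
    using card_ext_to_unbounded[OF n, of "D + 2"] by blast
  obtain j where j: "j \<ge> m1" "?e / 2 * card (?R j) \<le> card {b \<in> ?R j. conjugation G (path_act B (n + j) (inv b)) H \<in> ?A}"
    using freq by blast
  define m where "m = n + j"
  have m: "m \<ge> 1" "n \<le> m" "m \<ge> m1" using j(1) n by (auto simp: m_def)
  let ?F = "fibre_perms (W m) (t m)"
  define T where "T = {b \<in> ?F. conjugation G (path_act B m (inv b)) H \<in> ?A}"
  have freqT: "?e / 2 * card ?F \<le> card T" using j(2) by (simp add: T_def m_def)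
  have posF: "0 < card ?F" using card_fibre_perms_pos[OF finW] .
  have F\<Gamma>: "b \<in> \<Gamma> m" "inv b \<in> \<Gamma> m" "inv (inv b) = b" "bij b" if "b \<in> ?F" for b
  proof -
    show b: "b \<in> \<Gamma> m" using that R\<Gamma> by (rule subsetD[rotated])
    then show "inv b \<in> \<Gamma> m" by (rule level_perms_inv)
    show "bij b" using b by (rule level_permsD)
    then show "inv (inv b) = b" by (rule inv_inv_eq)
  qed
  have dense: "card ?F < D * card T"
  proof -
    have "real (card ?F) < 2 * real (card ?F)" using posF by simp
    also have "2 * real (card ?F) \<le> (real D * (?e / 2)) * card ?F"
    proof (rule mult_right_mono)
      have "4 \<le> real D * ?e" using D e by (simp add: pos_divide_le_eq)
      then show "2 \<le> real D * (?e / 2)" by simp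
    qed simp
    also have "\<dots> \<le> real D * card T" using mult_left_mono[OF freqT, of "real D"] by (simp add: mult.assoc)
    finally have "real (card ?F) < real (D * card T)" by simp
    then show ?thesis by (simp only: of_nat_less_iff)
  qed
  have half: "transpose (b x) (b y) \<in> perms_in m H"
    if b: "b \<in> T" and r: "r = p \<or> r = q" and xy: "x \<in> exts B n m r" "y \<in> exts B n m r" "t m x = t m y" for b r x y
  proof -
    have bF: "b \<in> ?F" and "swaps n r (conjugation G (path_act B m (inv b)) H)" using b r by (auto simp: T_def)
    then have "path_act B m (transpose x y) \<in> conjugation G (path_act B m (inv b)) H"
      using xy m(2) unfolding swaps_def swap_def by blast
    moreover have "transpose x y \<in> \<Gamma> m" using xy by (intro level_perms_transpose) (auto simp: exts_iff)
    ultimately have "b \<circ> transpose x y \<circ> inv b \<in> perms_in m H"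
      using conj_path_act[OF m(1) F\<Gamma>(2)[OF bF] _ H] F\<Gamma>(3)[OF bF] by simp
    then show ?thesis using conj_transpose[OF F\<Gamma>(4)[OF bF]] by simp
  qed
  have disj: "exts B n m p \<inter> exts B n m q = {}" using pq(4) by (auto simp: exts_iff)
  have all: "transpose x y \<in> perms_in m H" if xy: "x \<in> W m" "y \<in> W m" "t m x = t m y" for x y
  proof (rule dense_halves_transpose[where A = "exts B n m p" and B = "exts B n m q" and T = T and D = D
        and t = "t m" and w = "t m x" and N = "\<lambda>s. s \<in> perms_in m H"])
    have w: "t m x \<in> vert B m" using xy(1) WP end_vertex_in[OF m(1)] by blast
    show "D + 2 \<le> card {z \<in> exts B n m p. t m z = t m x}" "D + 2 \<le> card {z \<in> exts B n m q. t m z = t m x}"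
      using m1[OF m(3) _ w] pq by (auto simp: ext_to_def)
    show "T \<subseteq> fibre_perms (exts B n m p \<union> exts B n m q) (t m)" by (auto simp: T_def W_def)
    show "card (fibre_perms (exts B n m p \<union> exts B n m q) (t m)) < D * card T" using dense by (simp add: W_def)
    show "finite (exts B n m p)" "finite (exts B n m q)" by (rule finite_exts)+
    show "x \<in> exts B n m p \<union> exts B n m q" "y \<in> exts B n m p \<union> exts B n m q" using xy by (auto simp: W_def)
    show "t m y = t m x" using xy(3) by (rule sym)
    show "transpose (b u) (b v) \<in> perms_in m H" if "b \<in> T" "u \<in> exts B n m p" "v \<in> exts B n m p" "t m u = t m v" for b u v
      by (rule half[OF that(1) _ that(2-4)]) simp
    show "transpose (b u) (b v) \<in> perms_in m H" if "b \<in> T" "u \<in> exts B n m q" "v \<in> exts B n m q" "t m u = t m v" for b u v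
      by (rule half[OF that(1) _ that(2-4)]) simp
  qed (use disj perms_in_closed(2)[OF H m(1)] in blast)+
  have allF: "s \<in> perms_in m H" if "s \<in> ?F" for s
    by (rule fibre_perms_generated_by_transpositions[OF finW perms_in_closed(1)[OF H m(1)] perms_in_closed(2)[OF H m(1)] that])
       (use all in auto)
  have "T \<noteq> {}" using dense by auto
  then obtain b where b: "b \<in> ?F" "swap n p q \<notin> conjugation G (path_act B m (inv b)) H" by (auto simp: T_def)
  let ?\<tau> = "transpose p q"
  have \<tau>: "?\<tau> \<in> \<Gamma> n" using pq(1-3) by (rule level_perms_transpose)
  let ?s = "lift_perm B n m ?\<tau>"
  have s': "?s \<in> \<Gamma> m" using n m(2) \<tau> by (rule lift_perm_in)
  have sF: "?s \<in> ?F"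
  proof -
    have fixed: "?s z = z" if "z \<in> P m - W m" for z
    proof (rule lift_perm_fixed)
      have "restrict z {1..n} \<noteq> p" "restrict z {1..n} \<noteq> q" using that by (auto simp: W_def exts_iff)
      then show "?\<tau> (restrict z {1..n}) = restrict z {1..n}" by simp
    qed
    have "?s permutes W m"
      by (rule permutes_superset[OF level_permsD(1)[OF s']]) (use fixed in auto)
    then show ?thesis using level_permsD(2)[OF s'] by (auto simp: fibre_perms_def)
  qed
  \<comment> \<open>\<open>b\<close> belongs to the group \<open>?F\<close> that \<open>H\<close>
    contains, so conjugation by it keeps the lifted swap in \<open>?F\<close> and hence in
    \<open>H\<close>.\<close>
  have "b \<circ> ?s \<circ> inv b \<in> ?F" using b(1) sF by (intro fibre_perms_comp fibre_perms_inv)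
  then have "inv (inv b) \<circ> ?s \<circ> inv b \<in> perms_in m H" using allF F\<Gamma>(3)[OF b(1)] by simp
  then have "path_act B m ?s \<in> conjugation G (path_act B m (inv b)) H"
    using conj_path_act[OF m(1) F\<Gamma>(2)[OF b(1)] s' H] by simp
  then show False using b(2) lift_perm_act[OF n m(2) \<tau>] by (simp add: swap_def)
qed

text \<open>For almost every subgroup, membership is decided by the cylinders whose rigid stabilizer it
  contains, so that it is a pointwise stabilizer.\<close>

definition structured :: "((nat \<Rightarrow> 'b) \<Rightarrow> nat \<Rightarrow> 'b) set \<Rightarrow> bool" where
  "structured H \<longleftrightarrow>
    (\<forall>n\<ge>1. \<forall>\<sigma>\<in>\<Gamma> n. path_act B n \<sigma> \<in> H \<longleftrightarrow> (\<forall>p\<in>P n. \<sigma> p \<noteq> p \<longrightarrow> swaps n p H)) \<and>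
    (\<forall>n\<ge>1. \<forall>m\<ge>n. \<forall>p\<in>P n. swaps n p H \<longleftrightarrow> (\<forall>x\<in>exts B n m p. swaps m x H))"

lemma swaps_exts:
  assumes "n \<le> m" "swaps n p H" "x \<in> exts B n m p"
  shows "swaps m x H"
proof -
  have "exts B m l x \<subseteq> exts B n l p" for l
    using assms(1,3) restrict_restrict_le[OF assms(1)] by (auto simp: exts_iff)
  then show ?thesis using assms(1,2) order_trans[OF assms(1)] unfolding swaps_def by blast
qed

text \<open>Countably many null events are discarded; the rest is an argument about a single
  subgroup. One kind of event says that an element of \<open>H\<close> moving a path brings along
  the whole rigid stabilizer of the cylinder it moves to, the other that the rigid stabilizers of
  two cylinders over one vertex bring along the swap between them.\<close>

lemma AE_structured:
  assumes IRS: "invariant_random_subgroup G \<phi>"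
  shows "AE H in \<phi>. structured H"
proof -
  note D = FG.IRS_D[OF IRS]
  interpret prob_space \<phi> by (rule D)
  have AE0: "AE H in \<phi>. Q H" if "{H. subgroup H G \<and> \<not> Q H} \<in> sets FG.SM" "measure \<phi> {H. subgroup H G \<and> \<not> Q H} = 0" for Q
    by (rule AE_I[where N = "{H. subgroup H G \<and> \<not> Q H}"]) (use that D(2,3) in \<open>auto simp: emeasure_eq_measure\<close>)
  let ?I = "SIGMA n:{1..}. SIGMA l:{n..}. \<Gamma> n \<times> P n \<times> P l \<times> P l"
  have cI: "countable ?I" by (intro countable_SIGMA countableI_type countable_finite finite_cartesian_product finite_level_perms finite_fin_paths)
  have "AE H in \<phi>. \<forall>i\<in>?I. (case i of (n, l, \<sigma>, p, x, y) \<Rightarrow>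
      \<sigma> p \<noteq> p \<longrightarrow> x \<in> exts B n l (\<sigma> p) \<longrightarrow> y \<in> exts B n l (\<sigma> p) \<longrightarrow> t l x = t l y \<longrightarrow>
      path_act B n \<sigma> \<in> H \<longrightarrow> swap l x y \<in> H)"
  proof (subst AE_ball_countable[OF cI], intro ballI)
    fix i assume "i \<in> ?I"
    then obtain n l \<sigma> p x y where i: "i = (n, l, \<sigma>, p, x, y)" "n \<ge> 1" "n \<le> l" "\<sigma> \<in> \<Gamma> n" "p \<in> P n" "x \<in> P l" "y \<in> P l"
      by auto
    show "AE H in \<phi>. (case i of (n, l, \<sigma>, p, x, y) \<Rightarrow>
      \<sigma> p \<noteq> p \<longrightarrow> x \<in> exts B n l (\<sigma> p) \<longrightarrow> y \<in> exts B n l (\<sigma> p) \<longrightarrow> t l x = t l y \<longrightarrow>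
      path_act B n \<sigma> \<in> H \<longrightarrow> swap l x y \<in> H)"
    proof (cases "\<sigma> p \<noteq> p \<and> x \<in> exts B n l (\<sigma> p) \<and> y \<in> exts B n l (\<sigma> p) \<and> t l x = t l y")
      case True
      have "AE H in \<phi>. path_act B n \<sigma> \<in> H \<longrightarrow> swap l x y \<in> H"
      proof (rule AE0)
        have eq: "{H. subgroup H G \<and> \<not> (path_act B n \<sigma> \<in> H \<longrightarrow> swap l x y \<in> H)} =
          {H. subgroup H G \<and> path_act B n \<sigma> \<in> H} - {H. subgroup H G \<and> swap l x y \<in> H}" by auto
        have c: "path_act B n \<sigma> \<in> carrier G" "swap l x y \<in> carrier G"
          using i True path_act_carrier swap_carrier[of l x y] by auto
        show "{H. subgroup H G \<and> \<not> (path_act B n \<sigma> \<in> H \<longrightarrow> swap l x y \<in> H)} \<in> sets FG.SM"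
          unfolding eq using FG.mem_sets c by (intro sets.Diff)
        show "measure \<phi> {H. subgroup H G \<and> \<not> (path_act B n \<sigma> \<in> H \<longrightarrow> swap l x y \<in> H)} = 0"
          using displaced_swap_AE[OF IRS i(2-5)] True by simp
      qed
      then show ?thesis by (simp add: i(1))
    qed (auto simp: i(1))
  qed
  then have 1: "AE H in \<phi>. \<forall>n\<ge>1. \<forall>l\<ge>n. \<forall>\<sigma>\<in>\<Gamma> n. \<forall>p\<in>P n. \<forall>x\<in>exts B n l (\<sigma> p). \<forall>y\<in>exts B n l (\<sigma> p).
      \<sigma> p \<noteq> p \<longrightarrow> t l x = t l y \<longrightarrow> path_act B n \<sigma> \<in> H \<longrightarrow> swap l x y \<in> H"
    by (rule eventually_mono) (force simp: exts_iff)
  let ?J = "SIGMA n:{1..}. P n \<times> P n"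
  have cJ: "countable ?J" by (intro countable_SIGMA countableI_type countable_finite finite_cartesian_product finite_level_perms finite_fin_paths)
  have "AE H in \<phi>. \<forall>i\<in>?J. (case i of (n, p, q) \<Rightarrow>
      t n p = t n q \<longrightarrow> p \<noteq> q \<longrightarrow> swaps n p H \<longrightarrow> swaps n q H \<longrightarrow> swap n p q \<in> H)"
  proof (subst AE_ball_countable[OF cJ], intro ballI)
    fix i assume "i \<in> ?J"
    then obtain n p q where i: "i = (n, p, q)" "n \<ge> 1" "p \<in> P n" "q \<in> P n" by auto
    show "AE H in \<phi>. (case i of (n, p, q) \<Rightarrow>
      t n p = t n q \<longrightarrow> p \<noteq> q \<longrightarrow> swaps n p H \<longrightarrow> swaps n q H \<longrightarrow> swap n p q \<in> H)"
    proof (cases "t n p = t n q \<and> p \<noteq> q")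
      case True
      have "AE H in \<phi>. swaps n p H \<longrightarrow> swaps n q H \<longrightarrow> swap n p q \<in> H"
      proof (rule AE0)
        have eq: "{H. subgroup H G \<and> \<not> (swaps n p H \<longrightarrow> swaps n q H \<longrightarrow> swap n p q \<in> H)} =
          ({H. subgroup H G \<and> swaps n p H} \<inter> {H. subgroup H G \<and> swaps n q H}) - {H. subgroup H G \<and> swap n p q \<in> H}" by auto
        show "{H. subgroup H G \<and> \<not> (swaps n p H \<longrightarrow> swaps n q H \<longrightarrow> swap n p q \<in> H)} \<in> sets FG.SM"
          unfolding eq using FG.mem_sets swap_carrier[OF i(2-4)] swaps_sets[OF i(2)] True by (intro sets.Diff sets.Int) auto
        show "measure \<phi> {H. subgroup H G \<and> \<not> (swaps n p H \<longrightarrow> swaps n q H \<longrightarrow> swap n p q \<in> H)} = 0"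
          using joined_swap_AE[OF IRS i(2-4)] True by simp
      qed
      then show ?thesis by (simp add: i(1))
    qed (auto simp: i(1))
  qed
  then have 2: "AE H in \<phi>. \<forall>n\<ge>1. \<forall>p\<in>P n. \<forall>q\<in>P n.
      t n p = t n q \<longrightarrow> p \<noteq> q \<longrightarrow> swaps n p H \<longrightarrow> swaps n q H \<longrightarrow> swap n p q \<in> H"
    by (rule eventually_mono) force
  have "AE H in \<phi>. subgroup H G" using AE_space[of \<phi>] D(3) by simp
  then show ?thesis using 1 2
  proof eventually_elim
    case (elim H)
    note H = elim(1) and d = elim(2) and jn = elim(3)
    have join: "swap n p q \<in> H" if "n \<ge> 1" "p \<in> P n" "q \<in> P n" "t n p = t n q" "swaps n p H" "swaps n q H" for n p q
    proof (cases "p = q")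
      case True
      then show ?thesis using subgroup.one_closed[OF H] path_act_one[of n] by (simp add: swap_def)
    qed (use jn that in blast)
    have mem: "path_act B n \<sigma> \<in> H \<longleftrightarrow> (\<forall>p\<in>P n. \<sigma> p \<noteq> p \<longrightarrow> swaps n p H)" if n: "n \<ge> 1" and s: "\<sigma> \<in> \<Gamma> n" for n \<sigma>
    proof
      assume g: "path_act B n \<sigma> \<in> H"
      show "\<forall>p\<in>P n. \<sigma> p \<noteq> p \<longrightarrow> swaps n p H"
      proof (intro ballI impI)
        fix p assume p: "p \<in> P n" "\<sigma> p \<noteq> p"
        have b: "bij \<sigma>" using s by (rule level_permsD)
        \<comment> \<open>The discarded events speak of targets \<open>\<sigma> q\<close> of moved
          paths. Since \<sigma> is a permutation, every moved path \<open>p\<close> is such a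
          target.\<close>
        obtain q where q: "q \<in> P n" "p = \<sigma> q" using permutes_image[OF level_permsD(1)[OF s]] p(1) by blast
        then have "\<sigma> q \<noteq> q" using p(2) by auto
        then show "swaps n p H" unfolding swaps_def q(2) using d n s q(1) g by blast
      qed
    next
      assume *: "\<forall>p\<in>P n. \<sigma> p \<noteq> p \<longrightarrow> swaps n p H"
      have "\<sigma> \<in> perms_in n H"
      proof (rule fibre_perms_generated_by_transpositions[OF finite_fin_paths perms_in_closed(1)[OF H n] perms_in_closed(2)[OF H n] s[unfolded level_perms_def]])
        fix x y assume xy: "x \<in> P n" "y \<in> P n" "\<sigma> x \<noteq> x" "\<sigma> y \<noteq> y" "t n x = t n y"
        then have "swap n x y \<in> H" using * join n by blast
        then show "transpose x y \<in> perms_in n H"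
          using xy by (simp add: perms_in_def swap_def level_perms_transpose)
      qed
      then show "path_act B n \<sigma> \<in> H" by (simp add: perms_in_def)
    qed
    have "swaps n p H \<longleftrightarrow> (\<forall>x\<in>exts B n m p. swaps m x H)" if n: "n \<ge> 1" "n \<le> m" and p: "p \<in> P n" for n m p
    proof
      assume *: "\<forall>x\<in>exts B n m p. swaps m x H"
      show "swaps n p H"
        unfolding swaps_def
      proof (intro allI ballI impI)
        fix l x y assume l: "n \<le> l" and xy: "x \<in> exts B n l p" "y \<in> exts B n l p" "t l x = t l y"
        have l1: "l \<ge> 1" and xyP: "x \<in> P l" "y \<in> P l" using l n xy by (auto simp: exts_iff)
        show "swap l x y \<in> H"
        \<comment> \<open>From level \<open>m\<close> on, two extensions are swapped by
          \<open>join\<close>; below \<open>m\<close> the swap is lifted to level \<open>m\<close>,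
          where it moves nothing but extensions of \<open>p\<close>.\<close>
        proof (cases "m \<le> l")
          case True
          have "swaps l z H" if "z \<in> exts B n l p" for z
          proof (rule swaps_exts[OF True])
            have "restrict z {1..m} \<in> exts B n m p"
              using that n True restrict_fin_path[of z l m] by (auto simp: exts_iff restrict_restrict_le)
            then show "swaps m (restrict z {1..m}) H" using * by blast
            show "z \<in> exts B m l (restrict z {1..m})" using that by (auto simp: exts_iff)
          qed
          then show ?thesis using join[OF l1 xyP xy(3)] xy by blast
        next
          case False
          then have lm: "l \<le> m" by simp
          let ?\<tau> = "transpose x y"
          have \<tau>: "?\<tau> \<in> \<Gamma> l" using xyP xy(3) by (rule level_perms_transpose)
          let ?s = "lift_perm B l m ?\<tau>"
          have "path_act B m ?s \<in> H \<longleftrightarrow> (\<forall>z\<in>P m. ?s z \<noteq> z \<longrightarrow> swaps m z H)"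
            by (rule mem[OF _ lift_perm_in[OF l1 lm \<tau>]]) (use l1 lm in simp)
          moreover have "swaps m z H" if z: "z \<in> P m" "?s z \<noteq> z" for z
          proof -
            have "?\<tau> (restrict z {1..l}) \<noteq> restrict z {1..l}" using lift_perm_fixed z(2) by metis
            then have "restrict z {1..l} = x \<or> restrict z {1..l} = y" by (auto simp: transpose_def split: if_splits)
            then have "restrict z {1..n} = p" using xy(1,2) l by (auto simp: exts_iff restrict_restrict_le)
            then show ?thesis using * z(1) by (auto simp: exts_iff)
          qed
          ultimately show ?thesis using lift_perm_act[OF l1 lm \<tau>] by (simp add: swap_def)
        qed
      qed
    qed (use swaps_exts[OF n(2)] in blast)
    then show "structured H" unfolding structured_def using mem by blast
  qed
qed

end

section \<open>Powers of ergodic measures\<close>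

context fin_ergodic_diagram
begin

abbreviation "idx \<alpha> \<equiv> power_index k \<alpha>"
abbreviation "MM \<alpha> \<equiv> product_power k \<mu> \<alpha>"

lemma finite_idx [simp]: "finite (idx \<alpha>)" by (simp add: power_index_def)

lemma idx_fst: "j \<in> idx \<alpha> \<Longrightarrow> fst j \<in> {1..k}" by (auto simp: power_index_def)

text \<open>Outside the index set the factors are irrelevant; they are replaced by \<open>\<mu> 1\<close> because
  \<open>finite_product_prob_space\<close> wants all of them to be probability spaces.\<close>

definition factor :: "(nat \<Rightarrow> nat) \<Rightarrow> nat \<times> nat \<Rightarrow> (nat \<Rightarrow> 'b) measure" where
  "factor \<alpha> j = \<mu> (if j \<in> idx \<alpha> then fst j else 1)"

lemma factor_idx: "j \<in> idx \<alpha> \<Longrightarrow> factor \<alpha> j = \<mu> (fst j)" by (simp add: factor_def)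

lemma MM_eq: "MM \<alpha> = PiM (idx \<alpha>) (factor \<alpha>)"
  unfolding product_power_def by (rule PiM_cong) (auto simp: factor_def)

lemma factor_dom: "(if j \<in> idx \<alpha> then fst j else 1) \<in> {1..k}"
  using k idx_fst[of j \<alpha>] by auto

lemma factor_prob: "prob_space (factor \<alpha> j)"
  and factor_sets: "sets (factor \<alpha> j) = sets PS"
  and factor_space: "space (factor \<alpha> j) = X"
  using mu_prob[OF factor_dom] mu_sets[OF factor_dom] mu_space[OF factor_dom] by (auto simp: factor_def)

lemma factor_product: "finite_product_prob_space (factor \<alpha>) (idx \<alpha>)"
proof -
  interpret prob_space "factor \<alpha> j" for j by (rule factor_prob)
  show ?thesis by unfold_locales simp
qed

lemma MM_prob: "prob_space (MM \<alpha>)"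
proof -
  interpret finite_product_prob_space "factor \<alpha>" "idx \<alpha>" by (rule factor_product)
  show ?thesis unfolding MM_eq by (rule prob_space_axioms)
qed

lemma MM_space: "space (MM \<alpha>) = (\<Pi>\<^sub>E j\<in>idx \<alpha>. X)"
  by (simp add: MM_eq space_PiM factor_space)

lemma MM_box_sets: "(\<And>j. j \<in> idx \<alpha> \<Longrightarrow> A j \<in> sets PS) \<Longrightarrow> Pi\<^sub>E (idx \<alpha>) A \<in> sets (MM \<alpha>)"
  unfolding MM_eq by (intro sets_PiM_I_finite) (auto simp: factor_sets)

lemma MM_box:
  assumes "\<And>j. j \<in> idx \<alpha> \<Longrightarrow> A j \<in> sets PS"
  shows "measure (MM \<alpha>) (Pi\<^sub>E (idx \<alpha>) A) = (\<Prod>j\<in>idx \<alpha>. measure (\<mu> (fst j)) (A j))"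
proof -
  interpret finite_product_prob_space "factor \<alpha>" "idx \<alpha>" by (rule factor_product)
  have "measure (MM \<alpha>) (Pi\<^sub>E (idx \<alpha>) A) = (\<Prod>j\<in>idx \<alpha>. measure (factor \<alpha> j) (A j))"
    unfolding MM_eq by (rule prob_times) (use assms factor_sets in auto)
  also have "\<dots> = (\<Prod>j\<in>idx \<alpha>. measure (\<mu> (fst j)) (A j))" by (intro prod.cong) (auto simp: factor_idx)
  finally show ?thesis .
qed

lemma diagonal_in:
  "g \<in> carrier G \<Longrightarrow> y \<in> (\<Pi>\<^sub>E j\<in>idx \<alpha>. X) \<Longrightarrow> diagonal_action (idx \<alpha>) g y \<in> (\<Pi>\<^sub>E j\<in>idx \<alpha>. X)"
  using full_group_in by (auto simp: diagonal_action_def PiE_iff)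

lemma diagonal_measurable:
  assumes g: "g \<in> carrier G"
  shows "diagonal_action (idx \<alpha>) g \<in> measurable (MM \<alpha>) (MM \<alpha>)"
proof -
  have "(\<lambda>y. g (y j)) \<in> measurable (PiM (idx \<alpha>) (factor \<alpha>)) (factor \<alpha> j)" if j: "j \<in> idx \<alpha>" for j
  proof -
    have "g \<in> measurable (factor \<alpha> j) (factor \<alpha> j)"
      using full_group_measurable[OF g] measurable_cong_sets[OF factor_sets factor_sets] by blast
    then show ?thesis using measurable_component_singleton[OF j] by (rule measurable_compose[rotated])
  qed
  then show ?thesis unfolding MM_eq diagonal_action_def by (intro measurable_restrict)
qed

lemma diagonal_vimage_box:
  assumes g: "g \<in> carrier G"
  shows "diagonal_action (idx \<alpha>) g -` (Pi\<^sub>E (idx \<alpha>) A) \<inter> space (MM \<alpha>) = Pi\<^sub>E (idx \<alpha>) (\<lambda>j. g -` A j \<inter> X)"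
  unfolding MM_space by (auto simp: diagonal_action_def PiE_iff)

lemma diagonal_distr:
  assumes g: "g \<in> carrier G"
  shows "distr (MM \<alpha>) (MM \<alpha>) (diagonal_action (idx \<alpha>) g) = MM \<alpha>"
proof -
  interpret finite_product_prob_space "factor \<alpha>" "idx \<alpha>" by (rule factor_product)
  have "distr (MM \<alpha>) (MM \<alpha>) (diagonal_action (idx \<alpha>) g) = PiM (idx \<alpha>) (factor \<alpha>)"
  proof (rule PiM_eqI)
    fix A assume A: "\<And>j. j \<in> idx \<alpha> \<Longrightarrow> A j \<in> sets (factor \<alpha> j)"
    then have A': "\<And>j. j \<in> idx \<alpha> \<Longrightarrow> A j \<in> sets PS" by (simp add: factor_sets)
    have gA: "g -` A j \<inter> X \<in> sets PS" if "j \<in> idx \<alpha>" for j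
      using measurable_sets[OF full_group_measurable[OF g] A'[OF that]] by (simp add: space_PS)
    have "emeasure (distr (MM \<alpha>) (MM \<alpha>) (diagonal_action (idx \<alpha>) g)) (Pi\<^sub>E (idx \<alpha>) A) = emeasure (MM \<alpha>) (Pi\<^sub>E (idx \<alpha>) (\<lambda>j. g -` A j \<inter> X))"
      using diagonal_measurable[OF g] MM_box_sets[OF A'] by (subst emeasure_distr) (auto simp: diagonal_vimage_box[OF g])
    also have "\<dots> = (\<Prod>j\<in>idx \<alpha>. emeasure (factor \<alpha> j) (g -` A j \<inter> X))"
      unfolding MM_eq by (rule emeasure_PiM) (use gA factor_sets in auto)
    also have "\<dots> = (\<Prod>j\<in>idx \<alpha>. emeasure (factor \<alpha> j) (A j))"
    proof (rule prod.cong[OF refl])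
      fix j assume j: "j \<in> idx \<alpha>"
      have "measure (factor \<alpha> j) (g -` A j \<inter> X) = measure (factor \<alpha> j) (A j)"
        unfolding factor_idx[OF j] using A'[OF j] mu_sets[OF idx_fst[OF j]]
        by (intro inv_measure_vimage[OF mu_inv[OF idx_fst[OF j]] g]) simp
      then show "emeasure (factor \<alpha> j) (g -` A j \<inter> X) = emeasure (factor \<alpha> j) (A j)"
        by (simp add: M.emeasure_eq_measure)
    qed
    finally show "emeasure (distr (MM \<alpha>) (MM \<alpha>) (diagonal_action (idx \<alpha>) g)) (Pi\<^sub>E (idx \<alpha>) A) = (\<Prod>j\<in>idx \<alpha>. emeasure (factor \<alpha> j) (A j))" .
  qed (auto simp: MM_eq)
  then show ?thesis by (simp add: MM_eq)
qed

subsection \<open>Ergodicity of the diagonal action\<close>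

definition cell :: "(nat \<Rightarrow> nat) \<Rightarrow> nat \<Rightarrow> (nat \<times> nat \<Rightarrow> nat \<Rightarrow> 'b) \<Rightarrow> (nat \<times> nat \<Rightarrow> nat \<Rightarrow> 'b) set" where
  "cell \<alpha> N u = (\<Pi>\<^sub>E j\<in>idx \<alpha>. cyl N (u j))"

definition cellw :: "(nat \<Rightarrow> nat) \<Rightarrow> nat \<Rightarrow> (nat \<times> nat \<Rightarrow> nat \<Rightarrow> 'b) \<Rightarrow> real" where
  "cellw \<alpha> N u = (\<Prod>j\<in>idx \<alpha>. weight (\<mu> (fst j)) (N, u j))"

abbreviation "types \<alpha> N \<equiv> (\<Pi>\<^sub>E j\<in>idx \<alpha>. P N)"

lemma finite_types [simp]: "finite (types \<alpha> N)" by (intro finite_PiE) auto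

lemma cell_measure: "N \<ge> 1 \<Longrightarrow> measure (MM \<alpha>) (cell \<alpha> N u) = cellw \<alpha> N u"
  unfolding cell_def cellw_def by (subst MM_box) (auto simp: weight_def)

lemma cell_sets: "N \<ge> 1 \<Longrightarrow> cell \<alpha> N u \<in> sets (MM \<alpha>)"
  unfolding cell_def by (rule MM_box_sets) auto

lemma weight_mu_nonneg: "i \<in> {1..k} \<Longrightarrow> 0 \<le> weight (\<mu> i) s"
  by (cases s) (simp add: weight_def)

lemma cellw_nonneg: "0 \<le> cellw \<alpha> N u"
  unfolding cellw_def using idx_fst by (intro prod_nonneg weight_mu_nonneg) auto

lemma weight_total: "i \<in> {1..k} \<Longrightarrow> N \<ge> 1 \<Longrightarrow> (\<Sum>x\<in>P N. weight (\<mu> i) (N, x)) = 1"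
  by (intro inv_weight_sum_level inv_weight_weight mu_inv)

lemma sum_cellw_prod:
  assumes N: "N \<ge> 1"
  shows "(\<Sum>u\<in>types \<alpha> N. cellw \<alpha> N u * (\<Prod>j\<in>idx \<alpha>. f j (u j))) = (\<Prod>j\<in>idx \<alpha>. \<Sum>x\<in>P N. weight (\<mu> (fst j)) (N, x) * f j x)"
  unfolding cellw_def prod.distrib[symmetric] by (rule prod_sum_PiE[symmetric]) auto

lemma sum_cellw_coordinate:
  assumes N: "N \<ge> 1" and j: "j \<in> idx \<alpha>"
  shows "(\<Sum>u\<in>types \<alpha> N. cellw \<alpha> N u * f (u j)) = (\<Sum>x\<in>P N. weight (\<mu> (fst j)) (N, x) * f x)"
proof -
  let ?f = "\<lambda>l x. if l = j then f x else 1"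
  have "(\<Sum>u\<in>types \<alpha> N. cellw \<alpha> N u * f (u j)) = (\<Sum>u\<in>types \<alpha> N. cellw \<alpha> N u * (\<Prod>l\<in>idx \<alpha>. ?f l (u l)))"
    using j by simp
  also have "\<dots> = (\<Prod>l\<in>idx \<alpha>. \<Sum>x\<in>P N. weight (\<mu> (fst l)) (N, x) * ?f l x)" by (rule sum_cellw_prod[OF N])
  also have "\<dots> = (\<Prod>l\<in>idx \<alpha>. if l = j then (\<Sum>x\<in>P N. weight (\<mu> (fst j)) (N, x) * f x) else 1)"
    using weight_total[OF idx_fst N] by (intro prod.cong refl) auto
  also have "\<dots> = (\<Sum>x\<in>P N. weight (\<mu> (fst j)) (N, x) * f x)" using j by simp
  finally show ?thesis .
qed

lemma sum_cellw_total: "N \<ge> 1 \<Longrightarrow> (\<Sum>u\<in>types \<alpha> N. cellw \<alpha> N u) = 1"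
  using sum_cellw_prod[of N \<alpha> "\<lambda>_ _. 1"] weight_total[OF idx_fst] by simp

text \<open>The coordinates are independent, and a given path is hit with probability at most 1 over
  the size of its fibre. Collisions have to be rare because a permutation moves equal coordinates
  together, which destroys independence.\<close>

lemma sum_cellw_collision:
  assumes N: "N \<ge> 1" and h: "h > 0" "\<And>w. w \<in> vert B N \<Longrightarrow> h \<le> real (card (fibre N w))"
    and j: "j \<in> idx \<alpha>" "l \<in> idx \<alpha>" "j \<noteq> l"
  shows "(\<Sum>u\<in>types \<alpha> N. if u j = u l then cellw \<alpha> N u else 0) \<le> 1 / h"
proof -
  have ij: "fst j \<in> {1..k}" "fst l \<in> {1..k}" using idx_fst j by auto
  let ?f = "\<lambda>x i y. if i = j \<or> i = l then (if y = x then 1 else 0) else (1::real)"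
  have ind: "(\<Prod>i\<in>idx \<alpha>. ?f x i (u i)) = (if u j = x \<and> u l = x then 1 else 0)" for x u
  proof -
    have "(\<Prod>i\<in>idx \<alpha>. ?f x i (u i)) = (\<Prod>i\<in>{j, l}. ?f x i (u i))"
      using j by (intro prod.mono_neutral_right) auto
    then show ?thesis using j by simp
  qed
  have "(\<Sum>u\<in>types \<alpha> N. if u j = u l then cellw \<alpha> N u else 0) = (\<Sum>u\<in>types \<alpha> N. \<Sum>x\<in>P N. cellw \<alpha> N u * (\<Prod>i\<in>idx \<alpha>. ?f x i (u i)))"
  proof (rule sum.cong[OF refl])
    fix u assume u: "u \<in> types \<alpha> N"
    have "(\<Sum>x\<in>P N. cellw \<alpha> N u * (if u j = x \<and> u l = x then 1 else 0)) = (\<Sum>x\<in>P N. if x = u j then (if u j = u l then cellw \<alpha> N u else 0) else 0)"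
      by (intro sum.cong) auto
    also have "\<dots> = (if u j = u l then cellw \<alpha> N u else 0)" using u j by (simp add: PiE_iff)
    finally show "(if u j = u l then cellw \<alpha> N u else 0) = (\<Sum>x\<in>P N. cellw \<alpha> N u * (\<Prod>i\<in>idx \<alpha>. ?f x i (u i)))"
      unfolding ind by simp
  qed
  also have "\<dots> = (\<Sum>x\<in>P N. \<Sum>u\<in>types \<alpha> N. cellw \<alpha> N u * (\<Prod>i\<in>idx \<alpha>. ?f x i (u i)))" by (rule sum.swap)
  also have "\<dots> = (\<Sum>x\<in>P N. weight (\<mu> (fst j)) (N, x) * weight (\<mu> (fst l)) (N, x))"
  proof (rule sum.cong[OF refl])
    fix x assume x: "x \<in> P N"
    have "(\<Sum>u\<in>types \<alpha> N. cellw \<alpha> N u * (\<Prod>i\<in>idx \<alpha>. ?f x i (u i))) = (\<Prod>i\<in>idx \<alpha>. \<Sum>y\<in>P N. weight (\<mu> (fst i)) (N, y) * ?f x i y)"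
      by (rule sum_cellw_prod[OF N])
    also have "\<dots> = (\<Prod>i\<in>{j, l}. \<Sum>y\<in>P N. weight (\<mu> (fst i)) (N, y) * ?f x i y)"
      using j weight_total[OF idx_fst N] by (intro prod.mono_neutral_right) auto
    also have "\<dots> = (\<Prod>i\<in>{j, l}. weight (\<mu> (fst i)) (N, x))"
    proof (rule prod.cong[OF refl])
      fix i assume "i \<in> {j, l}"
      then have "(\<Sum>y\<in>P N. weight (\<mu> (fst i)) (N, y) * ?f x i y) = (\<Sum>y\<in>P N. if y = x then weight (\<mu> (fst i)) (N, y) else 0)"
        by (intro sum.cong refl) auto
      then show "(\<Sum>y\<in>P N. weight (\<mu> (fst i)) (N, y) * ?f x i y) = weight (\<mu> (fst i)) (N, x)"
        using x by simp
    qed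
    also have "\<dots> = weight (\<mu> (fst j)) (N, x) * weight (\<mu> (fst l)) (N, x)" using j by simp
    finally show "(\<Sum>u\<in>types \<alpha> N. cellw \<alpha> N u * (\<Prod>i\<in>idx \<alpha>. ?f x i (u i))) = weight (\<mu> (fst j)) (N, x) * weight (\<mu> (fst l)) (N, x)" .
  qed
  also have "\<dots> \<le> (\<Sum>x\<in>P N. weight (\<mu> (fst j)) (N, x) * (1 / h))"
  proof (rule sum_mono)
    fix x assume x: "x \<in> P N"
    have w: "t N x \<in> vert B N" using x N by (intro end_vertex_in)
    have "vmass (fst l) N (t N x) \<le> (\<Sum>w\<in>vert B N. vmass (fst l) N w)"
      using w finite_vert vmass_nonneg[OF ij(2) N] by (intro member_le_sum) auto
    then have "vmass (fst l) N (t N x) \<le> 1" using vmass_total[OF ij(2) N] by simp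
    then have "vmass (fst l) N (t N x) / card (fibre N (t N x)) \<le> 1 / h"
      using h(1) h(2)[OF w] vmass_nonneg[OF ij(2) N] by (intro frac_le) auto
    then have "weight (\<mu> (fst l)) (N, x) \<le> 1 / h" using weight_fibre[OF ij(2) N x] by simp
    then show "weight (\<mu> (fst j)) (N, x) * weight (\<mu> (fst l)) (N, x) \<le> weight (\<mu> (fst j)) (N, x) * (1 / h)"
      using weight_mu_nonneg[OF ij(1)] by (intro mult_left_mono)
  qed
  also have "\<dots> = 1 / h" using weight_total[OF ij(1) N] by (simp add: sum_distrib_right[symmetric] sum_divide_distrib[symmetric])
  finally show ?thesis .
qed

definition freq :: "(nat \<Rightarrow> nat) \<Rightarrow> nat \<Rightarrow> (nat \<times> nat \<Rightarrow> nat \<Rightarrow> 'b) \<Rightarrow> (nat \<times> nat \<Rightarrow> (nat \<Rightarrow> 'b) set) \<Rightarrow> real" where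
  "freq \<alpha> N u A = real (card {\<sigma> \<in> \<Gamma> N. \<forall>j\<in>idx \<alpha>. \<sigma> (u j) \<in> A j}) / card (\<Gamma> N)"

lemma freq_bounds: "0 \<le> freq \<alpha> N u A" "freq \<alpha> N u A \<le> 1"
proof -
  have "card {\<sigma> \<in> \<Gamma> N. \<forall>j\<in>idx \<alpha>. \<sigma> (u j) \<in> A j} \<le> card (\<Gamma> N)" by (intro card_mono) auto
  then show "freq \<alpha> N u A \<le> 1" using card_level_perms_pos[of N] by (simp add: freq_def)
qed (simp add: freq_def)

text \<open>\<open>fibre_perms_independence\<close> for the paths \<open>u j\<close>; injectivity of
  \<open>u\<close> turns the product over paths into one over indices.\<close>

lemma freq_near_prod:
  assumes N: "N \<ge> 1" and h: "h > 0" "\<And>w. w \<in> vert B N \<Longrightarrow> h \<le> real (card (fibre N w))"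
    and u: "u \<in> types \<alpha> N" "inj_on u (idx \<alpha>)"
  shows "\<bar>freq \<alpha> N u A - (\<Prod>j\<in>idx \<alpha>. real (card (A j \<inter> fibre N (t N (u j)))) / card (fibre N (t N (u j))))\<bar> \<le> (card (idx \<alpha>))\<^sup>2 / h"
proof -
  let ?J = "u ` idx \<alpha>"
  define A' where "A' p = A (inv_into (idx \<alpha>) u p)" for p
  have A': "A' (u j) = A j" if "j \<in> idx \<alpha>" for j using u(2) that by (simp add: A'_def)
  have fib: "{x \<in> P N. t N x = t N p} = fibre N (t N p)" for p by (simp add: fibre_def)
  have J: "?J \<subseteq> P N" using u(1) by auto
  have "\<bar>real (card {\<sigma> \<in> \<Gamma> N. \<forall>p\<in>?J. \<sigma> p \<in> A' p}) / card (\<Gamma> N) -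
     (\<Prod>p\<in>?J. real (card (A' p \<inter> fibre N (t N p))) / card (fibre N (t N p)))\<bar> \<le> (card ?J)\<^sup>2 / h"
    unfolding level_perms_def fib[symmetric]
    by (rule fibre_perms_independence) (use h(1) h(2) end_vertex_in[OF N] J in \<open>auto simp: fib\<close>)
  moreover have "{\<sigma> \<in> \<Gamma> N. \<forall>p\<in>?J. \<sigma> p \<in> A' p} = {\<sigma> \<in> \<Gamma> N. \<forall>j\<in>idx \<alpha>. \<sigma> (u j) \<in> A j}" using A' by auto
  moreover have "(\<Prod>p\<in>?J. real (card (A' p \<inter> fibre N (t N p))) / card (fibre N (t N p))) =
     (\<Prod>j\<in>idx \<alpha>. real (card (A j \<inter> fibre N (t N (u j)))) / card (fibre N (t N (u j))))"
    using u(2) A' by (simp add: prod.reindex)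
  moreover have "card ?J = card (idx \<alpha>)" using u(2) by (rule card_image)
  ultimately show ?thesis by (simp add: freq_def)
qed

lemma cell_partition:
  assumes N: "N \<ge> 1" and A: "A \<in> sets (MM \<alpha>)"
  shows "measure (MM \<alpha>) A = (\<Sum>u\<in>types \<alpha> N. measure (MM \<alpha>) (A \<inter> cell \<alpha> N u))"
proof -
  interpret prob_space "MM \<alpha>" by (rule MM_prob)
  have AX: "A \<subseteq> (\<Pi>\<^sub>E j\<in>idx \<alpha>. X)" using sets.sets_into_space[OF A] by (simp add: MM_space)
  have "A = (\<Union>u\<in>types \<alpha> N. A \<inter> cell \<alpha> N u)"
  proof
    show "A \<subseteq> (\<Union>u\<in>types \<alpha> N. A \<inter> cell \<alpha> N u)"
    proof
      fix y assume y: "y \<in> A"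
      then have yX: "y \<in> (\<Pi>\<^sub>E j\<in>idx \<alpha>. X)" using AX by blast
      let ?u = "\<lambda>j\<in>idx \<alpha>. restrict (y j) {1..N}"
      have "?u \<in> types \<alpha> N" using yX by (auto simp: PiE_iff)
      moreover have "y \<in> cell \<alpha> N ?u" using yX by (auto simp: cell_def PiE_iff cylinder_def)
      ultimately show "y \<in> (\<Union>u\<in>types \<alpha> N. A \<inter> cell \<alpha> N u)" using y by blast
    qed
  qed auto
  moreover have "measure (MM \<alpha>) (\<Union>u\<in>types \<alpha> N. A \<inter> cell \<alpha> N u) = (\<Sum>u\<in>types \<alpha> N. measure (MM \<alpha>) (A \<inter> cell \<alpha> N u))"
  proof (rule finite_measure_finite_Union)
    show "disjoint_family_on (\<lambda>u. A \<inter> cell \<alpha> N u) (types \<alpha> N)"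
      unfolding disjoint_family_on_def
    proof (intro ballI impI, rule ccontr)
      fix u v assume uv: "u \<in> types \<alpha> N" "v \<in> types \<alpha> N" "u \<noteq> v" "(A \<inter> cell \<alpha> N u) \<inter> (A \<inter> cell \<alpha> N v) \<noteq> {}"
      then obtain y where y: "y \<in> cell \<alpha> N u" "y \<in> cell \<alpha> N v" by blast
      have "u j = v j" if "j \<in> idx \<alpha>" for j
        using PiE_mem[OF y(1)[unfolded cell_def] that] PiE_mem[OF y(2)[unfolded cell_def] that] by (simp add: cylinder_def)
      then have "u = v" using PiE_ext[OF uv(1,2)] by blast
      then show False using uv(3) by simp
    qed
    show "(\<lambda>u. A \<inter> cell \<alpha> N u) ` types \<alpha> N \<subseteq> sets (MM \<alpha>)" using A cell_sets[OF N] by auto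
  qed simp
  ultimately show ?thesis by simp
qed

text \<open>Every \<sigma> in \<open>\<Gamma> N\<close> moves the box while \<open>A\<close> and the
  measure stay put; the formula averages over \<sigma>. On a cell of level \<open>N\<close> the
  preimage of the box is all or nothing, as decided by the paths
  \<open>\<sigma> (u j)\<close>.\<close>

lemma box_invariant_average:
  assumes N: "N \<ge> 1" and s: "\<And>j. j \<in> idx \<alpha> \<Longrightarrow> 1 \<le> n j \<and> n j \<le> N \<and> p j \<in> P (n j)"
    and A: "A \<in> sets (MM \<alpha>)" and inv: "\<And>g. g \<in> carrier G \<Longrightarrow> diagonal_action (idx \<alpha>) g -` A \<inter> space (MM \<alpha>) = A"
  shows "measure (MM \<alpha>) ((\<Pi>\<^sub>E j\<in>idx \<alpha>. cyl (n j) (p j)) \<inter> A) =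
    (\<Sum>u\<in>types \<alpha> N. measure (MM \<alpha>) (A \<inter> cell \<alpha> N u) * freq \<alpha> N u (\<lambda>j. exts B (n j) N (p j)))"
proof -
  interpret prob_space "MM \<alpha>" by (rule MM_prob)
  let ?R = "\<Pi>\<^sub>E j\<in>idx \<alpha>. cyl (n j) (p j)"
  have R: "?R \<in> sets (MM \<alpha>)" using s by (intro MM_box_sets cyl_sets) auto
  have one: "measure (MM \<alpha>) (?R \<inter> A) = (\<Sum>u\<in>types \<alpha> N. measure (MM \<alpha>) (A \<inter> cell \<alpha> N u) * (if \<forall>j\<in>idx \<alpha>. \<sigma> (u j) \<in> exts B (n j) N (p j) then 1 else 0))"
    if \<sigma>: "\<sigma> \<in> \<Gamma> N" for \<sigma>
  proof -
    let ?g = "path_act B N \<sigma>"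
    let ?d = "diagonal_action (idx \<alpha>) ?g"
    have g: "?g \<in> carrier G" using N \<sigma> by (rule path_act_carrier)
    have dR: "?d -` ?R \<inter> space (MM \<alpha>) \<in> sets (MM \<alpha>)" using diagonal_measurable[OF g] R by (rule measurable_sets)
    have "measure (MM \<alpha>) (?R \<inter> A) = measure (distr (MM \<alpha>) (MM \<alpha>) ?d) (?R \<inter> A)" using diagonal_distr[OF g] by simp
    also have "\<dots> = measure (MM \<alpha>) (?d -` (?R \<inter> A) \<inter> space (MM \<alpha>))"
      using diagonal_measurable[OF g] R A by (intro measure_distr) auto
    also have "?d -` (?R \<inter> A) \<inter> space (MM \<alpha>) = (?d -` ?R \<inter> space (MM \<alpha>)) \<inter> A" using inv[OF g] by blast
    also have "measure (MM \<alpha>) \<dots> = (\<Sum>u\<in>types \<alpha> N. measure (MM \<alpha>) ((?d -` ?R \<inter> space (MM \<alpha>)) \<inter> A \<inter> cell \<alpha> N u))"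
      using dR A by (intro cell_partition[OF N]) auto
    also have "\<dots> = (\<Sum>u\<in>types \<alpha> N. measure (MM \<alpha>) (A \<inter> cell \<alpha> N u) * (if \<forall>j\<in>idx \<alpha>. \<sigma> (u j) \<in> exts B (n j) N (p j) then 1 else 0))"
    proof (rule sum.cong[OF refl])
      fix u assume u: "u \<in> types \<alpha> N"
      have in_R: "y \<in> ?d -` ?R \<inter> space (MM \<alpha>) \<longleftrightarrow> (\<forall>j\<in>idx \<alpha>. \<sigma> (u j) \<in> exts B (n j) N (p j))" if y: "y \<in> cell \<alpha> N u" for y
      proof -
        have yj: "y j \<in> X" "restrict (y j) {1..N} = u j" if "j \<in> idx \<alpha>" for j
          using PiE_mem[OF y[unfolded cell_def] that] by (auto simp: cylinder_def)
        have yP: "y \<in> (\<Pi>\<^sub>E j\<in>idx \<alpha>. X)" using y by (auto simp: cell_def PiE_iff cylinder_def)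
        have "?g (y j) \<in> cyl (n j) (p j) \<longleftrightarrow> \<sigma> (u j) \<in> exts B (n j) N (p j)" if j: "j \<in> idx \<alpha>" for j
        proof -
          have gy: "?g (y j) \<in> X" "restrict (?g (y j)) {1..N} = \<sigma> (u j)"
            using path_act_in[OF N \<sigma> yj(1)[OF j]] yj(2)[OF j] by auto
          have "restrict (?g (y j)) {1..n j} = restrict (\<sigma> (u j)) {1..n j}"
            using s[OF j] restrict_restrict_le[of "n j" N "?g (y j)"] gy(2) by simp
          moreover have "\<sigma> (u j) \<in> P N" using level_permsD(4)[OF \<sigma>] u j by (auto simp: PiE_iff)
          ultimately show ?thesis using gy(1) by (simp add: cylinder_def exts_iff)
        qed
        then show ?thesis using yP by (auto simp: MM_space diagonal_action_def PiE_iff)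
      qed
      show "measure (MM \<alpha>) ((?d -` ?R \<inter> space (MM \<alpha>)) \<inter> A \<inter> cell \<alpha> N u) =
        measure (MM \<alpha>) (A \<inter> cell \<alpha> N u) * (if \<forall>j\<in>idx \<alpha>. \<sigma> (u j) \<in> exts B (n j) N (p j) then 1 else 0)"
      proof (cases "\<forall>j\<in>idx \<alpha>. \<sigma> (u j) \<in> exts B (n j) N (p j)")
        case True
        then have "(?d -` ?R \<inter> space (MM \<alpha>)) \<inter> A \<inter> cell \<alpha> N u = A \<inter> cell \<alpha> N u" using in_R by blast
        then show ?thesis using True by simp
      next
        case False
        then have e: "(?d -` ?R \<inter> space (MM \<alpha>)) \<inter> A \<inter> cell \<alpha> N u = {}" using in_R by blast
        show ?thesis unfolding if_not_P[OF False] e by simp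
      qed
    qed
    finally show ?thesis .
  qed
  have fr: "freq \<alpha> N u C = (\<Sum>\<sigma>\<in>\<Gamma> N. if \<forall>j\<in>idx \<alpha>. \<sigma> (u j) \<in> C j then 1 else 0) / card (\<Gamma> N)" for u C
    by (simp add: freq_def sum.If_cases Int_def)
  have "real (card (\<Gamma> N)) * measure (MM \<alpha>) (?R \<inter> A) = (\<Sum>\<sigma>\<in>\<Gamma> N. measure (MM \<alpha>) (?R \<inter> A))" by simp
  also have "\<dots> = (\<Sum>\<sigma>\<in>\<Gamma> N. \<Sum>u\<in>types \<alpha> N. measure (MM \<alpha>) (A \<inter> cell \<alpha> N u) * (if \<forall>j\<in>idx \<alpha>. \<sigma> (u j) \<in> exts B (n j) N (p j) then 1 else 0))"
    by (intro sum.cong refl one)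
  also have "\<dots> = (\<Sum>u\<in>types \<alpha> N. measure (MM \<alpha>) (A \<inter> cell \<alpha> N u) * (\<Sum>\<sigma>\<in>\<Gamma> N. if \<forall>j\<in>idx \<alpha>. \<sigma> (u j) \<in> exts B (n j) N (p j) then 1 else 0))"
    unfolding sum_distrib_left by (rule sum.swap)
  also have "\<dots> = real (card (\<Gamma> N)) * (\<Sum>u\<in>types \<alpha> N. measure (MM \<alpha>) (A \<inter> cell \<alpha> N u) * freq \<alpha> N u (\<lambda>j. exts B (n j) N (p j)))"
    unfolding fr sum_distrib_left[of "real (card (\<Gamma> N))"] using card_level_perms_pos[of N] by (intro sum.cong refl) simp
  finally show ?thesis using card_level_perms_pos[of N] by (auto simp: card_gt_0_iff)
qed

text \<open>In the averaging formula \<open>freq\<close> is replaced by the constant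
  \<open>c\<close>. The error on a cell is at most the sum of \<open>r\<^sup>2 / h\<close> for the
  dependence between values of a permutation, the number of colliding pairs of coordinates, and the
  deviations of the fibre densities from the weights. Integrated over the cells, all three become
  small at high levels.\<close>

lemma box_invariant_independent:
  assumes s: "\<And>j. j \<in> idx \<alpha> \<Longrightarrow> 1 \<le> n j \<and> p j \<in> P (n j)"
    and A: "A \<in> sets (MM \<alpha>)" and inv: "\<And>g. g \<in> carrier G \<Longrightarrow> diagonal_action (idx \<alpha>) g -` A \<inter> space (MM \<alpha>) = A"
  shows "measure (MM \<alpha>) ((\<Pi>\<^sub>E j\<in>idx \<alpha>. cyl (n j) (p j)) \<inter> A) =
    measure (MM \<alpha>) (\<Pi>\<^sub>E j\<in>idx \<alpha>. cyl (n j) (p j)) * measure (MM \<alpha>) A"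
proof -
  interpret prob_space "MM \<alpha>" by (rule MM_prob)
  let ?R = "\<Pi>\<^sub>E j\<in>idx \<alpha>. cyl (n j) (p j)"
  let ?w = "\<lambda>j. weight (\<mu> (fst j)) (n j, p j)"
  define c where "c = (\<Prod>j\<in>idx \<alpha>. ?w j)"
  define r where "r = card (idx \<alpha>)"
  define L where "L j N = (\<Sum>w\<in>vert B N. vmass (fst j) N w * \<bar>dens N w (n j, p j) - ?w j\<bar>)" for j N
  have sI: "(n j, p j) \<in> cyl_index" if "j \<in> idx \<alpha>" for j using s[OF that] by (simp add: cyl_index_def)
  have c_eq: "measure (MM \<alpha>) ?R = c"
    unfolding c_def using s by (subst MM_box) (auto simp: weight_def)
  have w01: "0 \<le> ?w j \<and> ?w j \<le> 1" if "j \<in> idx \<alpha>" for j by (rule mu_bounds[OF idx_fst[OF that] sI[OF that]])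
  have c01: "0 \<le> c" "c \<le> 1" unfolding c_def using w01 by (auto intro: prod_nonneg prod_le_1)
  have L0: "(\<lambda>N. \<Sum>j\<in>idx \<alpha>. L j N) \<longlonglongrightarrow> (\<Sum>j\<in>idx \<alpha>. 0)"
    unfolding L_def by (intro tendsto_sum dens_L1_limit idx_fst sI)
  have est: "\<bar>measure (MM \<alpha>) (?R \<inter> A) - c * measure (MM \<alpha>) A\<bar> \<le> 2 * (real r)\<^sup>2 / h + (\<Sum>j\<in>idx \<alpha>. L j N)"
    if N: "N \<ge> 1" "\<And>j. j \<in> idx \<alpha> \<Longrightarrow> n j \<le> N" and h: "h > 0" "\<And>w. w \<in> vert B N \<Longrightarrow> h \<le> real (card (fibre N w))" for N h
  proof -
    let ?fr = "\<lambda>u. freq \<alpha> N u (\<lambda>j. exts B (n j) N (p j))"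
    let ?W = "cellw \<alpha> N"
    let ?d = "\<lambda>u j. dens N (t N (u j)) (n j, p j)"
    let ?pairs = "{(j, l) \<in> idx \<alpha> \<times> idx \<alpha>. j \<noteq> l}"
    have fp: "finite ?pairs" by (rule finite_subset[of _ "idx \<alpha> \<times> idx \<alpha>"]) auto
    have "\<bar>measure (MM \<alpha>) (?R \<inter> A) - c * measure (MM \<alpha>) A\<bar> = \<bar>\<Sum>u\<in>types \<alpha> N. measure (MM \<alpha>) (A \<inter> cell \<alpha> N u) * (?fr u - c)\<bar>"
      using box_invariant_average[OF N(1) _ A inv, of n p] s N(2) cell_partition[OF N(1) A]
      by (simp add: right_diff_distrib sum_subtractf sum_distrib_left mult.commute)
    also have "\<dots> \<le> (\<Sum>u\<in>types \<alpha> N. \<bar>measure (MM \<alpha>) (A \<inter> cell \<alpha> N u) * (?fr u - c)\<bar>)" by (rule sum_abs)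
    also have "\<dots> \<le> (\<Sum>u\<in>types \<alpha> N. ?W u * (r\<^sup>2 / h + (\<Sum>z\<in>?pairs. if u (fst z) = u (snd z) then 1 else 0) + (\<Sum>j\<in>idx \<alpha>. \<bar>?d u j - ?w j\<bar>)))"
    proof (rule sum_mono)
      fix u assume u: "u \<in> types \<alpha> N"
      have 1: "measure (MM \<alpha>) (A \<inter> cell \<alpha> N u) \<le> ?W u"
      proof -
        have "measure (MM \<alpha>) (A \<inter> cell \<alpha> N u) \<le> measure (MM \<alpha>) (cell \<alpha> N u)"
          by (rule finite_measure_mono[OF Int_lower2 cell_sets[OF N(1)]])
        then show ?thesis by (simp only: cell_measure[OF N(1)])
      qed
      have nn: "0 \<le> (\<Sum>z\<in>?pairs. if u (fst z) = u (snd z) then 1 else (0::real))" "0 \<le> (\<Sum>j\<in>idx \<alpha>. \<bar>?d u j - ?w j\<bar>)"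
        by (rule sum_nonneg, simp)+
      have 2: "\<bar>?fr u - c\<bar> \<le> r\<^sup>2 / h + (\<Sum>z\<in>?pairs. if u (fst z) = u (snd z) then 1 else 0) + (\<Sum>j\<in>idx \<alpha>. \<bar>?d u j - ?w j\<bar>)"
      proof (cases "inj_on u (idx \<alpha>)")
        case True
        have "exts B (n j) N (p j) \<inter> fibre N (t N (u j)) = ext_to (n j) N (p j) (t N (u j))" for j
          by (auto simp: ext_to_def fibre_def exts_iff)
        then have "\<bar>?fr u - (\<Prod>j\<in>idx \<alpha>. ?d u j)\<bar> \<le> r\<^sup>2 / h"
          using freq_near_prod[OF N(1) h u True, of "\<lambda>j. exts B (n j) N (p j)"] by (simp add: dens_def r_def)
        moreover have "\<bar>(\<Prod>j\<in>idx \<alpha>. ?d u j) - c\<bar> \<le> (\<Sum>j\<in>idx \<alpha>. \<bar>?d u j - ?w j\<bar>)"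
          unfolding c_def using norm_prod_diff[of "idx \<alpha>" "?d u" ?w] dens_bounds w01 by (simp add: abs_le_iff)
        ultimately show ?thesis using nn by linarith
      next
        case False
        then obtain j l where jl: "j \<in> idx \<alpha>" "l \<in> idx \<alpha>" "j \<noteq> l" "u j = u l" by (auto simp: inj_on_def)
        have "(\<lambda>z. if u (fst z) = u (snd z) then 1 else (0::real)) (j, l) \<le> (\<Sum>z\<in>?pairs. if u (fst z) = u (snd z) then 1 else 0)"
          using jl fp by (intro member_le_sum) auto
        then have "1 \<le> (\<Sum>z\<in>?pairs. if u (fst z) = u (snd z) then 1 else (0::real))" using jl by simp
        moreover have "\<bar>?fr u - c\<bar> \<le> 1" using freq_bounds[of \<alpha> N u "\<lambda>j. exts B (n j) N (p j)"] c01 by linarith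
        moreover have "0 \<le> r\<^sup>2 / h" using h(1) by simp
        ultimately show ?thesis using nn(2) by linarith
      qed
      have "\<bar>measure (MM \<alpha>) (A \<inter> cell \<alpha> N u) * (?fr u - c)\<bar> = measure (MM \<alpha>) (A \<inter> cell \<alpha> N u) * \<bar>?fr u - c\<bar>" by (simp add: abs_mult)
      also have "\<dots> \<le> ?W u * (r\<^sup>2 / h + (\<Sum>z\<in>?pairs. if u (fst z) = u (snd z) then 1 else 0) + (\<Sum>j\<in>idx \<alpha>. \<bar>?d u j - ?w j\<bar>))"
        using 1 2 cellw_nonneg by (intro mult_mono) auto
      finally show "\<bar>measure (MM \<alpha>) (A \<inter> cell \<alpha> N u) * (?fr u - c)\<bar> \<le> ?W u * (r\<^sup>2 / h + (\<Sum>z\<in>?pairs. if u (fst z) = u (snd z) then 1 else 0) + (\<Sum>j\<in>idx \<alpha>. \<bar>?d u j - ?w j\<bar>))" .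
    qed
    also have "\<dots> = (\<Sum>u\<in>types \<alpha> N. ?W u) * (r\<^sup>2 / h) + (\<Sum>u\<in>types \<alpha> N. \<Sum>z\<in>?pairs. ?W u * (if u (fst z) = u (snd z) then 1 else 0)) + (\<Sum>u\<in>types \<alpha> N. \<Sum>j\<in>idx \<alpha>. ?W u * \<bar>?d u j - ?w j\<bar>)"
      by (simp only: distrib_left sum.distrib sum_distrib_left sum_distrib_right)
    also have "(\<Sum>u\<in>types \<alpha> N. ?W u) = 1" by (rule sum_cellw_total[OF N(1)])
    also have "(\<Sum>u\<in>types \<alpha> N. \<Sum>z\<in>?pairs. ?W u * (if u (fst z) = u (snd z) then 1 else 0)) = (\<Sum>z\<in>?pairs. \<Sum>u\<in>types \<alpha> N. if u (fst z) = u (snd z) then ?W u else 0)"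
      by (subst sum.swap) (intro sum.cong refl, simp)
    also have "(\<Sum>u\<in>types \<alpha> N. \<Sum>j\<in>idx \<alpha>. ?W u * \<bar>?d u j - ?w j\<bar>) = (\<Sum>j\<in>idx \<alpha>. \<Sum>u\<in>types \<alpha> N. ?W u * \<bar>?d u j - ?w j\<bar>)"
      by (rule sum.swap)
    also have "\<dots> = (\<Sum>j\<in>idx \<alpha>. L j N)"
    proof (rule sum.cong[OF refl])
      fix j assume j: "j \<in> idx \<alpha>"
      have "(\<Sum>u\<in>types \<alpha> N. ?W u * \<bar>?d u j - ?w j\<bar>) = (\<Sum>x\<in>P N. weight (\<mu> (fst j)) (N, x) * \<bar>dens N (t N x) (n j, p j) - ?w j\<bar>)"
        by (rule sum_cellw_coordinate[OF N(1) j])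
      also have "\<dots> = (\<Sum>w\<in>vert B N. \<Sum>x\<in>{x \<in> P N. t N x = w}. weight (\<mu> (fst j)) (N, x) * \<bar>dens N (t N x) (n j, p j) - ?w j\<bar>)"
        by (rule sum_over_fibres[OF N(1) order_refl])
      also have "\<dots> = L j N"
        unfolding L_def vmass_def fibre_def sum_distrib_right by (intro sum.cong refl) auto
      finally show "(\<Sum>u\<in>types \<alpha> N. ?W u * \<bar>?d u j - ?w j\<bar>) = L j N" .
    qed
    also have "(\<Sum>z\<in>?pairs. \<Sum>u\<in>types \<alpha> N. if u (fst z) = u (snd z) then ?W u else 0) \<le> (\<Sum>z\<in>?pairs. 1 / h)"
    proof (rule sum_mono)
      fix z assume z: "z \<in> ?pairs"
      show "(\<Sum>u\<in>types \<alpha> N. if u (fst z) = u (snd z) then ?W u else 0) \<le> 1 / h"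
        by (rule sum_cellw_collision[OF N(1) h]) (use z in auto)
    qed
    also have "(\<Sum>z\<in>?pairs. 1 / h) \<le> r\<^sup>2 / h"
    proof -
      have "card ?pairs \<le> card (idx \<alpha> \<times> idx \<alpha>)" by (intro card_mono) auto
      then have "real (card ?pairs) \<le> real (r\<^sup>2)" by (simp only: of_nat_le_iff r_def card_cartesian_product power2_eq_square)
      then show ?thesis using h(1) by (simp add: divide_right_mono)
    qed
    finally show ?thesis by simp
  qed
  have "\<bar>measure (MM \<alpha>) (?R \<inter> A) - c * measure (MM \<alpha>) A\<bar> \<le> \<epsilon>" if \<epsilon>: "\<epsilon> > 0" for \<epsilon>
  proof -
    \<comment> \<open>Makes the bound \<open>2 * (real r)\<^sup>2 / H\<close> for dependence and
      collisions at most \<epsilon> / 2; the added 1 keeps \<open>H\<close> positive when there are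
      no coordinates.\<close>
    obtain H :: nat where H: "4 * (real r)\<^sup>2 / \<epsilon> + 1 \<le> real H" using real_arch_simple by blast
    have "0 \<le> 4 * (real r)\<^sup>2 / \<epsilon>" using \<epsilon> by simp
    then have Hpos: "real H > 0" using H by linarith
    obtain m1 where m1: "\<And>l w. l \<ge> m1 \<Longrightarrow> w \<in> vert B l \<Longrightarrow> H \<le> card (fibre l w)" using card_fibre_unbounded[of H] by blast
    have "eventually (\<lambda>N. (\<Sum>j\<in>idx \<alpha>. L j N) < \<epsilon> / 2) sequentially"
      using order_tendstoD(2)[OF L0, of "\<epsilon> / 2"] \<epsilon> by simp
    then obtain m2 where m2: "\<And>N. N \<ge> m2 \<Longrightarrow> (\<Sum>j\<in>idx \<alpha>. L j N) < \<epsilon> / 2" unfolding eventually_sequentially by blast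
    define N where "N = Max ({1, m1, m2} \<union> n ` idx \<alpha>)"
    have "i \<le> N" if "i \<in> {1, m1, m2} \<union> n ` idx \<alpha>" for i
      unfolding N_def by (rule Max_ge[OF _ that]) simp
    then have N: "N \<ge> 1" "N \<ge> m1" "N \<ge> m2" "\<And>j. j \<in> idx \<alpha> \<Longrightarrow> n j \<le> N" by blast+
    have "\<bar>measure (MM \<alpha>) (?R \<inter> A) - c * measure (MM \<alpha>) A\<bar> \<le> 2 * (real r)\<^sup>2 / H + (\<Sum>j\<in>idx \<alpha>. L j N)"
      by (rule est[OF N(1,4) Hpos]) (use m1[OF N(2)] in auto)
    moreover have "2 * (real r)\<^sup>2 / H \<le> \<epsilon> / 2"
    proof -
      have "4 * (real r)\<^sup>2 / \<epsilon> \<le> real H" using H by linarith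
      then have "4 * (real r)\<^sup>2 \<le> real H * \<epsilon>" using \<epsilon> by (simp add: pos_divide_le_eq)
      then show ?thesis using Hpos by (simp add: pos_divide_le_eq mult.commute)
    qed
    ultimately show ?thesis using m2[OF N(3)] by linarith
  qed
  then have "\<bar>measure (MM \<alpha>) (?R \<inter> A) - c * measure (MM \<alpha>) A\<bar> \<le> 0" by (rule field_le_epsilon[of _ 0, simplified])
  then show ?thesis using c_eq by simp
qed

lemma sets_MM_boxes:
  "sets (MM \<alpha>) = sigma_sets (\<Pi>\<^sub>E j\<in>idx \<alpha>. X) {Pi\<^sub>E (idx \<alpha>) F | F. \<forall>j\<in>idx \<alpha>. F j \<in> cyls}"
proof -
  let ?P = "{{f \<in> \<Pi>\<^sub>E j\<in>idx \<alpha>. X. \<forall>i\<in>j. f i \<in> A i} | A j. j \<in> {idx \<alpha>} \<and> A \<in> Pi j (\<lambda>_. cyls)}"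
  have "\<Union> cyls = X"
  proof
    show "X \<subseteq> \<Union> cyls"
    proof
      fix x assume x: "x \<in> X"
      have "x \<in> cyl 1 (restrict x {1..1})" using x by (simp add: cylinder_def)
      moreover have "cyl 1 (restrict x {1..1}) \<in> cyls" by (rule cyl_in_cyls[OF order_refl restrict_in_fin_paths[OF x]])
      ultimately show "x \<in> \<Union> cyls" by blast
    qed
  qed (auto simp: cyls_def cylinder_def)
  then have cov: "\<exists>S\<subseteq>cyls. countable S \<and> X = \<Union> S" using countable_cyls by (intro exI[of _ cyls]) simp
  have box: "{f \<in> \<Pi>\<^sub>E j\<in>idx \<alpha>. X. \<forall>i\<in>idx \<alpha>. f i \<in> A i} = Pi\<^sub>E (idx \<alpha>) A" if "\<forall>j\<in>idx \<alpha>. A j \<in> cyls" for A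
  proof -
    have "A j \<subseteq> X" if "j \<in> idx \<alpha>" for j using \<open>\<forall>j\<in>idx \<alpha>. A j \<in> cyls\<close> cyls_subset that by blast
    then show ?thesis unfolding PiE_def Pi_def by blast
  qed
  have P: "?P = {Pi\<^sub>E (idx \<alpha>) F | F. \<forall>j\<in>idx \<alpha>. F j \<in> cyls}"
  proof (intro equalityI subsetI)
    fix S assume "S \<in> ?P"
    then obtain A where A: "S = {f \<in> \<Pi>\<^sub>E j\<in>idx \<alpha>. X. \<forall>i\<in>idx \<alpha>. f i \<in> A i}" "A \<in> Pi (idx \<alpha>) (\<lambda>_. cyls)" by blast
    then have "\<forall>j\<in>idx \<alpha>. A j \<in> cyls" by blast
    then show "S \<in> {Pi\<^sub>E (idx \<alpha>) F | F. \<forall>j\<in>idx \<alpha>. F j \<in> cyls}" unfolding A(1) using box by blast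
  next
    fix S assume "S \<in> {Pi\<^sub>E (idx \<alpha>) F | F. \<forall>j\<in>idx \<alpha>. F j \<in> cyls}"
    then obtain F where F: "S = Pi\<^sub>E (idx \<alpha>) F" "\<forall>j\<in>idx \<alpha>. F j \<in> cyls" by blast
    then have "F \<in> Pi (idx \<alpha>) (\<lambda>_. cyls)" by blast
    then show "S \<in> ?P" unfolding F(1) box[OF F(2), symmetric] by blast
  qed
  have "sets (PiM (idx \<alpha>) (factor \<alpha>)) = sets (PiM (idx \<alpha>) (\<lambda>_. sigma X cyls))"
    using cyls_subset by (intro sets_PiM_cong) (auto simp: factor_sets sets_PS)
  also have "\<dots> = sets (sigma (\<Pi>\<^sub>E j\<in>idx \<alpha>. X) ?P)"
    by (rule sets_PiM_sigma) (use cov cyls_subset in auto)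
  also have "\<dots> = sigma_sets (\<Pi>\<^sub>E j\<in>idx \<alpha>. X) ?P" by (rule sets_measure_of) auto
  finally show ?thesis unfolding P by (simp only: MM_eq)
qed

text \<open>Conditioning on an invariant \<open>A\<close> does not change the measure of any box of
  cylinders and hence of any set; but the conditional measure gives \<open>A\<close> mass 1.\<close>

lemma MM_ergodic:
  assumes A: "A \<in> sets (MM \<alpha>)" and inv: "\<And>g. g \<in> carrier G \<Longrightarrow> diagonal_action (idx \<alpha>) g -` A \<inter> space (MM \<alpha>) = A"
  shows "measure (MM \<alpha>) A = 0 \<or> measure (MM \<alpha>) A = 1"
proof (rule ccontr)
  assume neg: "\<not> ?thesis"
  interpret prob_space "MM \<alpha>" by (rule MM_prob)
  have A01: "0 < measure (MM \<alpha>) A" "measure (MM \<alpha>) A < 1" using neg prob_le_1[of A] by (auto simp: less_le)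
  let ?E = "{Pi\<^sub>E (idx \<alpha>) F | F. \<forall>j\<in>idx \<alpha>. F j \<in> cyls}"
  have em: "emeasure (MM \<alpha>) A \<noteq> 0" "emeasure (MM \<alpha>) A \<noteq> \<infinity>" using A01 by (auto simp: emeasure_eq_measure)
  let ?N = "uniform_measure (MM \<alpha>) A"
  have N: "prob_space ?N" using em by (rule prob_space_uniform_measure)
  have "measure ?N A = (\<Sum>j\<in>{()}. 1 * measure (MM \<alpha>) A)"
  proof (rule finite_mixture_eq[where E = ?E and \<Omega> = "\<Pi>\<^sub>E j\<in>idx \<alpha>. X"])
    show "Int_stable ?E"
    proof (unfold Int_stable_def, intro ballI)
      fix R R' assume "R \<in> ?E" "R' \<in> ?E"
      then obtain F F' where F: "R = Pi\<^sub>E (idx \<alpha>) F" "R' = Pi\<^sub>E (idx \<alpha>) F'" "\<forall>j\<in>idx \<alpha>. F j \<in> cyls" "\<forall>j\<in>idx \<alpha>. F' j \<in> cyls" by blast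
      have "\<forall>j\<in>idx \<alpha>. F j \<inter> F' j \<in> cyls" using F(3,4) Int_stable_cyls unfolding Int_stable_def by blast
      moreover have "R \<inter> R' = Pi\<^sub>E (idx \<alpha>) (\<lambda>j. F j \<inter> F' j)" unfolding F(1,2) by (rule PiE_Int)
      ultimately show "R \<inter> R' \<in> ?E" by blast
    qed
    show "?E \<subseteq> Pow (\<Pi>\<^sub>E j\<in>idx \<alpha>. X)"
    proof
      fix R assume "R \<in> ?E"
      then obtain F where F: "R = Pi\<^sub>E (idx \<alpha>) F" "\<forall>j\<in>idx \<alpha>. F j \<in> cyls" by blast
      then have "F j \<subseteq> X" if "j \<in> idx \<alpha>" for j using that cyls_subset by blast
      then show "R \<in> Pow (\<Pi>\<^sub>E j\<in>idx \<alpha>. X)" unfolding F(1) by (auto intro: PiE_mono)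
    qed
    fix R assume "R \<in> ?E"
    then obtain F where F: "R = Pi\<^sub>E (idx \<alpha>) F" "\<forall>j\<in>idx \<alpha>. F j \<in> cyls" by blast
    have FS: "F j \<in> sets PS" if "j \<in> idx \<alpha>" for j using F(2) that unfolding sets_PS by (intro sigma_sets.Basic) auto
    have Rs: "R \<in> sets (MM \<alpha>)" unfolding F(1) by (rule MM_box_sets[OF FS])
    have RA: "measure (MM \<alpha>) (R \<inter> A) = measure (MM \<alpha>) R * measure (MM \<alpha>) A"
    proof (cases "\<exists>j\<in>idx \<alpha>. F j = {}")
      case True
      then have "R = {}" unfolding F(1) by (auto simp: PiE_eq_empty_iff)
      then show ?thesis by simp
    next
      case False
      have "\<exists>z. 1 \<le> fst z \<and> snd z \<in> P (fst z) \<and> F j = cyl (fst z) (snd z)" if "j \<in> idx \<alpha>" for j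
      proof -
        have "F j \<in> cyls" "F j \<noteq> {}" using F(2) False that by auto
        then show ?thesis by (auto simp: cyls_def)
      qed
      then obtain z where z: "\<And>j. j \<in> idx \<alpha> \<Longrightarrow> 1 \<le> fst (z j) \<and> snd (z j) \<in> P (fst (z j)) \<and> F j = cyl (fst (z j)) (snd (z j))"
        by metis
      have "R = (\<Pi>\<^sub>E j\<in>idx \<alpha>. cyl (fst (z j)) (snd (z j)))" unfolding F(1) using z by (intro PiE_cong) auto
      then show ?thesis using box_invariant_independent[of \<alpha> "\<lambda>j. fst (z j)" "\<lambda>j. snd (z j)", OF _ A inv] z by simp
    qed
    show "measure ?N R = (\<Sum>j\<in>{()}. 1 * measure (MM \<alpha>) R)"
      using measure_uniform_measure[OF em Rs] RA A01 by (simp add: Int_commute)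
  qed (use N prob_space_axioms sets_MM_boxes A in auto)
  moreover have "measure ?N A = 1" using measure_uniform_measure[OF em A] A01 by simp
  ultimately show False using A01 by simp
qed

subsection \<open>Stabilizer distributions\<close>

abbreviation "Stab \<alpha> \<equiv> stabilizer G (diagonal_action (idx \<alpha>))"

lemma Stab_iff:
  assumes "y \<in> (\<Pi>\<^sub>E j\<in>idx \<alpha>. X)"
  shows "g \<in> Stab \<alpha> y \<longleftrightarrow> g \<in> carrier G \<and> (\<forall>j\<in>idx \<alpha>. g (y j) = y j)"
proof -
  have "diagonal_action (idx \<alpha>) g y = y \<longleftrightarrow> (\<forall>j\<in>idx \<alpha>. g (y j) = y j)"
    using assms by (auto simp: diagonal_action_def fun_eq_iff PiE_iff extensional_def restrict_def)
  then show ?thesis by (simp add: stabilizer_def)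
qed

lemma inv_act:
  assumes "g \<in> carrier G" "x \<in> X"
  shows "m_inv G g (g x) = x" "g (m_inv G g x) = x"
proof -
  have i: "m_inv G g \<in> carrier G" using assms(1) by (rule FG.inv_closed)
  show "m_inv G g (g x) = x"
    using full_group_act(2)[OF i assms] FG.l_inv[OF assms(1)] full_group_act(1)[OF assms(2)] by simp
  show "g (m_inv G g x) = x"
    using full_group_act(2)[OF assms(1) i assms(2)] FG.r_inv[OF assms(1)] full_group_act(1)[OF assms(2)] by simp
qed

lemma Stab_subgroup:
  assumes y: "y \<in> (\<Pi>\<^sub>E j\<in>idx \<alpha>. X)"
  shows "subgroup (Stab \<alpha> y) G"
proof (rule FG.subgroupI)
  have yj: "y j \<in> X" if "j \<in> idx \<alpha>" for j using y that by auto
  show "Stab \<alpha> y \<subseteq> carrier G" using Stab_iff[OF y] by blast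
  have "\<one>\<^bsub>G\<^esub> \<in> Stab \<alpha> y" using Stab_iff[OF y] full_group_act(1)[OF yj] FG.one_closed by simp
  then show "Stab \<alpha> y \<noteq> {}" by blast
  fix g assume "g \<in> Stab \<alpha> y"
  then have g: "g \<in> carrier G" "\<And>j. j \<in> idx \<alpha> \<Longrightarrow> g (y j) = y j" using Stab_iff[OF y] by auto
  have "m_inv G g (y j) = y j" if "j \<in> idx \<alpha>" for j
    using inv_act(1)[OF g(1) yj[OF that]] g(2)[OF that] by simp
  then show "m_inv G g \<in> Stab \<alpha> y" using Stab_iff[OF y] g(1) by simp
  fix h assume "h \<in> Stab \<alpha> y"
  then have h: "h \<in> carrier G" "\<And>j. j \<in> idx \<alpha> \<Longrightarrow> h (y j) = y j" using Stab_iff[OF y] by auto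
  show "g \<otimes>\<^bsub>G\<^esub> h \<in> Stab \<alpha> y"
    using Stab_iff[OF y] g h full_group_act(2)[OF g(1) h(1) yj] FG.m_closed by simp
qed

definition fixset :: "((nat \<Rightarrow> 'b) \<Rightarrow> nat \<Rightarrow> 'b) \<Rightarrow> (nat \<Rightarrow> 'b) set" where
  "fixset g = {x \<in> X. g x = x}"

text \<open>Whether an element of level \<open>n\<close> fixes a path is decided by the first
  \<open>n\<close> edges.\<close>

lemma fixset_sets: assumes "g \<in> carrier G" shows "fixset g \<in> sets PS"
proof -
  obtain n \<sigma> where n: "n \<ge> 1" "\<sigma> \<in> \<Gamma> n" "g = path_act B n \<sigma>" using assms by (rule full_group_cases)
  have "g x = x \<longleftrightarrow> \<sigma> (restrict x {1..n}) = restrict x {1..n}" if "x \<in> X" for x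
  proof
    assume "\<sigma> (restrict x {1..n}) = restrict x {1..n}"
    then show "g x = x" using that by (simp add: n(3) path_act_def)
  qed (use path_act_in(2)[OF n(1,2) that] n(3) in auto)
  then have "level_set B n (fixset g)" by (auto simp: level_set_def fixset_def)
  then show ?thesis by (rule level_set_sets[OF n(1)])
qed

lemma Stab_measurable: "Stab \<alpha> \<in> measurable (MM \<alpha>) FG.SM"
proof (rule FG.measurable_SM)
  show "subgroup (Stab \<alpha> y) G" if "y \<in> space (MM \<alpha>)" for y using that Stab_subgroup by (simp add: MM_space)
  fix g assume g: "g \<in> carrier G"
  have "{y \<in> space (MM \<alpha>). g \<in> Stab \<alpha> y} = (\<Pi>\<^sub>E j\<in>idx \<alpha>. fixset g)"
    using g by (auto simp: MM_space Stab_iff fixset_def PiE_iff dest: extensional_arb)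
  then show "{y \<in> space (MM \<alpha>). g \<in> Stab \<alpha> y} \<in> sets (MM \<alpha>)" using MM_box_sets fixset_sets[OF g] by simp
qed

lemma product_IRS_eq: "product_IRS B k \<mu> \<alpha> = distr (MM \<alpha>) FG.SM (Stab \<alpha>)"
  by (simp add: product_IRS_def stabilizer_distribution_def)

lemma product_IRS_prob: "prob_space (product_IRS B k \<mu> \<alpha>)"
  and product_IRS_sets: "sets (product_IRS B k \<mu> \<alpha>) = sets FG.SM"
  unfolding product_IRS_eq using MM_prob Stab_measurable by (auto intro: prob_space.prob_space_distr)

lemma Stab_diagonal:
  assumes g: "g \<in> carrier G" and y: "y \<in> (\<Pi>\<^sub>E j\<in>idx \<alpha>. X)"
  shows "Stab \<alpha> (diagonal_action (idx \<alpha>) g y) = conjugation G g (Stab \<alpha> y)"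
proof (rule Set.set_eqI)
  fix h
  have yj: "y j \<in> X" if "j \<in> idx \<alpha>" for j using y that by auto
  have dy: "diagonal_action (idx \<alpha>) g y \<in> (\<Pi>\<^sub>E j\<in>idx \<alpha>. X)" using g y by (rule diagonal_in)
  have ig: "m_inv G g \<in> carrier G" using g by (rule FG.inv_closed)
  show "h \<in> Stab \<alpha> (diagonal_action (idx \<alpha>) g y) \<longleftrightarrow> h \<in> conjugation G g (Stab \<alpha> y)"
  proof (cases "h \<in> carrier G")
    case True
    have c: "m_inv G g \<otimes>\<^bsub>G\<^esub> h \<otimes>\<^bsub>G\<^esub> g \<in> carrier G" using ig True g by (intro FG.m_closed)
    have "h (g (y j)) = g (y j) \<longleftrightarrow> (m_inv G g \<otimes>\<^bsub>G\<^esub> h \<otimes>\<^bsub>G\<^esub> g) (y j) = y j" if j: "j \<in> idx \<alpha>" for j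
    proof -
      have gy: "g (y j) \<in> X" "h (g (y j)) \<in> X" using full_group_in g True yj[OF j] by auto
      have "(m_inv G g \<otimes>\<^bsub>G\<^esub> h \<otimes>\<^bsub>G\<^esub> g) (y j) = m_inv G g (h (g (y j)))"
        using full_group_act(2)[OF FG.m_closed[OF ig True] g yj[OF j]] full_group_act(2)[OF ig True gy(1)] by simp
      then show ?thesis using inv_act[OF g] gy yj[OF j] by metis
    qed
    then show ?thesis
      using FG.conjugation_mem[OF g Stab_subgroup[OF y], of h] Stab_iff[OF dy, of h] Stab_iff[OF y] True c
      by (simp add: diagonal_action_def)
  next
    case False
    then show ?thesis using FG.conjugation_mem[OF g Stab_subgroup[OF y], of h] Stab_iff[OF dy, of h] by simp
  qed
qed

lemma product_IRS_invariant: "invariant_random_subgroup G (product_IRS B k \<mu> \<alpha>)"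
  unfolding invariant_random_subgroup_def invariant_prob_def
proof (intro conjI ballI)
  show "sets (product_IRS B k \<mu> \<alpha>) = sets FG.SM" "prob_space (product_IRS B k \<mu> \<alpha>)"
    by (rule product_IRS_sets product_IRS_prob)+
  fix g assume g: "g \<in> carrier G"
  have cm: "conjugation G g \<in> measurable FG.SM FG.SM" using g by (rule FG.conjugation_measurable)
  show cm': "conjugation G g \<in> measurable (product_IRS B k \<mu> \<alpha>) (product_IRS B k \<mu> \<alpha>)"
    using cm measurable_cong_sets[OF product_IRS_sets product_IRS_sets] by blast
  have "distr (product_IRS B k \<mu> \<alpha>) (product_IRS B k \<mu> \<alpha>) (conjugation G g) = distr (product_IRS B k \<mu> \<alpha>) FG.SM (conjugation G g)"
    by (intro distr_cong) (auto simp: product_IRS_sets)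
  also have "\<dots> = distr (MM \<alpha>) FG.SM (conjugation G g \<circ> Stab \<alpha>)"
    unfolding product_IRS_eq by (rule distr_distr[OF cm Stab_measurable])
  also have "\<dots> = distr (MM \<alpha>) FG.SM (Stab \<alpha> \<circ> diagonal_action (idx \<alpha>) g)"
    by (intro distr_cong) (auto simp: MM_space Stab_diagonal[OF g])
  also have "\<dots> = distr (distr (MM \<alpha>) (MM \<alpha>) (diagonal_action (idx \<alpha>) g)) FG.SM (Stab \<alpha>)"
    by (rule distr_distr[OF Stab_measurable diagonal_measurable[OF g], symmetric])
  also have "\<dots> = product_IRS B k \<mu> \<alpha>" unfolding diagonal_distr[OF g] product_IRS_eq ..
  finally show "distr (product_IRS B k \<mu> \<alpha>) (product_IRS B k \<mu> \<alpha>) (conjugation G g) = product_IRS B k \<mu> \<alpha>" .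
qed

text \<open>\<open>Stab \<alpha>\<close> is equivariant, so an invariant set of subgroups pulls back
  to an invariant set of tuples, to which \<open>MM_ergodic\<close> applies.\<close>

theorem product_IRS_ergodic: "ergodic_IRS G (product_IRS B k \<mu> \<alpha>)"
  unfolding ergodic_IRS_def ergodic_prob_def
proof (intro conjI ballI impI)
  show "invariant_random_subgroup G (product_IRS B k \<mu> \<alpha>)" by (rule product_IRS_invariant)
  then show "invariant_prob G (conjugation G) (product_IRS B k \<mu> \<alpha>)" by (simp add: invariant_random_subgroup_def)
  fix A assume A: "A \<in> sets (product_IRS B k \<mu> \<alpha>)"
    and inv: "\<forall>g\<in>carrier G. conjugation G g -` A \<inter> space (product_IRS B k \<mu> \<alpha>) = A"
  let ?A = "Stab \<alpha> -` A \<inter> space (MM \<alpha>)"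
  have A': "A \<in> sets FG.SM" using A by (simp add: product_IRS_sets)
  have sp: "space (product_IRS B k \<mu> \<alpha>) = FG.Subs" by (simp add: product_IRS_eq FG.space_SM)
  have "measure (MM \<alpha>) ?A = 0 \<or> measure (MM \<alpha>) ?A = 1"
  proof (rule MM_ergodic)
    show "?A \<in> sets (MM \<alpha>)" using Stab_measurable A' by (rule measurable_sets)
    fix g assume g: "g \<in> carrier G"
    have "conjugation G g H \<in> A \<longleftrightarrow> H \<in> A" if "subgroup H G" for H
      using inv g that sp by (metis (mono_tags, lifting) Int_iff mem_Collect_eq vimage_eq)
    then show "diagonal_action (idx \<alpha>) g -` ?A \<inter> space (MM \<alpha>) = ?A"
      using Stab_diagonal[OF g] Stab_subgroup diagonal_in[OF g] by (auto simp: MM_space)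
  qed
  then show "measure (product_IRS B k \<mu> \<alpha>) A = 0 \<or> measure (product_IRS B k \<mu> \<alpha>) A = 1"
    unfolding product_IRS_eq using measure_distr[OF Stab_measurable A'] by simp
qed

text \<open>A stabilizer contains \<open>F\<close> exactly when every coordinate is a common fixed
  point of \<open>F\<close>, and the coordinates are independent. These monomials in the
  \<open>k\<close> masses are what the mixture expansion has to reproduce.\<close>

lemma product_IRS_above:
  assumes F: "finite F" "F \<subseteq> carrier G"
  shows "measure (product_IRS B k \<mu> \<alpha>) (FG.above F) = (\<Prod>i=1..k. measure (\<mu> i) {x \<in> X. \<forall>g\<in>F. g x = x} ^ \<alpha> i)"
proof -
  let ?S = "{x \<in> X. \<forall>g\<in>F. g x = x}"
  have S: "?S \<in> sets PS"
  proof (cases "F = {}")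
    case True
    then show ?thesis using sets.top[of PS] by (simp add: space_PS)
  next
    case False
    then have "?S = (\<Inter>g\<in>F. fixset g)" by (auto simp: fixset_def)
    also have "\<dots> \<in> sets PS" using F False fixset_sets by (intro sets.finite_INT) auto
    finally show ?thesis .
  qed
  have "measure (product_IRS B k \<mu> \<alpha>) (FG.above F) = measure (MM \<alpha>) (Stab \<alpha> -` FG.above F \<inter> space (MM \<alpha>))"
    unfolding product_IRS_eq using Stab_measurable FG.above_sets[OF F] by (rule measure_distr)
  also have "Stab \<alpha> -` FG.above F \<inter> space (MM \<alpha>) = (\<Pi>\<^sub>E j\<in>idx \<alpha>. ?S)"
    using F(2) Stab_subgroup by (auto simp: MM_space FG.above_def Stab_iff PiE_iff subset_iff)
  also have "measure (MM \<alpha>) \<dots> = (\<Prod>j\<in>idx \<alpha>. measure (\<mu> (fst j)) ?S)" by (rule MM_box[OF S])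
  also have "\<dots> = (\<Prod>i=1..k. \<Prod>j=1..\<alpha> i. measure (\<mu> i) ?S)"
    unfolding power_index_def by (subst prod.Sigma) (auto simp: case_prod_unfold)
  also have "\<dots> = (\<Prod>i=1..k. measure (\<mu> i) ?S ^ \<alpha> i)" by simp
  finally show ?thesis .
qed

end

section \<open>Classification of the ergodic invariant random subgroups\<close>

subsection \<open>Expanding products of mixtures\<close>

definition types_of :: "nat \<Rightarrow> 'a set \<Rightarrow> ('a \<Rightarrow> nat) \<Rightarrow> nat \<Rightarrow> nat" where
  "types_of k E f = (\<lambda>l\<in>{1..k}. card {p \<in> E. f p = l})"

text \<open>If each \<open>p\<close> in \<open>E\<close> independently draws an index in {1..k} with
  the probabilities \<open>c p l\<close>, this is the probability that the numbers of draws are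
  given by \<alpha>.\<close>

definition mix_coeff :: "nat \<Rightarrow> ('a \<Rightarrow> nat \<Rightarrow> real) \<Rightarrow> 'a set \<Rightarrow> (nat \<Rightarrow> nat) \<Rightarrow> real" where
  "mix_coeff k c E \<alpha> = (\<Sum>f\<in>{f \<in> E \<rightarrow>\<^sub>E {1..k}. types_of k E f = \<alpha>}. \<Prod>p\<in>E. c p (f p))"

lemma mix_coeff_nonneg:
  assumes "\<And>p l. p \<in> E \<Longrightarrow> l \<in> {1..k} \<Longrightarrow> 0 \<le> c p l"
  shows "0 \<le> mix_coeff k c E \<alpha>"
  unfolding mix_coeff_def using assms by (intro sum_nonneg prod_nonneg) (auto simp: PiE_iff)

text \<open>Multiplying out gives a sum over all choices of one index per factor; choices with equal
  multiplicities contribute the same monomial.\<close>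

lemma prod_mixture_expand:
  fixes c :: "'a \<Rightarrow> nat \<Rightarrow> real"
  assumes E: "finite E"
  shows "(\<Prod>p\<in>E. \<Sum>l=1..k. c p l * b l) = (\<Sum>\<alpha>\<in>{1..k} \<rightarrow>\<^sub>E {..card E}. mix_coeff k c E \<alpha> * (\<Prod>l=1..k. b l ^ \<alpha> l))"
proof -
  let ?S = "E \<rightarrow>\<^sub>E {1..k}" and ?T = "{1..k} \<rightarrow>\<^sub>E {..card E}"
  let ?w = "\<lambda>f. \<Prod>p\<in>E. c p (f p)" and ?B = "\<lambda>\<alpha>. \<Prod>l=1..k. b l ^ (\<alpha> l :: nat)"
  have fS: "finite ?S" "finite ?T" using E by (auto intro: finite_PiE)
  have T: "types_of k E ` ?S \<subseteq> ?T" using E by (auto simp: types_of_def intro!: card_mono)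
  have B: "(\<Prod>p\<in>E. b (f p)) = ?B (types_of k E f)" if "f \<in> ?S" for f
  proof -
    have "(\<Prod>p\<in>E. b (f p)) = (\<Prod>l=1..k. \<Prod>p\<in>{p \<in> E. f p = l}. b (f p))"
      by (rule prod.group[symmetric]) (use E that in auto)
    also have "\<dots> = ?B (types_of k E f)" by (intro prod.cong refl) (simp add: types_of_def)
    finally show ?thesis .
  qed
  have "(\<Prod>p\<in>E. \<Sum>l=1..k. c p l * b l) = (\<Sum>f\<in>?S. ?w f * (\<Prod>p\<in>E. b (f p)))"
    using E by (subst prod_sum_PiE) (auto simp: prod.distrib)
  also have "\<dots> = (\<Sum>f\<in>?S. ?w f * ?B (types_of k E f))" by (intro sum.cong refl) (simp only: B)
  also have "\<dots> = (\<Sum>\<alpha>\<in>?T. \<Sum>f\<in>{f \<in> ?S. types_of k E f = \<alpha>}. ?w f * ?B (types_of k E f))"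
    by (rule sum.group[OF fS T, symmetric])
  also have "\<dots> = (\<Sum>\<alpha>\<in>?T. mix_coeff k c E \<alpha> * ?B \<alpha>)"
    unfolding mix_coeff_def sum_distrib_right by (intro sum.cong refl) auto
  finally show ?thesis .
qed

text \<open>Dominated convergence for the indicator functions.\<close>

lemma (in prob_space) AE_eventually_prob_tendsto_0:
  assumes A: "\<And>m. A m \<in> events" and ev: "AE x in M. eventually (\<lambda>m::nat. x \<notin> A m) sequentially"
  shows "(\<lambda>m. prob (A m)) \<longlonglongrightarrow> 0"
proof -
  have "(\<lambda>m. \<integral>x. indicat_real (A m) x \<partial>M) \<longlonglongrightarrow> (\<integral>x. 0 \<partial>M)"
  proof (rule integral_dominated_convergence[where w = "\<lambda>_. 1"])
    show "AE x in M. (\<lambda>m. indicat_real (A m) x) \<longlonglongrightarrow> 0"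
      using ev by eventually_elim (auto intro!: tendsto_eventually elim: eventually_mono)
    show "AE x in M. norm (indicat_real (A m) x) \<le> 1" for m by (simp add: indicator_def)
  qed (use A in auto)
  then show ?thesis using A sets.sets_into_space[OF A] by (simp add: Int_absorb2)
qed

subsection \<open>Free cylinders\<close>

context bratteli_diagram
begin

text \<open>In an even diagram, for the pointwise stabilizer of a closed set, these are the
  truncations of its points to level \<open>n\<close>. In general they stand in for a fixed point
  set that has not been constructed.\<close>

definition free_paths :: "nat \<Rightarrow> ((nat \<Rightarrow> 'e) \<Rightarrow> nat \<Rightarrow> 'e) set \<Rightarrow> (nat \<Rightarrow> 'e) set" where
  "free_paths n H = {p \<in> P n. \<not> swaps n p H}"

lemma free_paths_subset: "free_paths n H \<subseteq> P n" by (auto simp: free_paths_def)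

lemma finite_free_paths [simp]: "finite (free_paths n H)"
  by (rule finite_subset[OF free_paths_subset finite_fin_paths])

text \<open>The lift of \<alpha> carries the extensions of \<open>p\<close> to those of
  \<open>\<alpha> p\<close> with the same end vertices, and conjugation by it carries swaps to
  swaps.\<close>

lemma swaps_conjugation:
  assumes n: "n \<ge> 1" and a: "\<alpha> \<in> \<Gamma> n" and H: "subgroup H G" and p: "p \<in> P n"
  shows "swaps n (\<alpha> p) (conjugation G (path_act B n \<alpha>) H) \<longleftrightarrow> swaps n p H"
proof -
  let ?l = "\<lambda>m. lift_perm B n m \<alpha>" and ?C = "conjugation G (path_act B n \<alpha>) H"
  have key: "swap m (?l m x) (?l m y) \<in> ?C \<longleftrightarrow> swap m x y \<in> H"
    if m: "n \<le> m" and xy: "x \<in> P m" "y \<in> P m" "t m x = t m y" for m x y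
  proof -
    have m1: "m \<ge> 1" using n m by simp
    have l: "?l m \<in> \<Gamma> m" using n m a by (rule lift_perm_in)
    have b: "bij (?l m)" using l by (rule level_permsD)
    have lx: "?l m x \<in> P m" "t m (?l m x) = t m x" using lift_perm_apply[OF n m a xy(1)] by blast+
    have ly: "?l m y \<in> P m" "t m (?l m y) = t m y" using lift_perm_apply[OF n m a xy(2)] by blast+
    have s: "transpose (?l m x) (?l m y) \<in> \<Gamma> m"
      by (rule level_perms_transpose) (use lx ly xy(3) in simp_all)
    have "inv (?l m) \<circ> (?l m \<circ> transpose x y \<circ> inv (?l m)) \<circ> ?l m = transpose x y"
      using b by (simp add: fun_eq_iff bij_is_inj)
    then have e: "inv (?l m) \<circ> transpose (?l m x) (?l m y) \<circ> ?l m = transpose x y"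
      using conj_transpose[OF b, of x y] by simp
    have "swap m (?l m x) (?l m y) \<in> ?C \<longleftrightarrow> transpose x y \<in> perms_in m H"
      using conj_path_act[OF m1 l s H] unfolding lift_perm_act[OF n m a] e swap_def .
    also have "\<dots> \<longleftrightarrow> swap m x y \<in> H"
      using level_perms_transpose[OF xy] by (simp add: perms_in_def swap_def)
    finally show ?thesis .
  qed
  show ?thesis
  proof
    assume L: "swaps n (\<alpha> p) ?C"
    show "swaps n p H" unfolding swaps_def
    proof (intro allI ballI impI)
      fix m x y assume m: "n \<le> m" and xy: "x \<in> exts B n m p" "y \<in> exts B n m p" "t m x = t m y"
      have P: "x \<in> P m" "y \<in> P m" using xy by (auto simp: exts_iff)
      note lx = lift_perm_apply[OF n m a P(1)] and ly = lift_perm_apply[OF n m a P(2)]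
      have "?l m x \<in> exts B n m (\<alpha> p)" "?l m y \<in> exts B n m (\<alpha> p)"
        using lx(1,3) ly(1,3) xy(1,2) by (simp_all add: exts_iff)
      moreover have "t m (?l m x) = t m (?l m y)" using lx(2) ly(2) xy(3) by simp
      ultimately have "swap m (?l m x) (?l m y) \<in> ?C" using L m unfolding swaps_def by blast
      then show "swap m x y \<in> H" using key[OF m P xy(3)] by blast
    qed
  next
    assume R: "swaps n p H"
    show "swaps n (\<alpha> p) ?C" unfolding swaps_def
    proof (intro allI ballI impI)
      fix m u v assume m: "n \<le> m" and uv: "u \<in> exts B n m (\<alpha> p)" "v \<in> exts B n m (\<alpha> p)" "t m u = t m v"
      have "u \<in> ?l m ` {x \<in> exts B n m p. t m x = t m u}" "v \<in> ?l m ` {x \<in> exts B n m p. t m x = t m u}"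
        unfolding lift_perm_exts[OF n m a p] using uv by simp_all
      then obtain x y where x: "u = ?l m x" "x \<in> exts B n m p" "t m x = t m u"
        and y: "v = ?l m y" "y \<in> exts B n m p" "t m y = t m u" by blast
      have P: "x \<in> P m" "y \<in> P m" using x y by (auto simp: exts_iff)
      have e: "t m x = t m y" using x(3) y(3) by simp
      have "swap m x y \<in> H" using R m x(2) y(2) e unfolding swaps_def by blast
      then show "swap m u v \<in> ?C" using key[OF m P e] x(1) y(1) by simp
    qed
  qed
qed

lemma free_paths_conjugation:
  assumes n: "n \<ge> 1" and a: "\<alpha> \<in> \<Gamma> n" and H: "subgroup H G"
  shows "free_paths n (conjugation G (path_act B n \<alpha>) H) = \<alpha> ` free_paths n H"
proof
  let ?C = "conjugation G (path_act B n \<alpha>) H"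
  show "\<alpha> ` free_paths n H \<subseteq> free_paths n ?C"
    using swaps_conjugation[OF n a H] level_permsD(4)[OF a] by (auto simp: free_paths_def)
  show "free_paths n ?C \<subseteq> \<alpha> ` free_paths n H"
  proof
    fix q assume q: "q \<in> free_paths n ?C"
    then obtain p where p: "p \<in> P n" "q = \<alpha> p"
      using permutes_image[OF level_permsD(1)[OF a]] by (auto simp: free_paths_def)
    then have "p \<in> free_paths n H" using q swaps_conjugation[OF n a H p(1)] by (auto simp: free_paths_def)
    then show "q \<in> \<alpha> ` free_paths n H" using p(2) by blast
  qed
qed

lemma card_free_paths_conjugation:
  assumes "n \<ge> 1" "\<alpha> \<in> \<Gamma> n" "subgroup H G"
  shows "card (free_paths n (conjugation G (path_act B n \<alpha>) H)) = card (free_paths n H)"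
  unfolding free_paths_conjugation[OF assms]
  using level_permsD(3)[OF assms(2)] by (intro card_image) (auto simp: bij_def intro: inj_on_subset)

end

section \<open>Averages over a level group and the number of free paths\<close>

context even_diagram
begin

lemma free_paths_eq_sets:
  assumes m: "m \<ge> 1"
  shows "{H. subgroup H G \<and> free_paths m H = E} \<in> sets FG.SM"
proof (cases "E \<subseteq> P m")
  case True
  have "{H \<in> space FG.SM. \<forall>p\<in>P m. swaps m p H \<longleftrightarrow> p \<notin> E} \<in> sets FG.SM"
  proof (rule sets.sets_Collect_finite_All'[OF _ finite_fin_paths])
    fix p assume "p \<in> P m"
    have s: "{H. subgroup H G \<and> swaps m p H} \<in> sets FG.SM" using m by (rule swaps_sets)
    have "{H \<in> space FG.SM. swaps m p H \<longleftrightarrow> p \<notin> E} =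
      (if p \<in> E then space FG.SM - {H. subgroup H G \<and> swaps m p H} else {H. subgroup H G \<and> swaps m p H})"
      by (auto simp: FG.space_SM)
    then show "{H \<in> space FG.SM. swaps m p H \<longleftrightarrow> p \<notin> E} \<in> sets FG.SM" using s by auto
  qed (use fin_paths_nonempty in auto)
  moreover have "{H \<in> space FG.SM. \<forall>p\<in>P m. swaps m p H \<longleftrightarrow> p \<notin> E} = {H. subgroup H G \<and> free_paths m H = E}"
    using True by (auto simp: FG.space_SM free_paths_def)
  ultimately show ?thesis by simp
next
  case False
  then have e: "{H. subgroup H G \<and> free_paths m H = E} = {}" using free_paths_subset by auto
  show ?thesis unfolding e by simp
qed

lemma free_paths_decompose:
  "{H. subgroup H G \<and> Q (free_paths m H)} = (\<Union>E\<in>{E \<in> Pow (P m). Q E}. {H. subgroup H G \<and> free_paths m H = E})"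
  using free_paths_subset by auto

lemma free_paths_sets:
  assumes "m \<ge> 1" shows "{H. subgroup H G \<and> Q (free_paths m H)} \<in> sets FG.SM"
  unfolding free_paths_decompose using free_paths_eq_sets[OF assms] by (intro sets.finite_UN) auto

lemma free_paths_measure:
  assumes "prob_space \<phi>" "sets \<phi> = sets FG.SM" and m: "m \<ge> 1"
  shows "measure \<phi> {H. subgroup H G \<and> Q (free_paths m H)} =
    (\<Sum>E\<in>Pow (P m). measure \<phi> {H. subgroup H G \<and> free_paths m H = E} * (if Q E then 1 else 0))"
proof -
  interpret prob_space \<phi> by fact
  have "measure \<phi> {H. subgroup H G \<and> Q (free_paths m H)} =
    (\<Sum>E\<in>{E \<in> Pow (P m). Q E}. measure \<phi> {H. subgroup H G \<and> free_paths m H = E})"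
    unfolding free_paths_decompose
  proof (rule finite_measure_finite_Union)
    show "(\<lambda>E. {H. subgroup H G \<and> free_paths m H = E}) ` {E \<in> Pow (P m). Q E} \<subseteq> sets \<phi>"
      using free_paths_eq_sets[OF m] assms(2) by auto
    show "disjoint_family_on (\<lambda>E. {H. subgroup H G \<and> free_paths m H = E}) {E \<in> Pow (P m). Q E}"
      by (auto simp: disjoint_family_on_def)
  qed simp
  also have "\<dots> = (\<Sum>E\<in>Pow (P m). if Q E then measure \<phi> {H. subgroup H G \<and> free_paths m H = E} else 0)"
    by (rule sum.inter_filter) simp
  also have "\<dots> = (\<Sum>E\<in>Pow (P m). measure \<phi> {H. subgroup H G \<and> free_paths m H = E} * (if Q E then 1 else 0))"
    by (intro sum.cong refl) simp
  finally show ?thesis .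
qed

definition miss_freq :: "nat \<Rightarrow> (nat \<Rightarrow> 'b) set \<Rightarrow> (nat \<Rightarrow> 'b) set \<Rightarrow> real" where
  "miss_freq m A E = real (card {\<sigma> \<in> \<Gamma> m. \<forall>p\<in>E. \<sigma> p \<in> P m - A}) / card (\<Gamma> m)"

lemma miss_freq_bounds: "0 \<le> miss_freq m A E" "miss_freq m A E \<le> 1"
proof -
  have "card {\<sigma> \<in> \<Gamma> m. \<forall>p\<in>E. \<sigma> p \<in> P m - A} \<le> card (\<Gamma> m)" using finite_level_perms by (intro card_mono) auto
  then show "miss_freq m A E \<le> 1" using card_level_perms_pos[of m] by (simp add: miss_freq_def)
qed (simp add: miss_freq_def)

lemma miss_freq_antimono: "E \<subseteq> E' \<Longrightarrow> miss_freq m A E' \<le> miss_freq m A E"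
  unfolding miss_freq_def using finite_level_perms by (intro divide_right_mono of_nat_mono card_mono) auto

lemma miss_freq_near_prod:
  assumes m: "m \<ge> 1" and h: "h > 0" "\<And>w. w \<in> vert B m \<Longrightarrow> h \<le> real (card (fibre m w))" and E: "E \<subseteq> P m"
  shows "\<bar>miss_freq m A E - (\<Prod>p\<in>E. real (card (fibre m (t m p) - A)) / card (fibre m (t m p)))\<bar> \<le> (card E)\<^sup>2 / h"
proof -
  have fib: "{x \<in> P m. t m x = t m p} = fibre m (t m p)" for p by (simp add: fibre_def)
  have fE: "finite E" using E finite_fin_paths by (rule finite_subset)
  have "\<bar>real (card {\<sigma> \<in> \<Gamma> m. \<forall>p\<in>E. \<sigma> p \<in> P m - A}) / card (\<Gamma> m) -
     (\<Prod>p\<in>E. real (card ((P m - A) \<inter> fibre m (t m p))) / card (fibre m (t m p)))\<bar> \<le> (card E)\<^sup>2 / h"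
    unfolding level_perms_def fib[symmetric]
    by (rule fibre_perms_independence) (use h(1) h(2) end_vertex_in[OF m] E fE in \<open>auto simp: fib\<close>)
  moreover have "(P m - A) \<inter> fibre m w = fibre m w - A" for w by (auto simp: fibre_def)
  ultimately show ?thesis by (simp add: miss_freq_def)
qed

text \<open>Averaging over the conjugates by \<open>\<Gamma> m\<close>.\<close>

lemma measure_free_paths_miss:
  assumes IRS: "invariant_random_subgroup G \<phi>" and m: "m \<ge> 1"
  shows "measure \<phi> {H. subgroup H G \<and> free_paths m H \<inter> A = {}} =
    (\<Sum>E\<in>Pow (P m). measure \<phi> {H. subgroup H G \<and> free_paths m H = E} * miss_freq m A E)"
proof -
  note D = FG.IRS_D[OF IRS]
  let ?w = "\<lambda>E. measure \<phi> {H. subgroup H G \<and> free_paths m H = E}"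
  let ?L = "measure \<phi> {H. subgroup H G \<and> free_paths m H \<inter> A = {}}"
  have one: "?L = (\<Sum>E\<in>Pow (P m). ?w E * (if \<forall>p\<in>E. \<sigma> p \<in> P m - A then 1 else 0))" if s: "\<sigma> \<in> \<Gamma> m" for \<sigma>
  proof -
    have "?L = measure \<phi> {H. subgroup H G \<and> conjugation G (path_act B m \<sigma>) H \<in> {H. subgroup H G \<and> free_paths m H \<inter> A = {}}}"
      by (rule FG.IRS_conj_measure[OF IRS path_act_carrier[OF m s] free_paths_sets[OF m], symmetric])
    also have "{H. subgroup H G \<and> conjugation G (path_act B m \<sigma>) H \<in> {H. subgroup H G \<and> free_paths m H \<inter> A = {}}} =
      {H. subgroup H G \<and> \<sigma> ` free_paths m H \<inter> A = {}}"
      using free_paths_conjugation[OF m s] FG.conjugation_subgroup[OF path_act_carrier[OF m s]] by auto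
    also have "measure \<phi> \<dots> = (\<Sum>E\<in>Pow (P m). ?w E * (if \<sigma> ` E \<inter> A = {} then 1 else 0))"
      by (rule free_paths_measure[OF D(1,2) m])
    also have "\<dots> = (\<Sum>E\<in>Pow (P m). ?w E * (if \<forall>p\<in>E. \<sigma> p \<in> P m - A then 1 else 0))"
    proof (rule sum.cong[OF refl])
      fix E assume "E \<in> Pow (P m)"
      then have "\<sigma> ` E \<subseteq> P m" using level_permsD(4)[OF s] by auto
      then have "\<sigma> ` E \<inter> A = {} \<longleftrightarrow> (\<forall>p\<in>E. \<sigma> p \<in> P m - A)" by auto
      then show "?w E * (if \<sigma> ` E \<inter> A = {} then 1 else 0) = ?w E * (if \<forall>p\<in>E. \<sigma> p \<in> P m - A then 1 else 0)" by simp
    qed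
    finally show ?thesis .
  qed
  have fr: "real (card (\<Gamma> m)) * miss_freq m A E = (\<Sum>\<sigma>\<in>\<Gamma> m. if \<forall>p\<in>E. \<sigma> p \<in> P m - A then 1 else 0)" for E
    unfolding miss_freq_def using card_level_perms_pos[of m] finite_level_perms[of m]
    by (simp add: sum.If_cases Int_def)
  have "real (card (\<Gamma> m)) * ?L = (\<Sum>\<sigma>\<in>\<Gamma> m. ?L)" by simp
  also have "\<dots> = (\<Sum>\<sigma>\<in>\<Gamma> m. \<Sum>E\<in>Pow (P m). ?w E * (if \<forall>p\<in>E. \<sigma> p \<in> P m - A then 1 else 0))"
    by (intro sum.cong refl one)
  also have "\<dots> = (\<Sum>E\<in>Pow (P m). \<Sum>\<sigma>\<in>\<Gamma> m. ?w E * (if \<forall>p\<in>E. \<sigma> p \<in> P m - A then 1 else 0))" by (rule sum.swap)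
  also have "\<dots> = (\<Sum>E\<in>Pow (P m). real (card (\<Gamma> m)) * (?w E * miss_freq m A E))"
  proof (rule sum.cong[OF refl])
    fix E
    have "(\<Sum>\<sigma>\<in>\<Gamma> m. ?w E * (if \<forall>p\<in>E. \<sigma> p \<in> P m - A then 1 else 0)) = ?w E * (real (card (\<Gamma> m)) * miss_freq m A E)"
      unfolding fr by (rule sum_distrib_left[symmetric])
    then show "(\<Sum>\<sigma>\<in>\<Gamma> m. ?w E * (if \<forall>p\<in>E. \<sigma> p \<in> P m - A then 1 else 0)) = real (card (\<Gamma> m)) * (?w E * miss_freq m A E)"
      by (simp only: mult.left_commute)
  qed
  also have "\<dots> = real (card (\<Gamma> m)) * (\<Sum>E\<in>Pow (P m). ?w E * miss_freq m A E)" by (rule sum_distrib_left[symmetric])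
  finally show ?thesis using card_level_perms_pos[of m] by (auto simp: card_gt_0_iff)
qed

text \<open>For a structured \<open>H\<close>, a path is free exactly if some extension of it to
  level \<open>m\<close> is free. Truncation thus maps free paths onto free paths, which is why
  their number grows with the level.\<close>

lemma structured_free_paths:
  assumes "structured H" "n \<ge> 1" "n \<le> m"
  shows "free_paths n H = (\<lambda>x. restrict x {1..n}) ` free_paths m H"
proof -
  have P1: "swaps n p H \<longleftrightarrow> (\<forall>x\<in>exts B n m p. swaps m x H)" if "p \<in> P n" for p
    using assms that unfolding structured_def by blast
  show ?thesis
  proof
    show "free_paths n H \<subseteq> (\<lambda>x. restrict x {1..n}) ` free_paths m H"
      using P1 by (fastforce simp: free_paths_def exts_iff image_iff)
    show "(\<lambda>x. restrict x {1..n}) ` free_paths m H \<subseteq> free_paths n H"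
    proof (rule image_subsetI)
      fix x assume x: "x \<in> free_paths m H"
      then have xP: "x \<in> P m" "\<not> swaps m x H" by (auto simp: free_paths_def)
      have r: "restrict x {1..n} \<in> P n" using xP(1) assms(3) by (rule restrict_fin_path)
      have "x \<in> exts B n m (restrict x {1..n})" using xP by (simp add: exts_iff)
      then show "restrict x {1..n} \<in> free_paths n H" using P1[OF r] xP(2) r by (auto simp: free_paths_def)
    qed
  qed
qed

lemma structured_card_mono:
  assumes "structured H" "n \<ge> 1" "n \<le> m"
  shows "card (free_paths n H) \<le> card (free_paths m H)"
  unfolding structured_free_paths[OF assms] by (intro card_image_le) simp

text \<open>To be read as: the random subgroup has exactly \<open>r\<close> fixed points. The tail
  formulation makes the event invariant, since conjugation by an element of some level permutes the
  free paths of all later levels.\<close>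

definition stable_card :: "nat \<Rightarrow> ((nat \<Rightarrow> 'b) \<Rightarrow> nat \<Rightarrow> 'b) set set" where
  "stable_card r = {H. subgroup H G \<and> (\<exists>N\<ge>1. \<forall>n\<ge>N. card (free_paths n H) = r)}"

lemma stable_card_sets: "stable_card r \<in> sets FG.SM"
proof -
  have "stable_card r = (\<Union>N\<in>{1..}. \<Inter>n\<in>{N..}. {H. subgroup H G \<and> card (free_paths n H) = r})"
    by (auto simp: stable_card_def)
  moreover have "(\<Inter>n\<in>{N..}. {H. subgroup H G \<and> card (free_paths n H) = r}) \<in> sets FG.SM" if "N \<ge> 1" for N
    by (intro sets.countable_INT') (use that free_paths_sets[of _ "\<lambda>E. card E = r"] in auto)
  ultimately show ?thesis by auto
qed

lemma stable_card_conjugation: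
  assumes g: "g \<in> carrier G" and H: "subgroup H G"
  shows "conjugation G g H \<in> stable_card r \<longleftrightarrow> H \<in> stable_card r"
proof -
  obtain N0 where N0: "N0 \<ge> 1" "\<And>n. n \<ge> N0 \<Longrightarrow> g \<in> path_act B n ` \<Gamma> n" using full_group_level[of "{g}"] g by auto
  have c: "card (free_paths n (conjugation G g H)) = card (free_paths n H)" if n: "n \<ge> N0" for n
  proof -
    obtain \<alpha> where "\<alpha> \<in> \<Gamma> n" "g = path_act B n \<alpha>" using N0(2)[OF n] by blast
    then show ?thesis using card_free_paths_conjugation[of n \<alpha> H] H N0(1) n by simp
  qed
  have "(\<exists>N\<ge>1. \<forall>n\<ge>N. card (free_paths n (conjugation G g H)) = r) \<longleftrightarrow> (\<exists>N\<ge>1. \<forall>n\<ge>N. card (free_paths n H) = r)"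
  proof safe
    fix N :: nat assume "N \<ge> 1" "\<forall>n\<ge>N. card (free_paths n (conjugation G g H)) = r"
    then show "\<exists>N\<ge>1. \<forall>n\<ge>N. card (free_paths n H) = r" using c by (intro exI[of _ "max N N0"]) auto
  next
    fix N :: nat assume "N \<ge> 1" "\<forall>n\<ge>N. card (free_paths n H) = r"
    then show "\<exists>N\<ge>1. \<forall>n\<ge>N. card (free_paths n (conjugation G g H)) = r" using c by (intro exI[of _ "max N N0"]) auto
  qed
  then show ?thesis using H FG.conjugation_subgroup[OF g H] by (simp add: stable_card_def)
qed

lemma stable_card_01:
  assumes "ergodic_IRS G \<phi>" shows "measure \<phi> (stable_card r) = 0 \<or> measure \<phi> (stable_card r) = 1"
proof -
  have IRS: "invariant_random_subgroup G \<phi>" using assms by (simp add: ergodic_IRS_def)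
  note D = FG.IRS_D[OF IRS]
  have "conjugation G g -` stable_card r \<inter> space \<phi> = stable_card r" if g: "g \<in> carrier G" for g
  proof (rule Set.set_eqI)
    fix H
    show "H \<in> conjugation G g -` stable_card r \<inter> space \<phi> \<longleftrightarrow> H \<in> stable_card r"
    proof (cases "subgroup H G")
      case True
      then show ?thesis using stable_card_conjugation[OF g True] D(3) by simp
    next
      case False
      then show ?thesis using D(3) by (simp add: stable_card_def)
    qed
  qed
  then show ?thesis using assms stable_card_sets D(2) by (auto simp: ergodic_IRS_def ergodic_prob_def)
qed

text \<open>For a structured subgroup the number of free paths increases with the level; if bounded,
  it is eventually equal to its maximum, and the subgroup lies in some
  \<open>stable_card r\<close>.\<close>

lemma AE_free_paths_unbounded:
  assumes IRS: "invariant_random_subgroup G \<phi>" and null: "\<And>r. measure \<phi> (stable_card r) = 0"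
  shows "AE H in \<phi>. eventually (\<lambda>m. R \<le> card (free_paths m H)) sequentially"
proof -
  note D = FG.IRS_D[OF IRS]
  interpret prob_space \<phi> by (rule D)
  have "AE H in \<phi>. H \<notin> stable_card r" for r
    using null[of r] stable_card_sets[of r] D(2) by (intro AE_not_in) (simp add: null_sets_def emeasure_eq_measure)
  then have "AE H in \<phi>. \<forall>r. H \<notin> stable_card r" by (simp add: AE_all_countable)
  moreover have "AE H in \<phi>. subgroup H G" using AE_space[of \<phi>] D(3) by simp
  ultimately show ?thesis using AE_structured[OF IRS]
  proof eventually_elim
    case (elim H)
    have "\<exists>m\<ge>1. R \<le> card (free_paths m H)"
    proof (rule ccontr)
      assume "\<not> ?thesis"
      then have lt: "card (free_paths m H) < R" if "m \<ge> 1" for m using that by auto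
      let ?S = "(\<lambda>m. card (free_paths m H)) ` {1..}"
      have fS: "finite ?S" using lt by (intro finite_subset[of ?S "{..<R}"]) auto
      then have "Max ?S \<in> ?S" by (intro Max_in) auto
      then obtain N where N: "N \<ge> 1" "card (free_paths N H) = Max ?S" by auto
      have "card (free_paths n H) = Max ?S" if "n \<ge> N" for n
      proof (rule antisym)
        show "card (free_paths n H) \<le> Max ?S" using fS that N(1) by (intro Max_ge) auto
        show "Max ?S \<le> card (free_paths n H)" using structured_card_mono[OF elim(3) N(1) that] N(2) by simp
      qed
      then have "H \<in> stable_card (Max ?S)" using elim(2) N(1) by (auto simp: stable_card_def)
      then show False using elim(1) by blast
    qed
    then obtain m where m: "m \<ge> 1" "R \<le> card (free_paths m H)" by blast
    show ?case unfolding eventually_sequentially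
      using order_trans[OF m(2) structured_card_mono[OF elim(3) m(1)]] by blast
  qed
qed

text \<open>Almost surely the rigid stabilizer lies in \<open>H\<close> exactly if no free path of
  level \<open>m\<close> extends \<open>p\<close>. Averaging over \<open>\<Gamma> m\<close> scatters
  at least \<open>R\<close> free paths over their fibres, in each of which the extensions of
  \<open>p\<close> have density at least \<open>e\<close>; all of them miss with probability at most
  about (1 - e)^R.\<close>

lemma swaps_null:
  assumes IRS: "invariant_random_subgroup G \<phi>" and null: "\<And>r. measure \<phi> (stable_card r) = 0"
    and n: "n \<ge> 1" and p: "p \<in> P n"
  shows "measure \<phi> {H. subgroup H G \<and> swaps n p H} = 0"
proof -
  note D = FG.IRS_D[OF IRS]
  interpret prob_space \<phi> by (rule D)
  let ?L = "measure \<phi> {H. subgroup H G \<and> swaps n p H}"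
  obtain e m0 where e: "e > 0" "m0 \<ge> n"
    and dens: "\<And>l w. l \<ge> m0 \<Longrightarrow> w \<in> vert B l \<Longrightarrow> e * real (card (fibre l w)) \<le> real (card (ext_to n l p w))"
    using ext_to_density[OF n] p by blast
  have e1: "1 - e \<ge> 0"
  proof -
    obtain x where x: "x \<in> P m0" using fin_paths_nonempty by blast
    have m0: "m0 \<ge> 1" using e n by simp
    have w: "t m0 x \<in> vert B m0" using m0 x by (rule end_vertex_in)
    have f: "finite (fibre m0 (t m0 x))" "fibre m0 (t m0 x) \<noteq> {}" using x by (auto simp: fibre_def)
    have "card (ext_to n m0 p (t m0 x)) \<le> card (fibre m0 (t m0 x))"
      using f(1) by (intro card_mono) (auto simp: ext_to_iff fibre_def)
    then have "e * real (card (fibre m0 (t m0 x))) \<le> 1 * real (card (fibre m0 (t m0 x)))" using dens[OF order_refl w] by simp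
    moreover have "real (card (fibre m0 (t m0 x))) > 0" using f by (simp add: card_gt_0_iff)
    ultimately show ?thesis by (simp only: mult_le_cancel_right_pos)
  qed
  have "?L \<le> \<delta>" if \<delta>: "\<delta> > 0" for \<delta>
  proof -
    \<comment> \<open>Three contributions of \<delta> / 3: the power of \<open>1 - e\<close>, the
      dependence error for \<open>R\<close> points, and the chance of fewer than \<open>R\<close>
      free paths. \<open>R\<close> is fixed before \<open>h\<close>, and both before the
      level.\<close>
    obtain R where R: "(1 - e) ^ R < \<delta> / 3" using real_arch_pow_inv[of "\<delta> / 3" "1 - e"] \<delta> e(1) by auto
    obtain h :: nat where h: "3 * (real R)\<^sup>2 / \<delta> + 1 \<le> real h" using real_arch_simple by blast
    have h0: "real h > 0" "(real R)\<^sup>2 / real h \<le> \<delta> / 3"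
    proof -
      have "0 \<le> 3 * (real R)\<^sup>2 / \<delta>" using \<delta> by simp
      then show h0: "real h > 0" using h by linarith
      have "3 * (real R)\<^sup>2 / \<delta> \<le> real h" using h by linarith
      then have "3 * (real R)\<^sup>2 \<le> real h * \<delta>" using \<delta> by (simp add: pos_divide_le_eq)
      then show "(real R)\<^sup>2 / real h \<le> \<delta> / 3" using h0 by (simp add: pos_divide_le_eq mult.commute)
    qed
    obtain m1 where m1: "\<And>l w. l \<ge> m1 \<Longrightarrow> w \<in> vert B l \<Longrightarrow> h \<le> card (fibre l w)" using card_fibre_unbounded[of h] by blast
    \<comment> \<open>Levels start at 1, hence the shift by \<open>Suc\<close>.\<close>
    let ?A = "\<lambda>m. {H. subgroup H G \<and> card (free_paths (Suc m) H) < R}"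
    have "(\<lambda>m. prob (?A m)) \<longlonglongrightarrow> 0"
    proof (rule AE_eventually_prob_tendsto_0)
      show "?A m \<in> events" for m using free_paths_sets[of "Suc m"] D(2) by simp
      show "AE H in \<phi>. eventually (\<lambda>m. H \<notin> ?A m) sequentially"
        using AE_free_paths_unbounded[OF IRS null, of R]
        by eventually_elim (subst (asm) eventually_sequentially_Suc[symmetric], erule eventually_mono, simp)
    qed
    then have "eventually (\<lambda>m. prob (?A m) < \<delta> / 3) sequentially" using order_tendstoD(2)[of _ 0 _ "\<delta> / 3"] \<delta> by simp
    then obtain m2 where m2: "\<And>m. m \<ge> m2 \<Longrightarrow> prob (?A m) < \<delta> / 3" unfolding eventually_sequentially by blast
    define m where "m = Suc (max n (max m0 (max m1 m2)))"
    have m: "m \<ge> 1" "n \<le> m" "m0 \<le> m" "m1 \<le> m" "m2 \<le> m - 1" "Suc (m - 1) = m" by (auto simp: m_def)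
    let ?w = "\<lambda>E. measure \<phi> {H. subgroup H G \<and> free_paths m H = E}"
    let ?X = "exts B n m p"
    have "?L = measure \<phi> {H. subgroup H G \<and> free_paths m H \<inter> ?X = {}}"
    proof (rule measure_eq_AE)
      show "AE H in \<phi>. (H \<in> {H. subgroup H G \<and> swaps n p H}) = (H \<in> {H. subgroup H G \<and> free_paths m H \<inter> ?X = {}})"
        using AE_structured[OF IRS]
      proof eventually_elim
        case (elim H)
        then have "swaps n p H \<longleftrightarrow> (\<forall>x\<in>?X. swaps m x H)" using n m(2) p unfolding structured_def by blast
        also have "\<dots> \<longleftrightarrow> free_paths m H \<inter> ?X = {}" by (auto simp: free_paths_def exts_iff)
        finally show ?case by simp
      qed
    qed (use swaps_sets[OF n] free_paths_sets[OF m(1)] D(2) in auto)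
    also have "\<dots> = (\<Sum>E\<in>Pow (P m). ?w E * miss_freq m ?X E)" by (rule measure_free_paths_miss[OF IRS m(1)])
    also have "\<dots> \<le> (\<Sum>E\<in>Pow (P m). ?w E * (if card E < R then 1 else 0) + ?w E * (2 * \<delta> / 3))"
    proof (rule sum_mono)
      fix E assume "E \<in> Pow (P m)"
      then have E: "E \<subseteq> P m" by simp
      have "miss_freq m ?X E \<le> 2 * \<delta> / 3" if ge: "\<not> card E < R"
      proof -
        \<comment> \<open>Exactly \<open>R\<close> of the free paths are kept: missing with all of
          \<open>E\<close> is no more likely than missing with \<open>J\<close>, while the
          dependence error grows with the number of points.\<close>
        obtain J where J: "J \<subseteq> E" "card J = R" using obtain_subset_with_card_n[of R E] ge by (metis not_less)
        have JP: "J \<subseteq> P m" using J(1) E by blast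
        have "miss_freq m ?X E \<le> miss_freq m ?X J" using J(1) by (rule miss_freq_antimono)
        also have "\<dots> \<le> (\<Prod>p\<in>J. real (card (fibre m (t m p) - ?X)) / card (fibre m (t m p))) + (card J)\<^sup>2 / real h"
          using miss_freq_near_prod[OF m(1) h0(1) _ JP, of ?X] m1[OF m(4)] by (simp add: abs_le_iff)
        also have "(\<Prod>p\<in>J. real (card (fibre m (t m p) - ?X)) / card (fibre m (t m p))) \<le> (\<Prod>p\<in>J. 1 - e)"
        proof (rule prod_mono)
          fix q assume q: "q \<in> J"
          let ?f = "fibre m (t m q)"
          have f: "finite ?f" "?f \<noteq> {}" using q JP by (auto simp: fibre_def)
          have "?f - ?X = ?f - ext_to n m p (t m q)" by (auto simp: fibre_def ext_to_iff exts_iff)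
          moreover have sub: "ext_to n m p (t m q) \<subseteq> ?f" by (auto simp: fibre_def ext_to_iff)
          ultimately have "card (?f - ?X) = card ?f - card (ext_to n m p (t m q))"
            using f(1) by (simp add: card_Diff_subset finite_subset)
          moreover have "card (ext_to n m p (t m q)) \<le> card ?f" using f(1) sub by (rule card_mono)
          ultimately have c: "real (card (?f - ?X)) = real (card ?f) - real (card (ext_to n m p (t m q)))" by simp
          have "t m q \<in> vert B m" using q JP m(1) by (intro end_vertex_in) auto
          then have "real (card (?f - ?X)) \<le> (1 - e) * real (card ?f)"
            unfolding c using dens[OF m(3)] by (simp add: left_diff_distrib)
          moreover have "real (card ?f) > 0" using f by (simp add: card_gt_0_iff)
          ultimately show "0 \<le> real (card (?f - ?X)) / real (card ?f) \<and> real (card (?f - ?X)) / real (card ?f) \<le> 1 - e"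
            by (simp add: pos_divide_le_eq)
        qed
        also have "(\<Prod>p\<in>J. 1 - e) = (1 - e) ^ R" using J(2) by simp
        finally have "miss_freq m ?X E \<le> (1 - e) ^ R + (real R)\<^sup>2 / real h" using J(2) by simp
        then show ?thesis using R h0(2) by linarith
      qed
      then have "miss_freq m ?X E \<le> (if card E < R then 1 else 0) + 2 * \<delta> / 3"
        using miss_freq_bounds(2)[of m ?X E] \<delta> by (cases "card E < R") auto
      then have "?w E * miss_freq m ?X E \<le> ?w E * ((if card E < R then 1 else 0) + 2 * \<delta> / 3)"
        by (intro mult_left_mono) simp_all
      then show "?w E * miss_freq m ?X E \<le> ?w E * (if card E < R then 1 else 0) + ?w E * (2 * \<delta> / 3)"
        by (simp only: distrib_left)
    qed
    also have "\<dots> = (\<Sum>E\<in>Pow (P m). ?w E * (if card E < R then 1 else 0)) + (\<Sum>E\<in>Pow (P m). ?w E) * (2 * \<delta> / 3)"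
      by (simp only: sum.distrib sum_distrib_right)
    also have "(\<Sum>E\<in>Pow (P m). ?w E * (if card E < R then 1 else 0)) = prob (?A (m - 1))"
      using free_paths_measure[OF D(1,2) m(1), of "\<lambda>E. card E < R"] m(6) by simp
    also have "(\<Sum>E\<in>Pow (P m). ?w E) = 1"
      using free_paths_measure[OF D(1,2) m(1), of "\<lambda>_. True"] prob_space D(3) by simp
    finally show ?thesis using m2[OF m(5)] by linarith
  qed
  then have "?L \<le> 0" using field_le_epsilon[of ?L 0] by simp
  then show ?thesis using measure_nonneg[of \<phi>] by (simp add: order_antisym)
qed

text \<open>Almost surely no cylinder has its rigid stabilizer inside \<open>H\<close>, and a
  structured \<open>H\<close> of this kind has no element that moves a path.\<close>

lemma unstable_trivial:
  assumes IRS: "invariant_random_subgroup G \<phi>" and null: "\<And>r. measure \<phi> (stable_card r) = 0"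
  shows "\<phi> = dirac_trivial G"
proof -
  note D = FG.IRS_D[OF IRS]
  interpret prob_space \<phi> by (rule D)
  let ?I = "SIGMA n:{1..}. P n"
  have cI: "countable ?I" by (intro countable_SIGMA countableI_type countable_finite finite_fin_paths)
  have AE0: "AE H in \<phi>. \<not> (subgroup H G \<and> swaps n p H)" if "n \<ge> 1" "p \<in> P n" for n p
  proof -
    have "AE H in \<phi>. H \<notin> {H. subgroup H G \<and> swaps n p H}"
      using swaps_null[OF IRS null that] swaps_sets[OF that(1)] D(2)
      by (intro AE_not_in) (simp add: null_sets_def emeasure_eq_measure)
    then show ?thesis by simp
  qed
  have "AE H in \<phi>. \<forall>i\<in>?I. \<not> (subgroup H G \<and> swaps (fst i) (snd i) H)"
    by (subst AE_ball_countable[OF cI]) (use AE0 in auto)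
  moreover have "AE H in \<phi>. subgroup H G" using AE_space[of \<phi>] D(3) by simp
  ultimately have triv: "AE H in \<phi>. H = {\<one>\<^bsub>G\<^esub>}" using AE_structured[OF IRS]
  proof eventually_elim
    case (elim H)
    have "g = \<one>\<^bsub>G\<^esub>" if g: "g \<in> H" for g
    proof -
      have "g \<in> carrier G" using subgroup.subset[OF elim(2)] g by blast
      then obtain n \<sigma> where n: "n \<ge> 1" "\<sigma> \<in> \<Gamma> n" "g = path_act B n \<sigma>" by (rule full_group_cases)
      have "\<forall>p\<in>P n. \<sigma> p \<noteq> p \<longrightarrow> swaps n p H" using elim(3) n g unfolding structured_def by blast
      moreover have "\<not> swaps n p H" if "p \<in> P n" for p using elim(1,2) n(1) that by force
      ultimately have "\<sigma> p = p" for p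
        using permutes_not_in[OF level_permsD(1)[OF n(2)], of p] by blast
      then have "\<sigma> = id" by (simp add: fun_eq_iff)
      then show ?thesis using n(3) path_act_one by simp
    qed
    then show ?case using subgroup.one_closed[OF elim(2)] by blast
  qed
  show ?thesis
  proof (rule measure_eqI)
    show "sets \<phi> = sets (dirac_trivial G)" using D(2) by (simp add: dirac_trivial_def)
    fix A assume A: "A \<in> sets \<phi>"
    show "emeasure \<phi> A = emeasure (dirac_trivial G) A"
    proof (cases "{\<one>\<^bsub>G\<^esub>} \<in> A")
      case True
      then have "AE H in \<phi>. H \<in> A" using triv by (auto elim: eventually_mono)
      then have "emeasure \<phi> A = 1" using A by (rule emeasure_eq_1_AE[rotated])
      then show ?thesis using True A D(2) by (simp add: dirac_trivial_def)
    next
      case False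
      then have "AE H in \<phi>. H \<notin> A" using triv by (auto elim: eventually_mono)
      then have "emeasure \<phi> A = 0" using A by (simp add: AE_iff_measurable[of A] sets.sets_into_space Int_absorb1 AE_iff_null_sets null_setsD1)
      then show ?thesis using False A D(2) by (simp add: dirac_trivial_def)
    qed
  qed
qed

end

subsection \<open>Limits of mixtures\<close>

context fin_ergodic_diagram
begin

lemma fixed_points_measure:
  assumes n: "n \<ge> 1" and i: "i \<in> {1..k}" and A: "A \<subseteq> P n"
  shows "measure (\<mu> i) {x \<in> X. restrict x {1..n} \<notin> A} = 1 - (\<Sum>p\<in>A. weight (\<mu> i) (n, p))"
proof -
  interpret prob_space "\<mu> i" using i by (rule mu_prob)
  have fA: "finite A" using A finite_fin_paths by (rule finite_subset)
  have cs: "cyl n p \<in> events" for p using cyl_sets[OF n] mu_sets[OF i] by simp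
  have "prob (\<Union>p\<in>A. cyl n p) = (\<Sum>p\<in>A. prob (cyl n p))"
    using cs cyl_disjoint fA by (intro finite_measure_finite_Union) (auto simp: disjoint_family_on_def)
  moreover have "{x \<in> X. restrict x {1..n} \<notin> A} = space (\<mu> i) - (\<Union>p\<in>A. cyl n p)"
    unfolding mu_space[OF i] by (auto simp: cylinder_def)
  moreover have "prob (space (\<mu> i) - (\<Union>p\<in>A. cyl n p)) = 1 - prob (\<Union>p\<in>A. cyl n p)"
    using cs fA by (intro prob_compl sets.finite_UN) auto
  ultimately show ?thesis by (simp add: weight_def)
qed

lemma missed_density:
  assumes "n \<ge> 1" "n \<le> m" "A \<subseteq> P n" and w: "w \<in> vert B m"
  shows "real (card (fibre m w - {x. restrict x {1..n} \<in> A})) / card (fibre m w) = 1 - (\<Sum>p\<in>A. dens m w (n, p))"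
proof -
  have fA: "finite A" using assms(3) finite_fin_paths by (rule finite_subset)
  have f: "finite (fibre m w)" "fibre m w \<noteq> {}"
    using fibre_vertex[of m w] assms by (auto simp: fibre_def)
  have U: "fibre m w \<inter> {x. restrict x {1..n} \<in> A} = (\<Union>p\<in>A. ext_to n m p w)"
    by (auto simp: fibre_def ext_to_iff)
  have "card (\<Union>p\<in>A. ext_to n m p w) = (\<Sum>p\<in>A. card (ext_to n m p w))"
    using fA by (intro card_UN_disjoint) (auto simp: ext_to_iff)
  then have "real (card (fibre m w \<inter> {x. restrict x {1..n} \<in> A})) = (\<Sum>p\<in>A. real (card (ext_to n m p w)))"
    unfolding U by simp
  moreover have "card (fibre m w - {x. restrict x {1..n} \<in> A}) = card (fibre m w) - card (fibre m w \<inter> {x. restrict x {1..n} \<in> A})"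
    using f(1) by (intro card_Diff_subset_Int) simp
  moreover have "card (fibre m w \<inter> {x. restrict x {1..n} \<in> A}) \<le> card (fibre m w)" using f(1) by (intro card_mono) auto
  ultimately have "real (card (fibre m w - {x. restrict x {1..n} \<in> A})) = real (card (fibre m w)) - (\<Sum>p\<in>A. real (card (ext_to n m p w)))"
    by simp
  then show ?thesis using f by (simp add: dens_def diff_divide_distrib sum_divide_distrib card_gt_0_iff)
qed

text \<open>\<open>A\<close> collects the paths of level \<open>n\<close> moved by some element of
  \<open>F\<close>. The same set describes both sides of the comparison: \<open>F\<close> lies in
  \<open>H\<close> when the free paths avoid the extensions of \<open>A\<close>, and a point is
  fixed by \<open>F\<close> when its truncation avoids \<open>A\<close>.\<close>

lemma above_free_paths:
  assumes F: "finite F" "F \<subseteq> carrier G"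
  obtains n A where "n \<ge> 1" "A \<subseteq> P n"
    "\<And>H m. structured H \<Longrightarrow> n \<le> m \<Longrightarrow> F \<subseteq> H \<longleftrightarrow> free_paths m H \<inter> {x. restrict x {1..n} \<in> A} = {}"
    "{x \<in> X. \<forall>g\<in>F. g x = x} = {x \<in> X. restrict x {1..n} \<notin> A}"
proof -
  obtain n where n: "n \<ge> 1" "F \<subseteq> path_act B n ` \<Gamma> n" using full_group_level[OF F] by blast
  define S where "S = {\<sigma> \<in> \<Gamma> n. path_act B n \<sigma> \<in> F}"
  define A where "A = {p \<in> P n. \<exists>\<sigma>\<in>S. \<sigma> p \<noteq> p}"
  have FS: "F = path_act B n ` S" using n(2) by (auto simp: S_def)
  show ?thesis
  proof (rule that[OF n(1)])
    show AP: "A \<subseteq> P n" by (auto simp: A_def)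
    fix H m assume H: "structured H" and m: "n \<le> m"
    have P2: "path_act B n \<sigma> \<in> H \<longleftrightarrow> (\<forall>p\<in>P n. \<sigma> p \<noteq> p \<longrightarrow> swaps n p H)" if "\<sigma> \<in> \<Gamma> n" for \<sigma>
      using H that n(1) unfolding structured_def by blast
    have "F \<subseteq> H \<longleftrightarrow> (\<forall>\<sigma>\<in>S. path_act B n \<sigma> \<in> H)" unfolding FS by blast
    also have "\<dots> \<longleftrightarrow> (\<forall>\<sigma>\<in>S. \<forall>p\<in>P n. \<sigma> p \<noteq> p \<longrightarrow> swaps n p H)"
      by (intro ball_cong refl P2) (simp add: S_def)
    also have "\<dots> \<longleftrightarrow> free_paths n H \<inter> A = {}" by (auto simp: A_def free_paths_def)
    also have "\<dots> \<longleftrightarrow> free_paths m H \<inter> {x. restrict x {1..n} \<in> A} = {}"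
      unfolding structured_free_paths[OF H n(1) m] by auto
    finally show "F \<subseteq> H \<longleftrightarrow> free_paths m H \<inter> {x. restrict x {1..n} \<in> A} = {}" .
  next
    have "(\<forall>g\<in>F. g x = x) \<longleftrightarrow> restrict x {1..n} \<notin> A" if x: "x \<in> X" for x
    proof -
      have "path_act B n \<sigma> x = x \<longleftrightarrow> \<sigma> (restrict x {1..n}) = restrict x {1..n}" if "\<sigma> \<in> S" for \<sigma>
      proof
        assume "\<sigma> (restrict x {1..n}) = restrict x {1..n}"
        then show "path_act B n \<sigma> x = x" using x by (simp add: path_act_def)
      next
        assume "path_act B n \<sigma> x = x"
        then show "\<sigma> (restrict x {1..n}) = restrict x {1..n}"
          using path_act_in(2)[OF n(1) _ x, of \<sigma>] that by (simp add: S_def)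
      qed
      then show ?thesis using restrict_in_fin_paths[OF x, of n] by (auto simp: FS A_def)
    qed
    then show "{x \<in> X. \<forall>g\<in>F. g x = x} = {x \<in> X. restrict x {1..n} \<notin> A}" by blast
  qed
qed

text \<open>Two replacements: the values of a random permutation are treated as independent, at cost
  \<open>(card E)\<^sup>2 / h\<close>, and the density missed in each fibre becomes the mass missed
  under the mixture \<open>c (t m p)\<close>, at cost \<open>card A * \<delta>\<close> per path. A
  product of factors of modulus at most 1 changes by at most the sum of the changes.\<close>

lemma miss_freq_near_mixture:
  fixes h \<delta> :: real
  assumes m: "m \<ge> 1" "n \<ge> 1" "n \<le> m" and h: "h > 0" "\<And>w. w \<in> vert B m \<Longrightarrow> h \<le> real (card (fibre m w))"
    and A: "A \<subseteq> P n" and E: "E \<subseteq> P m"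
    and c: "\<And>w. w \<in> vert B m \<Longrightarrow> c w \<in> convex_coeffs k"
    and near: "\<And>w p. w \<in> vert B m \<Longrightarrow> p \<in> A \<Longrightarrow> \<bar>dens m w (n, p) - mix (c w) (n, p)\<bar> \<le> \<delta>"
  shows "\<bar>miss_freq m {x. restrict x {1..n} \<in> A} E -
    (\<Prod>p\<in>E. \<Sum>l=1..k. c (t m p) l * measure (\<mu> l) {x \<in> X. restrict x {1..n} \<notin> A})\<bar> \<le> (card E)\<^sup>2 / h + card E * (card A * \<delta>)"
proof -
  let ?A = "{x. restrict x {1..n} \<in> A}" and ?b = "\<lambda>l. measure (\<mu> l) {x \<in> X. restrict x {1..n} \<notin> A}"
  let ?z = "\<lambda>p. real (card (fibre m (t m p) - ?A)) / card (fibre m (t m p))"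
  let ?y = "\<lambda>p. \<Sum>l=1..k. c (t m p) l * ?b l"
  have w: "t m p \<in> vert B m" if "p \<in> E" for p using that E m(1) by (intro end_vertex_in) auto
  have y_eq: "?y p = 1 - (\<Sum>q\<in>A. mix (c (t m p)) (n, q))" if p: "p \<in> E" for p
  proof -
    have "?y p = (\<Sum>l=1..k. c (t m p) l - c (t m p) l * (\<Sum>q\<in>A. weight (\<mu> l) (n, q)))"
      by (intro sum.cong refl) (simp add: fixed_points_measure[OF m(2) _ A] right_diff_distrib)
    also have "\<dots> = 1 - (\<Sum>l=1..k. c (t m p) l * (\<Sum>q\<in>A. weight (\<mu> l) (n, q)))"
      using c[OF w[OF p]] by (simp add: sum_subtractf convex_coeffs_def)
    also have "(\<Sum>l=1..k. c (t m p) l * (\<Sum>q\<in>A. weight (\<mu> l) (n, q))) = (\<Sum>q\<in>A. mix (c (t m p)) (n, q))"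
      unfolding mix_def sum_distrib_left by (rule sum.swap)
    finally show ?thesis .
  qed
  have zy: "\<bar>?z p - ?y p\<bar> \<le> card A * \<delta>" if p: "p \<in> E" for p
  proof -
    have "?z p - ?y p = (\<Sum>q\<in>A. mix (c (t m p)) (n, q) - dens m (t m p) (n, q))"
      unfolding missed_density[OF m(2,3) A w[OF p]] y_eq[OF p] by (simp add: sum_subtractf)
    then have "\<bar>?z p - ?y p\<bar> \<le> (\<Sum>q\<in>A. \<bar>mix (c (t m p)) (n, q) - dens m (t m p) (n, q)\<bar>)" by (simp only: sum_abs)
    also have "\<dots> \<le> (\<Sum>q\<in>A. \<delta>)" using near[OF w[OF p]] by (intro sum_mono) (simp add: abs_minus_commute)
    finally show ?thesis by simp
  qed
  have z1: "norm (?z p) \<le> 1" for p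
  proof -
    have "card (fibre m (t m p) - ?A) \<le> card (fibre m (t m p))" by (intro card_mono) (auto simp: fibre_def)
    moreover have "finite (fibre m (t m p))" by (simp add: fibre_def)
    ultimately show ?thesis by (auto simp: divide_le_eq card_gt_0_iff)
  qed
  have y1: "norm (?y p) \<le> 1" if p: "p \<in> E" for p
  proof -
    have cc: "\<And>l. l \<in> {1..k} \<Longrightarrow> 0 \<le> c (t m p) l" "(\<Sum>l=1..k. c (t m p) l) = 1"
      using c[OF w[OF p]] by (auto simp: convex_coeffs_def)
    have "?b l \<le> 1" if "l \<in> {1..k}" for l using prob_space.prob_le_1[OF mu_prob[OF that]] .
    then have "?y p \<le> (\<Sum>l=1..k. c (t m p) l)" using cc(1) by (intro sum_mono mult_left_le) auto
    moreover have "0 \<le> ?y p" using cc(1) by (intro sum_nonneg mult_nonneg_nonneg) auto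
    ultimately show ?thesis using cc(2) by simp
  qed
  have "\<bar>(\<Prod>p\<in>E. ?z p) - (\<Prod>p\<in>E. ?y p)\<bar> \<le> (\<Sum>p\<in>E. \<bar>?z p - ?y p\<bar>)"
    using norm_prod_diff[of E ?z ?y] z1 y1 by simp
  also have "\<dots> \<le> (\<Sum>p\<in>E. card A * \<delta>)" by (intro sum_mono zy)
  also have "\<dots> = card E * (card A * \<delta>)" by simp
  finally have "\<bar>(\<Prod>p\<in>E. ?z p) - (\<Prod>p\<in>E. ?y p)\<bar> \<le> card E * (card A * \<delta>)" .
  moreover have "\<bar>miss_freq m ?A E - (\<Prod>p\<in>E. ?z p)\<bar> \<le> (card E)\<^sup>2 / h" by (rule miss_freq_near_prod[OF m(1) h E])
  ultimately show ?thesis by linarith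
qed

section \<open>Random subgroups with a fixed number of free paths\<close>

lemma stable_card_tendsto:
  assumes IRS: "invariant_random_subgroup G \<phi>" and one: "measure \<phi> (stable_card r) = 1"
  shows "(\<lambda>m. measure \<phi> {H. subgroup H G \<and> card (free_paths (Suc m) H) \<noteq> r}) \<longlonglongrightarrow> 0"
proof -
  note D = FG.IRS_D[OF IRS]
  interpret prob_space \<phi> by (rule D)
  show ?thesis
  proof (rule AE_eventually_prob_tendsto_0)
    show "{H. subgroup H G \<and> card (free_paths (Suc m) H) \<noteq> r} \<in> events" for m
      using free_paths_sets[of "Suc m" "\<lambda>E. card E \<noteq> r"] D(2) by simp
    have "AE H in \<phi>. H \<in> stable_card r" using one stable_card_sets[of r] D(2) by (intro AE_in_set_eq_1[THEN iffD2]) auto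
    then show "AE H in \<phi>. eventually (\<lambda>m. H \<notin> {H. subgroup H G \<and> card (free_paths (Suc m) H) \<noteq> r}) sequentially"
    proof eventually_elim
      case (elim H)
      then obtain N where "\<forall>n\<ge>N. card (free_paths n H) = r" by (auto simp: stable_card_def)
      then show ?case unfolding eventually_sequentially by (intro exI[of _ N]) simp
    qed
  qed
qed

text \<open>The coefficient of \<open>\<alpha>\<close> in the mixture seen at level \<open>m\<close>; \<open>c w\<close> are the barycentric coordinates
  of the fibre over the vertex \<open>w\<close>.\<close>

definition level_coeff :: "((nat \<Rightarrow> 'b) \<Rightarrow> nat \<Rightarrow> 'b) set measure \<Rightarrow> nat \<Rightarrow> nat \<Rightarrow> ('a \<Rightarrow> nat \<Rightarrow> real) \<Rightarrow> (nat \<Rightarrow> nat) \<Rightarrow> real" where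
  "level_coeff \<phi> r m c \<alpha> = (\<Sum>E\<in>{E \<in> Pow (P m). card E = r}.
     measure \<phi> {H. subgroup H G \<and> free_paths m H = E} * mix_coeff k (\<lambda>p. c (t m p)) E \<alpha>)"

lemma level_coeff_expand:
  "(\<Sum>\<alpha>\<in>{1..k} \<rightarrow>\<^sub>E {..r}. level_coeff \<phi> r m c \<alpha> * (\<Prod>l=1..k. b l ^ \<alpha> l)) =
   (\<Sum>E\<in>{E \<in> Pow (P m). card E = r}. measure \<phi> {H. subgroup H G \<and> free_paths m H = E} * (\<Prod>p\<in>E. \<Sum>l=1..k. c (t m p) l * b l))"
proof -
  let ?w = "\<lambda>E. measure \<phi> {H. subgroup H G \<and> free_paths m H = E}" and ?T = "{1..k} \<rightarrow>\<^sub>E {..r}"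
  let ?B = "\<lambda>\<alpha>. \<Prod>l=1..k. b l ^ (\<alpha> l :: nat)" and ?c = "\<lambda>E. mix_coeff k (\<lambda>p. c (t m p)) E"
  have "(\<Sum>\<alpha>\<in>?T. level_coeff \<phi> r m c \<alpha> * ?B \<alpha>) = (\<Sum>\<alpha>\<in>?T. \<Sum>E\<in>{E \<in> Pow (P m). card E = r}. ?w E * (?c E \<alpha> * ?B \<alpha>))"
    unfolding level_coeff_def sum_distrib_right by (simp only: mult.assoc)
  also have "\<dots> = (\<Sum>E\<in>{E \<in> Pow (P m). card E = r}. \<Sum>\<alpha>\<in>?T. ?w E * (?c E \<alpha> * ?B \<alpha>))" by (rule sum.swap)
  also have "\<dots> = (\<Sum>E\<in>{E \<in> Pow (P m). card E = r}. ?w E * (\<Prod>p\<in>E. \<Sum>l=1..k. c (t m p) l * b l))"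
  proof (rule sum.cong[OF refl])
    fix E assume "E \<in> {E \<in> Pow (P m). card E = r}"
    then have E: "finite E" "card E = r" using finite_fin_paths by (auto intro: finite_subset)
    show "(\<Sum>\<alpha>\<in>?T. ?w E * (?c E \<alpha> * ?B \<alpha>)) = ?w E * (\<Prod>p\<in>E. \<Sum>l=1..k. c (t m p) l * b l)"
      unfolding prod_mixture_expand[OF E(1)] E(2) by (rule sum_distrib_left[symmetric])
  qed
  finally show ?thesis .
qed

text \<open>Evaluating the expansion at the constant 1 shows that the coefficients sum to the
  probability of having exactly \<open>r\<close> free paths.\<close>

lemma level_coeff_bounds:
  assumes IRS: "invariant_random_subgroup G \<phi>" and m: "m \<ge> 1" and c: "\<And>w. w \<in> vert B m \<Longrightarrow> c w \<in> convex_coeffs k"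
    and \<alpha>: "\<alpha> \<in> {1..k} \<rightarrow>\<^sub>E {..r}"
  shows "0 \<le> level_coeff \<phi> r m c \<alpha>" "level_coeff \<phi> r m c \<alpha> \<le> 1"
proof -
  note D = FG.IRS_D[OF IRS]
  interpret prob_space \<phi> by (rule D)
  let ?w = "\<lambda>E. measure \<phi> {H. subgroup H G \<and> free_paths m H = E}" and ?T = "{1..k} \<rightarrow>\<^sub>E {..r}"
  have cc: "0 \<le> c (t m p) l" "(\<Sum>l=1..k. c (t m p) l) = 1" if "p \<in> P m" "l \<in> {1..k}" for p l
    using c[OF end_vertex_in[OF m that(1)]] that(2) by (auto simp: convex_coeffs_def)
  have nn: "0 \<le> level_coeff \<phi> r m c \<beta>" for \<beta>
    unfolding level_coeff_def by (intro sum_nonneg mult_nonneg_nonneg mix_coeff_nonneg) (use cc in auto)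
  show "0 \<le> level_coeff \<phi> r m c \<alpha>" by (rule nn)
  have fT: "finite ?T" by (intro finite_PiE) auto
  have "level_coeff \<phi> r m c \<alpha> \<le> (\<Sum>\<alpha>\<in>?T. level_coeff \<phi> r m c \<alpha> * (\<Prod>l=1..k. 1 ^ \<alpha> l))"
    using member_le_sum[OF \<alpha>, of "level_coeff \<phi> r m c"] nn fT by simp
  also have "\<dots> = (\<Sum>E\<in>{E \<in> Pow (P m). card E = r}. ?w E * (\<Prod>p\<in>E. \<Sum>l=1..k. c (t m p) l * 1))"
    by (rule level_coeff_expand)
  also have "\<dots> = (\<Sum>E\<in>{E \<in> Pow (P m). card E = r}. ?w E * 1)"
  proof (rule sum.cong[OF refl])
    fix E assume "E \<in> {E \<in> Pow (P m). card E = r}"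
    then have "(\<Sum>l=1..k. c (t m p) l * 1) = 1" if "p \<in> E" for p using cc(2)[of p 1] k that by auto
    then have "(\<Prod>p\<in>E. \<Sum>l=1..k. c (t m p) l * 1) = 1" by (intro prod.neutral ballI)
    then show "?w E * (\<Prod>p\<in>E. \<Sum>l=1..k. c (t m p) l * 1) = ?w E * 1" by (simp only:)
  qed
  also have "\<dots> \<le> (\<Sum>E\<in>Pow (P m). ?w E * 1)" by (intro sum_mono2) auto
  also have "\<dots> = 1" using free_paths_measure[OF D(1,2) m, of "\<lambda>_. True"] prob_space D(3) by simp
  finally show "level_coeff \<phi> r m c \<alpha> \<le> 1" .
qed

text \<open>Sets of free paths with \<open>r\<close> elements contribute the error of
  \<open>miss_freq_near_mixture\<close>; the others contribute at most their total probability, a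
  miss frequency lying between 0 and 1.\<close>

lemma measure_above_near_mixture:
  fixes h \<delta> :: real
  assumes IRS: "invariant_random_subgroup G \<phi>" and m: "m \<ge> 1" "n \<ge> 1" "n \<le> m"
    and h: "h > 0" "\<And>w. w \<in> vert B m \<Longrightarrow> h \<le> real (card (fibre m w))"
    and c: "\<And>w. w \<in> vert B m \<Longrightarrow> c w \<in> convex_coeffs k" and A: "A \<subseteq> P n" and \<delta>: "\<delta> \<ge> 0"
    and near: "\<And>w p. w \<in> vert B m \<Longrightarrow> p \<in> A \<Longrightarrow> \<bar>dens m w (n, p) - mix (c w) (n, p)\<bar> \<le> \<delta>"
  shows "\<bar>measure \<phi> {H. subgroup H G \<and> free_paths m H \<inter> {x. restrict x {1..n} \<in> A} = {}} -
    (\<Sum>\<alpha>\<in>{1..k} \<rightarrow>\<^sub>E {..r}. level_coeff \<phi> r m c \<alpha> * (\<Prod>l=1..k. measure (\<mu> l) {x \<in> X. restrict x {1..n} \<notin> A} ^ \<alpha> l))\<bar>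
    \<le> measure \<phi> {H. subgroup H G \<and> card (free_paths m H) \<noteq> r} + (r\<^sup>2 / h + r * (card A * \<delta>))"
proof -
  note D = FG.IRS_D[OF IRS]
  interpret prob_space \<phi> by (rule D)
  let ?w = "\<lambda>E. measure \<phi> {H. subgroup H G \<and> free_paths m H = E}" and ?A = "{x. restrict x {1..n} \<in> A}"
  let ?y = "\<lambda>E. \<Prod>p\<in>E. \<Sum>l=1..k. c (t m p) l * measure (\<mu> l) {x \<in> X. restrict x {1..n} \<notin> A}"
  let ?K = "r\<^sup>2 / h + r * (card A * \<delta>)"
  have K: "0 \<le> ?K" using h(1) \<delta> by simp
  have fin: "finite (Pow (P m))" by simp
  let ?S = "\<Sum>\<alpha>\<in>{1..k} \<rightarrow>\<^sub>E {..r}. level_coeff \<phi> r m c \<alpha> * (\<Prod>l=1..k. measure (\<mu> l) {x \<in> X. restrict x {1..n} \<notin> A} ^ \<alpha> l)"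
  have S: "?S = (\<Sum>E\<in>Pow (P m). if card E = r then ?w E * ?y E else 0)"
    unfolding level_coeff_expand by (rule sum.inter_filter[OF fin])
  have "\<bar>measure \<phi> {H. subgroup H G \<and> free_paths m H \<inter> ?A = {}} - ?S\<bar> =
      \<bar>\<Sum>E\<in>Pow (P m). ?w E * miss_freq m ?A E - (if card E = r then ?w E * ?y E else 0)\<bar>"
    unfolding S measure_free_paths_miss[OF IRS m(1)] by (simp only: sum_subtractf)
  also have "\<dots> \<le> (\<Sum>E\<in>Pow (P m). \<bar>?w E * miss_freq m ?A E - (if card E = r then ?w E * ?y E else 0)\<bar>)" by (rule sum_abs)
  also have "\<dots> \<le> (\<Sum>E\<in>Pow (P m). ?w E * (if card E \<noteq> r then 1 else 0) + ?w E * ?K)"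
  proof (rule sum_mono)
    fix E assume "E \<in> Pow (P m)"
    then have E: "E \<subseteq> P m" by simp
    show "\<bar>?w E * miss_freq m ?A E - (if card E = r then ?w E * ?y E else 0)\<bar> \<le> ?w E * (if card E \<noteq> r then 1 else 0) + ?w E * ?K"
    proof (cases "card E = r")
      case True
      have le: "\<bar>miss_freq m ?A E - ?y E\<bar> \<le> ?K"
        using miss_freq_near_mixture[OF m h A E c near] unfolding True .
      have "\<bar>?w E * miss_freq m ?A E - ?w E * ?y E\<bar> = ?w E * \<bar>miss_freq m ?A E - ?y E\<bar>"
        unfolding right_diff_distrib[symmetric] abs_mult by simp
      also have "\<dots> \<le> ?w E * ?K" using le by (intro mult_left_mono) simp_all
      finally show ?thesis using True by simp
    next
      case False
      have "?w E * miss_freq m ?A E \<le> ?w E * 1" using miss_freq_bounds(2) by (intro mult_left_mono) simp_all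
      moreover have "0 \<le> ?w E * miss_freq m ?A E" using miss_freq_bounds(1) by (intro mult_nonneg_nonneg) simp_all
      moreover have "0 \<le> ?w E * ?K" using K by (intro mult_nonneg_nonneg) simp_all
      ultimately show ?thesis using False by simp
    qed
  qed
  also have "\<dots> = (\<Sum>E\<in>Pow (P m). ?w E * (if card E \<noteq> r then 1 else 0)) + (\<Sum>E\<in>Pow (P m). ?w E) * ?K"
    by (simp only: sum.distrib sum_distrib_right)
  also have "(\<Sum>E\<in>Pow (P m). ?w E * (if card E \<noteq> r then 1 else 0)) = measure \<phi> {H. subgroup H G \<and> card (free_paths m H) \<noteq> r}"
    by (rule free_paths_measure[OF D(1,2) m(1), symmetric])
  also have "(\<Sum>E\<in>Pow (P m). ?w E) = 1"
    using free_paths_measure[OF D(1,2) m(1), of "\<lambda>_. True"] prob_space D(3) by simp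
  finally have le: "\<bar>measure \<phi> {H. subgroup H G \<and> free_paths m H \<inter> ?A = {}} - ?S\<bar> \<le>
      measure \<phi> {H. subgroup H G \<and> card (free_paths m H) \<noteq> r} + 1 * ?K" .
  have e: "1 * ?K = (real r)\<^sup>2 / h + r * (card A * \<delta>)" by simp
  from le[unfolded e] show ?thesis .
qed

text \<open>For each \<open>j\<close> a level \<open>M j\<close> is chosen at which densities, fibre
  sizes and the number of free paths are all good up to 1 / (j + 1). As there are finitely many
  exponents \<alpha>, one subsequence makes all coefficients converge. It is chosen before
  \<open>F\<close>: each \<open>F\<close> involves finitely many cylinders, which are all covered
  once \<open>j\<close> is large, so the same limits serve every \<open>F\<close>.\<close>

lemma stable_is_mixture:
  assumes IRS: "invariant_random_subgroup G \<phi>" and one: "measure \<phi> (stable_card r) = 1"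
  obtains c where "\<And>\<alpha>. \<alpha> \<in> {1..k} \<rightarrow>\<^sub>E {..r} \<Longrightarrow> 0 \<le> c \<alpha>"
    "\<And>F. finite F \<Longrightarrow> F \<subseteq> carrier G \<Longrightarrow>
      measure \<phi> (FG.above F) = (\<Sum>\<alpha>\<in>{1..k} \<rightarrow>\<^sub>E {..r}. c \<alpha> * measure (product_IRS B k \<mu> \<alpha>) (FG.above F))"
proof -
  note D = FG.IRS_D[OF IRS]
  interpret prob_space \<phi> by (rule D)
  let ?T = "{1..k} \<rightarrow>\<^sub>E {..r}"
  have fT: "finite ?T" by (intro finite_PiE) auto
  define idx where "idx = from_nat_into cyl_index"
  have idx: "idx j \<in> cyl_index" "range idx = cyl_index" for j
    unfolding idx_def using cyl_index_nonempty countable_cyl_index by (auto simp: from_nat_into range_from_nat_into)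
  define bad where "bad m = measure \<phi> {H. subgroup H G \<and> card (free_paths m H) \<noteq> r}" for m
  let ?near = "\<lambda>j m c. \<forall>w\<in>vert B m. c w \<in> convex_coeffs k \<and> (\<forall>s\<in>idx ` {..j}. \<bar>dens m w s - mix (c w) s\<bar> < 1 / real (Suc j))"
  have "\<exists>m c. m \<ge> Suc j \<and> bad m < 1 / real (Suc j) \<and> (\<forall>w\<in>vert B m. Suc j \<le> card (fibre m w)) \<and> ?near j m c" for j
  proof -
    obtain N0 where N0: "\<And>m. m \<ge> N0 \<Longrightarrow> \<forall>w\<in>vert B m. \<exists>c\<in>convex_coeffs k. \<forall>s\<in>idx ` {..j}. \<bar>dens m w s - mix c s\<bar> < 1 / real (Suc j)"
      using dens_near_mixture[of "idx ` {..j}" "1 / real (Suc j)"] idx(1) by auto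
    obtain N1 where N1: "\<And>m. m \<ge> N1 \<Longrightarrow> \<forall>w\<in>vert B m. Suc j \<le> card (fibre m w)" using card_fibre_unbounded[of "Suc j"] by blast
    have "eventually (\<lambda>m. bad (Suc m) < 1 / real (Suc j)) sequentially"
      using order_tendstoD(2)[OF stable_card_tendsto[OF IRS one], of "1 / real (Suc j)"] by (simp add: bad_def)
    then obtain N2 where N2: "\<And>m. m \<ge> N2 \<Longrightarrow> bad (Suc m) < 1 / real (Suc j)" unfolding eventually_sequentially by blast
    define m where "m = Suc (max (max N0 N1) (max N2 j))"
    have m: "m \<ge> N0" "m \<ge> N1" "m \<ge> Suc j" "bad m < 1 / real (Suc j)" using N2 by (auto simp: m_def)
    have "\<forall>w\<in>vert B m. \<exists>c. c \<in> convex_coeffs k \<and> (\<forall>s\<in>idx ` {..j}. \<bar>dens m w s - mix c s\<bar> < 1 / real (Suc j))"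
      using N0[OF m(1)] by blast
    then have "\<exists>c. ?near j m c" by (rule bchoice)
    then show ?thesis using m N1[OF m(2)] by blast
  qed
  moreover define Q where "Q j z \<longleftrightarrow> fst z \<ge> Suc j \<and> bad (fst z) < 1 / real (Suc j) \<and>
      (\<forall>w\<in>vert B (fst z). Suc j \<le> card (fibre (fst z) w)) \<and> ?near j (fst z) (snd z)"
    for j and z :: "nat \<times> ('a \<Rightarrow> nat \<Rightarrow> real)"
  ultimately have "\<forall>j. \<exists>z. Q j z" by simp
  then obtain z where z: "\<And>j. Q j (z j)" using choice[of Q] by blast
  define M cc where "M j = fst (z j)" and "cc j = snd (z j)" for j
  have M: "\<And>j. M j \<ge> Suc j" "\<And>j. bad (M j) < 1 / real (Suc j)" "\<And>j w. w \<in> vert B (M j) \<Longrightarrow> Suc j \<le> card (fibre (M j) w)"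
    and near: "\<And>j. ?near j (M j) (cc j)"
    using z unfolding Q_def M_def cc_def by blast+
  have M1: "M j \<ge> 1" for j using M(1)[of j] by simp
  have cc: "cc j w \<in> convex_coeffs k" if "w \<in> vert B (M j)" for j w using near that by blast
  define a where "a j = level_coeff \<phi> r (M j) (cc j)" for j
  have a: "0 \<le> a j \<alpha>" "a j \<alpha> \<le> 1" if "\<alpha> \<in> ?T" for j \<alpha>
    unfolding a_def by (rule level_coeff_bounds[OF IRS M1 _ that], erule cc)+
  have nb: "norm (a j \<alpha>) \<le> 1" if "\<alpha> \<in> ?T" for j \<alpha> using a[OF that] by simp
  obtain s where s: "strict_mono (s :: nat \<Rightarrow> nat)" and conv: "\<And>\<alpha>. \<alpha> \<in> ?T \<Longrightarrow> \<exists>x. (\<lambda>j. a (s j) \<alpha>) \<longlonglongrightarrow> x"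
  proof (rule function_convergent_subsequence[OF countable_finite[OF fT], of a 1], goal_cases)
    case (1 j \<alpha>)
    show ?case by (rule nb[OF 1(2)])
  next
    case (2 s)
    show ?case by (rule 2(1)[OF 2(2,3)])
  qed
  define L where "L \<alpha> = lim (\<lambda>j. a (s j) \<alpha>)" for \<alpha>
  have L: "(\<lambda>j. a (s j) \<alpha>) \<longlonglongrightarrow> L \<alpha>" if "\<alpha> \<in> ?T" for \<alpha>
  proof -
    have "convergent (\<lambda>j. a (s j) \<alpha>)" using conv[OF that] by (simp add: convergent_def)
    then show ?thesis by (simp add: convergent_LIMSEQ_iff L_def)
  qed
  show ?thesis
  proof (rule that)
    show "0 \<le> L \<alpha>" if "\<alpha> \<in> ?T" for \<alpha> by (rule LIMSEQ_le_const[OF L[OF that]]) (use a(1)[OF that] in auto)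
    fix F assume F: "finite F" "F \<subseteq> carrier G"
    obtain n A where n: "n \<ge> 1" "A \<subseteq> P n"
      and ab: "\<And>H m. structured H \<Longrightarrow> n \<le> m \<Longrightarrow> F \<subseteq> H \<longleftrightarrow> free_paths m H \<inter> {x. restrict x {1..n} \<in> A} = {}"
      and fixF: "{x \<in> X. \<forall>g\<in>F. g x = x} = {x \<in> X. restrict x {1..n} \<notin> A}"
    proof (rule above_free_paths[OF F], goal_cases)
      case (1 n A)
      show ?case by (rule 1(1)[OF 1(2-5)])
    qed
    have fA: "finite A" using n(2) finite_fin_paths by (rule finite_subset)
    let ?v = "\<lambda>\<alpha>. \<Prod>l=1..k. measure (\<mu> l) {x \<in> X. restrict x {1..n} \<notin> A} ^ (\<alpha> l :: nat)"
    have v: "measure (product_IRS B k \<mu> \<alpha>) (FG.above F) = ?v \<alpha>" for \<alpha>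
      unfolding product_IRS_above[OF F] fixF ..
    obtain J where J: "\<And>p. p \<in> A \<Longrightarrow> (n, p) \<in> idx ` {..J}"
    proof -
      have "\<exists>j. idx j = (n, p)" if "p \<in> A" for p
      proof -
        have "(n, p) \<in> range idx" using that n unfolding idx(2) by (auto simp: cyl_index_def)
        then show ?thesis by (metis rangeE)
      qed
      then obtain g where g: "\<And>p. p \<in> A \<Longrightarrow> idx (g p) = (n, p)" by metis
      have "(n, p) \<in> idx ` {..Max (g ` A)}" if "p \<in> A" for p
        using g[OF that] fA that by (intro image_eqI[of _ idx "g p"]) auto
      then show ?thesis by (rule that)
    qed
    \<comment> \<open>Three errors, each times 1 / (j + 1): 1 for a wrong number of free paths,
      \<open>(real r)\<^sup>2\<close> for dependence, and \<open>r\<close> times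
      \<open>card A\<close> for the densities.\<close>
    let ?C = "1 + (real r)\<^sup>2 + real r * real (card A)"
    have est: "\<bar>measure \<phi> (FG.above F) - (\<Sum>\<alpha>\<in>?T. a j \<alpha> * ?v \<alpha>)\<bar> \<le> ?C * (1 / real (Suc j))" if j: "j \<ge> J" "j \<ge> n" for j
    proof -
      have nM: "n \<le> M j" using M(1)[of j] j(2) by simp
      have "measure \<phi> (FG.above F) = measure \<phi> {H. subgroup H G \<and> free_paths (M j) H \<inter> {x. restrict x {1..n} \<in> A} = {}}"
      proof (rule measure_eq_AE)
        show "AE H in \<phi>. (H \<in> FG.above F) = (H \<in> {H. subgroup H G \<and> free_paths (M j) H \<inter> {x. restrict x {1..n} \<in> A} = {}})"
          using AE_structured[OF IRS] by eventually_elim (simp add: FG.above_def ab[OF _ nM])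
      qed (use FG.above_sets[OF F] free_paths_sets[OF M1] D(2) in auto)
      moreover have "\<bar>measure \<phi> {H. subgroup H G \<and> free_paths (M j) H \<inter> {x. restrict x {1..n} \<in> A} = {}} - (\<Sum>\<alpha>\<in>?T. a j \<alpha> * ?v \<alpha>)\<bar>
          \<le> bad (M j) + ((real r)\<^sup>2 / real (Suc j) + r * (card A * (1 / real (Suc j))))"
        unfolding a_def bad_def
      proof (rule measure_above_near_mixture[OF IRS M1 n(1) nM _ _ _ n(2)])
        show "cc j w \<in> convex_coeffs k" if "w \<in> vert B (M j)" for w using that by (rule cc)
        show "real (Suc j) \<le> real (card (fibre (M j) w))" if "w \<in> vert B (M j)" for w
          using M(3)[OF that] by (simp only: of_nat_le_iff)
        show "\<bar>dens (M j) w (n, p) - mix (cc j w) (n, p)\<bar> \<le> 1 / real (Suc j)" if "w \<in> vert B (M j)" "p \<in> A" for w p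
        proof -
          have "(n, p) \<in> idx ` {..j}" using J[OF that(2)] j(1) by auto
          then have "\<bar>dens (M j) w (n, p) - mix (cc j w) (n, p)\<bar> < 1 / real (Suc j)" using near that(1) by blast
          then show ?thesis by (rule less_imp_le)
        qed
      qed auto
      moreover have "bad (M j) + ((real r)\<^sup>2 / real (Suc j) + r * (card A * (1 / real (Suc j)))) \<le> ?C * (1 / real (Suc j))"
        using M(2)[of j] by (simp add: add_divide_distrib)
      ultimately show ?thesis by linarith
    qed
    have "(\<lambda>j. \<Sum>\<alpha>\<in>?T. a (s j) \<alpha> * ?v \<alpha>) \<longlonglongrightarrow> (\<Sum>\<alpha>\<in>?T. L \<alpha> * ?v \<alpha>)"
      by (intro tendsto_sum tendsto_mult L tendsto_const)
    moreover have "(\<lambda>j. \<Sum>\<alpha>\<in>?T. a (s j) \<alpha> * ?v \<alpha>) \<longlonglongrightarrow> measure \<phi> (FG.above F)"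
    proof (rule LIM_zero_cancel, rule Lim_null_comparison)
      show "eventually (\<lambda>j. norm ((\<Sum>\<alpha>\<in>?T. a (s j) \<alpha> * ?v \<alpha>) - measure \<phi> (FG.above F)) \<le> ?C * (1 / real (Suc (s j)))) sequentially"
        unfolding eventually_sequentially
      proof (intro exI[of _ "max J n"] allI impI)
        fix j assume "max J n \<le> j"
        then have "s j \<ge> J" "s j \<ge> n" using seq_suble[OF s, of j] by auto
        from est[OF this] show "norm ((\<Sum>\<alpha>\<in>?T. a (s j) \<alpha> * ?v \<alpha>) - measure \<phi> (FG.above F)) \<le> ?C * (1 / real (Suc (s j)))"
          by (simp only: real_norm_def abs_minus_commute)
      qed
      have "(\<lambda>j. 1 / real (Suc (s j))) \<longlonglongrightarrow> 0"
        using LIMSEQ_subseq_LIMSEQ[OF LIMSEQ_Suc[OF lim_1_over_n] s] by (simp add: o_def)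
      then show "(\<lambda>j. ?C * (1 / real (Suc (s j)))) \<longlonglongrightarrow> 0" by (rule tendsto_mult_right_zero)
    qed
    ultimately show "measure \<phi> (FG.above F) = (\<Sum>\<alpha>\<in>?T. L \<alpha> * measure (product_IRS B k \<mu> \<alpha>) (FG.above F))"
      unfolding v using LIMSEQ_unique by blast
  qed
qed

text \<open>Some coefficient \<open>c \<alpha>\<close> of the mixture is positive, so \<phi>
  dominates a multiple of the invariant measure \<open>product_IRS B k \<mu> \<alpha>\<close>;
  ergodicity of \<phi> makes the two equal.\<close>

lemma stable_classification:
  assumes erg: "ergodic_IRS G \<phi>" and one: "measure \<phi> (stable_card r) = 1"
  shows "\<exists>\<alpha>\<in>{1..k} \<rightarrow>\<^sub>E UNIV. \<phi> = product_IRS B k \<mu> \<alpha>"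
proof -
  have IRS: "invariant_random_subgroup G \<phi>" using erg by (simp add: ergodic_IRS_def)
  note D = FG.IRS_D[OF IRS]
  interpret prob_space \<phi> by (rule D)
  let ?T = "{1..k} \<rightarrow>\<^sub>E {..r}"
  have fT: "finite ?T" by (intro finite_PiE) auto
  obtain c where c: "\<And>\<alpha>. \<alpha> \<in> ?T \<Longrightarrow> 0 \<le> c \<alpha>"
    and mixF: "\<And>F. finite F \<Longrightarrow> F \<subseteq> carrier G \<Longrightarrow>
      measure \<phi> (FG.above F) = (\<Sum>\<alpha>\<in>?T. c \<alpha> * measure (product_IRS B k \<mu> \<alpha>) (FG.above F))"
    using stable_is_mixture[OF IRS one] by blast
  \<comment> \<open>Every subgroup contains the empty set, so the mixture formula for
    \<open>F = {}\<close> is the normalisation of the coefficients.\<close>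
  have sum1: "(\<Sum>\<alpha>\<in>?T. c \<alpha>) = 1"
  proof -
    have e: "FG.above {} = space \<phi>" using D(3) by (simp add: FG.above_def)
    have "measure (product_IRS B k \<mu> \<alpha>) (FG.above {}) = 1" for \<alpha>
      unfolding e using prob_space.prob_space[OF product_IRS_prob, of \<alpha>] sets_eq_imp_space_eq[OF product_IRS_sets, of \<alpha>]
        sets_eq_imp_space_eq[OF D(2)] by simp
    then show ?thesis using mixF[of "{}"] prob_space by (simp add: e)
  qed
  then obtain \<alpha> where \<alpha>: "\<alpha> \<in> ?T" "c \<alpha> \<noteq> 0" by (metis sum.neutral zero_neq_one)
  have "c \<alpha> > 0" using c[OF \<alpha>(1)] \<alpha>(2) by simp
  have mixA: "measure \<phi> A = (\<Sum>\<beta>\<in>?T. c \<beta> * measure (product_IRS B k \<mu> \<beta>) A)" if "A \<in> sets FG.SM" for A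
    by (rule FG.random_subgroup_mixture[OF D(1,2) product_IRS_prob product_IRS_sets fT sum1 mixF that])
  have "product_IRS B k \<mu> \<alpha> = \<phi>"
  proof (rule ergodic_prob_extreme[where \<phi> = "conjugation G" and c = "c \<alpha>"])
    show "group G" "countable (carrier G)" by (rule group_full_group countable_full_group)+
    show "conjugation G \<one>\<^bsub>G\<^esub> H = H" if "H \<in> space \<phi>" for H using that D(3) FG.conjugation_one by simp
    show "conjugation G (g \<otimes>\<^bsub>G\<^esub> h) H = conjugation G g (conjugation G h H)"
      if "g \<in> carrier G" "h \<in> carrier G" "H \<in> space \<phi>" for g h H using that D(3) FG.conjugation_mult by simp
    show "ergodic_prob G (conjugation G) \<phi>" using erg by (simp add: ergodic_IRS_def)
    show "invariant_prob G (conjugation G) (product_IRS B k \<mu> \<alpha>)"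
      using product_IRS_invariant by (simp add: invariant_random_subgroup_def)
    show "sets (product_IRS B k \<mu> \<alpha>) = sets \<phi>" using product_IRS_sets D(2) by simp
    show "0 < c \<alpha>" by fact
    fix A assume "A \<in> sets \<phi>"
    then have A: "A \<in> sets FG.SM" using D(2) by simp
    show "c \<alpha> * measure (product_IRS B k \<mu> \<alpha>) A \<le> measure \<phi> A"
      unfolding mixA[OF A] using fT \<alpha>(1) c
      by (intro member_le_sum[of \<alpha> ?T "\<lambda>\<beta>. c \<beta> * measure (product_IRS B k \<mu> \<beta>) A"]) auto
  qed
  moreover have "\<alpha> \<in> {1..k} \<rightarrow>\<^sub>E UNIV" using \<alpha>(1) by auto
  ultimately show ?thesis by blast
qed

lemma ergodic_IRS_classification:
  assumes erg: "ergodic_IRS G \<phi>"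
  shows "\<phi> = dirac_trivial G \<or> (\<exists>\<alpha>\<in>{1..k} \<rightarrow>\<^sub>E UNIV. \<phi> = product_IRS B k \<mu> \<alpha>)"
proof (cases "\<exists>r. measure \<phi> (stable_card r) = 1")
  case True
  then show ?thesis using stable_classification[OF erg] by blast
next
  case False
  then have "measure \<phi> (stable_card r) = 0" for r using stable_card_01[OF erg] by blast
  then show ?thesis using unstable_trivial erg by (simp add: ergodic_IRS_def)
qed

end

theorem theorem1p1:
  fixes B :: "('v, 'e) bratteli"
    and k :: nat
    and \<mu> :: "nat \<Rightarrow> (nat \<Rightarrow> 'e) measure"
  assumes "bratteli_diagram B"
    and "even_bratteli B"
    and "k \<ge> 1"
    and "bij_betw \<mu> {1..k} (ergodic_path_measures B)"
  shows "(\<forall>\<alpha> \<in> {1..k} \<rightarrow>\<^sub>E (UNIV :: nat set). ergodic_IRS (full_group B) (product_IRS B k \<mu> \<alpha>)) \<and>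
    (\<forall>\<phi>. ergodic_IRS (full_group B) \<phi> \<longrightarrow>
       \<phi> = dirac_trivial (full_group B) \<or>
       (\<exists>\<alpha> \<in> {1..k} \<rightarrow>\<^sub>E (UNIV :: nat set). \<phi> = product_IRS B k \<mu> \<alpha>))"
proof -
  interpret fin_ergodic_diagram B k \<mu>
    using assms by (intro fin_ergodic_diagram.intro even_diagram.intro even_diagram_axioms.intro fin_ergodic_diagram_axioms.intro)
  show ?thesis using product_IRS_ergodic ergodic_IRS_classification by blast
qed

end
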